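(* $\mathsf{WKL}_0 + \mathsf{RT}^2_2$ is $\forall \Pi^0_4$ conservative over $\mathsf{RCA}_0 + \mathsf{B}\Sigma^0_2$; that is, every $\forall\Pi^0_4$ sentence provable in $\mathsf{WKL}_0 + \mathsf{RT}^2_2$ is provable in $\mathsf{RCA}_0 + \mathsf{B}\Sigma^0_2$.
   Context: $\mathsf{RT}^2_2$ is Ramsey's theorem for pairs and two colors: every coloring $f:[\mathbb{N}]^2\to 2$ admits an infinite homogeneous set. A $\forall\Pi^0_4$ formula is one of the form $\forall X\,\varphi(X)$ where $\varphi$ is a $\Pi^0_4$ formula (of second-order arithmetic, with set parameter $X$). $\mathsf{B}\Sigma^0_2$ is the $\Sigma^0_2$ collection scheme; $\mathsf{WKL}_0=\mathsf{RCA}_0+$ weak König's lemma. *)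

theory Defs
  imports Main
begin

section \<open>The language of second-order arithmetic\<close>

text \<open>
  Two-sorted first-order syntax with de Bruijn indices.  The two sorts have independent index
  spaces: \<open>AllN\<close> and \<open>ExN\<close> bind number variable \<open>0\<close>, \<open>AllS\<close> and \<open>ExS\<close> bind set variable \<open>0\<close>.
  The only terms of set sort are variables.  Equality is primitive for numbers only; as usual,
  equality of sets is an abbreviation for coextensionality and hence not part of the syntax.
\<close>

datatype tm = NVar nat | Zero | One | Add tm tm | Mul tm tm

datatype fm =
    Fls
  | Eq tm tm
  | Less tm tm
  | Mem tm nat
  | Imp fm fm
  | Conj fm fm
  | Disj fm fm
  | AllN fm
  | ExN fm
  | AllS fm
  | ExS fm

abbreviation Neg :: "fm \<Rightarrow> fm" where "Neg p \<equiv> Imp p Fls"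
abbreviation Iff :: "fm \<Rightarrow> fm \<Rightarrow> fm" where "Iff p q \<equiv> Conj (Imp p q) (Imp q p)"

text \<open>Simultaneous capture-avoiding substitution: terms for number variables, set variables for
  set variables.\<close>

primrec subst_tm :: "(nat \<Rightarrow> tm) \<Rightarrow> tm \<Rightarrow> tm" where
  "subst_tm \<sigma> (NVar n) = \<sigma> n"
| "subst_tm \<sigma> Zero = Zero"
| "subst_tm \<sigma> One = One"
| "subst_tm \<sigma> (Add t u) = Add (subst_tm \<sigma> t) (subst_tm \<sigma> u)"
| "subst_tm \<sigma> (Mul t u) = Mul (subst_tm \<sigma> t) (subst_tm \<sigma> u)"

definition shift :: "nat \<Rightarrow> tm \<Rightarrow> tm" where
  "shift k = subst_tm (\<lambda>n. NVar (n + k))"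

definition upN :: "(nat \<Rightarrow> tm) \<Rightarrow> nat \<Rightarrow> tm" where
  "upN \<sigma> = case_nat (NVar 0) (\<lambda>n. shift 1 (\<sigma> n))"

definition upS :: "(nat \<Rightarrow> nat) \<Rightarrow> nat \<Rightarrow> nat" where
  "upS \<rho> = case_nat 0 (\<lambda>n. Suc (\<rho> n))"

primrec subst :: "(nat \<Rightarrow> tm) \<Rightarrow> (nat \<Rightarrow> nat) \<Rightarrow> fm \<Rightarrow> fm" where
  "subst \<sigma> \<rho> Fls = Fls"
| "subst \<sigma> \<rho> (Eq t u) = Eq (subst_tm \<sigma> t) (subst_tm \<sigma> u)"
| "subst \<sigma> \<rho> (Less t u) = Less (subst_tm \<sigma> t) (subst_tm \<sigma> u)"
| "subst \<sigma> \<rho> (Mem t X) = Mem (subst_tm \<sigma> t) (\<rho> X)"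
| "subst \<sigma> \<rho> (Imp p q) = Imp (subst \<sigma> \<rho> p) (subst \<sigma> \<rho> q)"
| "subst \<sigma> \<rho> (Conj p q) = Conj (subst \<sigma> \<rho> p) (subst \<sigma> \<rho> q)"
| "subst \<sigma> \<rho> (Disj p q) = Disj (subst \<sigma> \<rho> p) (subst \<sigma> \<rho> q)"
| "subst \<sigma> \<rho> (AllN p) = AllN (subst (upN \<sigma>) \<rho> p)"
| "subst \<sigma> \<rho> (ExN p) = ExN (subst (upN \<sigma>) \<rho> p)"
| "subst \<sigma> \<rho> (AllS p) = AllS (subst \<sigma> (upS \<rho>) p)"
| "subst \<sigma> \<rho> (ExS p) = ExS (subst \<sigma> (upS \<rho>) p)"

definition substN :: "(nat \<Rightarrow> tm) \<Rightarrow> fm \<Rightarrow> fm" where "substN \<sigma> = subst \<sigma> id"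
definition substS :: "(nat \<Rightarrow> nat) \<Rightarrow> fm \<Rightarrow> fm" where "substS = subst NVar"

definition instN :: "tm \<Rightarrow> fm \<Rightarrow> fm" where "instN t = substN (case_nat t NVar)"
definition instS :: "nat \<Rightarrow> fm \<Rightarrow> fm" where "instS X = substS (case_nat X id)"

text \<open>\<open>liftN k d\<close> makes room for \<open>d\<close> further number variables above the first \<open>k\<close> ones.\<close>

definition liftN :: "nat \<Rightarrow> nat \<Rightarrow> fm \<Rightarrow> fm" where
  "liftN k d = substN (\<lambda>n. NVar (if n < k then n else n + d))"

definition liftS :: "fm \<Rightarrow> fm" where "liftS = substS Suc"

text \<open>\<open>closed n m p\<close>: the free number variables of \<open>p\<close> are below \<open>n\<close>, its free set variables
  below \<open>m\<close>.\<close>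

primrec closed_tm :: "nat \<Rightarrow> tm \<Rightarrow> bool" where
  "closed_tm n (NVar i) \<longleftrightarrow> i < n"
| "closed_tm n Zero \<longleftrightarrow> True"
| "closed_tm n One \<longleftrightarrow> True"
| "closed_tm n (Add t u) \<longleftrightarrow> closed_tm n t \<and> closed_tm n u"
| "closed_tm n (Mul t u) \<longleftrightarrow> closed_tm n t \<and> closed_tm n u"

primrec closed :: "nat \<Rightarrow> nat \<Rightarrow> fm \<Rightarrow> bool" where
  "closed n m Fls \<longleftrightarrow> True"
| "closed n m (Eq t u) \<longleftrightarrow> closed_tm n t \<and> closed_tm n u"
| "closed n m (Less t u) \<longleftrightarrow> closed_tm n t \<and> closed_tm n u"
| "closed n m (Mem t X) \<longleftrightarrow> closed_tm n t \<and> X < m"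
| "closed n m (Imp p q) \<longleftrightarrow> closed n m p \<and> closed n m q"
| "closed n m (Conj p q) \<longleftrightarrow> closed n m p \<and> closed n m q"
| "closed n m (Disj p q) \<longleftrightarrow> closed n m p \<and> closed n m q"
| "closed n m (AllN p) \<longleftrightarrow> closed (Suc n) m p"
| "closed n m (ExN p) \<longleftrightarrow> closed (Suc n) m p"
| "closed n m (AllS p) \<longleftrightarrow> closed n (Suc m) p"
| "closed n m (ExS p) \<longleftrightarrow> closed n (Suc m) p"

definition sentence :: "fm \<Rightarrow> bool" where "sentence p \<longleftrightarrow> closed 0 0 p"


section \<open>Provability\<close>

text \<open>Natural deduction for classical two-sorted first-order logic with equality on numbers.
  Lifting the context expresses the eigenvariable conditions.\<close>

inductive provable :: "fm set \<Rightarrow> fm \<Rightarrow> bool" (infix "\<turnstile>" 50) where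
  Assm:  "p \<in> \<Gamma> \<Longrightarrow> \<Gamma> \<turnstile> p"
| ImpI:  "insert p \<Gamma> \<turnstile> q \<Longrightarrow> \<Gamma> \<turnstile> Imp p q"
| ImpE:  "\<Gamma> \<turnstile> Imp p q \<Longrightarrow> \<Gamma> \<turnstile> p \<Longrightarrow> \<Gamma> \<turnstile> q"
| ConjI: "\<Gamma> \<turnstile> p \<Longrightarrow> \<Gamma> \<turnstile> q \<Longrightarrow> \<Gamma> \<turnstile> Conj p q"
| ConjE1: "\<Gamma> \<turnstile> Conj p q \<Longrightarrow> \<Gamma> \<turnstile> p"
| ConjE2: "\<Gamma> \<turnstile> Conj p q \<Longrightarrow> \<Gamma> \<turnstile> q"
| DisjI1: "\<Gamma> \<turnstile> p \<Longrightarrow> \<Gamma> \<turnstile> Disj p q"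
| DisjI2: "\<Gamma> \<turnstile> q \<Longrightarrow> \<Gamma> \<turnstile> Disj p q"
| DisjE: "\<Gamma> \<turnstile> Disj p q \<Longrightarrow> insert p \<Gamma> \<turnstile> r \<Longrightarrow> insert q \<Gamma> \<turnstile> r \<Longrightarrow> \<Gamma> \<turnstile> r"
| RAA:   "insert (Neg p) \<Gamma> \<turnstile> Fls \<Longrightarrow> \<Gamma> \<turnstile> p"
| AllNI: "liftN 0 1 ` \<Gamma> \<turnstile> p \<Longrightarrow> \<Gamma> \<turnstile> AllN p"
| AllNE: "\<Gamma> \<turnstile> AllN p \<Longrightarrow> \<Gamma> \<turnstile> instN t p"
| ExNI:  "\<Gamma> \<turnstile> instN t p \<Longrightarrow> \<Gamma> \<turnstile> ExN p"
| ExNE:  "\<Gamma> \<turnstile> ExN p \<Longrightarrow> insert p (liftN 0 1 ` \<Gamma>) \<turnstile> liftN 0 1 q \<Longrightarrow> \<Gamma> \<turnstile> q"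
| AllSI: "liftS ` \<Gamma> \<turnstile> p \<Longrightarrow> \<Gamma> \<turnstile> AllS p"
| AllSE: "\<Gamma> \<turnstile> AllS p \<Longrightarrow> \<Gamma> \<turnstile> instS X p"
| ExSI:  "\<Gamma> \<turnstile> instS X p \<Longrightarrow> \<Gamma> \<turnstile> ExS p"
| ExSE:  "\<Gamma> \<turnstile> ExS p \<Longrightarrow> insert p (liftS ` \<Gamma>) \<turnstile> liftS q \<Longrightarrow> \<Gamma> \<turnstile> q"
| EqI:   "\<Gamma> \<turnstile> Eq t t"
| EqE:   "\<Gamma> \<turnstile> Eq t u \<Longrightarrow> \<Gamma> \<turnstile> instN t p \<Longrightarrow> \<Gamma> \<turnstile> instN u p"


section \<open>The arithmetical hierarchy\<close>

abbreviation BAll :: "tm \<Rightarrow> fm \<Rightarrow> fm" where "BAll t p \<equiv> AllN (Imp (Less (NVar 0) (shift 1 t)) p)"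
abbreviation BEx :: "tm \<Rightarrow> fm \<Rightarrow> fm" where "BEx t p \<equiv> ExN (Conj (Less (NVar 0) (shift 1 t)) p)"

inductive bounded :: "fm \<Rightarrow> bool" where
  "bounded Fls"
| "bounded (Eq t u)"
| "bounded (Less t u)"
| "bounded (Mem t X)"
| "bounded p \<Longrightarrow> bounded q \<Longrightarrow> bounded (Imp p q)"
| "bounded p \<Longrightarrow> bounded q \<Longrightarrow> bounded (Conj p q)"
| "bounded p \<Longrightarrow> bounded q \<Longrightarrow> bounded (Disj p q)"
| "bounded p \<Longrightarrow> bounded (BAll t p)"
| "bounded p \<Longrightarrow> bounded (BEx t p)"

fun Sigma0 :: "nat \<Rightarrow> fm set" and Pi0 :: "nat \<Rightarrow> fm set" where
  "Sigma0 0 = Collect bounded"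
| "Sigma0 (Suc n) = ExN ` Pi0 n"
| "Pi0 0 = Collect bounded"
| "Pi0 (Suc n) = AllN ` Sigma0 n"

definition forall_Pi0 :: "nat \<Rightarrow> fm set" where "forall_Pi0 n = AllS ` Pi0 n"


section \<open>Axioms\<close>

text \<open>The universal closures of a formula; the prefix may contain vacuous quantifiers.\<close>

definition closures :: "fm \<Rightarrow> fm set" where
  "closures p = {q. sentence q \<and> (\<exists>n m. q = (AllN ^^ n) ((AllS ^^ m) p))}"

definition basic_axioms :: "fm set" where
  "basic_axioms = (let m = NVar 1; n = NVar 0 in
    {AllN (Neg (Eq (Add n One) Zero)),
     AllN (AllN (Imp (Eq (Add m One) (Add n One)) (Eq m n))),
     AllN (Eq (Add n Zero) n),
     AllN (AllN (Eq (Add m (Add n One)) (Add (Add m n) One))),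
     AllN (Eq (Mul n Zero) Zero),
     AllN (AllN (Eq (Mul m (Add n One)) (Add (Mul m n) m))),
     AllN (Neg (Less n Zero)),
     AllN (AllN (Iff (Less m (Add n One)) (Disj (Less m n) (Eq m n))))})"

text \<open>In the schemes below the formula arguments may contain further free variables as
  parameters; the induction and comprehension variable is number variable \<open>0\<close>.\<close>

definition induction_ax :: "fm \<Rightarrow> fm" where
  "induction_ax p =
     Imp (Conj (instN Zero p) (AllN (Imp p (substN (NVar(0 := Add (NVar 0) One)) p)))) (AllN p)"

definition comprehension_ax :: "fm \<Rightarrow> fm \<Rightarrow> fm" where
  "comprehension_ax p q =
     Imp (AllN (Iff p q)) (ExS (AllN (Iff (Mem (NVar 0) 0) (liftS p))))"

text \<open>Collection for \<open>p(x, y)\<close>, where \<open>y\<close> is number variable \<open>0\<close> and \<open>x\<close> number variable \<open>1\<close>: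
  for all \<open>t\<close>, if \<open>\<forall>x<t. \<exists>y. p(x, y)\<close> then \<open>\<exists>s. \<forall>x<t. \<exists>y<s. p(x, y)\<close>.\<close>

definition collection_ax :: "fm \<Rightarrow> fm" where
  "collection_ax p =
     AllN (Imp (BAll (NVar 0) (ExN (liftN 2 1 p)))
               (ExN (BAll (NVar 1) (BEx (NVar 1) (liftN 2 2 p)))))"

definition RCA0 :: "fm set" where
  "RCA0 = basic_axioms
     \<union> (\<Union>p\<in>Sigma0 1. closures (induction_ax p))
     \<union> (\<Union>p\<in>Sigma0 1. \<Union>q\<in>Pi0 1. closures (comprehension_ax p q))"

definition BSigma02 :: "fm set" where
  "BSigma02 = (\<Union>p\<in>Sigma0 2. closures (collection_ax p))"


section \<open>Coding of finite sequences, functions and colorings\<close>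

text \<open>The coding is that of Simpson, Subsystems of Second Order Arithmetic, Section II.2.  Formula
  macros take terms for their number arguments and variable indices for their set arguments.\<close>

abbreviation Two :: tm where "Two \<equiv> Add One One"

definition pair :: "tm \<Rightarrow> tm \<Rightarrow> tm" where
  "pair t u = Add (Mul (Add t u) (Add t u)) t"

definition dvdF :: "tm \<Rightarrow> tm \<Rightarrow> fm" where
  "dvdF t u = ExN (Eq (shift 1 u) (Mul (shift 1 t) (NVar 0)))"

definition tripleF :: "tm \<Rightarrow> fm" where
  "tripleF c = ExN (ExN (ExN (Eq (shift 3 c) (pair (NVar 2) (pair (NVar 1) (NVar 0))))))"

text \<open>The triple \<open>(k, (m, n))\<close> represents the finite set of all \<open>i < k\<close> such that
  \<open>m * (i + 1) + 1\<close> divides \<open>n\<close>.\<close>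

definition inF :: "tm \<Rightarrow> tm \<Rightarrow> fm" where
  "inF i c = (let k = NVar 2; m = NVar 1; n = NVar 0 in
     ExN (ExN (ExN (Conj (Eq (shift 3 c) (pair k (pair m n)))
       (Conj (Less (shift 3 i) k)
             (dvdF (Add (Mul m (Add (shift 3 i) One)) One) n))))))"

text \<open>The code of a finite set is the least triple representing it, so codes are unique.\<close>

definition fin_codeF :: "tm \<Rightarrow> fm" where
  "fin_codeF c = Conj (tripleF c)
     (BAll c (Imp (tripleF (NVar 0))
       (Neg (AllN (Iff (inF (NVar 0) (NVar 1)) (inF (NVar 0) (shift 2 c)))))))"

definition lengthF :: "tm \<Rightarrow> tm \<Rightarrow> fm" where
  "lengthF s l =
     AllN (Iff (Less (NVar 0) (shift 1 l)) (ExN (inF (pair (NVar 1) (NVar 0)) (shift 2 s))))"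

text \<open>A finite sequence is a finite set of pairs that is single-valued and whose domain is an
  initial segment of the numbers.\<close>

definition seqF :: "tm \<Rightarrow> fm" where
  "seqF s = Conj (fin_codeF s)
    (Conj (AllN (Imp (inF (NVar 0) (shift 1 s))
             (ExN (ExN (Eq (NVar 2) (pair (NVar 1) (NVar 0)))))))
    (Conj (AllN (AllN (AllN (Imp
             (Conj (inF (pair (NVar 2) (NVar 1)) (shift 3 s))
                   (inF (pair (NVar 2) (NVar 0)) (shift 3 s)))
             (Eq (NVar 1) (NVar 0))))))
          (ExN (lengthF (shift 1 s) (NVar 0)))))"

definition binseqF :: "tm \<Rightarrow> fm" where
  "binseqF s = Conj (seqF s)
     (AllN (AllN (Imp (inF (pair (NVar 1) (NVar 0)) (shift 2 s)) (Less (NVar 0) Two))))"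

definition subseteqF :: "tm \<Rightarrow> tm \<Rightarrow> fm" where
  "subseteqF s t = AllN (Imp (inF (NVar 0) (shift 1 s)) (inF (NVar 0) (shift 1 t)))"

text \<open>For finite sequences, inclusion of the sets of pairs is the initial segment relation.\<close>

definition bintreeF :: "nat \<Rightarrow> fm" where
  "bintreeF T = Conj (AllN (Imp (Mem (NVar 0) T) (binseqF (NVar 0))))
     (AllN (AllN (Imp (Conj (Mem (NVar 1) T) (Conj (seqF (NVar 0)) (subseteqF (NVar 0) (NVar 1))))
                      (Mem (NVar 0) T))))"

definition infiniteF :: "nat \<Rightarrow> fm" where
  "infiniteF X = AllN (ExN (Conj (Less (NVar 1) (NVar 0)) (Mem (NVar 0) X)))"

definition Ex1N :: "fm \<Rightarrow> fm" where
  "Ex1N p = ExN (Conj p (AllN (Imp (liftN 1 1 p) (Eq (NVar 0) (NVar 1)))))"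

text \<open>Functions are sets of pairs.\<close>

definition functionF :: "nat \<Rightarrow> fm" where
  "functionF f =
     Conj (AllN (Imp (Mem (NVar 0) f) (ExN (ExN (Eq (NVar 2) (pair (NVar 1) (NVar 0)))))))
          (AllN (Ex1N (Mem (pair (NVar 1) (NVar 0)) f)))"

text \<open>\<open>f\<close> is a path through \<open>T\<close>: for every \<open>n\<close>, the sequence \<open>(f(0), \<dots>, f(n - 1))\<close> is in \<open>T\<close>.\<close>

definition pathF :: "nat \<Rightarrow> nat \<Rightarrow> fm" where
  "pathF f T = Conj (functionF f)
     (AllN (ExN (Conj (Mem (NVar 0) T) (Conj (seqF (NVar 0)) (Conj (lengthF (NVar 0) (NVar 1))
        (AllN (Imp (inF (NVar 0) (NVar 1)) (Mem (NVar 0) f))))))))"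

definition WKL :: fm where
  "WKL = AllS (Imp (Conj (bintreeF 0) (infiniteF 0)) (ExS (pathF 0 1)))"

text \<open>A coloring of pairs with two colors is a function with domain the set of all pairs \<open>(x, y)\<close>
  with \<open>x < y\<close> (representing the unordered pair) and values below \<open>2\<close>.\<close>

definition coloringF :: "nat \<Rightarrow> fm" where
  "coloringF f =
     Conj (AllN (Imp (Mem (NVar 0) f)
            (ExN (ExN (ExN (Conj (Less (NVar 2) (NVar 1)) (Conj (Less (NVar 0) Two)
               (Eq (NVar 3) (pair (pair (NVar 2) (NVar 1)) (NVar 0))))))))))
          (AllN (AllN (Imp (Less (NVar 1) (NVar 0))
             (Ex1N (Mem (pair (pair (NVar 2) (NVar 1)) (NVar 0)) f)))))"

definition homogeneousF :: "nat \<Rightarrow> nat \<Rightarrow> fm" where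
  "homogeneousF H f = BEx Two (AllN (AllN (Imp
     (Conj (Mem (NVar 1) H) (Conj (Mem (NVar 0) H) (Less (NVar 1) (NVar 0))))
     (Mem (pair (pair (NVar 1) (NVar 0)) (NVar 2)) f))))"

definition RT22 :: fm where
  "RT22 = AllS (Imp (coloringF 0) (ExS (Conj (infiniteF 0) (homogeneousF 0 1))))"

definition WKL0 :: "fm set" where "WKL0 = insert WKL RCA0"


section \<open>Conservation\<close>

definition conservative_over :: "fm set \<Rightarrow> fm set \<Rightarrow> fm set \<Rightarrow> bool" where
  "conservative_over C T' T \<longleftrightarrow> (\<forall>p\<in>C. sentence p \<longrightarrow> T' \<turnstile> p \<longrightarrow> T \<turnstile> p)"

end

theory Submission
  imports Defs "HOL-Library.Countable_Set" "HOL-Library.Nat_Bijection"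
begin

text \<open>Suppose that \<open>\<forall>A \<forall>w \<exists>x \<forall>y \<exists>z \<phi>\<close> is not provable in \<open>RCA\<^sub>0 + B\<Sigma>\<^sub>2\<close>. By completeness and compactness its
  negation holds in a countable nonstandard model \<open>M\<close> of \<open>RCA\<^sub>0 + B\<Sigma>\<^sub>2\<close>, so there are \<open>A\<close> and \<open>w\<close> with
  \<open>\<forall>x \<exists>y \<forall>z Th(x, y, z)\<close> where \<open>Th\<close> is \<open>\<not> \<phi>\<close>; \<open>B\<Sigma>\<^sub>2\<close> bounds the \<open>y\<close> uniformly for \<open>x \<le> t\<close>. Call a finite
  set large of order \<open>0\<close> on \<open>[u, v]\<close> if it meets this interval, and large of order \<open>n + 1\<close> if \<open>[u, v]\<close> contains
  \<open>u\<close> successive blocks on which it is large of order \<open>n\<close>, such that for every \<open>x\<close> below the start of the gap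
  before a block a \<open>y\<close> with \<open>\<forall>z Th(x, y, z)\<close>, for \<open>z\<close> up to the end of the block, is found below the end of the
  gap. In \<open>M\<close> there are sets large of every standard order, hence by overspill of a nonstandard one. For every
  standard \<open>n\<close> there is a standard \<open>m\<close> such that each two-colouring of the pairs of a set large of order \<open>m\<close>
  has a homogeneous subset large of order \<open>n\<close>; similarly a set large of sufficient order has large pieces
  avoiding the range of a given coded function with fewer than \<open>u\<close> arguments. Treating all coded colourings and
  functions in \<open>\<omega>\<close> steps yields a cut \<open>J\<close> such that \<open>J\<close> with the sets coded in \<open>M\<close> satisfies \<open>WKL\<^sub>0\<close>
  (by semiregularity), \<open>RT\<^sup>2\<^sub>2\<close> and \<open>\<forall>x \<exists>y \<forall>z \<not> \<phi>\<close>, whence soundness gives the claim.\<close>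

section \<open>Semantics\<close>

text \<open>\<open>M\<close> need not satisfy Sigma_2 induction, so the Ramsey step cannot be
  iterated inside \<open>M\<close>, nor be proved there for nonstandard orders. Each step is
  therefore proved for every standard order separately; as its claim is Sigma_1, overspill restores
  a nonstandard order afterwards, and the iteration runs outside \<open>M\<close>, which is where
  countability enters. Collection for Sigma_2 formulas is used only to see that large sets exist.
  Truth of the Pi_3 statement in \<open>J\<close> is carried by a finite condition: a witness found
  in a gap has to serve only the \<open>z\<close> up to the end of the following block. In the limit
  the gaps end inside \<open>J\<close> and the blocks beyond it, so the witness serves all
  \<open>z\<close> in \<open>J\<close>. The gaps also exceed \<open>hh\<close>. Its summands bound
  the codes of sets of points up to \<open>t\<close>, the codes of sets of block indices up to
  \<open>2^(2t)\<close>, and the number of pairs of a colour and a length. Thus the colourings in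
  the Ramsey step have fewer colours than the start of a block, and \<open>J\<close> is closed under
  addition and multiplication.\<close>

record 'a model =
  univ :: "'a set"
  zeroM :: 'a
  oneM :: 'a
  addM :: "'a \<Rightarrow> 'a \<Rightarrow> 'a"
  mulM :: "'a \<Rightarrow> 'a \<Rightarrow> 'a"
  lessM :: "'a \<Rightarrow> 'a \<Rightarrow> bool"
  setsM :: "'a set set"

abbreviation scons :: "'a \<Rightarrow> (nat \<Rightarrow> 'a) \<Rightarrow> nat \<Rightarrow> 'a" (infixr "##" 65) where
  "x ## e \<equiv> case_nat x e"

primrec val :: "('a, 'b) model_scheme \<Rightarrow> (nat \<Rightarrow> 'a) \<Rightarrow> tm \<Rightarrow> 'a" where
  "val A e (NVar n) = e n"
| "val A e Zero = zeroM A"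
| "val A e One = oneM A"
| "val A e (Add t u) = addM A (val A e t) (val A e u)"
| "val A e (Mul t u) = mulM A (val A e t) (val A e u)"

primrec sat :: "('a, 'b) model_scheme \<Rightarrow> (nat \<Rightarrow> 'a) \<Rightarrow> (nat \<Rightarrow> 'a set) \<Rightarrow> fm \<Rightarrow> bool" where
  "sat A e s Fls \<longleftrightarrow> False"
| "sat A e s (Eq t u) \<longleftrightarrow> val A e t = val A e u"
| "sat A e s (Less t u) \<longleftrightarrow> lessM A (val A e t) (val A e u)"
| "sat A e s (Mem t X) \<longleftrightarrow> val A e t \<in> s X"
| "sat A e s (Imp p q) \<longleftrightarrow> (sat A e s p \<longrightarrow> sat A e s q)"
| "sat A e s (Conj p q) \<longleftrightarrow> sat A e s p \<and> sat A e s q"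
| "sat A e s (Disj p q) \<longleftrightarrow> sat A e s p \<or> sat A e s q"
| "sat A e s (AllN p) \<longleftrightarrow> (\<forall>x\<in>univ A. sat A (x ## e) s p)"
| "sat A e s (ExN p) \<longleftrightarrow> (\<exists>x\<in>univ A. sat A (x ## e) s p)"
| "sat A e s (AllS p) \<longleftrightarrow> (\<forall>X\<in>setsM A. sat A e (X ## s) p)"
| "sat A e s (ExS p) \<longleftrightarrow> (\<exists>X\<in>setsM A. sat A e (X ## s) p)"

lemma scons_eta: "(e 0 ## (\<lambda>n. e (Suc n))) = e"
  by (auto split: nat.split)

lemma val_subst: "val A e (subst_tm \<sigma> t) = val A (\<lambda>n. val A e (\<sigma> n)) t"
  by (induction t) auto

lemma val_shift: "val A (x ## e) (shift (Suc 0) t) = val A e t"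
  by (simp add: shift_def val_subst)

lemma val_upN: "(\<lambda>n. val A (x ## e) (upN \<sigma> n)) = x ## (\<lambda>n. val A e (\<sigma> n))"
  by (rule ext) (simp add: upN_def val_shift split: nat.split)

lemma upS_scons: "(\<lambda>n. (X ## s) (upS \<rho> n)) = X ## (\<lambda>n. s (\<rho> n))"
  by (rule ext) (simp add: upS_def split: nat.split)

lemma sat_subst:
  "sat A e s (subst \<sigma> \<rho> p) \<longleftrightarrow> sat A (\<lambda>n. val A e (\<sigma> n)) (\<lambda>n. s (\<rho> n)) p"
  by (induction p arbitrary: e s \<sigma> \<rho>) (simp_all add: val_subst val_upN upS_scons)

lemma sat_liftN1: "sat A (x ## e) s (liftN 0 (Suc 0) p) \<longleftrightarrow> sat A e s p"
  by (simp add: liftN_def substN_def sat_subst)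

lemma sat_liftS: "sat A e (X ## s) (liftS p) \<longleftrightarrow> sat A e s p"
  by (simp add: liftS_def substS_def sat_subst)

lemma sat_instN: "sat A e s (instN t p) \<longleftrightarrow> sat A (val A e t ## e) s p"
proof -
  have "(\<lambda>n. val A e (case_nat t NVar n)) = val A e t ## e"
    by (auto split: nat.split)
  then show ?thesis by (simp add: instN_def substN_def sat_subst)
qed

lemma sat_instS: "sat A e s (instS X p) \<longleftrightarrow> sat A e (s X ## s) p"
proof -
  have "(\<lambda>n. s (case_nat X id n)) = s X ## s"
    by (rule ext) (simp split: nat.split)
  then show ?thesis by (simp add: instS_def substS_def sat_subst)
qed

definition wf_model :: "('a, 'b) model_scheme \<Rightarrow> bool" where
  "wf_model A \<longleftrightarrow> zeroM A \<in> univ A \<and> oneM A \<in> univ A \<and>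
     (\<forall>x\<in>univ A. \<forall>y\<in>univ A. addM A x y \<in> univ A \<and> mulM A x y \<in> univ A) \<and> setsM A \<noteq> {}"

lemma val_univ: "wf_model A \<Longrightarrow> range e \<subseteq> univ A \<Longrightarrow> val A e t \<in> univ A"
  by (induction t) (auto simp: wf_model_def)

lemma range_scons: "range (x ## e) \<subseteq> D \<longleftrightarrow> x \<in> D \<and> range e \<subseteq> D"
  by (force simp: image_subset_iff split: nat.split)

theorem soundness:
  assumes "\<Gamma> \<turnstile> p" "wf_model A" "range e \<subseteq> univ A" "range s \<subseteq> setsM A" "\<forall>q\<in>\<Gamma>. sat A e s q"
  shows "sat A e s p"
  using assms
proof (induction arbitrary: e s)
  case (AllNE \<Gamma> p t)
  then show ?case by (simp add: sat_instN val_univ)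
next
  case (ExNI \<Gamma> t p)
  then have "sat A (val A e t ## e) s p" by (simp add: sat_instN)
  with ExNI.prems show ?case by (auto intro: val_univ)
next
  case (ExNE \<Gamma> p q)
  have "sat A e s (ExN p)" by (rule ExNE.IH(1)[OF ExNE.prems])
  then obtain x where "x \<in> univ A" "sat A (x ## e) s p" by auto
  with ExNE.prems have "sat A (x ## e) s (liftN 0 1 q)"
    by (intro ExNE.IH(2)) (auto simp: sat_liftN1 range_scons)
  then show ?case by (simp add: sat_liftN1)
next
  case (ExSE \<Gamma> p q)
  have "sat A e s (ExS p)" by (rule ExSE.IH(1)[OF ExSE.prems])
  then obtain x where "x \<in> setsM A" "sat A e (x ## s) p" by auto
  with ExSE.prems have "sat A e (x ## s) (liftS q)"
    by (intro ExSE.IH(2)) (auto simp: sat_liftS range_scons)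
  then show ?case by (simp add: sat_liftS)
next
  case (EqE \<Gamma> t u p)
  then show ?case by (simp add: sat_instN)
next
  case (AllNI \<Gamma> p)
  then show ?case by (auto simp: sat_liftN1 range_scons)
next
  case (AllSI \<Gamma> p)
  then show ?case by (auto simp: sat_liftS range_scons)
next
  case (AllSE \<Gamma> p X)
  then show ?case by (simp add: sat_instS) (metis range_subsetD)
next
  case (ExSI \<Gamma> X p)
  then show ?case by (simp add: sat_instS) (metis range_subsetD)
next
  case (RAA p \<Gamma>)
  then show ?case by fastforce
next
  case (DisjE \<Gamma> p q r)
  have "sat A e s (Disj p q)" by (rule DisjE.IH(1)[OF DisjE.prems])
  then consider "sat A e s p" | "sat A e s q" by auto
  then show ?case
    by cases (rule DisjE.IH(2), use DisjE.prems in auto, rule DisjE.IH(3), use DisjE.prems in auto)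
qed auto


section \<open>Completeness\<close>

lemma weakening: "\<Gamma> \<turnstile> p \<Longrightarrow> \<Gamma> \<subseteq> \<Delta> \<Longrightarrow> \<Delta> \<turnstile> p"
proof (induction arbitrary: \<Delta> rule: provable.induct)
  case (Assm p \<Gamma>)
  then show ?case by (auto intro: provable.Assm)
next
  case (ImpI p \<Gamma> q)
  then show ?case by (intro provable.ImpI ImpI.IH) auto
next
  case (ImpE \<Gamma> p q)
  show ?case by (rule provable.ImpE[of _ p]) (use ImpE in simp_all)
next
  case (ConjI \<Gamma> p q)
  then show ?case by (intro provable.ConjI) simp_all
next
  case (ConjE1 \<Gamma> p q)
  show ?case by (rule provable.ConjE1[of _ p q]) (use ConjE1 in simp)
next
  case (ConjE2 \<Gamma> p q)
  show ?case by (rule provable.ConjE2[of _ p q]) (use ConjE2 in simp)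
next
  case (DisjI1 \<Gamma> p q)
  then show ?case by (intro provable.DisjI1) simp
next
  case (DisjI2 \<Gamma> q p)
  then show ?case by (intro provable.DisjI2) simp
next
  case (DisjE \<Gamma> p q r)
  have "\<Delta> \<turnstile> Disj p q" by (rule DisjE.IH) (use DisjE.prems in auto)
  moreover have "insert p \<Delta> \<turnstile> r" by (rule DisjE.IH(2)) (use DisjE.prems in auto)
  moreover have "insert q \<Delta> \<turnstile> r" by (rule DisjE.IH(3)) (use DisjE.prems in auto)
  ultimately show ?case by (rule provable.DisjE)
next
  case (RAA p \<Gamma>)
  then show ?case by (auto intro!: provable.RAA[of p] RAA.IH)
next
  case (AllNI \<Gamma> p)
  then show ?case by (intro provable.AllNI AllNI.IH) auto
next
  case (AllNE \<Gamma> p t)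
  then show ?case by (intro provable.AllNE) simp
next
  case (ExNI \<Gamma> t p)
  show ?case by (rule provable.ExNI[of _ t]) (use ExNI in simp)
next
  case (ExNE \<Gamma> p q)
  have "\<Delta> \<turnstile> ExN p" using ExNE.prems by (rule ExNE.IH)
  moreover have "insert p (liftN 0 1 ` \<Delta>) \<turnstile> liftN 0 1 q"
    by (rule ExNE.IH(2)) (use ExNE.prems in auto)
  ultimately show ?case by (rule provable.ExNE)
next
  case (AllSI \<Gamma> p)
  then show ?case by (intro provable.AllSI AllSI.IH) auto
next
  case (AllSE \<Gamma> p t)
  then show ?case by (intro provable.AllSE) simp
next
  case (ExSI \<Gamma> t p)
  show ?case by (rule provable.ExSI[of _ t]) (use ExSI in simp)
next
  case (ExSE \<Gamma> p q)
  have "\<Delta> \<turnstile> ExS p" using ExSE.prems by (rule ExSE.IH)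
  moreover have "insert p (liftS ` \<Delta>) \<turnstile> liftS q"
    by (rule ExSE.IH(2)) (use ExSE.prems in auto)
  ultimately show ?case by (rule provable.ExSE)
next
  case (EqI \<Gamma> t)
  show ?case by (rule provable.EqI)
next
  case (EqE \<Gamma> t u p)
  then show ?case by (meson provable.EqE)
qed

text \<open>Compactness for derivations: each rule uses finitely many premises of its
  subderivations, and a finite part of a lifted context is the lift of a finite part of the
  context.\<close>

lemma provable_finite: "\<Gamma> \<turnstile> p \<Longrightarrow> \<exists>\<Delta>. finite \<Delta> \<and> \<Delta> \<subseteq> \<Gamma> \<and> \<Delta> \<turnstile> p"
proof (induction rule: provable.induct)
  case (Assm p \<Gamma>)
  then show ?case by (intro exI[of _ "{p}"]) (auto intro: provable.Assm)
next
  case (ImpI p \<Gamma> q)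
  then obtain \<Delta> where "finite \<Delta>" "\<Delta> \<subseteq> insert p \<Gamma>" "\<Delta> \<turnstile> q" by blast
  then show ?case
    by (intro exI[of _ "\<Delta> - {p}"]) (auto intro!: provable.ImpI elim: weakening)
next
  case (ImpE \<Gamma> p q)
  then obtain \<Delta> \<Delta>' where "finite \<Delta>" "\<Delta> \<subseteq> \<Gamma>" "\<Delta> \<turnstile> Imp p q" "finite \<Delta>'" "\<Delta>' \<subseteq> \<Gamma>" "\<Delta>' \<turnstile> p" by blast
  then show ?case
    by (intro exI[of _ "\<Delta> \<union> \<Delta>'"]) (auto intro!: provable.ImpE[of _ p q] elim: weakening)
next
  case (ConjI \<Gamma> p q)
  then obtain \<Delta> \<Delta>' where "finite \<Delta>" "\<Delta> \<subseteq> \<Gamma>" "\<Delta> \<turnstile> p" "finite \<Delta>'" "\<Delta>' \<subseteq> \<Gamma>" "\<Delta>' \<turnstile> q" by blast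
  then show ?case
    by (intro exI[of _ "\<Delta> \<union> \<Delta>'"]) (auto intro!: provable.ConjI elim: weakening)
next
  case (DisjE \<Gamma> p q r)
  then obtain \<Delta> \<Delta>' \<Delta>'' where "finite \<Delta>" "\<Delta> \<subseteq> \<Gamma>" "\<Delta> \<turnstile> Disj p q" "finite \<Delta>'" "\<Delta>' \<subseteq> insert p \<Gamma>" "\<Delta>' \<turnstile> r"
     "finite \<Delta>''" "\<Delta>'' \<subseteq> insert q \<Gamma>" "\<Delta>'' \<turnstile> r" by metis
  then have "(\<Delta> \<union> (\<Delta>' - {p}) \<union> (\<Delta>'' - {q})) \<turnstile> r" 
    by - (rule provable.DisjE[of _ p q]; erule weakening; blast)
  with \<open>finite \<Delta>\<close> \<open>finite \<Delta>'\<close> \<open>finite \<Delta>''\<close> \<open>\<Delta> \<subseteq> \<Gamma>\<close> \<open>\<Delta>' \<subseteq> insert p \<Gamma>\<close> \<open>\<Delta>'' \<subseteq> insert q \<Gamma>\<close>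
  show ?case by (intro exI[of _ "\<Delta> \<union> (\<Delta>' - {p}) \<union> (\<Delta>'' - {q})"]) auto
next
  case (RAA p \<Gamma>)
  then obtain \<Delta> where "finite \<Delta>" "\<Delta> \<subseteq> insert (Neg p) \<Gamma>" "\<Delta> \<turnstile> Fls" by blast
  moreover have "\<Delta> - {Neg p} \<turnstile> p"
    by (rule provable.RAA, rule weakening[OF \<open>\<Delta> \<turnstile> Fls\<close>]) auto
  ultimately show ?case by (intro exI[of _ "\<Delta> - {Neg p}"]) auto
next
  case (AllNI \<Gamma> p)
  then obtain \<Delta> where "finite \<Delta>" "\<Delta> \<subseteq> \<Gamma>" "liftN 0 1 ` \<Delta> \<turnstile> p" by (metis finite_subset_image)
  then show ?case by (blast intro: provable.AllNI)
next
  case (AllSI \<Gamma> p)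
  then obtain \<Delta> where "finite \<Delta>" "\<Delta> \<subseteq> \<Gamma>" "liftS ` \<Delta> \<turnstile> p" by (metis finite_subset_image)
  then show ?case by (blast intro: provable.AllSI)
next
  case (ExNE \<Gamma> p q)
  then obtain \<Delta> \<Delta>' where D: "finite \<Delta>" "\<Delta> \<subseteq> \<Gamma>" "\<Delta> \<turnstile> ExN p"
    "finite \<Delta>'" "\<Delta>' \<subseteq> insert p (liftN 0 1 ` \<Gamma>)" "\<Delta>' \<turnstile> liftN 0 1 q" by blast
  then obtain E where E: "finite E" "E \<subseteq> \<Gamma>" "\<Delta>' - {p} = liftN 0 1 ` E"
    by (metis Diff_subset_conv finite_Diff finite_subset_image insert_is_Un)
  then have "\<Delta>' \<subseteq> insert p (liftN 0 1 ` (\<Delta> \<union> E))" by auto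
  with D E show ?case
    by (intro exI[of _ "\<Delta> \<union> E"]) (auto intro!: provable.ExNE[of _ p q] elim: weakening)
next
  case (ExSE \<Gamma> p q)
  then obtain \<Delta> \<Delta>' where D: "finite \<Delta>" "\<Delta> \<subseteq> \<Gamma>" "\<Delta> \<turnstile> ExS p"
    "finite \<Delta>'" "\<Delta>' \<subseteq> insert p (liftS ` \<Gamma>)" "\<Delta>' \<turnstile> liftS q" by blast
  then obtain E where E: "finite E" "E \<subseteq> \<Gamma>" "\<Delta>' - {p} = liftS ` E"
    by (metis Diff_subset_conv finite_Diff finite_subset_image insert_is_Un)
  then have "\<Delta>' \<subseteq> insert p (liftS ` (\<Delta> \<union> E))" by auto
  with D E show ?case
    by (intro exI[of _ "\<Delta> \<union> E"]) (auto intro!: provable.ExSE[of _ p q] elim: weakening)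
next
  case (EqE \<Gamma> t u p)
  then obtain \<Delta> \<Delta>' where "finite \<Delta>" "\<Delta> \<subseteq> \<Gamma>" "\<Delta> \<turnstile> Eq t u" "finite \<Delta>'" "\<Delta>' \<subseteq> \<Gamma>" "\<Delta>' \<turnstile> instN t p" by blast
  then show ?case
    by (intro exI[of _ "\<Delta> \<union> \<Delta>'"]) (auto intro!: provable.EqE[of _ t u p] elim: weakening)
next
  case (EqI \<Gamma> t)
  then show ?case by (intro exI[of _ "{}"]) (auto intro: provable.EqI)
qed (meson provable.intros)+

section \<open>Substitution calculus\<close>

lemma subst_tm_comp: "subst_tm \<sigma> (subst_tm \<tau> t) = subst_tm (\<lambda>n. subst_tm \<sigma> (\<tau> n)) t"
  by (induction t) auto

lemma subst_tm_NVar: "subst_tm NVar t = t"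
  by (induction t) auto

lemma upN_shift: "subst_tm (upN \<sigma>) (shift (Suc 0) t) = shift (Suc 0) (subst_tm \<sigma> t)"
  by (simp add: shift_def subst_tm_comp upN_def)

lemma inst_shift: "subst_tm (t ## \<sigma>) (shift (Suc 0) u) = subst_tm \<sigma> u"
  by (simp add: shift_def subst_tm_comp)

lemma upN_comp: "(\<lambda>n. subst_tm (upN \<sigma>) (upN \<tau> n)) = upN (\<lambda>n. subst_tm \<sigma> (\<tau> n))"
  by (rule ext) (auto simp: upN_shift[unfolded One_nat_def] upN_def[of \<tau>] upN_def[of "\<lambda>n. subst_tm \<sigma> (\<tau> n)"] upN_def[of \<sigma> ] shift_def subst_tm_comp split: nat.split)

lemma upS_comp: "upS \<rho> \<circ> upS \<pi> = upS (\<rho> \<circ> \<pi>)"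
  by (rule ext) (simp add: upS_def split: nat.split)

lemma subst_comp:
  "subst \<sigma> \<rho> (subst \<tau> \<pi> p) = subst (\<lambda>n. subst_tm \<sigma> (\<tau> n)) (\<rho> \<circ> \<pi>) p"
  by (induction p arbitrary: \<sigma> \<rho> \<tau> \<pi>) (simp_all add: subst_tm_comp upN_comp upS_comp)

lemma upN_NVar [simp]: "upN NVar = NVar"
  by (rule ext) (simp add: upN_def shift_def split: nat.split)

lemma upS_id [simp]: "upS id = id"
  by (rule ext) (simp add: upS_def split: nat.split)

lemma subst_id: "subst NVar id p = p"
proof (induction p)
  case (Mem t X)
  show ?case by (simp add: subst_tm_NVar)
qed (simp_all only: subst.simps upN_NVar upS_id subst_tm_NVar)

lemma subst_lift:
  "subst (upN \<sigma>) \<rho> (liftN 0 (Suc 0) p) = liftN 0 (Suc 0) (subst \<sigma> \<rho> p)"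
  "subst \<sigma> (upS \<rho>) (liftS p) = liftS (subst \<sigma> \<rho> p)"
  by (simp_all add: liftN_def liftS_def substN_def substS_def subst_comp upN_def upS_def comp_def
      shift_def subst_tm_NVar id_def)

lemma subst_scons_upN: "(\<lambda>n. subst_tm (t ## NVar) (upN \<sigma> n)) = t ## \<sigma>"
  by (rule ext) (simp add: upN_def shift_def subst_tm_comp subst_tm_NVar split: nat.split)

lemma instN_subst: "instN t (subst (upN \<sigma>) \<rho> p) = subst (t ## \<sigma>) \<rho> p"
  by (simp add: instN_def substN_def subst_comp subst_scons_upN)

lemma instS_subst: "instS X (subst \<sigma> (upS \<rho>) p) = subst \<sigma> (X ## \<rho>) p"
proof -
  have "(case_nat X id) \<circ> upS \<rho> = X ## \<rho>"
    by (rule ext) (simp add: upS_def split: nat.split)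
  then show ?thesis by (simp add: instS_def substS_def subst_comp subst_tm_NVar)
qed

lemma subst_instN: "subst \<sigma> \<rho> (instN t p) = instN (subst_tm \<sigma> t) (subst (upN \<sigma>) \<rho> p)"
proof -
  have "(\<lambda>n. subst_tm \<sigma> (case_nat t NVar n)) = case_nat (subst_tm \<sigma> t) \<sigma>"
    by (rule ext) (simp split: nat.split)
  then show ?thesis by (simp only: instN_subst) (simp add: instN_def substN_def subst_comp)
qed

lemma subst_instS: "subst \<sigma> \<rho> (instS X p) = instS (\<rho> X) (subst \<sigma> (upS \<rho>) p)"
proof -
  have "\<rho> \<circ> case_nat X id = case_nat (\<rho> X) \<rho>"
    by (rule ext) (simp split: nat.split)
  then show ?thesis by (simp only: instS_subst) (simp add: instS_def substS_def subst_comp)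
qed

text \<open>With this a fresh free variable can be renamed into the eigenvariable of a quantifier
  rule; the Henkin witnesses rest on it.\<close>

lemma provable_subst: "\<Gamma> \<turnstile> p \<Longrightarrow> subst \<sigma> \<rho> ` \<Gamma> \<turnstile> subst \<sigma> \<rho> p"
proof (induction arbitrary: \<sigma> \<rho> rule: provable.induct)
  case (AllNI \<Gamma> p)
  from AllNI.IH[of "upN \<sigma>" \<rho>] show ?case
    by (auto intro!: provable.AllNI simp: image_image subst_lift)
next
  case (AllSI \<Gamma> p)
  from AllSI.IH[of \<sigma> "upS \<rho>"] show ?case
    by (auto intro!: provable.AllSI simp: image_image subst_lift)
next
  case (ExNE \<Gamma> p q)
  show ?case
    by (rule provable.ExNE[of _ "subst (upN \<sigma>) \<rho> p"])
       (use ExNE.IH(1)[of \<sigma> \<rho>] ExNE.IH(2)[of "upN \<sigma>" \<rho>] in \<open>simp_all add: image_image subst_lift\<close>)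
next
  case (ExSE \<Gamma> p q)
  show ?case
    by (rule provable.ExSE[of _ "subst \<sigma> (upS \<rho>) p"])
       (use ExSE.IH(1)[of \<sigma> \<rho>] ExSE.IH(2)[of \<sigma> "upS \<rho>"] in \<open>simp_all add: image_image subst_lift\<close>)
next
  case (EqE \<Gamma> t u p)
  show ?case
    using EqE.IH(1)[of \<sigma> \<rho>] EqE.IH(2)[of \<sigma> \<rho>] by (simp add: subst_instN provable.EqE)
next
  case (DisjE \<Gamma> p q r)
  show ?case
    by (rule provable.DisjE[of _ "subst \<sigma> \<rho> p" "subst \<sigma> \<rho> q"])
      (use DisjE.IH[of \<sigma> \<rho>] in simp_all)
next
  case (AllNE \<Gamma> p t)
  then show ?case by (auto simp: subst_instN intro!: provable.AllNE)
next
  case (ExNI \<Gamma> t p)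
  from ExNI.IH[of \<sigma> \<rho>] show ?case by (simp add: subst_instN) (rule provable.ExNI)
next
  case (AllSE \<Gamma> p X)
  then show ?case by (auto simp: subst_instS intro!: provable.AllSE)
next
  case (ExSI \<Gamma> X p)
  from ExSI.IH[of \<sigma> \<rho>] show ?case by (simp add: subst_instS) (rule provable.ExSI)
next
  case (ImpE \<Gamma> p q)
  from ImpE.IH[of \<sigma> \<rho>] show ?case by (auto intro: provable.ImpE)
next
  case (ConjE1 \<Gamma> p q)
  from ConjE1.IH[of \<sigma> \<rho>] show ?case by (auto intro: provable.ConjE1)
next
  case (ConjE2 \<Gamma> p q)
  from ConjE2.IH[of \<sigma> \<rho>] show ?case by (auto intro: provable.ConjE2)
qed (auto intro: provable.intros)

section \<open>Henkin sets\<close>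

definition cons :: "fm set \<Rightarrow> bool" where "cons \<Gamma> \<longleftrightarrow> \<not> \<Gamma> \<turnstile> Fls"

text \<open>The bound is common to all formulas of the set, so some variable is fresh for the whole
  set and can serve as a Henkin constant; the language need not be extended.\<close>

definition fresh_bound :: "fm set \<Rightarrow> bool" where
  "fresh_bound \<Gamma> \<longleftrightarrow> (\<exists>n m. \<forall>p\<in>\<Gamma>. closed n m p)"

lemma closed_tm_mono: "closed_tm n t \<Longrightarrow> n \<le> n' \<Longrightarrow> closed_tm n' t"
  by (induction t) auto

lemma closed_mono: "closed n m p \<Longrightarrow> n \<le> n' \<Longrightarrow> m \<le> m' \<Longrightarrow> closed n' m' p"
  by (induction p arbitrary: n m n' m') (auto intro: closed_tm_mono)

lemma closed_tm_ex: "\<exists>n. closed_tm n t"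
proof (induction t)
  case (Add t u)
  then obtain n k where "closed_tm n t" "closed_tm k u" by blast
  then show ?case by (intro exI[of _ "max n k"]) (auto intro: closed_tm_mono)
next
  case (Mul t u)
  then obtain n k where "closed_tm n t" "closed_tm k u" by blast
  then show ?case by (intro exI[of _ "max n k"]) (auto intro: closed_tm_mono)
qed auto

lemma closed_ex: "\<exists>n m. closed n m p"
proof -
  have *: "\<exists>n m. closed n m p \<and> closed n m q" if "\<exists>n m. closed n m p" "\<exists>n m. closed n m q" for p q
  proof -
    from that obtain n m n' m' where "closed n m p" "closed n' m' q" by blast
    then show ?thesis by (intro exI[of _ "max n n'"] exI[of _ "max m m'"]) (auto intro: closed_mono)
  qed
  have tt: "\<exists>n. closed_tm n t \<and> closed_tm n u" for t u
  proof -
    obtain n k where "closed_tm n t" "closed_tm k u" using closed_tm_ex by blast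
    then show ?thesis by (intro exI[of _ "max n k"]) (auto intro: closed_tm_mono)
  qed
  show ?thesis
  proof (induction p)
    case (Mem t X)
    then show ?case using closed_tm_ex[of t] by (auto intro!: exI[of _ "Suc X"])
  next
    case (AllN p)
    then obtain n m where "closed n m p" by blast
    then show ?case by (intro exI[of _ n] exI[of _ m]) (auto intro: closed_mono)
  next
    case (ExN p)
    then obtain n m where "closed n m p" by blast
    then show ?case by (intro exI[of _ n] exI[of _ m]) (auto intro: closed_mono)
  next
    case (AllS p)
    then obtain n m where "closed n m p" by blast
    then show ?case by (intro exI[of _ n] exI[of _ m]) (auto intro: closed_mono)
  next
    case (ExS p)
    then obtain n m where "closed n m p" by blast
    then show ?case by (intro exI[of _ n] exI[of _ m]) (auto intro: closed_mono)
  qed (use tt * in auto)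
qed

lemma fresh_bound_insert: "fresh_bound (insert p \<Gamma>) \<longleftrightarrow> fresh_bound \<Gamma>"
proof
  assume "fresh_bound \<Gamma>"
  then obtain n m where "\<forall>p\<in>\<Gamma>. closed n m p" by (auto simp: fresh_bound_def)
  moreover obtain n' m' where "closed n' m' p" using closed_ex by blast
  ultimately have "\<forall>p\<in>insert p \<Gamma>. closed (max n n') (max m m') p" by (auto intro: closed_mono)
  then show "fresh_bound (insert p \<Gamma>)" unfolding fresh_bound_def by blast
qed (auto simp: fresh_bound_def)

lemma subst_tm_closed: "closed_tm n t \<Longrightarrow> (\<And>i. i < n \<Longrightarrow> \<sigma> i = \<tau> i) \<Longrightarrow> subst_tm \<sigma> t = subst_tm \<tau> t"
  by (induction t) auto

lemma subst_closed:
  "closed n m p \<Longrightarrow> (\<And>i. i < n \<Longrightarrow> \<sigma> i = \<tau> i) \<Longrightarrow> (\<And>i. i < m \<Longrightarrow> \<rho> i = \<pi> i) \<Longrightarrow>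
    subst \<sigma> \<rho> p = subst \<tau> \<pi> p"
proof (induction p arbitrary: n m \<sigma> \<tau> \<rho> \<pi>)
  case (AllN p)
  have "subst (upN \<sigma>) \<rho> p = subst (upN \<tau>) \<pi> p"
    using AllN.prems by (intro AllN.IH[of "Suc n" m]) (auto simp: upN_def split: nat.split)
  then show ?case by simp
next
  case (ExN p)
  have "subst (upN \<sigma>) \<rho> p = subst (upN \<tau>) \<pi> p"
    using ExN.prems by (intro ExN.IH[of "Suc n" m]) (auto simp: upN_def split: nat.split)
  then show ?case by simp
next
  case (AllS p)
  have "subst \<sigma> (upS \<rho>) p = subst \<tau> (upS \<pi>) p"
    using AllS.prems by (intro AllS.IH[of n "Suc m"]) (auto simp: upS_def split: nat.split)
  then show ?case by simp
next
  case (ExS p)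
  have "subst \<sigma> (upS \<rho>) p = subst \<tau> (upS \<pi>) p"
    using ExS.prems by (intro ExS.IH[of n "Suc m"]) (auto simp: upS_def split: nat.split)
  then show ?case by simp
next
  case (Imp p q)
  then show ?case by simp metis
next
  case (Conj p q)
  then show ?case by simp metis
next
  case (Disj p q)
  then show ?case by simp metis
qed (auto intro: subst_tm_closed)

text \<open>The variable \<open>n\<close> is fresh. The substitution \<open>\<sigma>\<close> sends
  it to variable 0 and shifts all others, so it acts on the context as the lift and turns the
  witness instance back into \<open>p\<close>; a refutation of the extended set is then an instance
  of \<open>ExNE\<close>.\<close>

lemma witnessN:
  assumes "cons (insert (ExN p) \<Gamma>)" and cl: "\<forall>q\<in>insert (ExN p) \<Gamma>. closed n m q"
  shows "cons (insert (instN (NVar n) p) (insert (ExN p) \<Gamma>))"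
proof (rule ccontr)
  assume "\<not> ?thesis"
  then have *: "insert (instN (NVar n) p) (insert (ExN p) \<Gamma>) \<turnstile> Fls" by (simp add: cons_def)
  define \<sigma> where "\<sigma> = (\<lambda>i. if i = n then NVar 0 else NVar (Suc i))"
  have 1: "subst \<sigma> id q = liftN 0 1 q" if "q \<in> insert (ExN p) \<Gamma>" for q
    unfolding liftN_def substN_def
    by (rule subst_closed[of n m]) (use cl that in \<open>auto simp: \<sigma>_def\<close>)
  have "subst \<sigma> id (instN (NVar n) p) = subst (case_nat (NVar 0) \<sigma>) id p"
    by (simp only: subst_instN instN_subst) (simp add: \<sigma>_def)
  also have "\<dots> = subst NVar id p"
    by (rule subst_closed[of "Suc n" m]) (use cl in \<open>auto simp: \<sigma>_def split: nat.split\<close>)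
  finally have 2: "subst \<sigma> id (instN (NVar n) p) = p" by (simp only: subst_id)
  from provable_subst[OF *, of \<sigma> id] 2
  have "insert p (subst \<sigma> id ` (insert (ExN p) \<Gamma>)) \<turnstile> Fls" by (simp only: image_insert subst.simps)
  also have "subst \<sigma> id ` (insert (ExN p) \<Gamma>) = liftN 0 1 ` insert (ExN p) \<Gamma>"
    by (rule image_cong[OF refl 1])
  finally have "insert (ExN p) \<Gamma> \<turnstile> Fls"
    by - (rule provable.ExNE[of _ p Fls], rule provable.Assm, simp, simp add: liftN_def substN_def)
  with assms(1) show False by (simp add: cons_def)
qed

lemma witnessS:
  assumes "cons (insert (ExS p) \<Gamma>)" and cl: "\<forall>q\<in>insert (ExS p) \<Gamma>. closed n m q"
  shows "cons (insert (instS m p) (insert (ExS p) \<Gamma>))"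
proof (rule ccontr)
  assume "\<not> ?thesis"
  then have *: "insert (instS m p) (insert (ExS p) \<Gamma>) \<turnstile> Fls" by (simp add: cons_def)
  define \<sigma> where "\<sigma> = (\<lambda>i. if i = m then 0 else Suc i)"
  have 1: "subst NVar \<sigma> q = liftS q" if "q \<in> insert (ExS p) \<Gamma>" for q
    unfolding liftS_def substS_def
    by (rule subst_closed[of n m]) (use cl that in \<open>auto simp: \<sigma>_def\<close>)
  have "subst NVar \<sigma> (instS m p) = subst NVar (case_nat 0 \<sigma>) p"
    by (simp only: subst_instS instS_subst) (simp add: \<sigma>_def)
  also have "\<dots> = subst NVar id p"
    by (rule subst_closed[of n "Suc m"]) (use cl in \<open>auto simp: \<sigma>_def split: nat.split\<close>)
  finally have 2: "subst NVar \<sigma> (instS m p) = p" by (simp only: subst_id)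
  from provable_subst[OF *, of NVar \<sigma>] 2
  have "insert p (subst NVar \<sigma> ` (insert (ExS p) \<Gamma>)) \<turnstile> Fls" by (simp only: image_insert subst.simps)
  also have "subst NVar \<sigma> ` (insert (ExS p) \<Gamma>) = liftS ` insert (ExS p) \<Gamma>"
    by (rule image_cong[OF refl 1])
  finally have "insert (ExS p) \<Gamma> \<turnstile> Fls"
    by - (rule provable.ExSE[of _ p Fls], rule provable.Assm, simp, simp add: liftS_def substS_def)
  with assms(1) show False by (simp add: cons_def)
qed

lemma henkin_step:
  assumes "cons \<Gamma>" "fresh_bound \<Gamma>"
  shows "\<exists>\<Delta>. cons \<Delta> \<and> fresh_bound \<Delta> \<and> \<Gamma> \<subseteq> \<Delta> \<and> (p \<in> \<Delta> \<or> \<Gamma> \<turnstile> Neg p) \<and>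
    (\<forall>q. p = ExN q \<longrightarrow> p \<in> \<Delta> \<longrightarrow> (\<exists>t. instN t q \<in> \<Delta>)) \<and>
    (\<forall>q. p = ExS q \<longrightarrow> p \<in> \<Delta> \<longrightarrow> (\<exists>X. instS X q \<in> \<Delta>))"
proof (cases "cons (insert p \<Gamma>)")
  case False
  then have "\<Gamma> \<turnstile> Neg p" by (auto simp: cons_def intro: provable.ImpI)
  moreover have "p \<notin> \<Gamma>" using False assms by (auto simp: insert_absorb)
  ultimately show ?thesis using assms by (intro exI[of _ \<Gamma>]) auto
next
  case True
  have fb: "fresh_bound (insert p \<Gamma>)" using assms by (simp add: fresh_bound_insert)
  then obtain n m where nm: "\<forall>q\<in>insert p \<Gamma>. closed n m q" by (auto simp: fresh_bound_def)
  consider q where "p = ExN q" | q where "p = ExS q" | "\<forall>q. p \<noteq> ExN q \<and> p \<noteq> ExS q" by blast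
  then show ?thesis
  proof cases
    case 1
    show ?thesis
      by (rule exI[of _ "insert (instN (NVar n) q) (insert p \<Gamma>)"])
        (use witnessN[of q \<Gamma> n m] True nm fb 1 in \<open>auto simp: fresh_bound_insert\<close>)
  next
    case 2
    show ?thesis
      by (rule exI[of _ "insert (instS m q) (insert p \<Gamma>)"])
        (use witnessS[of q \<Gamma> n m] True nm fb 2 in \<open>auto simp: fresh_bound_insert\<close>)
  next
    case 3
    show ?thesis
      by (rule exI[of _ "insert p \<Gamma>"]) (use True fb 3 in auto)
  qed
qed

instance tm :: countable by countable_datatype
instance fm :: countable by countable_datatype

lemma henkin_extension:
  assumes "cons \<Gamma>" "fresh_bound \<Gamma>"
  obtains U where "cons U" "\<Gamma> \<subseteq> U" "\<And>p. p \<in> U \<or> U \<turnstile> Neg p"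
    "\<And>p. ExN p \<in> U \<Longrightarrow> \<exists>t. instN t p \<in> U" "\<And>p. ExS p \<in> U \<Longrightarrow> \<exists>X. instS X p \<in> U"
proof -
  define Q where "Q = (\<lambda>p \<Gamma> \<Delta>. \<Gamma> \<subseteq> \<Delta> \<and> (p \<in> \<Delta> \<or> \<Gamma> \<turnstile> Neg p) \<and>
    (\<forall>q. p = ExN q \<longrightarrow> p \<in> \<Delta> \<longrightarrow> (\<exists>t. instN t q \<in> \<Delta>)) \<and>
    (\<forall>q. p = ExS q \<longrightarrow> p \<in> \<Delta> \<longrightarrow> (\<exists>X. instS X q \<in> \<Delta>)))"
  have "\<exists>f. \<forall>k. (cons (f k) \<and> fresh_bound (f k) \<and> (k = 0 \<longrightarrow> f k = \<Gamma>)) \<and> Q (from_nat k) (f k) (f (Suc k))"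
  proof (rule dependent_nat_choice)
    show "\<exists>x. cons x \<and> fresh_bound x \<and> (0 = (0::nat) \<longrightarrow> x = \<Gamma>)" using assms by blast
  next
    fix x and k :: nat
    assume "cons x \<and> fresh_bound x \<and> (k = 0 \<longrightarrow> x = \<Gamma>)"
    then have "cons x" "fresh_bound x" by auto
    from henkin_step[OF this, of "from_nat k"]
    show "\<exists>y. (cons y \<and> fresh_bound y \<and> (Suc k = 0 \<longrightarrow> y = \<Gamma>)) \<and> Q (from_nat k) x y"
      unfolding Q_def by auto
  qed
  then obtain f where f: "\<And>k. cons (f k)" "f 0 = \<Gamma>" "\<And>k. Q (from_nat k) (f k) (f (Suc k))" by metis
  have mono: "f i \<subseteq> f j" if "i \<le> j" for i j
    by (rule lift_Suc_mono_le[OF _ that]) (use f(3) in \<open>auto simp: Q_def\<close>)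
  define U where "U = (\<Union>k. f k)"
  have fin: "\<exists>k. \<Delta> \<subseteq> f k" if "finite \<Delta>" "\<Delta> \<subseteq> U" for \<Delta>
    using that
  proof (induction rule: finite_induct)
    case (insert x F)
    then obtain k l where "F \<subseteq> f k" "x \<in> f l" by (auto simp: U_def)
    then have "insert x F \<subseteq> f (max k l)" using mono[of k "max k l"] mono[of l "max k l"] by auto
    then show ?case by blast
  qed auto
  show ?thesis
  proof
    show "cons U"
      unfolding cons_def
    proof
      assume "U \<turnstile> Fls"
      then obtain \<Delta> where "finite \<Delta>" "\<Delta> \<subseteq> U" "\<Delta> \<turnstile> Fls" using provable_finite by blast
      with fin obtain k where "\<Delta> \<subseteq> f k" by blast
      with \<open>\<Delta> \<turnstile> Fls\<close> have "f k \<turnstile> Fls" by (rule weakening)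
      with f(1) show False by (auto simp: cons_def)
    qed
    show "\<Gamma> \<subseteq> U" using f(2) by (auto simp: U_def)
  next
    fix p :: fm
    from f(3)[of "to_nat p"] from_nat_to_nat[of p] have "p \<in> f (Suc (to_nat p)) \<or> f (to_nat p) \<turnstile> Neg p"
      unfolding Q_def by metis
    moreover have "f k \<subseteq> U" for k by (auto simp: U_def)
    ultimately show "p \<in> U \<or> U \<turnstile> Neg p" by (meson subsetD weakening)
  next
    fix p assume "ExN p \<in> U"
    then obtain l where "ExN p \<in> f l" by (auto simp: U_def)
    let ?k = "to_nat (ExN p)"
    \<comment> \<open>The formula may have entered at another stage than its own. It was not refuted
      at its own stage, as the refutation would persist and contradict stage
      \<open>max ?k l\<close>; hence it was added there, together with a witness.\<close>
    have "\<not> f ?k \<turnstile> Neg (ExN p)"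
    proof
      assume "f ?k \<turnstile> Neg (ExN p)"
      then have "f (max ?k l) \<turnstile> Neg (ExN p)" using mono[of ?k "max ?k l"] by (auto intro: weakening)
      moreover have "f (max ?k l) \<turnstile> ExN p" using mono[of l "max ?k l"] \<open>ExN p \<in> f l\<close> by (auto intro: provable.Assm)
      ultimately have "f (max ?k l) \<turnstile> Fls" by (rule provable.ImpE)
      then show False using f(1) by (auto simp: cons_def)
    qed
    with f(3)[of ?k] have "\<exists>t. instN t p \<in> f (Suc ?k)" unfolding Q_def by auto
    then show "\<exists>t. instN t p \<in> U" unfolding U_def by blast
  next
    fix p assume "ExS p \<in> U"
    then obtain l where "ExS p \<in> f l" by (auto simp: U_def)
    let ?k = "to_nat (ExS p)"
    have "\<not> f ?k \<turnstile> Neg (ExS p)"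
    proof
      assume "f ?k \<turnstile> Neg (ExS p)"
      then have "f (max ?k l) \<turnstile> Neg (ExS p)" using mono[of ?k "max ?k l"] by (auto intro: weakening)
      moreover have "f (max ?k l) \<turnstile> ExS p" using mono[of l "max ?k l"] \<open>ExS p \<in> f l\<close> by (auto intro: provable.Assm)
      ultimately have "f (max ?k l) \<turnstile> Fls" by (rule provable.ImpE)
      then show False using f(1) by (auto simp: cons_def)
    qed
    with f(3)[of ?k] have "\<exists>t. instS t p \<in> f (Suc ?k)" unfolding Q_def by auto
    then show "\<exists>t. instS t p \<in> U" unfolding U_def by blast
  qed
qed

section \<open>Derived rules for equality and for negated quantifiers\<close>

lemma Eq_sym: assumes "\<Gamma> \<turnstile> Eq t u" shows "\<Gamma> \<turnstile> Eq u t"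
  using provable.EqE[OF assms, of "Eq (NVar 0) (shift 1 t)"]
  by (simp add: instN_def substN_def inst_shift subst_tm_NVar provable.EqI)

lemma Eq_trans: assumes "\<Gamma> \<turnstile> Eq t u" "\<Gamma> \<turnstile> Eq u w" shows "\<Gamma> \<turnstile> Eq t w"
  using provable.EqE[OF assms(2), of "Eq (shift 1 t) (NVar 0)"] assms(1)
  by (simp add: instN_def substN_def inst_shift subst_tm_NVar)

lemma Eq_Less: assumes "\<Gamma> \<turnstile> Eq t t'" "\<Gamma> \<turnstile> Eq u u'" "\<Gamma> \<turnstile> Less t u" shows "\<Gamma> \<turnstile> Less t' u'"
  using provable.EqE[OF assms(1), of "Less (NVar 0) (shift 1 u)"]
    provable.EqE[OF assms(2), of "Less (shift 1 t') (NVar 0)"] assms(3)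
  by (simp add: instN_def substN_def inst_shift subst_tm_NVar)

lemma Eq_Mem: assumes "\<Gamma> \<turnstile> Eq t t'" "\<Gamma> \<turnstile> Mem t X" shows "\<Gamma> \<turnstile> Mem t' X"
  using provable.EqE[OF assms(1), of "Mem (NVar 0) X"] assms(2)
  by (simp add: instN_def substN_def)

lemma Eq_Add: assumes "\<Gamma> \<turnstile> Eq t t'" "\<Gamma> \<turnstile> Eq u u'" shows "\<Gamma> \<turnstile> Eq (Add t u) (Add t' u')"
  using provable.EqE[OF assms(1), of "Eq (Add (shift 1 t) (shift 1 u)) (Add (NVar 0) (shift 1 u))"]
    provable.EqE[OF assms(2), of "Eq (Add (shift 1 t) (shift 1 u)) (Add (shift 1 t') (NVar 0))"]
  by (simp add: instN_def substN_def inst_shift subst_tm_NVar provable.EqI)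

lemma Eq_Mul: assumes "\<Gamma> \<turnstile> Eq t t'" "\<Gamma> \<turnstile> Eq u u'" shows "\<Gamma> \<turnstile> Eq (Mul t u) (Mul t' u')"
  using provable.EqE[OF assms(1), of "Eq (Mul (shift 1 t) (shift 1 u)) (Mul (NVar 0) (shift 1 u))"]
    provable.EqE[OF assms(2), of "Eq (Mul (shift 1 t) (shift 1 u)) (Mul (shift 1 t') (NVar 0))"]
  by (simp add: instN_def substN_def inst_shift subst_tm_NVar provable.EqI)

lemma ex_falso: "\<Gamma> \<turnstile> Fls \<Longrightarrow> \<Gamma> \<turnstile> p"
  by (rule provable.RAA, erule weakening) auto

lemma not_AllN: assumes "\<Gamma> \<turnstile> Neg (AllN p)" shows "\<Gamma> \<turnstile> ExN (Neg p)"
proof (rule provable.RAA)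
  let ?G = "insert (Neg (ExN (Neg p))) \<Gamma>"
  let ?G' = "insert (Neg p) (liftN 0 1 ` ?G)"
  \<comment> \<open>Lifting a body past a new variable and instantiating it with that variable
    cancel.\<close>
  have *: "instN (NVar 0) (subst (upN (\<lambda>n. NVar (Suc n))) id q) = q" for q
  proof -
    have "instN (NVar 0) (subst (upN (\<lambda>n. NVar (Suc n))) id q) = subst (NVar 0 ## (\<lambda>n. NVar (Suc n))) id q"
      by (rule instN_subst)
    also have "(NVar 0 ## (\<lambda>n. NVar (Suc n))) = NVar" by (auto split: nat.split)
    finally show ?thesis by (simp only: subst_id)
  qed
  have "?G' \<turnstile> Imp (liftN 0 1 (ExN (Neg p))) Fls"
    by (rule provable.Assm) (simp add: liftN_def substN_def)
  moreover have "?G' \<turnstile> liftN 0 1 (ExN (Neg p))"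
    unfolding liftN_def substN_def
    by (simp, rule provable.ExNI[of _ "NVar 0"])
      (simp only: *[of "Neg p", unfolded subst.simps], rule provable.Assm, simp)
  ultimately have "?G' \<turnstile> Fls" by (rule provable.ImpE)
  then have "?G \<turnstile> AllN p" by (rule provable.AllNI[OF provable.RAA])
  moreover have "?G \<turnstile> Neg (AllN p)" by (rule weakening[OF assms]) auto
  ultimately show "?G \<turnstile> Fls" by (rule provable.ImpE[rotated])
qed

lemma not_AllS: assumes "\<Gamma> \<turnstile> Neg (AllS p)" shows "\<Gamma> \<turnstile> ExS (Neg p)"
proof (rule provable.RAA)
  let ?G = "insert (Neg (ExS (Neg p))) \<Gamma>"
  let ?G' = "insert (Neg p) (liftS ` ?G)"
  have *: "instS 0 (subst NVar (upS Suc) q) = q" for q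
  proof -
    have "instS 0 (subst NVar (upS Suc) q) = subst NVar (0 ## Suc) q"
      by (rule instS_subst)
    also have "(0 ## Suc) = id" by (auto split: nat.split)
    finally show ?thesis by (simp only: subst_id)
  qed
  have "?G' \<turnstile> Imp (liftS (ExS (Neg p))) Fls"
    by (rule provable.Assm) (simp add: liftS_def substS_def)
  moreover have "?G' \<turnstile> liftS (ExS (Neg p))"
    unfolding liftS_def substS_def
    by (simp, rule provable.ExSI[of _ "0"])
      (simp only: *[of "Neg p", unfolded subst.simps], rule provable.Assm, simp)
  ultimately have "?G' \<turnstile> Fls" by (rule provable.ImpE)
  then have "?G \<turnstile> AllS p" by (rule provable.AllSI[OF provable.RAA])
  moreover have "?G \<turnstile> Neg (AllS p)" by (rule weakening[OF assms]) auto
  ultimately show "?G \<turnstile> Fls" by (rule provable.ImpE[rotated])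
qed

text \<open>The canonical model of a Henkin set \<open>U\<close>: terms, represented by a chosen element of their
  class modulo provable equality, and the extensions of the set variables.\<close>

definition rep :: "fm set \<Rightarrow> tm \<Rightarrow> tm" where "rep U t = (SOME u. U \<turnstile> Eq t u)"

definition ext :: "fm set \<Rightarrow> nat \<Rightarrow> tm set" where "ext U X = {rep U t | t. U \<turnstile> Mem t X}"

definition canonical :: "fm set \<Rightarrow> tm model" where
  "canonical U = \<lparr>univ = range (rep U), zeroM = rep U Zero, oneM = rep U One,
     addM = (\<lambda>t u. rep U (Add t u)), mulM = (\<lambda>t u. rep U (Mul t u)),
     lessM = (\<lambda>t u. U \<turnstile> Less t u), setsM = range (ext U)\<rparr>"

lemma rep_Eq: "U \<turnstile> Eq t (rep U t)"
  unfolding rep_def by (rule someI[of "\<lambda>u. U \<turnstile> Eq t u" t]) (rule provable.EqI)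

lemma rep_eq_iff: "rep U t = rep U u \<longleftrightarrow> U \<turnstile> Eq t u"
proof
  assume "rep U t = rep U u"
  then show "U \<turnstile> Eq t u" using rep_Eq Eq_sym Eq_trans by metis
next
  assume "U \<turnstile> Eq t u"
  then have "(\<lambda>w. U \<turnstile> Eq t w) = (\<lambda>w. U \<turnstile> Eq u w)" using Eq_sym Eq_trans by blast
  then show "rep U t = rep U u" by (simp add: rep_def)
qed

lemma wf_canonical: "wf_model (canonical U)"
  by (auto simp: wf_model_def canonical_def)

lemma val_canonical: "val (canonical U) (\<lambda>n. rep U (\<sigma> n)) t = rep U (subst_tm \<sigma> t)"
proof (induction t)
  case (Add t u)
  then show ?case by (auto simp: canonical_def rep_eq_iff intro: Eq_Add Eq_sym rep_Eq)
next
  case (Mul t u)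
  then show ?case by (auto simp: canonical_def rep_eq_iff intro: Eq_Mul Eq_sym rep_Eq)
qed (simp_all add: canonical_def)

text \<open>The truth lemma. It ranges over all substitutions because the quantifier cases extend
  the environment by a term or a set variable, which on the syntactic side is a
  substitution.\<close>

lemma sat_canonical:
  assumes U: "cons U" "\<And>p. p \<in> U \<or> U \<turnstile> Neg p"
    "\<And>p. ExN p \<in> U \<Longrightarrow> \<exists>t. instN t p \<in> U" "\<And>p. ExS p \<in> U \<Longrightarrow> \<exists>X. instS X p \<in> U"
  shows "sat (canonical U) (\<lambda>n. rep U (\<sigma> n)) (\<lambda>n. ext U (\<rho> n)) p \<longleftrightarrow> U \<turnstile> subst \<sigma> \<rho> p"
proof (induction p arbitrary: \<sigma> \<rho>)
  have neg: "\<not> U \<turnstile> p \<longleftrightarrow> U \<turnstile> Neg p" for p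
  proof
    show "U \<turnstile> Neg p" if "\<not> U \<turnstile> p" using that U(2)[of p] provable.Assm by blast
    show "\<not> U \<turnstile> p" if "U \<turnstile> Neg p" using that U(1) provable.ImpE by (auto simp: cons_def)
  qed
  have mem: "U \<turnstile> p \<longleftrightarrow> p \<in> U" for p
    using neg[of p] U(2)[of p] provable.Assm by blast
  have rep_cons: "(rep U t ## (\<lambda>n. rep U (\<sigma> n))) = (\<lambda>n. rep U ((t ## \<sigma>) n))" for t \<sigma>
    by (rule HOL.ext) (simp split: nat.split)
  have ext_cons: "(ext U X ## (\<lambda>n. ext U (\<sigma> n))) = (\<lambda>n. ext U ((X ## \<sigma>) n))" for X \<sigma>
    by (rule HOL.ext) (simp split: nat.split)
  {
    case Fls
    then show ?case using U(1) by (simp add: cons_def)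
  next
    case (Eq t u)
    then show ?case by (simp add: val_canonical rep_eq_iff)
  next
    case (Less t u)
    have "U \<turnstile> Less (rep U (subst_tm \<sigma> t)) (rep U (subst_tm \<sigma> u)) \<longleftrightarrow> U \<turnstile> Less (subst_tm \<sigma> t) (subst_tm \<sigma> u)"
      by (meson Eq_Less Eq_sym rep_Eq)
    then show ?case by (simp add: val_canonical) (simp add: canonical_def)
  next
    case (Mem t X)
    have "rep U (subst_tm \<sigma> t) \<in> ext U (\<rho> X) \<longleftrightarrow> U \<turnstile> Mem (subst_tm \<sigma> t) (\<rho> X)"
      by (auto simp: ext_def rep_eq_iff intro: Eq_Mem Eq_sym provable.EqI)
    then show ?case by (simp add: val_canonical)
  next
    case (Imp p q)
    have "U \<turnstile> Imp p q \<longleftrightarrow> (U \<turnstile> p \<longrightarrow> U \<turnstile> q)" for p q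
    proof
      assume *: "U \<turnstile> p \<longrightarrow> U \<turnstile> q"
      show "U \<turnstile> Imp p q"
      proof (cases "U \<turnstile> p")
        case True
        then show ?thesis using * by (blast intro: provable.ImpI weakening)
      next
        case False
        then have "insert p U \<turnstile> Fls"
          using neg by (meson insertI1 provable.Assm provable.ImpE subset_insertI weakening)
        then show ?thesis by (blast intro: provable.ImpI ex_falso)
      qed
    qed (blast intro: provable.ImpE)
    then show ?case using Imp by simp
  next
    case (Conj p q)
    have "U \<turnstile> Conj p q \<longleftrightarrow> U \<turnstile> p \<and> U \<turnstile> q" for p q
      by (meson provable.ConjE1 provable.ConjE2 provable.ConjI)
    then show ?case using Conj by simp
  next
    case (Disj p q)
    have "U \<turnstile> Disj p q \<longleftrightarrow> U \<turnstile> p \<or> U \<turnstile> q" for p q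
    proof
      assume *: "U \<turnstile> Disj p q"
      show "U \<turnstile> p \<or> U \<turnstile> q"
      proof (rule ccontr)
        assume "\<not> (U \<turnstile> p \<or> U \<turnstile> q)"
        then have "U \<turnstile> Neg p" "U \<turnstile> Neg q" using neg by auto
        then have "insert p U \<turnstile> Fls" "insert q U \<turnstile> Fls"
          by (meson insertI1 provable.Assm provable.ImpE subset_insertI weakening)+
        with * have "U \<turnstile> Fls" by (rule provable.DisjE)
        then show False using U(1) by (simp add: cons_def)
      qed
    qed (meson provable.DisjI1 provable.DisjI2)
    then show ?case using Disj by simp
  next
    case (AllN p)
    have "U \<turnstile> AllN q \<longleftrightarrow> (\<forall>t. U \<turnstile> instN t q)" for q
    proof
      assume *: "\<forall>t. U \<turnstile> instN t q"
      show "U \<turnstile> AllN q"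
      proof (rule ccontr)
        assume "\<not> U \<turnstile> AllN q"
        then obtain t where "instN t (Neg q) \<in> U"
          using neg not_AllN mem U(3) by metis
        then have "U \<turnstile> Neg (instN t q)" by (simp add: instN_def substN_def provable.Assm)
        then show False using * neg by blast
      qed
    qed (blast intro: provable.AllNE)
    then show ?case by (simp add: instN_subst AllN[symmetric] rep_cons[symmetric]) (simp add: canonical_def)
  next
    case (ExN p)
    have "U \<turnstile> ExN q \<longleftrightarrow> (\<exists>t. U \<turnstile> instN t q)" for q
      using mem U(3) provable.ExNI by blast
    then show ?case by (simp add: instN_subst ExN[symmetric] rep_cons[symmetric]) (simp add: canonical_def)
  next
    case (AllS p)
    have "U \<turnstile> AllS q \<longleftrightarrow> (\<forall>t. U \<turnstile> instS t q)" for q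
    proof
      assume *: "\<forall>t. U \<turnstile> instS t q"
      show "U \<turnstile> AllS q"
      proof (rule ccontr)
        assume "\<not> U \<turnstile> AllS q"
        then obtain t where "instS t (Neg q) \<in> U"
          using neg not_AllS mem U(4) by metis
        then have "U \<turnstile> Neg (instS t q)" by (simp add: instS_def substS_def provable.Assm)
        then show False using * neg by blast
      qed
    qed (blast intro: provable.AllSE)
    then show ?case by (simp add: instS_subst AllS[symmetric] ext_cons[symmetric]) (simp add: canonical_def)
  next
    case (ExS p)
    have "U \<turnstile> ExS q \<longleftrightarrow> (\<exists>t. U \<turnstile> instS t q)" for q
      using mem U(4) provable.ExSI by blast
    then show ?case by (simp add: instS_subst ExS[symmetric] ext_cons[symmetric]) (simp add: canonical_def)
  }
qed

theorem completeness:
  assumes "cons \<Gamma>" "fresh_bound \<Gamma>"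
  obtains A :: "tm model" and e s where "wf_model A" "range e \<subseteq> univ A" "range s \<subseteq> setsM A"
    "\<forall>p\<in>\<Gamma>. sat A e s p"
proof -
  obtain U where U: "cons U" "\<Gamma> \<subseteq> U" "\<And>p. p \<in> U \<or> U \<turnstile> Neg p"
    "\<And>p. ExN p \<in> U \<Longrightarrow> \<exists>t. instN t p \<in> U" "\<And>p. ExS p \<in> U \<Longrightarrow> \<exists>X. instS X p \<in> U"
    using henkin_extension[OF assms] by metis
  show ?thesis
  proof (rule that[OF wf_canonical])
    show "range (\<lambda>n. rep U (NVar n)) \<subseteq> univ (canonical U)"
      "range (\<lambda>n. ext U (id n)) \<subseteq> setsM (canonical U)" by (auto simp: canonical_def)
    show "\<forall>p\<in>\<Gamma>. sat (canonical U) (\<lambda>n. rep U (NVar n)) (\<lambda>n. ext U (id n)) p"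
      using sat_canonical[OF U(1,3-5), of NVar id] U(2) by (simp only: subst_id) (blast intro: provable.Assm)
  qed
qed

section \<open>Definability in models of recursive comprehension\<close>

definition mk_model :: "'a \<Rightarrow> 'a \<Rightarrow> ('a \<Rightarrow> 'a \<Rightarrow> 'a) \<Rightarrow> ('a \<Rightarrow> 'a \<Rightarrow> 'a) \<Rightarrow> ('a \<Rightarrow> 'a \<Rightarrow> bool) \<Rightarrow>
    'a set \<Rightarrow> 'a set set \<Rightarrow> 'a model" where
  "mk_model z u a m l D S = \<lparr>univ = D, zeroM = z, oneM = u, addM = a, mulM = m, lessM = l, setsM = S\<rparr>"

lemma mk_model_simps [simp]:
  "univ (mk_model z u a m l D S) = D" "zeroM (mk_model z u a m l D S) = z"
  "oneM (mk_model z u a m l D S) = u" "addM (mk_model z u a m l D S) = a"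
  "mulM (mk_model z u a m l D S) = m" "lessM (mk_model z u a m l D S) = l"
  "setsM (mk_model z u a m l D S) = S"
  by (simp_all add: mk_model_def)

abbreviation std :: "'a::{semiring_1,ord} set \<Rightarrow> 'a set set \<Rightarrow> 'a model" where
  "std \<equiv> mk_model 0 1 (+) (*) (<)"

text \<open>The empty family of sets is harmless for formulas without set quantifiers.\<close>

abbreviation bsat :: "(nat \<Rightarrow> 'a::{semiring_1,ord}) \<Rightarrow> (nat \<Rightarrow> 'a set) \<Rightarrow> fm \<Rightarrow> bool" where
  "bsat \<equiv> sat (std UNIV {})"

abbreviation bval :: "(nat \<Rightarrow> 'a::{semiring_1,ord}) \<Rightarrow> tm \<Rightarrow> 'a" where
  "bval \<equiv> val (std UNIV {})"

lemma val_std: "val (std D S) e t = bval e t"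
  by (induction t) simp_all

lemma sat_std: "bounded p \<Longrightarrow> sat (std UNIV S) e s p = bsat e s p"
  by (induction p arbitrary: e rule: bounded.induct) (simp_all add: val_std[of UNIV S])

text \<open>A type class, so that the reasoning about ordered semirings applies directly to the
  elements of a model. The additional assumption is the last of the basic axioms and makes the order
  discrete.\<close>

class ordered_arith = linordered_semidom + canonically_ordered_monoid_add +
  assumes less_add_one_iff [simp]: "a < b + 1 \<longleftrightarrow> a \<le> b"

text \<open>One unbounded quantifier is split off from each formula, so that only bounded formulas
  have to be handled. The predicates introduced below replace this syntactic form in all later
  arguments.\<close>

class rca0 = ordered_arith +
  fixes second_order :: "'a set set"
  assumes second_order_nonempty: "second_order \<noteq> {}"
  and sigma1_induction:
    "bounded p \<Longrightarrow> range s \<subseteq> second_order \<Longrightarrow> \<exists>y. sat (mk_model 0 1 (+) (*) (<) UNIV {}) (y ## 0 ## e) s p \<Longrightarrow>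
     (\<And>x. \<exists>y. sat (mk_model 0 1 (+) (*) (<) UNIV {}) (y ## x ## e) s p \<Longrightarrow> \<exists>y. sat (mk_model 0 1 (+) (*) (<) UNIV {}) (y ## (x + 1) ## e) s p) \<Longrightarrow>
     \<exists>y. sat (mk_model 0 1 (+) (*) (<) UNIV {}) (y ## x ## e) s p"
  and delta1_comprehension:
    "bounded p \<Longrightarrow> bounded q \<Longrightarrow> range s \<subseteq> second_order \<Longrightarrow>
     (\<And>x. (\<exists>y. sat (mk_model 0 1 (+) (*) (<) UNIV {}) (y ## x ## e) s p) \<longleftrightarrow> (\<forall>y. sat (mk_model 0 1 (+) (*) (<) UNIV {}) (y ## x ## e) s q)) \<Longrightarrow>
     {x. \<exists>y. sat (mk_model 0 1 (+) (*) (<) UNIV {}) (y ## x ## e) s p} \<in> second_order"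

lemma add_one_le_iff [simp]: "a + 1 \<le> b \<longleftrightarrow> a < (b::'a::ordered_arith)"
  by (metis less_add_one_iff linorder_not_le)

lemma less_one_iff [simp]: "a < 1 \<longleftrightarrow> a = (0::'a::ordered_arith)"
  by (metis add_0 le_zero_eq less_add_one_iff)

lemma not_zero_ex: "a \<noteq> 0 \<Longrightarrow> \<exists>b. a = b + (1::'a::ordered_arith)"
  by (metis add.commute le_iff_add less_one_iff linorder_not_le)

lemma less_add_one_self [simp]: "a < a + (1::'a::ordered_arith)"
  by simp

subsection \<open>Bounded predicates with parameters\<close>

text \<open>A variable of a formula is evaluated either by the environment or by a parameter.\<close>

definition ev :: "(nat \<Rightarrow> 'a) \<Rightarrow> nat + 'a \<Rightarrow> 'a" where
  "ev e x = (case x of Inl i \<Rightarrow> e i | Inr c \<Rightarrow> c)"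

lemma ev_simps [simp]: "ev e (Inl i) = e i" "ev e (Inr c) = c"
  by (simp_all add: ev_def)

definition tmf :: "((nat \<Rightarrow> 'a::rca0) \<Rightarrow> 'a) \<Rightarrow> bool" where
  "tmf f \<longleftrightarrow> (\<exists>t v. \<forall>e. f e = bval (\<lambda>n. ev e (v n)) t)"

definition dlt :: "((nat \<Rightarrow> 'a::rca0) \<Rightarrow> bool) \<Rightarrow> bool" where
  "dlt P \<longleftrightarrow> (\<exists>p s v. bounded p \<and> range s \<subseteq> second_order \<and> (\<forall>e. P e \<longleftrightarrow> bsat (\<lambda>n. ev e (v n)) s p))"

text \<open>Interleaves the variables of two formulas, so that they can be joined without a clash of
  parameters.\<close>

definition mix :: "(nat \<Rightarrow> 'b) \<Rightarrow> (nat \<Rightarrow> 'b) \<Rightarrow> nat \<Rightarrow> 'b" where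
  "mix v w n = (if even n then v (n div 2) else w (n div 2))"

lemma mix_simps [simp]: "mix v w (2 * n) = v n" "mix v w (Suc (2 * n)) = w n"
  by (simp_all add: mix_def)

lemma range_mix: "range s \<subseteq> S \<Longrightarrow> range s' \<subseteq> S \<Longrightarrow> range (mix s s') \<subseteq> S"
  by (auto simp: mix_def)

lemma bounded_subst: "bounded p \<Longrightarrow> bounded (subst \<sigma> \<rho> p)"
proof (induction p arbitrary: \<sigma> \<rho> rule: bounded.induct)
  case (8 p t)
  then show ?case
    by (simp add: upN_shift) (simp add: upN_def bounded.intros(8)[unfolded One_nat_def])
next
  case (9 p t)
  then show ?case
    by (simp add: upN_shift) (simp add: upN_def bounded.intros(9)[unfolded One_nat_def])
qed (auto intro: bounded.intros)

lemma tmf_var [intro]: "tmf (\<lambda>e. e i)"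
  unfolding tmf_def by (rule exI[of _ "NVar 0"], rule exI[of _ "\<lambda>_. Inl i"]) simp

lemma tmf_const [intro]: "tmf (\<lambda>e. c)"
  unfolding tmf_def by (rule exI[of _ "NVar 0"], rule exI[of _ "\<lambda>_. Inr c"]) simp

lemma tmf_op:
  assumes "tmf f" "tmf g"
  shows "tmf (\<lambda>e. f e + g e)" "tmf (\<lambda>e. f e * g e)"
proof -
  from assms obtain t v u w where
    "\<forall>e. f e = bval (\<lambda>n. ev e (v n)) t" "\<forall>e. g e = bval (\<lambda>n. ev e (w n)) u"
    by (auto simp: tmf_def)
  then have *: "f e = bval (\<lambda>n. ev e (mix v w n)) (subst_tm (\<lambda>n. NVar (2 * n)) t)"
    "g e = bval (\<lambda>n. ev e (mix v w n)) (subst_tm (\<lambda>n. NVar (Suc (2 * n))) u)" for e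
    by (simp_all add: val_subst)
  show "tmf (\<lambda>e. f e + g e)" unfolding tmf_def *
    by (rule exI[of _ "Add (subst_tm (\<lambda>n. NVar (2 * n)) t) (subst_tm (\<lambda>n. NVar (Suc (2 * n))) u)"],
        rule exI[of _ "mix v w"]) simp
  show "tmf (\<lambda>e. f e * g e)" unfolding tmf_def *
    by (rule exI[of _ "Mul (subst_tm (\<lambda>n. NVar (2 * n)) t) (subst_tm (\<lambda>n. NVar (Suc (2 * n))) u)"],
        rule exI[of _ "mix v w"]) simp
qed

lemma dlt_not: "dlt P \<Longrightarrow> dlt (\<lambda>e. \<not> P e)"
  unfolding dlt_def by (metis bounded.intros(1,5) sat.simps(1,5))

lemma dlt_imp:
  assumes "dlt P" "dlt Q"
  shows "dlt (\<lambda>e. P e \<longrightarrow> Q e)"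
proof -
  from assms(1) obtain p s v where 1: "bounded p" "range s \<subseteq> second_order"
    "\<forall>e. P e \<longleftrightarrow> bsat (\<lambda>n. ev e (v n)) s p" by (auto simp: dlt_def)
  from assms(2) obtain q s' w where 2: "bounded q" "range s' \<subseteq> second_order"
    "\<forall>e. Q e \<longleftrightarrow> bsat (\<lambda>n. ev e (w n)) s' q" by (auto simp: dlt_def)
  from 1 2 show ?thesis unfolding dlt_def
    by (intro exI[of _ "Imp (subst (\<lambda>n. NVar (2 * n)) (\<lambda>n. 2 * n) p) (subst (\<lambda>n. NVar (Suc (2 * n))) (\<lambda>n. Suc (2 * n)) q)"]
      exI[of _ "mix s s'"] exI[of _ "mix v w"])
      (simp add: sat_subst range_mix bounded.intros bounded_subst)
qed

lemma dlt_conj: "dlt P \<Longrightarrow> dlt Q \<Longrightarrow> dlt (\<lambda>e. P e \<and> Q e)"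
  using dlt_not[OF dlt_imp[OF _ dlt_not]] by simp

lemma dlt_disj: "dlt P \<Longrightarrow> dlt Q \<Longrightarrow> dlt (\<lambda>e. P e \<or> Q e)"
  using dlt_imp[OF dlt_not, of P Q] by (simp add: disj_imp)

lemma dlt_atom:
  assumes "tmf f" "tmf g"
  shows "dlt (\<lambda>e. f e = g e)" "dlt (\<lambda>e. f e < g e)"
proof -
  from assms obtain t v u w where
    "\<forall>e. f e = bval (\<lambda>n. ev e (v n)) t" "\<forall>e. g e = bval (\<lambda>n. ev e (w n)) u"
    by (auto simp: tmf_def)
  then have *: "f e = bval (\<lambda>n. ev e (mix v w n)) (subst_tm (\<lambda>n. NVar (2 * n)) t)"
    "g e = bval (\<lambda>n. ev e (mix v w n)) (subst_tm (\<lambda>n. NVar (Suc (2 * n))) u)" for e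
    by (simp_all add: val_subst)
  obtain Z where S: "Z \<in> (second_order :: 'a set set)" using second_order_nonempty by blast
  show "dlt (\<lambda>e. f e = g e)" unfolding dlt_def *
    by (rule exI[of _ "Eq (subst_tm (\<lambda>n. NVar (2 * n)) t) (subst_tm (\<lambda>n. NVar (Suc (2 * n))) u)"],
      rule exI[of _ "\<lambda>_. Z"], rule exI[of _ "mix v w"])
      (auto intro: bounded.intros S)
  show "dlt (\<lambda>e. f e < g e)" unfolding dlt_def *
    by (rule exI[of _ "Less (subst_tm (\<lambda>n. NVar (2 * n)) t) (subst_tm (\<lambda>n. NVar (Suc (2 * n))) u)"],
      rule exI[of _ "\<lambda>_. Z"], rule exI[of _ "mix v w"])
      (auto intro: bounded.intros S)
qed

lemma dlt_mem:
  assumes "tmf f" "Z \<in> second_order"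
  shows "dlt (\<lambda>e. f e \<in> Z)"
proof -
  from assms obtain t v where "\<forall>e. f e = bval (\<lambda>n. ev e (v n)) t" by (auto simp: tmf_def)
  then show ?thesis unfolding dlt_def
    by (intro exI[of _ "Mem t 0"] exI[of _ "\<lambda>_. Z"] exI[of _ v]) (use assms in \<open>auto intro: bounded.intros\<close>)
qed

lemma dlt_env:
  assumes "dlt P" shows "dlt (\<lambda>e. P (\<lambda>n. ev e (w n)))"
proof -
  from assms obtain p s v where *: "bounded p" "range s \<subseteq> second_order"
    "\<forall>e. P e \<longleftrightarrow> bsat (\<lambda>n. ev e (v n)) s p" by (auto simp: dlt_def)
  have "ev (\<lambda>n. ev e (w n)) (v n) = ev e (case v n of Inl i \<Rightarrow> w i | Inr c \<Rightarrow> Inr c)" for e n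
    by (simp split: sum.split)
  with * show ?thesis unfolding dlt_def
    by (intro exI[of _ p] exI[of _ s] exI[of _ "\<lambda>n. case v n of Inl i \<Rightarrow> w i | Inr c \<Rightarrow> Inr c"]) simp
qed

lemma dlt_bex:
  assumes f: "tmf f" and P: "dlt P"
  shows "dlt (\<lambda>e. \<exists>y<f e. P (y ## e))"
proof -
  from f obtain t w where t: "\<forall>e. f e = bval (\<lambda>n. ev e (w n)) t" by (auto simp: tmf_def)
  from P obtain p s v where *: "bounded p" "range s \<subseteq> second_order"
    "\<forall>e. P e \<longleftrightarrow> bsat (\<lambda>n. ev e (v n)) s p" by (auto simp: dlt_def)
  \<comment> \<open>Variables of \<open>p\<close> that read position 0 become the bound variable.
    The others move down by one position and sit at the odd places of the interleaved environment,
    hence at \<open>2 * n + 2\<close> under the quantifier.\<close>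
  define v' where "v' n = (case v n of Inl (Suc i) \<Rightarrow> Inl i | x \<Rightarrow> x)" for n
  define \<sigma> where "\<sigma> n = (if v n = Inl 0 then NVar 0 else NVar (Suc (Suc (2 * n))))" for n
  have ev: "ev (y ## e) (v n) = bval (y ## (\<lambda>n. ev e (mix w v' n))) (\<sigma> n)" for e y n
    by (auto simp: \<sigma>_def v'_def split: sum.split nat.split)
  have "f e = bval (\<lambda>n. ev e (mix w v' n)) (subst_tm (\<lambda>n. NVar (2 * n)) t)" for e
    using t by (simp add: val_subst)
  moreover have "P (y ## e) \<longleftrightarrow> bsat (y ## (\<lambda>n. ev e (mix w v' n))) s (subst \<sigma> id p)" for e y
    using * by (simp add: sat_subst ev)
  ultimately show ?thesis unfolding dlt_def
    by (intro exI[of _ "BEx (subst_tm (\<lambda>n. NVar (2 * n)) t) (subst \<sigma> id p)"] exI[of _ s] exI[of _ "mix w v'"])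
      (use * in \<open>auto intro!: bounded.intros(9)[unfolded One_nat_def] bounded_subst simp: val_shift\<close>)
qed

lemma dlt_ren: "dlt P \<Longrightarrow> dlt (\<lambda>e. P (\<lambda>n. e (h n)))"
  using dlt_env[of P "\<lambda>n. Inl (h n)"] by simp

lemma dlt_ball:
  assumes "tmf f" "dlt P"
  shows "dlt (\<lambda>e. \<forall>y<f e. P (y ## e))"
  using dlt_not[OF dlt_bex[OF assms(1) dlt_not[OF assms(2)]]] by simp

text \<open>The body receives the bound variable and the outer environment as separate arguments, so
  that \<open>intro\<close> can descend through a formula written in HOL.\<close>

lemma dlt_hoas:
  assumes "tmf f" "dlt (\<lambda>e. P (e 0) (\<lambda>n. e (Suc n)))"
  shows "dlt (\<lambda>e. \<exists>y<f e. P y e)" "dlt (\<lambda>e. \<forall>y<f e. P y e)"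
  using dlt_bex[OF assms] dlt_ball[OF assms] by simp_all

lemmas dlt_intros = tmf_var tmf_const tmf_op dlt_hoas dlt_not dlt_imp dlt_conj dlt_disj dlt_atom

text \<open>Brings a predicate into the shape of the class axioms: two distinguished variables in
  front of a fixed environment that holds all parameters.\<close>

lemma dlt_formula:
  assumes "dlt Q"
  obtains p s e' where "bounded p" "range s \<subseteq> second_order"
    "\<And>x y. Q (y ## x ## e) \<longleftrightarrow> bsat (y ## x ## e') s p"
proof -
  from assms obtain p s v where *: "bounded p" "range s \<subseteq> second_order"
    "\<forall>e. Q e \<longleftrightarrow> bsat (\<lambda>n. ev e (v n)) s p" by (auto simp: dlt_def)
  define \<sigma> where "\<sigma> n = (case v n of Inl 0 \<Rightarrow> NVar 0 | Inl (Suc 0) \<Rightarrow> NVar (Suc 0) | _ \<Rightarrow> NVar (Suc (Suc n)))" for n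
  define e' where "e' n = (case v n of Inl i \<Rightarrow> e (i - 2) | Inr c \<Rightarrow> c)" for n
  have "ev (y ## x ## e) (v n) = bval (y ## x ## e') (\<sigma> n)" for x y n
    by (auto simp: \<sigma>_def e'_def split: sum.split nat.split)
  then have "Q (y ## x ## e) \<longleftrightarrow> bsat (y ## x ## e') s (subst \<sigma> id p)" for x y
    using * by (simp add: sat_subst)
  then show thesis using that[of "subst \<sigma> id p" s e'] * by (simp add: bounded_subst)
qed

subsection \<open>The predicates of the first level\<close>

text \<open>\<open>sig\<close>, \<open>recd\<close> and \<open>recf\<close>: \<open>\<Sigma>\<^sub>1\<close> predicates, \<open>\<Delta>\<^sub>1\<close> predicates and functions with \<open>\<Sigma>\<^sub>1\<close> graph.\<close>

definition sig :: "((nat \<Rightarrow> 'a::rca0) \<Rightarrow> bool) \<Rightarrow> bool" where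
  "sig P \<longleftrightarrow> (\<exists>Q. dlt Q \<and> (\<forall>e. P e \<longleftrightarrow> (\<exists>y. Q (y ## e))))"

definition recd :: "((nat \<Rightarrow> 'a::rca0) \<Rightarrow> bool) \<Rightarrow> bool" where
  "recd P \<longleftrightarrow> sig P \<and> sig (\<lambda>e. \<not> P e)"

definition recf :: "((nat \<Rightarrow> 'a::rca0) \<Rightarrow> 'a) \<Rightarrow> bool" where
  "recf f \<longleftrightarrow> sig (\<lambda>e. e 0 = f (\<lambda>n. e (Suc n)))"

lemma sig_induct_env:
  assumes "sig P" "P (0 ## e)" "\<And>x. P (x ## e) \<Longrightarrow> P ((x + 1) ## e)"
  shows "P (x ## e)"
proof -
  from assms(1) obtain Q where "dlt Q" and PQ: "\<And>e. P e \<longleftrightarrow> (\<exists>y. Q (y ## e))" by (auto simp: sig_def)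
  obtain p s e' where *: "bounded p" "range s \<subseteq> second_order"
    "\<And>x y. Q (y ## x ## e) \<longleftrightarrow> bsat (y ## x ## e') s p"
    by (rule dlt_formula[OF \<open>dlt Q\<close>, of e]) blast
  have "\<exists>y. bsat (y ## x ## e') s p"
    by (rule sigma1_induction[OF *(1,2)]) (use assms(2,3) PQ *(3) in auto)
  then show ?thesis using PQ *(3) by simp
qed

lemma sig_induct [consumes 1, case_names zero step]:
  assumes "sig (\<lambda>e. P (e 0))" "P 0" "\<And>x. P x \<Longrightarrow> P (x + 1)"
  shows "P x"
  using sig_induct_env[OF assms(1), of undefined x] assms(2,3) by simp

lemma sig_dlt: "dlt P \<Longrightarrow> sig P"
  unfolding sig_def by (rule exI[of _ "\<lambda>e. P (\<lambda>n. e (Suc n))"]) (simp add: dlt_ren)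

lemma two_bound: "\<exists>w. (x::'a::rca0) < w \<and> y < w"
  by (rule exI[of _ "x + y + 1"]) simp

lemma sig_ren: assumes "sig P" shows "sig (\<lambda>e. P (\<lambda>n. ev e (w n)))"
proof -
  from assms obtain Q where Q: "dlt Q" "\<And>e. P e \<longleftrightarrow> (\<exists>y. Q (y ## e))" by (auto simp: sig_def)
  have *: "dlt (\<lambda>e. Q (\<lambda>n. ev e (case n of 0 \<Rightarrow> Inl 0 | Suc n \<Rightarrow> (case w n of Inl i \<Rightarrow> Inl (Suc i) | Inr c \<Rightarrow> Inr c))))"
    by (rule dlt_env[OF Q(1)])
  have "(\<lambda>n. ev (y ## e) (case n of 0 \<Rightarrow> Inl 0 | Suc n \<Rightarrow> (case w n of Inl i \<Rightarrow> Inl (Suc i) | Inr c \<Rightarrow> Inr c)))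
     = y ## (\<lambda>n. ev e (w n))" for y e
    by (rule HOL.ext) (auto split: nat.split sum.split)
  with * show ?thesis unfolding sig_def Q(2) by (intro exI conjI) (assumption, simp)
qed

lemma sig_shift: "sig P \<Longrightarrow> sig (\<lambda>e. P (\<lambda>n. e (Suc n)))"
  using sig_ren[of P "\<lambda>n. Inl (Suc n)"] by simp

text \<open>One number bounds both witnesses, which leaves a single unbounded quantifier.\<close>

lemma sig_conj:
  assumes "sig P" "sig P'" shows "sig (\<lambda>e. P e \<and> P' e)"
proof -
  from assms obtain Q Q' where Q: "dlt Q" "\<And>e. P e \<longleftrightarrow> (\<exists>y. Q (y ## e))"
    and Q': "dlt Q'" "\<And>e. P' e \<longleftrightarrow> (\<exists>y. Q' (y ## e))" by (auto simp: sig_def)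
  let ?R = "\<lambda>e. (\<exists>y<e 0. Q (y ## (\<lambda>n. e (Suc n)))) \<and> (\<exists>y<e 0. Q' (y ## (\<lambda>n. e (Suc n))))"
  have *: "dlt (\<lambda>e. Q (e 0 ## (\<lambda>n. e (Suc (Suc n)))))" if "dlt Q" for Q :: "(nat \<Rightarrow> 'a) \<Rightarrow> bool"
  proof -
    have "(e 0 ## (\<lambda>n. e (Suc (Suc n)))) = (\<lambda>n. e (case n of 0 \<Rightarrow> 0 | Suc n \<Rightarrow> Suc (Suc n)))" for e :: "nat \<Rightarrow> 'a"
      by (rule HOL.ext) (simp split: nat.split)
    then show ?thesis using dlt_ren[OF that] by simp
  qed
  have "dlt ?R" by (intro dlt_intros *) (use Q Q' in auto)
  moreover have "P e \<and> P' e \<longleftrightarrow> (\<exists>y. ?R (y ## e))" for e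
    unfolding Q(2) Q'(2) by (simp, meson two_bound order_less_trans)
  ultimately show ?thesis unfolding sig_def by blast
qed

lemma sig_disj:
  assumes "sig P" "sig P'" shows "sig (\<lambda>e. P e \<or> P' e)"
proof -
  from assms obtain Q Q' where Q: "dlt Q" "\<And>e. P e \<longleftrightarrow> (\<exists>y. Q (y ## e))"
    and Q': "dlt Q'" "\<And>e. P' e \<longleftrightarrow> (\<exists>y. Q' (y ## e))" by (auto simp: sig_def)
  show ?thesis unfolding sig_def Q(2) Q'(2)
    by (rule exI[of _ "\<lambda>e. Q e \<or> Q' e"]) (use dlt_disj Q(1) Q'(1) in blast)
qed

lemma sig_ex_env:
  assumes "sig P" shows "sig (\<lambda>e. \<exists>x. P (x ## e))"
proof -
  from assms obtain Q where Q: "dlt Q" "\<And>e. P e \<longleftrightarrow> (\<exists>y. Q (y ## e))" by (auto simp: sig_def)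
  let ?R = "\<lambda>e. \<exists>x<e 0. \<exists>y<e 0. Q (y ## x ## (\<lambda>n. e (Suc n)))"
  have "(e 0 ## e (Suc 0) ## (\<lambda>n. e (Suc (Suc (Suc n))))) =
      (\<lambda>n. e (case n of 0 \<Rightarrow> 0 | Suc 0 \<Rightarrow> Suc 0 | Suc (Suc n) \<Rightarrow> Suc (Suc (Suc n))))" for e :: "nat \<Rightarrow> 'a"
    by (rule HOL.ext) (simp split: nat.split)
  then have "dlt (\<lambda>e. Q (e 0 ## e (Suc 0) ## (\<lambda>n. e (Suc (Suc (Suc n))))))" using dlt_ren[OF Q(1)] by simp
  then have "dlt ?R" by (intro dlt_intros) simp
  moreover have "(\<exists>x. P (x ## e)) \<longleftrightarrow> (\<exists>y. ?R (y ## e))" for e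
    unfolding Q(2) by (simp, meson two_bound order_less_trans)
  ultimately show ?thesis unfolding sig_def by blast
qed

text \<open>Sigma_1 induction on \<open>z\<close> for the part of the claim below \<open>z\<close>.
  The guard \<open>x < a\<close> inside \<open>R\<close> lets the induction run over all
  numbers.\<close>

lemma collection:
  assumes "dlt Q" "\<And>x. x < a \<Longrightarrow> \<exists>y. Q (y ## x ## e)"
  shows "\<exists>b. \<forall>x<a. \<exists>y<b. Q (y ## x ## e)"
proof -
  define R where "R z b \<longleftrightarrow> (\<forall>x<z. x < a \<longrightarrow> (\<exists>y<b. Q (y ## x ## e)))" for z b
  have "(e' 0 ## e' (Suc 0) ## e) = (\<lambda>n. ev e' (case n of 0 \<Rightarrow> Inl 0 | Suc 0 \<Rightarrow> Inl (Suc 0) | Suc (Suc n) \<Rightarrow> Inr (e n)))"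
    for e' by (rule HOL.ext) (simp split: nat.split)
  then have "dlt (\<lambda>e'. Q (e' 0 ## e' (Suc 0) ## e))" using dlt_env[OF assms(1)] by simp
  then have "dlt (\<lambda>e'. R (e' 1) (e' 0))" unfolding R_def by (intro dlt_intros) simp
  then have "sig (\<lambda>e'. \<exists>b. R (e' 0) b)" unfolding sig_def
    by (intro exI[of _ "\<lambda>e'. R (e' 1) (e' 0)"]) simp
  then have "\<exists>b. R a b"
  proof (induction a rule: sig_induct)
    case zero
    show ?case by (simp add: R_def)
  next
    case (step x)
    then obtain b where b: "R x b" by blast
    show ?case
    proof (cases "x < a")
      case True
      then obtain y where "Q (y ## x ## e)" using assms(2) by blast
      then have "R (x + 1) (b + y + 1)" using b unfolding R_def less_add_one_iff
        by (metis add.commute le_add_same_cancel1 le_add_same_cancel2 le_iff_add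
            linorder_not_less order_le_less order_le_less_trans zero_le)
      then show ?thesis by blast
    next
      case False
      then have "R (x + 1) b" using b unfolding R_def by (metis less_add_one_iff order_le_less)
      then show ?thesis by blast
    qed
  qed
  then show ?thesis by (auto simp: R_def)
qed

lemma sig_ball_env:
  assumes "sig P" shows "sig (\<lambda>e. \<forall>x<e i. P (x ## e))"
proof -
  from assms obtain Q where Q: "dlt Q" "\<And>e. P e \<longleftrightarrow> (\<exists>y. Q (y ## e))" by (auto simp: sig_def)
  let ?R = "\<lambda>e. \<forall>x<e (Suc i). \<exists>y<e 0. Q (y ## x ## (\<lambda>n. e (Suc n)))"
  have "(e 0 ## e (Suc 0) ## (\<lambda>n. e (Suc (Suc (Suc n))))) =
      (\<lambda>n. e (case n of 0 \<Rightarrow> 0 | Suc 0 \<Rightarrow> Suc 0 | Suc (Suc n) \<Rightarrow> Suc (Suc (Suc n))))" for e :: "nat \<Rightarrow> 'a"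
    by (rule HOL.ext) (simp split: nat.split)
  then have "dlt (\<lambda>e. Q (e 0 ## e (Suc 0) ## (\<lambda>n. e (Suc (Suc (Suc n))))))" using dlt_ren[OF Q(1)] by simp
  then have "dlt ?R" by (intro dlt_intros) simp
  moreover have "(\<forall>x<e i. P (x ## e)) \<longleftrightarrow> (\<exists>y. ?R (y ## e))" for e
    unfolding Q(2) using collection[OF Q(1), of "e i" e] by auto
  ultimately show ?thesis unfolding sig_def by blast
qed

lemma sig_ex: "sig (\<lambda>e. P (e 0) (\<lambda>n. e (Suc n))) \<Longrightarrow> sig (\<lambda>e. \<exists>x. P x e)"
  using sig_ex_env by force

lemma recf_var: "recf (\<lambda>e. e i)"
  unfolding recf_def by (intro sig_dlt dlt_intros)

lemma recf_const: "recf (\<lambda>e. c)"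
  unfolding recf_def by (intro sig_dlt dlt_intros)

text \<open>Substitution as \<open>\<exists>y. y = f e \<and> P y\<close>. Applied to a predicate
  and to its negation, it shows that Delta_1 predicates also admit total functions with Sigma_1
  graph.\<close>

lemma sig_recf:
  assumes "sig P" "recf f" shows "sig (\<lambda>e. P (f e ## e))"
proof -
  have "sig (\<lambda>e. \<exists>y. y = f e \<and> P (y ## e))"
    by (rule sig_ex) (use assms in \<open>simp add: recf_def scons_eta sig_conj\<close>)
  then show ?thesis by simp
qed

lemma recf_shift: "recf f \<Longrightarrow> recf (\<lambda>e. f (\<lambda>n. e (Suc n)))"
  unfolding recf_def using sig_ren[of "\<lambda>e. e 0 = f (\<lambda>n. e (Suc n))" "\<lambda>n. case n of 0 \<Rightarrow> Inl 0 | Suc n \<Rightarrow> Inl (Suc (Suc n))"]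
  by simp

lemma sig_let: "sig (\<lambda>e. P (e 0) (\<lambda>n. e (Suc n))) \<Longrightarrow> recf f \<Longrightarrow> sig (\<lambda>e. P (f e) e)"
  using sig_recf[of "\<lambda>e. P (e 0) (\<lambda>n. e (Suc n))" f] by simp

lemma sig_comp1:
  assumes "sig (\<lambda>e. P (e 0))" "recf f" shows "sig (\<lambda>e. P (f e))"
  using sig_recf[OF assms] by simp

lemma sig_comp2:
  assumes "sig (\<lambda>e. P (e 0) (e (Suc 0)))" "recf f" "recf g" shows "sig (\<lambda>e. P (f e) (g e))"
  apply (rule sig_let[where P = "\<lambda>x e. P x (g e)", OF _ assms(2)])
  apply (rule sig_let[where P = "\<lambda>x e. P (e 0) x", OF _ recf_shift[OF assms(3)]])
  \<comment> \<open>The values are pushed onto the environment one after the other and end up in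
    reverse order, which \<open>1 - n\<close> undoes.\<close>
  using sig_ren[OF assms(1), of "\<lambda>n. Inl (1 - n)"] by simp

lemma sig_comp3:
  assumes "sig (\<lambda>e. P (e 0) (e (Suc 0)) (e (Suc (Suc 0))))" "recf f" "recf g" "recf h"
  shows "sig (\<lambda>e. P (f e) (g e) (h e))"
  apply (rule sig_let[where P = "\<lambda>x e. P x (g e) (h e)", OF _ assms(2)])
  apply (rule sig_let[where P = "\<lambda>x e. P (e 0) x (h (\<lambda>n. e (Suc n)))", OF _ recf_shift[OF assms(3)]])
  apply (rule sig_let[where P = "\<lambda>x e. P (e (Suc 0)) (e 0) x", OF _ recf_shift[OF recf_shift[OF assms(4)]]])
  using sig_ren[OF assms(1), of "\<lambda>n. Inl (2 - n)"] by (simp add: numeral_2_eq_2)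

lemma sig_comp4:
  assumes "sig (\<lambda>e. P (e 0) (e (Suc 0)) (e (Suc (Suc 0))) (e (Suc (Suc (Suc 0)))))"
    "recf f" "recf g" "recf h" "recf k"
  shows "sig (\<lambda>e. P (f e) (g e) (h e) (k e))"
  apply (rule sig_let[where P = "\<lambda>x e. P x (g e) (h e) (k e)", OF _ assms(2)])
  apply (rule sig_let[where P = "\<lambda>x e. P (e 0) x (h (\<lambda>n. e (Suc n))) (k (\<lambda>n. e (Suc n)))", OF _ recf_shift[OF assms(3)]])
  apply (rule sig_let[where P = "\<lambda>x e. P (e (Suc 0)) (e 0) x (k (\<lambda>n. e (Suc (Suc n))))", OF _ recf_shift[OF recf_shift[OF assms(4)]]])
  apply (rule sig_let[where P = "\<lambda>x e. P (e (Suc (Suc 0))) (e (Suc 0)) (e 0) x",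
        OF _ recf_shift[OF recf_shift[OF recf_shift[OF assms(5)]]]])
  using sig_ren[OF assms(1), of "\<lambda>n. Inl (3 - n)"] by (simp add: numeral_3_eq_3)

lemma recf_comp1: "recf (\<lambda>e. h (e 0)) \<Longrightarrow> recf f \<Longrightarrow> recf (\<lambda>e. h (f e))"
  unfolding recf_def[of "\<lambda>e. h (e 0)"] recf_def[of "\<lambda>e. h (f e)"]
  using sig_comp2[of "\<lambda>z x. z = h x", OF _ recf_var[of 0] recf_shift] by blast

lemma recf_comp2:
  "recf (\<lambda>e. h (e 0) (e (Suc 0))) \<Longrightarrow> recf f \<Longrightarrow> recf g \<Longrightarrow> recf (\<lambda>e. h (f e) (g e))"
  unfolding recf_def[of "\<lambda>e. h (e 0) (e (Suc 0))"] recf_def[of "\<lambda>e. h (f e) (g e)"]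
  using sig_comp3[of "\<lambda>z x y. z = h x y", OF _ recf_var[of 0] recf_shift recf_shift] by blast

lemma recf_comp3:
  "recf (\<lambda>e. h (e 0) (e (Suc 0)) (e (Suc (Suc 0)))) \<Longrightarrow> recf f \<Longrightarrow> recf g \<Longrightarrow> recf k \<Longrightarrow>
    recf (\<lambda>e. h (f e) (g e) (k e))"
  unfolding recf_def[of "\<lambda>e. h (e 0) (e (Suc 0)) (e (Suc (Suc 0)))"] recf_def[of "\<lambda>e. h (f e) (g e) (k e)"]
  using sig_comp4[of "\<lambda>z x y w. z = h x y w", OF _ recf_var[of 0] recf_shift recf_shift recf_shift] by blast

lemma recd_comp1: "recd (\<lambda>e. P (e 0)) \<Longrightarrow> recf f \<Longrightarrow> recd (\<lambda>e. P (f e))"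
  unfolding recd_def using sig_comp1[of P f] sig_comp1[of "\<lambda>x. \<not> P x" f] by blast

lemma recd_comp2: "recd (\<lambda>e. P (e 0) (e (Suc 0))) \<Longrightarrow> recf f \<Longrightarrow> recf g \<Longrightarrow> recd (\<lambda>e. P (f e) (g e))"
  unfolding recd_def using sig_comp2[of P f g] sig_comp2[of "\<lambda>x y. \<not> P x y" f g] by blast

lemma recd_comp3:
  "recd (\<lambda>e. P (e 0) (e (Suc 0)) (e (Suc (Suc 0)))) \<Longrightarrow> recf f \<Longrightarrow> recf g \<Longrightarrow> recf h \<Longrightarrow>
    recd (\<lambda>e. P (f e) (g e) (h e))"
  unfolding recd_def using sig_comp3[of P f g h] sig_comp3[of "\<lambda>x y z. \<not> P x y z" f g h] by blast

lemma recd_comp4: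
  "recd (\<lambda>e. P (e 0) (e (Suc 0)) (e (Suc (Suc 0))) (e (Suc (Suc (Suc 0))))) \<Longrightarrow> recf f \<Longrightarrow> recf g \<Longrightarrow>
    recf h \<Longrightarrow> recf k \<Longrightarrow> recd (\<lambda>e. P (f e) (g e) (h e) (k e))"
  unfolding recd_def using sig_comp4[of P f g h k] sig_comp4[of "\<lambda>x y z w. \<not> P x y z w" f g h k] by blast

lemma recd_dlt: "dlt P \<Longrightarrow> recd P"
  by (simp add: recd_def sig_dlt dlt_not)

lemma recd_eq: "recf f \<Longrightarrow> recf g \<Longrightarrow> recd (\<lambda>e. f e = g e)"
  by (rule recd_comp2[of "(=)"]) (intro recd_dlt dlt_intros)

lemma recd_less: "recf f \<Longrightarrow> recf g \<Longrightarrow> recd (\<lambda>e. f e < g e)"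
  by (rule recd_comp2[of "(<)"]) (intro recd_dlt dlt_intros)

lemma recd_not: "recd P \<Longrightarrow> recd (\<lambda>e. \<not> P e)"
  by (simp add: recd_def)

lemma recd_conj: "recd P \<Longrightarrow> recd Q \<Longrightarrow> recd (\<lambda>e. P e \<and> Q e)"
  unfolding recd_def de_Morgan_conj by (elim conjE, intro conjI sig_conj sig_disj)

lemma recd_disj: "recd P \<Longrightarrow> recd Q \<Longrightarrow> recd (\<lambda>e. P e \<or> Q e)"
  unfolding recd_def de_Morgan_disj by (elim conjE, intro conjI sig_conj sig_disj)

lemma recd_imp: "recd P \<Longrightarrow> recd Q \<Longrightarrow> recd (\<lambda>e. P e \<longrightarrow> Q e)"
  unfolding imp_conv_disj by (intro recd_disj recd_not)

lemma recd_iff: "recd P \<Longrightarrow> recd Q \<Longrightarrow> recd (\<lambda>e. P e \<longleftrightarrow> Q e)"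
  unfolding iff_conv_conj_imp by (intro recd_conj recd_imp)

lemma recd_le: "recf f \<Longrightarrow> recf g \<Longrightarrow> recd (\<lambda>e. f e \<le> g e)"
  using recd_not[OF recd_less, of g f] by (simp add: not_less)

lemma recd_triv: "recd (\<lambda>e. P)"
proof (cases P)
  case True
  then show ?thesis using recd_eq[OF recf_const[of "0::'a"] recf_const[of 0]] by simp
next
  case False
  then show ?thesis using recd_not[OF recd_eq[OF recf_const[of "0::'a"] recf_const[of 0]]] by simp
qed

lemma sig_ball:
  assumes "sig (\<lambda>e. P (e 0) (\<lambda>n. e (Suc n)))" "recf f" shows "sig (\<lambda>e. \<forall>x<f e. P x e)"
proof (rule sig_let[where P = "\<lambda>y e. \<forall>x<y. P x e", OF _ assms(2)])
  have "sig (\<lambda>e. P (e 0) (\<lambda>n. e (Suc (Suc n))))"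
    using sig_ren[OF assms(1), of "\<lambda>n. case n of 0 \<Rightarrow> Inl 0 | Suc n \<Rightarrow> Inl (Suc (Suc n))"] by simp
  from sig_ball_env[OF this, of 0]
  show "sig (\<lambda>e. \<forall>x<e 0. P x (\<lambda>n. e (Suc n)))" by simp
qed

lemma sig_bex:
  assumes "sig (\<lambda>e. P (e 0) (\<lambda>n. e (Suc n)))" "recf f" shows "sig (\<lambda>e. \<exists>x<f e. P x e)"
proof (rule sig_ex)
  have "sig (\<lambda>e. e 0 < f (\<lambda>n. e (Suc n)))"
    using recd_less[OF recf_var recf_shift[OF assms(2)]] by (simp add: recd_def)
  then show "sig (\<lambda>e. e 0 < f (\<lambda>n. e (Suc n)) \<and> P (e 0) (\<lambda>n. e (Suc n)))"
    using assms(1) by (rule sig_conj)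
qed

lemma recd_ball: "recf f \<Longrightarrow> recd (\<lambda>e. P (e 0) (\<lambda>n. e (Suc n))) \<Longrightarrow> recd (\<lambda>e. \<forall>x<f e. P x e)"
  unfolding recd_def using sig_ball[of P f] sig_bex[of "\<lambda>x e. \<not> P x e" f] by simp

lemma recd_bex: "recf f \<Longrightarrow> recd (\<lambda>e. P (e 0) (\<lambda>n. e (Suc n))) \<Longrightarrow> recd (\<lambda>e. \<exists>x<f e. P x e)"
  unfolding recd_def using sig_bex[of P f] sig_ball[of "\<lambda>x e. \<not> P x e" f] by simp

lemma recf_add: "recf f \<Longrightarrow> recf g \<Longrightarrow> recf (\<lambda>e. f e + g e)"
  by (rule recf_comp2[of "(+)"], unfold recf_def) (intro sig_dlt dlt_intros)

lemma recf_mul: "recf f \<Longrightarrow> recf g \<Longrightarrow> recf (\<lambda>e. f e * g e)"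
  by (rule recf_comp2[of "(*)"], unfold recf_def) (intro sig_dlt dlt_intros)

lemma recf_if:
  assumes "recd P" "recf f" "recf g" shows "recf (\<lambda>e. if P e then f e else g e)"
proof -
  have "sig (\<lambda>e. P (\<lambda>n. e (Suc n)) \<and> e 0 = f (\<lambda>n. e (Suc n)) \<or> \<not> P (\<lambda>n. e (Suc n)) \<and> e 0 = g (\<lambda>n. e (Suc n)))"
    using assms unfolding recd_def recf_def by (intro sig_disj sig_conj) (auto intro: sig_shift)
  then show ?thesis unfolding recf_def by (rule back_subst[of sig]) auto
qed

lemma recd_bquant_le:
  assumes "recf f" "recd (\<lambda>e. P (e 0) (\<lambda>n. e (Suc n)))"
  shows "recd (\<lambda>e. \<forall>x\<le>f e. P x e)" "recd (\<lambda>e. \<exists>x\<le>f e. P x e)"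
  using recd_ball[OF recf_add[OF assms(1) recf_const[of 1]] assms(2)]
    recd_bex[OF recf_add[OF assms(1) recf_const[of 1]] assms(2)] by simp_all

text \<open>Rules that follow the structure of a HOL expression; with them a definability claim is
  usually settled by \<open>intro\<close>.\<close>

named_theorems definable

lemmas [definable] = recf_var recf_const recf_add recf_mul recf_if recd_eq recd_less recd_le
  recd_not recd_conj recd_disj recd_imp recd_iff recd_ball recd_bex recd_bquant_le

lemma recd_sig: "recd P \<Longrightarrow> sig P"
  by (simp add: recd_def)

lemma recf_the:
  assumes "recd (\<lambda>e. P (e 0) (\<lambda>n. e (Suc n)))" "\<And>e y. P y e \<longleftrightarrow> y = f e"
  shows "recf f"
  using assms unfolding recf_def recd_def by simp

subsection \<open>Induction and comprehension\<close>

text \<open>If there were no least element, \<open>w\<close> steps downwards from \<open>x\<close>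
  would reach some \<open>y\<close> in \<open>P\<close> with \<open>y + w \<le> x\<close>, for every
  \<open>w\<close>; at \<open>w = x + 1\<close> this is absurd.\<close>

lemma recd_least:
  assumes "sig (\<lambda>e. P (e 0))" "P x"
  shows "\<exists>y\<le>x. P y \<and> (\<forall>z<y. \<not> P z)"
proof (rule ccontr)
  assume no: "\<not> ?thesis"
  have "sig (\<lambda>e. \<exists>y<x + 1. y + e 0 \<le> x \<and> P y)"
    by (intro sig_bex sig_conj recd_sig definable sig_comp1[OF assms(1)])
  then have "\<exists>y<x+1. y + (x + 1) \<le> x \<and> P y"
  proof (rule sig_induct[where P = "\<lambda>w. \<exists>y<x + 1. y + w \<le> x \<and> P y"])
    show "\<exists>y<x + 1. y + 0 \<le> x \<and> P y" using assms(2) by auto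
  next
    fix w assume "\<exists>y<x + 1. y + w \<le> x \<and> P y"
    then obtain y where y: "y + w \<le> x" "P y" "y \<le> x" by auto
    with no obtain z where z: "z < y" "P z" by blast
    then have "z + 1 + w \<le> y + w" by simp
    then have "z + (w + 1) \<le> x" using y by (simp add: ac_simps)
    with z y show "\<exists>y<x + 1. y + (w + 1) \<le> x \<and> P y" by (auto intro!: exI[of _ z])
  qed
  then obtain y where y: "y + (x + 1) \<le> x" by blast
  have "x + 1 \<le> y + (x + 1)" by simp
  with y have "x + 1 \<le> x" by (rule order_trans[rotated])
  then show False by simp
qed

lemma comprehension:
  assumes "recd (\<lambda>e. P (e 0))" shows "{x. P x} \<in> second_order"
proof -
  from assms obtain Q R where Q: "dlt Q" "\<And>e. P (e 0) \<longleftrightarrow> (\<exists>y. Q (y ## e))"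
    and R: "dlt R" "\<And>e. \<not> P (e 0) \<longleftrightarrow> (\<exists>y. R (y ## e))" by (auto simp: recd_def sig_def)
  obtain p s e1 where p: "bounded p" "range s \<subseteq> second_order"
    "\<And>x y. Q (y ## x ## undefined) \<longleftrightarrow> bsat (y ## x ## e1) s p" by (rule dlt_formula[OF Q(1), of undefined]) blast
  obtain q t e2 where q: "bounded q" "range t \<subseteq> second_order"
    "\<And>x y. \<not> R (y ## x ## undefined) \<longleftrightarrow> bsat (y ## x ## e2) t q"
    by (rule dlt_formula[OF dlt_not[OF R(1)], of undefined]) blast
  \<comment> \<open>Both formulas have to share one environment and one assignment of sets, so their
    parameters are interleaved behind the two distinguished variables.\<close>
  define p' where "p' = subst (\<lambda>n. case n of 0 \<Rightarrow> NVar 0 | Suc 0 \<Rightarrow> NVar 1 | Suc (Suc n) \<Rightarrow> NVar (Suc (Suc (2 * n)))) (\<lambda>n. 2 * n) p"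
  define q' where "q' = subst (\<lambda>n. case n of 0 \<Rightarrow> NVar 0 | Suc 0 \<Rightarrow> NVar 1 | Suc (Suc n) \<Rightarrow> NVar (Suc (Suc (Suc (2 * n))))) (\<lambda>n. Suc (2 * n)) q"
  define e where "e = mix e1 e2"
  define u where "u = mix s t"
  have "(\<lambda>n. bval (y ## x ## mix e1 e2) (case n of 0 \<Rightarrow> NVar 0 | Suc 0 \<Rightarrow> NVar 1 | Suc (Suc n) \<Rightarrow> NVar (Suc (Suc (2 * n)))))
     = y ## x ## e1" for x y by (rule HOL.ext) (simp split: nat.split)
  then have p': "P x \<longleftrightarrow> (\<exists>y. bsat (y ## x ## e) u p')" for x
    using Q(2)[of "x ## undefined"] p(3)[of _ x] by (simp add: p'_def sat_subst e_def u_def)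
  have "(\<lambda>n. bval (y ## x ## mix e1 e2) (case n of 0 \<Rightarrow> NVar 0 | Suc 0 \<Rightarrow> NVar 1 | Suc (Suc n) \<Rightarrow> NVar (Suc (Suc (Suc (2 * n))))))
     = y ## x ## e2" for x y by (rule HOL.ext) (simp split: nat.split)
  then have q': "P x \<longleftrightarrow> (\<forall>y. bsat (y ## x ## e) u q')" for x
    using R(2)[of "x ## undefined"] q(3)[of _ x] by (auto simp: q'_def sat_subst e_def u_def)
  have "{x. \<exists>y. bsat (y ## x ## e) u p'} \<in> second_order"
    by (rule delta1_comprehension[where q = q'])
      (use p q p' q' in \<open>simp_all add: p'_def q'_def bounded_subst range_mix u_def\<close>)
  then show ?thesis by (simp add: p'[symmetric])
qed

section \<open>Coding of finite sets\<close>

definition pr :: "'a::ordered_arith \<Rightarrow> 'a \<Rightarrow> 'a" where "pr x y = (x + y) * (x + y) + x"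

lemma le_square: "(x::'a::ordered_arith) \<le> x * x"
proof (cases "x = 0")
  case False
  then have "1 \<le> x" by (metis less_one_iff not_less)
  then show ?thesis using mult_left_mono[of 1 x x] by simp
qed simp

lemma pr_ge1: "x \<le> pr x y" by (simp add: pr_def)

lemma pr_ge2: "y \<le> pr x y"
proof -
  have "y \<le> x + y" by simp
  also have "\<dots> \<le> (x + y) * (x + y)" by (rule le_square)
  finally show ?thesis by (simp add: pr_def add_increasing2)
qed

lemma pr_mono: "x \<le> x' \<Longrightarrow> y \<le> y' \<Longrightarrow> pr x y \<le> pr x' y'"
  unfolding pr_def by (intro add_mono mult_mono) auto

text \<open>The code lies between \<open>(x + y)^2\<close> and \<open>(x + y + 1)^2\<close>, so it
  determines the sum, and then \<open>x\<close>.\<close>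

lemma pr_less: assumes "x + y < x' + y'" shows "pr x y < pr x' y'"
proof -
  have "pr x y < (x + y + 1) * (x + y + 1)"
  proof -
    have "pr x y + (y + (x + y) + 1) = (x + y + 1) * (x + y + 1)"
      by (simp add: pr_def algebra_simps)
    then show ?thesis by (metis add.assoc le_add_same_cancel1 add_one_le_iff zero_le add.commute less_add_one_iff)
  qed
  also have "\<dots> \<le> (x' + y') * (x' + y')"
    using assms by (intro mult_mono) (simp_all only: add_one_le_iff zero_le)
  also have "\<dots> \<le> pr x' y'" by (simp add: pr_def)
  finally show ?thesis .
qed

lemma pr_inject [simp]: "pr x y = pr x' y' \<longleftrightarrow> x = x' \<and> y = y'"
proof
  assume *: "pr x y = pr x' y'"
  then have "x + y = x' + y'" by (metis linorder_neqE pr_less less_irrefl)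
  with * show "x = x' \<and> y = y'" by (auto simp: pr_def)
qed simp

lemma recf_pr [definable]: "recf f \<Longrightarrow> recf g \<Longrightarrow> recf (\<lambda>e. pr (f e) (g e))"
  unfolding pr_def by (intro definable)

lemma dvd_bound: "(x::'a::ordered_arith) dvd y \<longleftrightarrow> (\<exists>q\<le>y. y = x * q)"
proof
  assume "x dvd y"
  then obtain q where q: "y = x * q" by blast
  show "\<exists>q\<le>y. y = x * q"
  proof (cases "x = 0")
    case False
    then have "1 \<le> x" by (metis less_one_iff not_less)
    then have "q \<le> y" using mult_right_mono[of 1 x q] q by simp
    with q show ?thesis by blast
  qed (use q in auto)
qed auto

lemma recd_dvd [definable]: "recf f \<Longrightarrow> recf g \<Longrightarrow> recd (\<lambda>e. f e dvd g e)"
  by (rule recd_comp2[of "(dvd)"], unfold dvd_bound) (intro definable)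

text \<open>Goedel's coding by divisibility, as in \<open>inF\<close>: if all small positive numbers
  divide \<open>m\<close>, the moduli \<open>m * (i + 1) + 1\<close> are coprime to one another, and
  a product of them records a set of indices.\<close>

definition mem :: "'a::ordered_arith \<Rightarrow> 'a \<Rightarrow> bool" where
  "mem i c \<longleftrightarrow> (\<exists>k m n. c = pr k (pr m n) \<and> i < k \<and> m * (i + 1) + 1 dvd n)"

lemma the_unique: "\<exists>x. R x \<Longrightarrow> (\<And>x y. R x \<Longrightarrow> R y \<Longrightarrow> x = y) \<Longrightarrow> R (THE x. R x)"
  by (metis theI)

lemma mem_less: "mem i c \<Longrightarrow> i < c"
  unfolding mem_def by (metis order_less_le_trans pr_ge1)

lemma recd_mem_code [definable]: "recf (f :: (nat \<Rightarrow> 'a::rca0) \<Rightarrow> 'a) \<Longrightarrow> recf g \<Longrightarrow> recd (\<lambda>e. mem (f e) (g e))"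
proof (rule recd_comp2[of mem])
  have *: "mem i c \<longleftrightarrow> (\<exists>k\<le>c. \<exists>m\<le>c. \<exists>n\<le>c. c = pr k (pr m n) \<and> i < k \<and> m * (i + 1) + 1 dvd n)"
    for i c :: 'a
  proof -
    have "k \<le> c \<and> m \<le> c \<and> n \<le> c" if "c = pr k (pr m n)" for k m n
      unfolding that by (intro conjI pr_ge1 order_trans[OF pr_ge1 pr_ge2] order_trans[OF pr_ge2 pr_ge2])
    then show ?thesis unfolding mem_def by metis
  qed
  show "recd (\<lambda>e :: nat \<Rightarrow> 'a. mem (e 0) (e (Suc 0)))" unfolding * by (intro definable)
qed

definition fset :: "'a::ordered_arith \<Rightarrow> 'a set" where "fset c = {i. mem i c}"

lemma mem_fset [simp]: "i \<in> fset c \<longleftrightarrow> mem i c" by (simp add: fset_def)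

lemma common_multiple: "\<exists>m>0. \<forall>d\<le>b. 0 < d \<longrightarrow> d dvd (m::'a::rca0)"
proof -
  have "sig (\<lambda>e. \<exists>m. 0 < m \<and> (\<forall>d\<le>e 0. 0 < d \<longrightarrow> d dvd (m::'a)))"
    by (intro sig_ex recd_sig definable)
  then show ?thesis
  proof (induction b rule: sig_induct)
    case zero
    show ?case by (rule exI[of _ 1]) auto
  next
    case (step b)
    then obtain m where m: "0 < m" "\<forall>d\<le>b. 0 < d \<longrightarrow> d dvd m" by blast
    have "d dvd m * (b + 1)" if "d \<le> b + 1" "0 < d" for d
    proof (cases "d = b + 1")
      case False
      then have "d \<le> b" using that by (metis less_add_one_iff order_le_less)
      then show ?thesis using m that by (metis dvd_mult2)
    qed simp
    moreover have "0 < m * (b + 1)" using m(1) by (metis mult_pos_pos less_add_one_iff zero_le)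
    ultimately show ?case by blast
  qed
qed

text \<open>Coprimality without gcd or primes. The combination
  \<open>(j + 1) * ?a - (i + 1) * ?c\<close> of the two moduli equals \<open>j - i\<close>, so
  \<open>?a\<close> divides \<open>d * n\<close> for the distance \<open>d\<close> of
  \<open>i\<close> and \<open>j\<close>. As \<open>d\<close> divides \<open>m\<close>, it divides
  \<open>m * (i + 1) * n\<close>, which differs from its multiple \<open>?a * n\<close> by
  \<open>n\<close>.\<close>

lemma coprime_factor:
  fixes m n i j :: "'a::ordered_arith"
  assumes m: "\<forall>d\<le>b. 0 < d \<longrightarrow> d dvd m" and ij: "i < b" "j < b" "i \<noteq> j"
    and dvd: "m * (i + 1) + 1 dvd n * (m * (j + 1) + 1)"
  shows "m * (i + 1) + 1 dvd n"
proof -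
  let ?a = "m * (i + 1) + 1" and ?c = "m * (j + 1) + 1"
  obtain d where d: "0 < d" "d \<le> b" "?a dvd d * n"
  proof (cases "i < j")
    case True
    then obtain d where d: "j = i + d" by (meson le_iff_add less_imp_le)
    have "(j + 1) * ?a * n = (i + 1) * (n * ?c) + d * n" unfolding d by (simp add: algebra_simps)
    moreover have "?a dvd (j + 1) * ?a * n" by (simp add: mult.assoc)
    ultimately have "?a dvd d * n" using dvd by (metis dvd_add_right_iff dvd_mult)
    moreover have "0 < d" using True d by auto
    moreover have "d \<le> b" using d ij by (metis add.commute le_add_same_cancel1 zero_le order_less_imp_le order_trans)
    ultimately show thesis using that by blast
  next
    case False
    then obtain d where d: "i = j + d" by (meson le_iff_add not_less)
    have "(i + 1) * (n * ?c) = (j + 1) * ?a * n + d * n" unfolding d by (simp add: algebra_simps)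
    moreover have "?a dvd (j + 1) * ?a * n" by (simp add: mult.assoc)
    ultimately have "?a dvd d * n" using dvd by (metis dvd_add_right_iff dvd_mult)
    moreover have "0 < d" using d ij by (metis add_0_right zero_less_iff_neq_zero)
    moreover have "d \<le> b" using d ij by (metis add.commute le_add_same_cancel1 zero_le order_less_imp_le order_trans)
    ultimately show thesis using that by blast
  qed
  then obtain q where q: "m = d * q" using m by blast
  have "?a dvd (q * (i + 1)) * (d * n)" using d(3) by (rule dvd_mult)
  also have "\<dots> = m * (i + 1) * n" by (simp add: q ac_simps)
  finally have "?a dvd m * (i + 1) * n" .
  moreover have "?a dvd m * (i + 1) * n + n" using dvd_triv_left[of ?a n] by (simp add: algebra_simps)
  ultimately show ?thesis using dvd_add_right_iff by blast
qed

definition codes_below :: "'a::ordered_arith \<Rightarrow> ('a \<Rightarrow> bool) \<Rightarrow> 'a \<Rightarrow> 'a \<Rightarrow> 'a \<Rightarrow> bool" where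
  "codes_below b P m j n \<longleftrightarrow> (\<forall>i<b. m * (i + 1) + 1 dvd n \<longleftrightarrow> i < j \<and> P i)"

lemma codes_below_zero:
  assumes "0 < (m::'a::ordered_arith)" shows "codes_below b P m 0 1"
proof -
  have "\<not> m * (i + 1) + 1 dvd 1" for i
  proof
    assume "m * (i + 1) + 1 dvd 1"
    then obtain q where q: "1 = (m * (i + 1) + 1) * q" by blast
    then have "q \<noteq> 0" by auto
    then have "1 \<le> q" by (metis less_one_iff not_less)
    then have "(m * (i + 1) + 1) * 1 \<le> 1" unfolding q[symmetric] using mult_left_mono[of 1 q "m * (i+1) + 1"] q by simp
    then have "m * (i + 1) + 1 \<le> 0 + 1" by simp
    then have "m * (i + 1) \<le> 0" by (simp only: add_le_cancel_right)
    then show False using assms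
      by (metis add_one_le_iff less_add_one_iff linorder_not_le mult_eq_0_iff le_zero_eq zero_le)
  qed
  then show ?thesis by (simp add: codes_below_def)
qed

lemma codes_below_step:
  fixes m :: "'a::ordered_arith"
  assumes "\<forall>d\<le>b. 0 < d \<longrightarrow> d dvd m" "codes_below b P m j n"
  shows "codes_below b P m (j + 1) (if j < b \<and> P j then n * (m * (j + 1) + 1) else n)"
proof (cases "j < b \<and> P j")
  case True
  have "m * (i + 1) + 1 dvd n * (m * (j + 1) + 1) \<longleftrightarrow> i < j + 1 \<and> P i" if "i < b" for i
  proof (cases "i = j")
    case False
    have "m * (i + 1) + 1 dvd n * (m * (j + 1) + 1) \<longleftrightarrow> m * (i + 1) + 1 dvd n"
    proof
      show "m * (i + 1) + 1 dvd n" if "m * (i + 1) + 1 dvd n * (m * (j + 1) + 1)"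
        by (rule coprime_factor[OF assms(1) \<open>i < b\<close> _ False that]) (use True in blast)
    qed (rule dvd_mult2)
    then show ?thesis using assms(2) that False by (auto simp: codes_below_def)
  qed (use True in simp)
  then show ?thesis using True by (simp add: codes_below_def)
next
  case False
  then show ?thesis using assms(2) unfolding codes_below_def
    by (metis less_add_one_iff order_le_less)
qed

lemma mem_pr: "mem i (pr k (pr m n)) \<longleftrightarrow> i < k \<and> m * (i + 1) + 1 dvd n"
  by (auto simp: mem_def)

lemma code_exists:
  assumes "recd (\<lambda>e. P (e 0))"
  shows "\<exists>c. \<forall>i. mem i c \<longleftrightarrow> i < b \<and> P i"
proof -
  obtain m where m: "0 < m" "\<forall>d\<le>b. 0 < d \<longrightarrow> d dvd m" using common_multiple by blast
  have "sig (\<lambda>e. \<exists>n. codes_below b P m (e 0) n)" unfolding codes_below_def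
    by (intro sig_ex recd_sig definable recd_comp1[OF assms])
  then have "\<exists>n. codes_below b P m b n"
  proof (induction b rule: sig_induct)
    case zero
    show ?case using codes_below_zero[OF m(1)] by blast
  next
    case (step j)
    then show ?case using codes_below_step[OF m(2)] by blast
  qed
  then obtain n where "codes_below b P m b n" by blast
  then show ?thesis by (intro exI[of _ "pr b (pr m n)"]) (auto simp: mem_pr codes_below_def)
qed

text \<open>Members of \<open>c\<close> are below \<open>c\<close>, so the bound \<open>c + b\<close> loses nothing and keeps the predicate bounded.\<close>

definition is_cset :: "'a::ordered_arith \<Rightarrow> ('a \<Rightarrow> bool) \<Rightarrow> 'a \<Rightarrow> bool" where
  "is_cset b P c \<longleftrightarrow> (\<forall>i<c + b. mem i c \<longleftrightarrow> i < b \<and> P i)"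

text \<open>The least code depends on the set alone, so it is a function with recursive graph, and
  it is the code that \<open>fin_codeF\<close> asks for.\<close>

definition cset :: "'a::ordered_arith \<Rightarrow> ('a \<Rightarrow> bool) \<Rightarrow> 'a" where
  "cset b P = (THE c. is_cset b P c \<and> (\<forall>c'<c. \<not> is_cset b P c'))"

lemma is_cset_iff: "is_cset b P c \<longleftrightarrow> (\<forall>i. mem i c \<longleftrightarrow> i < b \<and> P i)"
  unfolding is_cset_def using mem_less
  by (metis add.commute add_increasing2 le_iff_add order_less_le_trans zero_le)

lemma cset_unique:
  assumes "recd (\<lambda>e. P (e 0))"
  shows "c = cset b P \<longleftrightarrow> is_cset b P c \<and> (\<forall>c'<c. \<not> is_cset b P c')"
proof -
  have "recd (\<lambda>e. is_cset b P (e 0))" unfolding is_cset_def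
    by (intro definable recd_comp1[OF assms])
  then have ex: "\<exists>c. is_cset b P c \<and> (\<forall>c'<c. \<not> is_cset b P c')"
    using recd_least[of "is_cset b P", OF recd_sig] code_exists[OF assms, of b] is_cset_iff by metis
  have uniq: "c = c'" if "is_cset b P c \<and> (\<forall>c'<c. \<not> is_cset b P c')"
    "is_cset b P c' \<and> (\<forall>c''<c'. \<not> is_cset b P c'')" for c c'
    using that linorder_neqE by blast
  have "is_cset b P (cset b P) \<and> (\<forall>c'<cset b P. \<not> is_cset b P c')"
    unfolding cset_def by (rule the_unique[OF ex uniq])
  then show ?thesis using uniq by blast
qed

lemma mem_cset: "recd (\<lambda>e. P (e 0)) \<Longrightarrow> mem i (cset b P) \<longleftrightarrow> i < b \<and> P i"
  using cset_unique[of P "cset b P" b] by (simp add: is_cset_iff)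

lemma recd_param:
  assumes "recd (\<lambda>e. P (e 0) (\<lambda>n. e (Suc n)))" shows "recd (\<lambda>e'. P (e' 0) e)"
proof -
  have *: "(\<lambda>n. ev e' (case n of 0 \<Rightarrow> Inl 0 | Suc n \<Rightarrow> Inr (e n))) = e' 0 ## e" for e'
    by (rule HOL.ext) (simp split: nat.split)
  show ?thesis using assms
      sig_ren[of "\<lambda>e. P (e 0) (\<lambda>n. e (Suc n))" "\<lambda>n. case n of 0 \<Rightarrow> Inl 0 | Suc n \<Rightarrow> Inr (e n)"]
      sig_ren[of "\<lambda>e. \<not> P (e 0) (\<lambda>n. e (Suc n))" "\<lambda>n. case n of 0 \<Rightarrow> Inl 0 | Suc n \<Rightarrow> Inr (e n)"]
    unfolding recd_def * by simp
qed

lemma recd_ren: "recd P \<Longrightarrow> recd (\<lambda>e. P (\<lambda>n. e (h n)))"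
  unfolding recd_def using sig_ren[of _ "\<lambda>n. Inl (h n)"] by fastforce

lemma recf_cset [definable]:
  assumes b: "recf b" and P: "recd (\<lambda>e. P (e 0) (\<lambda>n. e (Suc n)))"
  shows "recf (\<lambda>e. cset (b e) (\<lambda>i. P i e))"
proof (rule recf_the[where P = "\<lambda>c e. is_cset (b e) (\<lambda>i. P i e) c \<and> (\<forall>c'<c. \<not> is_cset (b e) (\<lambda>i. P i e) c')"])
  have P2: "recd (\<lambda>e. P (e 0) (\<lambda>n. e (Suc (Suc n))))"
    using recd_ren[OF P, of "\<lambda>n. case n of 0 \<Rightarrow> 0 | Suc n \<Rightarrow> Suc (Suc n)"] by simp
  have P3: "recd (\<lambda>e. P (e 0) (\<lambda>n. e (Suc (Suc (Suc n)))))"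
    using recd_ren[OF P, of "\<lambda>n. case n of 0 \<Rightarrow> 0 | Suc n \<Rightarrow> Suc (Suc (Suc n))"] by simp
  show "recd (\<lambda>e. is_cset (b (\<lambda>n. e (Suc n))) (\<lambda>i. P i (\<lambda>n. e (Suc n))) (e 0) \<and>
         (\<forall>c'<e 0. \<not> is_cset (b (\<lambda>n. e (Suc n))) (\<lambda>i. P i (\<lambda>n. e (Suc n))) c'))"
    unfolding is_cset_def by (intro definable recf_shift[OF b] recf_shift[OF recf_shift[OF b]]
        recf_shift[OF recf_shift[OF recf_shift[OF b]]] P2 P3)
  show "(is_cset (b e) (\<lambda>i. P i e) y \<and> (\<forall>c'<y. \<not> is_cset (b e) (\<lambda>i. P i e) c')) = (y = cset (b e) (\<lambda>i. P i e))"
    for e y using cset_unique[OF recd_param[OF P]] by blast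
qed

subsection \<open>Finite sequences and primitive recursion\<close>

text \<open>Total on all numbers: the least value if there are several, and 0 if there is none. So
  every number is a sequence, without side conditions.\<close>

definition ap :: "'a::ordered_arith \<Rightarrow> 'a \<Rightarrow> 'a" where
  "ap s i = (THE y. (mem (pr i y) s \<and> (\<forall>z<y. \<not> mem (pr i z) s)) \<or> (y = 0 \<and> (\<forall>z<s. \<not> mem (pr i z) s)))"

lemma ap_iff:
  "y = ap s i \<longleftrightarrow> (mem (pr i y) s \<and> (\<forall>z<y. \<not> mem (pr i z) s)) \<or> (y = 0 \<and> (\<forall>z<s. \<not> mem (pr i z) s))"
  (is "_ \<longleftrightarrow> ?R y") for s :: "'a::rca0"
proof -
  have less: "mem (pr i z) s \<Longrightarrow> z < s" for z
    using mem_less pr_ge2 order_le_less_trans by metis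
  have "\<exists>y. ?R y"
  proof (cases "\<exists>z. mem (pr i z) s")
    case True
    then obtain z where "mem (pr i z) s" by blast
    moreover have "sig (\<lambda>e. mem (pr i (e 0)) s)" by (intro recd_sig definable)
    ultimately show ?thesis using recd_least[of "\<lambda>z. mem (pr i z) s" z] by blast
  qed auto
  moreover have uniq: "y = y'" if "?R y" "?R y'" for y y'
    using that less linorder_neqE by metis
  ultimately have "?R (ap s i)" unfolding ap_def by (rule the_unique)
  then show ?thesis using uniq by blast
qed

lemma recf_ap [definable]: "recf f \<Longrightarrow> recf g \<Longrightarrow> recf (\<lambda>e. ap (f e) (g e))"
proof (rule recf_comp2[of ap])
  show "recf (\<lambda>e. ap (e 0) (e (Suc 0)) :: 'a)"
    by (rule recf_the[OF _ ap_iff[symmetric]]) (intro definable)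
qed

lemma ap_eqI: "mem (pr i y) s \<Longrightarrow> (\<And>z. mem (pr i z) s \<Longrightarrow> z = y) \<Longrightarrow> ap s i = (y::'a::rca0)"
  by (rule sym, rule ap_iff[THEN iffD2], rule disjI1) (metis less_irrefl)

lemma recf_bounded:
  assumes "recf (\<lambda>e. h (e 0))" shows "\<exists>b. \<forall>i<k. h i < (b::'a::rca0)"
proof -
  have "sig (\<lambda>e. \<exists>b. \<forall>i<e 0. h i < b)"
    by (intro sig_ex recd_sig definable recf_comp1[OF assms])
  then show ?thesis
  proof (induction k rule: sig_induct)
    case (step k)
    then obtain b where b: "\<forall>i<k. h i < b" by blast
    have "h i < b + h k + 1" if "i < k + 1" for i
    proof (cases "i = k")
      case False
      then have "h i < b" using b that by (simp add: order_le_less)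
      then show ?thesis by (metis add.assoc add_less_le_mono add_0_right zero_le)
    qed (simp add: add_increasing)
    then show ?case by blast
  qed simp
qed

lemma sequence_code:
  assumes "recf (\<lambda>e. g (e 0))" shows "\<exists>s. \<forall>i<k. ap s i = (g i :: 'a::rca0)"
proof -
  have "recf (\<lambda>e. pr (e 0) (g (e 0)))" by (intro definable recf_comp1[OF assms])
  then obtain b where b: "\<forall>i<k. pr i (g i) < b" using recf_bounded[of "\<lambda>i. pr i (g i)"] by blast
  have "recd (\<lambda>e. \<exists>i<k. e 0 = pr i (g i))" by (intro definable recf_comp1[OF assms])
  then obtain s where s: "\<forall>z. mem z s \<longleftrightarrow> z < b \<and> (\<exists>i<k. z = pr i (g i))"
    using code_exists[of "\<lambda>z. \<exists>i<k. z = pr i (g i)"] by blast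
  have "ap s i = g i" if "i < k" for i
    by (rule ap_eqI) (use s b that in auto)
  then show ?thesis by blast
qed

definition seqok :: "'a::rca0 \<Rightarrow> ('a \<Rightarrow> 'a \<Rightarrow> 'a) \<Rightarrow> 'a \<Rightarrow> 'a \<Rightarrow> bool" where
  "seqok c g s k \<longleftrightarrow> ap s 0 = c \<and> (\<forall>i<k. ap s (i + 1) = g i (ap s i))"

text \<open>Primitive recursion by coded computations; the number \<open>k\<close> of steps may be
  nonstandard, since computations exist by Sigma_1 induction.\<close>

definition prec :: "'a::rca0 \<Rightarrow> ('a \<Rightarrow> 'a \<Rightarrow> 'a) \<Rightarrow> 'a \<Rightarrow> 'a" where
  "prec c g k = (THE y. \<exists>s. seqok c g s k \<and> y = ap s k)"

lemma seqok_exists: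
  assumes g: "recf (\<lambda>e. g (e 0) (e (Suc 0)))" shows "\<exists>s. seqok c g s k"
proof -
  have "sig (\<lambda>e. \<exists>s. seqok c g s (e 0))" unfolding seqok_def
    by (intro sig_ex recd_sig definable recf_comp2[OF g])
  then show ?thesis
  proof (induction k rule: sig_induct)
    case zero
    obtain s where "\<forall>i<1. ap s i = c" using sequence_code[OF recf_const[of c], of 1] by metis
    then show ?case by (intro exI[of _ s]) (simp add: seqok_def)
  next
    case (step k)
    then obtain s where s: "seqok c g s k" by blast
    have "recf (\<lambda>e. if e 0 \<le> k then ap s (e 0) else g k (ap s k))" by (intro definable)
    then obtain s' where s': "\<forall>i<k + 1 + 1. ap s' i = (if i \<le> k then ap s i else g k (ap s k))"
      using sequence_code[of "\<lambda>i. if i \<le> k then ap s i else g k (ap s k)"] by blast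
    have "ap s' (i + 1) = g i (ap s' i)" if "i \<le> k" for i
    proof (cases "i = k")
      case True
      then show ?thesis using s' by (simp add: order_less_imp_le)
    next
      case False
      then have "i < k" using that by simp
      then show ?thesis using s s' by (simp add: seqok_def order_less_imp_le)
    qed
    moreover have "ap s' 0 = c" using s' s by (simp add: seqok_def)
    ultimately show ?case by (intro exI[of _ s']) (simp add: seqok_def)
  qed
qed

lemma seqok_unique:
  assumes "seqok c g s k" "seqok c g s' k" "i \<le> k" shows "ap s i = ap s' i"
proof -
  have "recd (\<lambda>e. e 0 \<le> k \<longrightarrow> ap s (e 0) = ap s' (e 0))" by (intro definable)
  from recd_sig[OF this] have "i \<le> k \<longrightarrow> ap s i = ap s' i"
  proof (induction i rule: sig_induct)
    case zero
    then show ?case using assms by (simp add: seqok_def)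
  next
    case (step i)
    then show ?case using assms by (auto simp: seqok_def)
  qed
  then show ?thesis using assms(3) by blast
qed

lemma prec_iff:
  assumes g: "recf (\<lambda>e. g (e 0) (e (Suc 0)))"
  shows "y = prec c g k \<longleftrightarrow> (\<exists>s. seqok c g s k \<and> y = ap s k)"
proof -
  obtain s where s: "seqok c g s k" using seqok_exists[OF g] by blast
  have "prec c g k = ap s k"
    unfolding prec_def by (rule the_equality) (use s seqok_unique in blast)+
  moreover have "ap s' k = ap s k" if "seqok c g s' k" for s' using seqok_unique[OF that s] by simp
  ultimately show ?thesis using s by metis
qed

lemma prec_0: assumes "recf (\<lambda>e. g (e 0) (e (Suc 0)))" shows "prec c g 0 = c"
  using prec_iff[OF assms, of "prec c g 0" c 0] by (auto simp: seqok_def)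

lemma prec_step: assumes "recf (\<lambda>e. g (e 0) (e (Suc 0)))" shows "prec c g (k + 1) = g k (prec c g k)"
proof -
  obtain s where s: "seqok c g s (k + 1)" using seqok_exists[OF assms] by blast
  then have "seqok c g s k" by (simp add: seqok_def order_less_imp_le)
  then have "prec c g k = ap s k" "prec c g (k + 1) = ap s (k + 1)"
    using s prec_iff[OF assms] by metis+
  then show ?thesis using s by (simp add: seqok_def)
qed

lemma recf_prec:
  assumes c: "recf (\<lambda>e. c (e 0))" and g: "recf (\<lambda>e. g (e 0) (e (Suc 0)) (e (Suc (Suc 0))))"
    and p: "recf p" and k: "recf k"
  shows "recf (\<lambda>e. prec (c (p e)) (g (p e)) (k e))"
proof (rule recf_comp2[of "\<lambda>p k. prec (c p) (g p) k", OF _ p k])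
  have *: "recf (\<lambda>e. g p (e 0) (e (Suc 0)))" for p by (intro recf_comp3[OF g] definable)
  have "sig (\<lambda>e. \<exists>s. seqok (c (e (Suc 0))) (g (e (Suc 0))) s (e (Suc (Suc 0))) \<and> e 0 = ap s (e (Suc (Suc 0))))"
    unfolding seqok_def by (intro sig_ex recd_sig definable recf_comp1[OF c] recf_comp3[OF g])
  then show "recf (\<lambda>e. prec (c (e 0)) (g (e 0)) (e (Suc 0)))"
    unfolding recf_def by (simp add: prec_iff[OF *])
qed

section \<open>Powers, predecessor and a bound for the codes of sets\<close>

definition pow :: "'a::rca0 \<Rightarrow> 'a \<Rightarrow> 'a" where
  "pow b k = prec ((\<lambda>_. 1) b) ((\<lambda>p i y. y * p) b) k"

text \<open>The redexes in \<open>pow\<close> exhibit \<open>b\<close> as the parameter in the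
  position where \<open>recf_prec\<close> expects it.\<close>

lemma recf_pow [definable]: "recf f \<Longrightarrow> recf g \<Longrightarrow> recf (\<lambda>e. pow (f e) (g e))"
  unfolding pow_def by (rule recf_prec) (intro definable | assumption)+

lemma pow_simps [simp]: "pow b 0 = 1" "pow b (k + 1) = pow b k * b"
proof -
  have *: "recf (\<lambda>e. (\<lambda>p i y. y * p) b (e 0) (e (Suc 0)))" by (intro definable)
  show "pow b 0 = 1" "pow b (k + 1) = pow b k * b"
    unfolding pow_def prec_0[OF *] prec_step[OF *] by simp_all
qed

definition pd :: "'a::rca0 \<Rightarrow> 'a" where "pd x = (THE y. (x = 0 \<and> y = 0) \<or> y + 1 = x)"

lemma pd_iff: "((x = 0 \<and> y = 0) \<or> y + 1 = x) \<longleftrightarrow> y = pd x"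
proof (cases "x = 0")
  case False
  then obtain z where "x = z + 1" using not_zero_ex by blast
  then show ?thesis by (auto simp: pd_def)
qed (auto simp: pd_def)

lemma pd_add [simp]: "pd (x + 1) = x"
  using pd_iff[of "x + 1" x] by simp

lemma recf_pd [definable]: "recf f \<Longrightarrow> recf (\<lambda>e. pd (f e))"
proof (rule recf_comp1[of pd])
  show "recf (\<lambda>e. pd (e 0) :: 'a)" by (rule recf_the[OF _ pd_iff]) (intro definable)
qed

definition mult_upto :: "'a::rca0 \<Rightarrow> 'a \<Rightarrow> bool" where
  "mult_upto b m \<longleftrightarrow> 0 < m \<and> (\<forall>d\<le>b. 0 < d \<longrightarrow> d dvd m)"

definition mm :: "'a::rca0 \<Rightarrow> 'a" where
  "mm b = (THE m. mult_upto b m \<and> (\<forall>m'<m. \<not> mult_upto b m'))"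

lemma mm_iff: "(mult_upto b m \<and> (\<forall>m'<m. \<not> mult_upto b m')) \<longleftrightarrow> m = mm b"
proof -
  have "sig (\<lambda>e. mult_upto b (e 0))" unfolding mult_upto_def by (intro recd_sig definable)
  moreover obtain k where "mult_upto b k" using common_multiple[of b] by (auto simp: mult_upto_def)
  ultimately have "\<exists>m. mult_upto b m \<and> (\<forall>m'<m. \<not> mult_upto b m')"
    using recd_least[of "mult_upto b" k] by blast
  moreover have uniq: "m = m'" if "mult_upto b m \<and> (\<forall>k<m. \<not> mult_upto b k)"
    "mult_upto b m' \<and> (\<forall>k<m'. \<not> mult_upto b k)" for m m'
    using that linorder_neqE by blast
  ultimately have "mult_upto b (mm b) \<and> (\<forall>m'<mm b. \<not> mult_upto b m')"
    unfolding mm_def by (rule the_unique)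
  then show ?thesis using uniq by blast
qed

lemma recf_mm [definable]: "recf f \<Longrightarrow> recf (\<lambda>e. mm (f e))"
proof (rule recf_comp1[of mm])
  show "recf (\<lambda>e. mm (e 0) :: 'a)"
    by (rule recf_the[OF _ mm_iff], unfold mult_upto_def) (intro definable)
qed

text \<open>A subset of the numbers below \<open>b\<close> is coded with modulus \<open>mm b\<close>
  by a product of at most \<open>b\<close> factors, each at most \<open>mm b * b + 1\<close>; the
  last summand makes the bound strict.\<close>

definition cb :: "'a::rca0 \<Rightarrow> 'a" where
  "cb b = pr b (pr (mm b) (pow (mm b * b + 1) b)) + 1"

lemma recf_cb [definable]: "recf f \<Longrightarrow> recf (\<lambda>e. cb (f e))"
  unfolding cb_def by (intro definable)

lemma cb_gt: "b < cb b"
  unfolding cb_def by (simp add: pr_ge1)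

lemma cset_less:
  assumes "recd (\<lambda>e. P (e 0))"
  shows "cset b P < cb b"
proof -
  let ?m = "mm b"
  have m: "0 < ?m" "\<forall>d\<le>b. 0 < d \<longrightarrow> d dvd ?m"
    using mm_iff[of b ?m] by (auto simp: mult_upto_def)
  have "sig (\<lambda>e. \<exists>n. codes_below b P ?m (e 0) n \<and> n \<le> pow (?m * b + 1) (e 0))" unfolding codes_below_def
    by (intro sig_ex recd_sig definable recd_comp1[OF assms])
  then have "\<exists>n. codes_below b P ?m b n \<and> n \<le> pow (?m * b + 1) b"
  proof (induction b rule: sig_induct)
    case zero
    show ?case using codes_below_zero[OF m(1)] by (metis order_refl pow_simps(1))
  next
    case (step j)
    then obtain n where n: "codes_below b P ?m j n" "n \<le> pow (?m * b + 1) j" by blast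
    have "(if j < b \<and> P j then n * (?m * (j + 1) + 1) else n) \<le> pow (?m * b + 1) (j + 1)"
    proof (cases "j < b \<and> P j")
      case True
      then have "j + 1 \<le> b" by simp
      then have "?m * (j + 1) + 1 \<le> ?m * b + 1" by (simp only: add_right_mono mult_left_mono zero_le)
      then show ?thesis using n(2) True by (simp only: pow_simps if_True simp_thms) (intro mult_mono zero_le)
    next
      case False
      have "n * 1 \<le> pow (?m * b + 1) j * (?m * b + 1)" using n(2) by (intro mult_mono) auto
      then show ?thesis using False by (simp only: pow_simps if_False mult_1_right)
    qed
    then show ?case using codes_below_step[OF m(2) n(1)] by blast
  qed
  then obtain n where n: "codes_below b P ?m b n" "n \<le> pow (?m * b + 1) b" by blast
  then have "is_cset b P (pr b (pr ?m n))" by (auto simp: is_cset_iff mem_pr codes_below_def)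
  moreover have "\<forall>c'<cset b P. \<not> is_cset b P c'" using cset_unique[OF assms] by blast
  ultimately have "cset b P \<le> pr b (pr ?m n)" by (meson not_less)
  also have "\<dots> < cb b" unfolding cb_def using n(2) by (simp add: pr_mono)
  finally show ?thesis .
qed

subsection \<open>The pigeonhole principle\<close>

text \<open>A least counterexample \<open>K = L + 1\<close> yields a smaller one: the index with the
  top value \<open>L\<close>, if any, is redirected to the value of the last index. Minimality is
  available because the injections are coded.\<close>

lemma pigeonhole_code:
  fixes s :: "'a::rca0"
  assumes "\<forall>i<K + 1. ap s i < K" "\<forall>i<K + 1. \<forall>j<i. ap s j \<noteq> ap s i"
  shows False
proof -
  define P where "P K s \<longleftrightarrow> (\<forall>i<K + 1. ap s i < K) \<and> (\<forall>i<K + 1. \<forall>j<i. ap s j \<noteq> ap s i)" for K s :: 'a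
  have "sig (\<lambda>e. \<exists>s. P (e 0) s)" unfolding P_def by (intro sig_ex recd_sig definable)
  moreover have "\<exists>s. P K s" using assms by (auto simp: P_def)
  ultimately obtain K s where K: "P K s" "\<forall>L<K. \<not> (\<exists>s. P L s)"
    using recd_least[of "\<lambda>K. \<exists>s. P K s" K] by blast
  have "K \<noteq> 0" using K(1) unfolding P_def by (metis add_0 less_one_iff not_less_zero)
  then obtain L where L: "K = L + 1" using not_zero_ex by blast
  have "recf (\<lambda>e. if ap s (e 0) = L then ap s (L + 1) else ap s (e 0))" by (intro definable)
  from sequence_code[OF this, of "L + 1"]
  obtain s' where s': "\<forall>i<L + 1. ap s' i = (if ap s i = L then ap s (L + 1) else ap s i)" by blast
  have val: "\<And>i. i \<le> L + 1 \<Longrightarrow> ap s i \<le> L" and inj: "\<And>i j. i \<le> L + 1 \<Longrightarrow> j < i \<Longrightarrow> ap s j \<noteq> ap s i"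
    using K(1) unfolding P_def L by auto
  have inj': "ap s j = ap s i \<Longrightarrow> j = i" if "i \<le> L + 1" "j \<le> L + 1" for i j
    using inj[of i j] inj[of j i] that by (metis linorder_neqE)
  have "P L s'" unfolding P_def
  proof (intro conjI allI impI)
    fix i assume i: "i < L + 1"
    then have "i < L + 1" "i \<le> L + 1" by (auto simp: add_increasing2)
    then show "ap s' i < L" using s' val[of i] val[of "L + 1"] inj[of "L + 1" i]
      by (auto simp: order_le_less)
    fix j assume "j < i"
    then have "j < L + 1" "j \<noteq> i" using i by (auto dest: order_less_imp_le)
    then have "j \<le> L + 1" by (rule_tac order_less_imp_le)
    moreover have "ap s' j = (if ap s j = L then ap s (L + 1) else ap s j)"
      "ap s' i = (if ap s i = L then ap s (L + 1) else ap s i)"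
      using s' i \<open>j < L + 1\<close> by blast+
    moreover have "ap s i \<noteq> ap s (L + 1)" "ap s j \<noteq> ap s (L + 1)" "ap s j \<noteq> ap s i"
      using inj[of "L + 1" i] inj[of "L + 1" j] inj'[of i j] i \<open>j < L + 1\<close> \<open>j \<noteq> i\<close> \<open>i \<le> L + 1\<close> \<open>j \<le> L + 1\<close> by auto
    ultimately show "ap s' j \<noteq> ap s' i" by metis
  qed
  moreover have "L < K" using L by simp
  ultimately show False using K(2) by blast
qed

lemma pigeonhole:
  assumes "recf (\<lambda>e. h (e 0))" "\<And>i. i < N \<Longrightarrow> h i < K" "K < N"
  shows "\<exists>i j. i < j \<and> j < N \<and> h i = (h j :: 'a::rca0)"
proof (rule ccontr)
  assume *: "\<not> ?thesis"
  obtain s where s: "\<forall>i<K + 1. ap s i = h i" using sequence_code[OF assms(1)] by blast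
  have less: "i < N" if "i < K + 1" for i using that assms(3) by simp
  show False
  proof (rule pigeonhole_code[of K s])
    show "\<forall>i<K + 1. ap s i < K" using s assms(2) less by simp
    show "\<forall>i<K + 1. \<forall>j<i. ap s j \<noteq> ap s i" using s * less by (metis order_less_trans)
  qed
qed

subsection \<open>Chains\<close>

text \<open>The pairs of an index up to \<open>k\<close> and a value up to \<open>w\<close> have
  codes up to \<open>pr k w\<close>. The resulting bound on \<open>s\<close> makes the predicate
  Delta_1 instead of merely Sigma_1, so it can be iterated in \<open>tab\<close>.\<close>

definition chain :: "('a::rca0 \<Rightarrow> 'a \<Rightarrow> bool) \<Rightarrow> 'a \<Rightarrow> 'a \<Rightarrow> 'a \<Rightarrow> bool" where
  "chain R k t w \<longleftrightarrow> (\<exists>s<cb (pr k w + 1). ap s 0 = t \<and> (\<forall>i<k. R (ap s i) (ap s (i + 1))) \<and> (\<forall>i\<le>k. ap s i \<le> w))"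

lemma recd_let: "recd (\<lambda>e. P (e 0) (\<lambda>n. e (Suc n))) \<Longrightarrow> recf f \<Longrightarrow> recd (\<lambda>e. P (f e) e)"
  unfolding recd_def using sig_let[of P f] sig_let[of "\<lambda>x e. \<not> P x e" f] by blast

lemma recd_let2:
  assumes "recd (\<lambda>e. P (e 0) (e (Suc 0)) (\<lambda>n. e (Suc (Suc n))))" "recf f" "recf g"
  shows "recd (\<lambda>e. P (f e) (g e) e)"
  apply (rule recd_let[where P = "\<lambda>x e. P x (g e) e", OF _ assms(2)])
  apply (rule recd_let[where P = "\<lambda>x e. P (e 0) x (\<lambda>n. e (Suc n))", OF _ recf_shift[OF assms(3)]])
  using recd_ren[OF assms(1), of "\<lambda>n. case n of 0 \<Rightarrow> 1 | Suc 0 \<Rightarrow> 0 | Suc (Suc n) \<Rightarrow> Suc (Suc n)"] by simp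

lemma recd_chain [definable]:
  assumes R: "recd (\<lambda>e. R (e 0) (e (Suc 0)) (\<lambda>n. e (Suc (Suc n))))" and "recf k" "recf t" "recf w"
  shows "recd (\<lambda>e. chain (\<lambda>x y. R x y e) (k e) (t e) (w e))"
proof -
  have "recd (\<lambda>e. R (e 0) (e (Suc 0)) (\<lambda>n. e (Suc (Suc (Suc (Suc n))))))"
    using recd_ren[OF R, of "\<lambda>n. case n of 0 \<Rightarrow> 0 | Suc 0 \<Rightarrow> 1 | Suc (Suc n) \<Rightarrow> Suc (Suc (Suc (Suc n)))"] by simp
  then have "recd (\<lambda>e. R (ap (e (Suc 0)) (e 0)) (ap (e (Suc 0)) (e 0 + 1)) (\<lambda>n. e (Suc (Suc n))))"
    by (rule recd_let2) (intro definable)+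
  then show ?thesis unfolding chain_def
    by (intro definable recf_shift[OF assms(2)] recf_shift[OF assms(3)] recf_shift[OF assms(4)]
        recf_shift[OF recf_shift[OF assms(4)]] assms)
qed

lemma chainI:
  assumes h: "recf (\<lambda>e. h (e 0))" and "h 0 = t" "\<And>i. i < k \<Longrightarrow> R (h i) (h (i + 1))" "\<And>i. i \<le> k \<Longrightarrow> h i \<le> w"
  shows "chain R k t w"
proof -
  let ?P = "\<lambda>z. \<exists>i\<le>k. z = pr i (h i)"
  have P: "recd (\<lambda>e. ?P (e 0))" by (intro definable recf_comp1[OF h])
  define s where "s = cset (pr k w + 1) ?P"
  have "ap s i = h i" if "i \<le> k" for i
    by (rule ap_eqI) (use that assms(4) in \<open>auto simp: s_def mem_cset[OF P] pr_mono\<close>)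
  moreover have "s < cb (pr k w + 1)" unfolding s_def by (rule cset_less[OF P])
  ultimately show ?thesis unfolding chain_def using assms(2-4)
    by (intro exI[of _ s]) (auto simp: order_less_imp_le)
qed

lemma chainE:
  assumes "chain R k t w"
  obtains s where "ap s 0 = t" "\<And>i. i < k \<Longrightarrow> R (ap s i) (ap s (i + 1))" "\<And>i. i \<le> k \<Longrightarrow> ap s i \<le> w"
  using assms unfolding chain_def by blast

lemma chain_0 [simp]: "chain R 0 t w \<longleftrightarrow> t \<le> w"
proof
  show "t \<le> w \<Longrightarrow> chain R 0 t w" by (rule chainI[of "\<lambda>_. t"]) (auto intro: recf_const)
qed (auto simp: chain_def)

lemma chain_le: "chain R k t w \<Longrightarrow> t \<le> w"
  by (auto simp: chain_def)

lemma chain_mono: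
  assumes "chain R k t w" "\<And>x y. R x y \<Longrightarrow> x \<le> w \<Longrightarrow> y \<le> w \<Longrightarrow> R' x y" "k' \<le> k" "w \<le> w'"
  shows "chain R' k' t w'"
proof -
  obtain s where s: "ap s 0 = t" "\<And>i. i < k \<Longrightarrow> R (ap s i) (ap s (i + 1))" "\<And>i. i \<le> k \<Longrightarrow> ap s i \<le> w"
    by (rule chainE[OF assms(1)]) blast
  show ?thesis
  proof (rule chainI[of "ap s"])
    show "recf (\<lambda>e. ap s (e 0))" by (intro definable)
    show "R' (ap s i) (ap s (i + 1))" if "i < k'" for i
    proof -
      have "i < k" using that assms(3) by simp
      then show ?thesis using s by (intro assms(2)) (simp_all add: order_less_imp_le)
    qed
  qed (use s assms in \<open>auto intro: order_trans\<close>)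
qed

lemma chain_cong:
  "(\<And>x y. x \<le> w \<Longrightarrow> y \<le> w \<Longrightarrow> R x y \<longleftrightarrow> R' x y) \<Longrightarrow> chain R k t w \<longleftrightarrow> chain R' k t w"
  using chain_mono[of R k t w R' k w] chain_mono[of R' k t w R k w] by blast

lemma chain_uncons:
  assumes "chain R (k + 1) t w" shows "\<exists>v\<le>w. R t v \<and> chain R k v w"
proof -
  obtain s where s: "ap s 0 = t" "\<And>i. i < k + 1 \<Longrightarrow> R (ap s i) (ap s (i + 1))" "\<And>i. i \<le> k + 1 \<Longrightarrow> ap s i \<le> w"
    by (rule chainE[OF assms]) blast
  have "R t (ap s 1)" using s(2)[of 0] s(1) by simp
  moreover have "ap s 1 \<le> w" using s(3)[of 1] by simp
  moreover have "chain R k (ap s 1) w"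
  proof (rule chainI[of "\<lambda>i. ap s (i + 1)"])
    show "recf (\<lambda>e. ap s (e 0 + 1))" by (intro definable)
  qed (use s in auto)
  ultimately show ?thesis by blast
qed

lemma chain_snoc:
  assumes "chain R k t v" "R v' w" "v \<le> v'" "v' \<le> w" and anti: "\<And>x x' y. R x y \<Longrightarrow> x' \<le> x \<Longrightarrow> R x' y"
  shows "chain R (k + 1) t w"
proof -
  obtain s where s: "ap s 0 = t" "\<And>i. i < k \<Longrightarrow> R (ap s i) (ap s (i + 1))" "\<And>i. i \<le> k \<Longrightarrow> ap s i \<le> v"
    by (rule chainE[OF assms(1)]) blast
  show ?thesis
  proof (rule chainI[of "\<lambda>i. if i \<le> k then ap s i else w"])
    show "recf (\<lambda>e. if e 0 \<le> k then ap s (e 0) else w)" by (intro definable)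
    show "R (if i \<le> k then ap s i else w) (if i + 1 \<le> k then ap s (i + 1) else w)" if "i < k + 1" for i
      using that s(2)[of i] anti[OF assms(2), of "ap s i"] s(3)[of i] assms(3) by auto
    show "(if i \<le> k then ap s i else w) \<le> w" if "i \<le> k + 1" for i
      using s(3)[of i] assms(3,4) by auto
  qed (use s in simp)
qed

lemma chain_anti:
  assumes "chain R k t w" "t' \<le> t" and anti: "\<And>x x' y. R x y \<Longrightarrow> x' \<le> x \<Longrightarrow> R x' y"
  shows "chain R k t' w"
proof (cases "k = 0")
  case False
  then obtain j where j: "k = j + 1" using not_zero_ex by blast
  with assms(1) obtain v where v: "v \<le> w" "R t v" "chain R j v w" using chain_uncons by blast
  obtain s where s: "ap s 0 = t" "\<And>i. i < k \<Longrightarrow> R (ap s i) (ap s (i + 1))" "\<And>i. i \<le> k \<Longrightarrow> ap s i \<le> w"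
    by (rule chainE[OF assms(1)]) blast
  show ?thesis
  proof (rule chainI[of "\<lambda>i. if i = 0 then t' else ap s i"])
    show "recf (\<lambda>e. if e 0 = 0 then t' else ap s (e 0))" by (intro definable)
    show "R (if i = 0 then t' else ap s i) (if i + 1 = 0 then t' else ap s (i + 1))" if "i < k" for i
      using s(2)[OF that] anti[of t "ap s 1" t'] s(1) assms(2) by auto
    show "(if i = 0 then t' else ap s i) \<le> w" if "i \<le> k" for i
      using s(3)[OF that] s(1) assms(2) s(3)[of 0] by auto
  qed simp
qed (use assms chain_le order_trans in auto)

lemma chain_ge:
  fixes s :: "'a::rca0"
  assumes "ap s 0 = t" "\<And>i. i < k \<Longrightarrow> R (ap s i) (ap s (i + 1))" "\<And>x y. R x y \<Longrightarrow> x \<le> y" "i \<le> k"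
  shows "t \<le> ap s i"
proof -
  have "recd (\<lambda>e. e 0 \<le> k \<longrightarrow> t \<le> ap s (e 0))" by (intro definable)
  from recd_sig[OF this] have "i \<le> k \<longrightarrow> t \<le> ap s i"
  proof (induction i rule: sig_induct)
    case (step i)
    show ?case
    proof
      assume "i + 1 \<le> k"
      then have "i < k" by simp
      then show "t \<le> ap s (i + 1)" using step assms(3)[OF assms(2)] by (meson order_less_imp_le order_trans)
    qed
  qed (use assms in simp)
  then show ?thesis using assms(4) by blast
qed

lemma chain_mono2:
  assumes "chain R k t w" "\<And>x y. R x y \<Longrightarrow> t \<le> x \<Longrightarrow> x \<le> w \<Longrightarrow> y \<le> w \<Longrightarrow> R' x y"
    "\<And>x y. R x y \<Longrightarrow> x \<le> y"
  shows "chain R' k t w"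
proof -
  obtain s where s: "ap s 0 = t" "\<And>i. i < k \<Longrightarrow> R (ap s i) (ap s (i + 1))" "\<And>i. i \<le> k \<Longrightarrow> ap s i \<le> w"
    by (rule chainE[OF assms(1)]) blast
  show ?thesis
  proof (rule chainI[of "ap s"])
    show "recf (\<lambda>e. ap s (e 0))" by (intro definable)
    show "R' (ap s i) (ap s (i + 1))" if "i < k" for i
      using that s chain_ge[of s t k R i, OF s(1,2) assms(3)] by (intro assms(2)) (simp_all add: order_less_imp_le)
  qed (use s in auto)
qed

section \<open>Projections of pairs, with default value 0\<close>

definition fs_rel :: "'a::rca0 \<Rightarrow> 'a \<Rightarrow> bool" where
  "fs_rel p x \<longleftrightarrow> (\<exists>y\<le>p. p = pr x y) \<or> (\<forall>x'\<le>p. \<forall>y'\<le>p. p \<noteq> pr x' y') \<and> x = 0"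

definition fs :: "'a::rca0 \<Rightarrow> 'a" where "fs p = (THE z. fs_rel p z)"

lemma fs_iff: "fs_rel p z \<longleftrightarrow> z = fs p"
proof -
  have ex: "\<exists>z. fs_rel p z" unfolding fs_rel_def by blast
  have uniq: "z = z'" if "fs_rel p z" "fs_rel p z'" for z z'
    using that unfolding fs_rel_def by (metis pr_inject pr_ge1 pr_ge2)
  have "fs_rel p (fs p)" unfolding fs_def by (rule the_unique[OF ex uniq])
  then show ?thesis using uniq by metis
qed

lemma recf_fs [definable]: "recf p \<Longrightarrow> recf (\<lambda>e. fs (p e))"
proof (rule recf_comp1[of fs])
  show "recf (\<lambda>e. fs (e 0) :: 'a)"
    by (rule recf_the[OF _ fs_iff], unfold fs_rel_def) (intro definable)
qed

definition sn_rel :: "'a::rca0 \<Rightarrow> 'a \<Rightarrow> bool" where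
  "sn_rel p y \<longleftrightarrow> (\<exists>x\<le>p. p = pr x y) \<or> (\<forall>x'\<le>p. \<forall>y'\<le>p. p \<noteq> pr x' y') \<and> y = 0"

definition sn :: "'a::rca0 \<Rightarrow> 'a" where "sn p = (THE z. sn_rel p z)"

lemma sn_iff: "sn_rel p z \<longleftrightarrow> z = sn p"
proof -
  have ex: "\<exists>z. sn_rel p z" unfolding sn_rel_def by blast
  have uniq: "z = z'" if "sn_rel p z" "sn_rel p z'" for z z'
    using that unfolding sn_rel_def by (metis pr_inject pr_ge1 pr_ge2)
  have "sn_rel p (sn p)" unfolding sn_def by (rule the_unique[OF ex uniq])
  then show ?thesis using uniq by metis
qed

lemma recf_sn [definable]: "recf p \<Longrightarrow> recf (\<lambda>e. sn (p e))"
proof (rule recf_comp1[of sn])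
  show "recf (\<lambda>e. sn (e 0) :: 'a)"
    by (rule recf_the[OF _ sn_iff], unfold sn_rel_def) (intro definable)
qed

lemma fs_pr [simp]: "fs (pr x y) = x"
  using fs_iff[of "pr x y" x] pr_ge2[of y x] by (auto simp: fs_rel_def)

lemma sn_pr [simp]: "sn (pr x y) = y"
  using sn_iff[of "pr x y" y] pr_ge1[of x y] by (auto simp: sn_rel_def)

section \<open>Largeness\<close>

text \<open>A gap from \<open>t\<close> to \<open>u\<close> must exceed \<open>hh t\<close>, which bounds the codes of the sets and of the
  families of sets that occur as colour patterns below.\<close>

definition hh :: "'a::rca0 \<Rightarrow> 'a" where
  "hh t = cb (t + 1) + cb (pow 2 (t + t) + 2) + (t + 1) * (t + 1) + 2"

lemma recf_hh [definable]: "recf f \<Longrightarrow> recf (\<lambda>e. hh (f e))"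
  unfolding hh_def by (intro definable)

locale apart =
  fixes Th :: "'a::rca0 \<Rightarrow> 'a \<Rightarrow> 'a \<Rightarrow> bool"
  assumes recd_Th: "recd (\<lambda>e. Th (e 0) (e (Suc 0)) (e (Suc (Suc 0))))"
begin

text \<open>The gap reaches from \<open>t\<close> to \<open>u\<close>, the block after it up to
  \<open>v\<close>. Bounding \<open>z\<close> by \<open>v\<close> keeps the condition Delta_1.
  Asking for \<open>hh x \<le> u\<close> at all \<open>x \<le> t\<close> makes it antitone in
  \<open>t\<close> without any monotonicity of \<open>hh\<close>.\<close>

definition Ap :: "'a \<Rightarrow> 'a \<Rightarrow> 'a \<Rightarrow> bool" where
  "Ap t u v \<longleftrightarrow> t < u \<and> u \<le> v \<and> (\<forall>x\<le>t. hh x \<le> u) \<and> (\<forall>x\<le>t. \<exists>y\<le>u. \<forall>z\<le>v. Th x y z)"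

lemma recd_Ap: "recf f \<Longrightarrow> recf g \<Longrightarrow> recf h \<Longrightarrow> recd (\<lambda>e. Ap (f e) (g e) (h e))"
proof (rule recd_comp3[of Ap])
  show "recd (\<lambda>e. Ap (e 0) (e (Suc 0)) (e (Suc (Suc 0))))"
    unfolding Ap_def by (intro definable recd_comp3[OF recd_Th])
qed

lemma Ap_anti: "Ap t u v \<Longrightarrow> t' \<le> t \<Longrightarrow> Ap t' u v"
  by (auto simp: Ap_def)

text \<open>The link relation of the chains, with the previous order looked up in the table
  \<open>\<tau>\<close>; this turns the recursion on the order into a primitive recursion on
  codes.\<close>

definition stp :: "'a \<Rightarrow> 'a \<Rightarrow> 'a \<Rightarrow> bool" where
  "stp \<tau> t y \<longleftrightarrow> (\<exists>U\<le>y. Ap t U y \<and> mem (pr U y) \<tau>)"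

lemma recd_stp: "recf f \<Longrightarrow> recf g \<Longrightarrow> recf h \<Longrightarrow> recd (\<lambda>e. stp (f e) (g e) (h e))"
  by (rule recd_comp3[of stp], unfold stp_def) (intro definable recd_Ap)

definition tab0 :: "'a \<Rightarrow> 'a \<Rightarrow> 'a" where
  "tab0 X d = cset (pr d d + 1) (\<lambda>z. \<exists>u\<le>d. \<exists>v\<le>d. z = pr u v \<and> (\<exists>x\<le>v. u \<le> x \<and> mem x X))"

definition tabS :: "'a \<Rightarrow> 'a \<Rightarrow> 'a" where
  "tabS d \<tau> = cset (pr d d + 1) (\<lambda>z. \<exists>u\<le>d. \<exists>v\<le>d. z = pr u v \<and> chain (stp \<tau>) u u v)"

text \<open>\<open>tab X d n\<close> codes the set of all pairs \<open>(u, v)\<close> below \<open>d\<close> such that the part of \<open>X\<close> in \<open>[u, v]\<close>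
  is large of order \<open>n\<close>.\<close>

definition tab :: "'a \<Rightarrow> 'a \<Rightarrow> 'a \<Rightarrow> 'a" where
  "tab X d n = prec ((\<lambda>p. tab0 (fs p) (sn p)) (pr X d)) ((\<lambda>p i \<tau>. tabS (sn p) \<tau>) (pr X d)) n"

lemma recf_tabS: "recf f \<Longrightarrow> recf g \<Longrightarrow> recf (\<lambda>e. tabS (f e) (g e))"
  by (rule recf_comp2[of tabS], unfold tabS_def) (intro definable recd_stp)

lemma recf_tab0: "recf f \<Longrightarrow> recf g \<Longrightarrow> recf (\<lambda>e. tab0 (f e) (g e))"
  by (rule recf_comp2[of tab0], unfold tab0_def) (intro definable)

lemma recf_tab: "recf f \<Longrightarrow> recf g \<Longrightarrow> recf h \<Longrightarrow> recf (\<lambda>e. tab (f e) (g e) (h e))"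
  unfolding tab_def by (rule recf_prec) (intro definable recf_tab0 recf_tabS | assumption)+

lemma tab_simps:
  "tab X d 0 = tab0 X d" "tab X d (n + 1) = tabS d (tab X d n)"
proof -
  have *: "recf (\<lambda>e. (\<lambda>p i \<tau>. tabS (sn p) \<tau>) (pr X d) (e 0) (e (Suc 0)))" by (intro definable recf_tabS)
  show "tab X d 0 = tab0 X d" "tab X d (n + 1) = tabS d (tab X d n)"
    unfolding tab_def prec_0[OF *] prec_step[OF *] by simp_all
qed

lemma mem_tab0: "mem (pr u v) (tab0 X d) \<longleftrightarrow> v \<le> d \<and> (\<exists>x\<le>v. u \<le> x \<and> mem x X)"
proof -
  have "recd (\<lambda>e. \<exists>u\<le>d. \<exists>v\<le>d. e 0 = pr u v \<and> (\<exists>x\<le>v. u \<le> x \<and> mem x X))" by (intro definable)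
  note mem_cset[OF this]
  then show ?thesis unfolding tab0_def by (auto intro: pr_mono)
qed

lemma mem_tabS: "mem (pr u v) (tabS d \<tau>) \<longleftrightarrow> v \<le> d \<and> chain (stp \<tau>) u u v"
proof -
  have "recd (\<lambda>e. \<exists>u\<le>d. \<exists>v\<le>d. e 0 = pr u v \<and> chain (stp \<tau>) u u v)" by (intro definable recd_stp)
  note mem_cset[OF this]
  then show ?thesis unfolding tabS_def using chain_le[of "stp \<tau>" u u v] by (auto intro: pr_mono)
qed

text \<open>The table bound only truncates, because an entry for \<open>[u, v]\<close> depends only
  on entries with right end up to \<open>v\<close>. Bounding all quantifiers by \<open>d\<close>
  keeps the induction formula Delta_1, as is required for nonstandard \<open>n\<close>.\<close>

lemma tab_indep:
  assumes "v \<le> d" shows "mem (pr u v) (tab X d n) \<longleftrightarrow> mem (pr u v) (tab X v n)"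
proof -
  have "recd (\<lambda>e. \<forall>d'\<le>d. \<forall>u\<le>d. \<forall>v\<le>d'. mem (pr u v) (tab X d' (e 0)) \<longleftrightarrow> mem (pr u v) (tab X v (e 0)))"
    by (intro definable recf_tab)
  from recd_sig[OF this]
  have "\<forall>d'\<le>d. \<forall>u\<le>d. \<forall>v\<le>d'. mem (pr u v) (tab X d' n) \<longleftrightarrow> mem (pr u v) (tab X v n)"
  proof (induction n rule: sig_induct)
    case zero
    then show ?case by (auto simp: tab_simps mem_tab0)
  next
    case (step n)
    show ?case
    proof (intro allI impI)
      fix d' u v assume d': "d' \<le> d" and "u \<le> d" "v \<le> d'"
      have "stp (tab X d' n) x y \<longleftrightarrow> stp (tab X v n) x y" if "x \<le> v" "y \<le> v" for x y
      proof -
        have "mem (pr U y) (tab X d' n) \<longleftrightarrow> mem (pr U y) (tab X v n)" if "U \<le> y" for U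
        proof -
          have y: "y \<le> d'" "y \<le> v" "v \<le> d" "U \<le> d" using d' \<open>v \<le> d'\<close> \<open>y \<le> v\<close> that by auto
          then show ?thesis using step[rule_format, of d' U y] step[rule_format, of v U y] d' by blast
        qed
        then show ?thesis unfolding stp_def by blast
      qed
      then have "chain (stp (tab X d' n)) u u v \<longleftrightarrow> chain (stp (tab X v n)) u u v"
        by (rule chain_cong)
      then show "mem (pr u v) (tab X d' (n + 1)) \<longleftrightarrow> mem (pr u v) (tab X v (n + 1))"
        using \<open>v \<le> d'\<close> by (simp add: tab_simps mem_tabS)
    qed
  qed
  moreover have "u \<le> v" if "mem (pr u v) (tab X d n)" for d
  proof (cases "n = 0")
    case True
    then show ?thesis using that by (auto simp: tab_simps mem_tab0)
  next
    case False
    then obtain m where "n = m + 1" using not_zero_ex[of n] by auto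
    then show ?thesis using that chain_le by (auto simp: tab_simps mem_tabS)
  qed
  ultimately show ?thesis using assms order_trans by blast
qed

text \<open>The order \<open>n\<close> may be nonstandard, hence the coded recursion.\<close>

definition B :: "'a \<Rightarrow> 'a \<Rightarrow> 'a \<Rightarrow> 'a \<Rightarrow> bool" where
  "B n X u v \<longleftrightarrow> mem (pr u v) (tab X v n)"

text \<open>One link of a chain: a gap starting at \<open>t\<close>, then a block of order
  \<open>n\<close> that ends at \<open>y\<close>, where the next gap starts.\<close>

definition Rn :: "'a \<Rightarrow> 'a \<Rightarrow> 'a \<Rightarrow> 'a \<Rightarrow> bool" where
  "Rn n X t y \<longleftrightarrow> (\<exists>U\<le>y. Ap t U y \<and> B n X U y)"

lemma recd_B: "recf f \<Longrightarrow> recf g \<Longrightarrow> recf h \<Longrightarrow> recf k \<Longrightarrow> recd (\<lambda>e. B (f e) (g e) (h e) (k e))"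
  unfolding B_def by (intro definable recf_tab)

lemma recd_Rn: "recf f \<Longrightarrow> recf g \<Longrightarrow> recf h \<Longrightarrow> recf k \<Longrightarrow> recd (\<lambda>e. Rn (f e) (g e) (h e) (k e))"
  by (rule recd_comp4[of Rn], unfold Rn_def) (intro definable recd_Ap recd_B)

lemmas defs = definable recd_Ap recd_B recd_Rn

lemma B_0: "B 0 X u v \<longleftrightarrow> (\<exists>x\<le>v. u \<le> x \<and> mem x X)"
  by (simp add: B_def tab_simps mem_tab0)

lemma B_Suc: "B (n + 1) X u v \<longleftrightarrow> chain (Rn n X) u u v"
proof -
  have "chain (stp (tab X v n)) u u v \<longleftrightarrow> chain (Rn n X) u u v"
    by (rule chain_cong, unfold stp_def Rn_def B_def)
      (intro ex_cong1 conj_cong refl, rule tab_indep)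
  then show ?thesis by (simp add: B_def tab_simps mem_tabS)
qed

lemma Rn_less: "Rn n X t y \<Longrightarrow> t < y"
  by (auto simp: Rn_def Ap_def)

lemma Rn_le: "Rn n X t y \<Longrightarrow> t \<le> y"
  using Rn_less order_less_imp_le by blast

lemma Rn_anti: "Rn n X t y \<Longrightarrow> t' \<le> t \<Longrightarrow> Rn n X t' y"
  by (auto simp: Rn_def intro: Ap_anti)

lemma B_cases:
  fixes n :: 'a
  obtains "n = 0" | m where "n = m + 1"
  using not_zero_ex[of n] by (cases "n = 0") auto

lemma B_le_ends: "B n X u v \<Longrightarrow> u \<le> v"
  by (rule B_cases[of n]) (auto simp: B_0 B_Suc dest: chain_le)

lemma B_right: "B n X u v \<Longrightarrow> v \<le> v' \<Longrightarrow> B n X u v'"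
proof (rule B_cases[of n])
  show "B n X u v'" if "B n X u v" "v \<le> v'" "n = m + 1" for m
    using that chain_mono[of "Rn m X" u u v "Rn m X" u v'] by (simp add: B_Suc)
qed (auto simp: B_0 intro: order_trans)

lemma B_left: "B n X u v \<Longrightarrow> u' \<le> u \<Longrightarrow> B n X u' v"
proof (rule B_cases[of n])
  show "B n X u' v" if "B n X u v" "u' \<le> u" "n = m + 1" for m
  proof -
    have "chain (Rn m X) u' u v"
      using chain_mono[of "Rn m X" u u v "Rn m X" u' v] that by (simp add: B_Suc)
    then have "chain (Rn m X) u' u' v" by (rule chain_anti) (use that Rn_anti in auto)
    then show ?thesis using that by (simp add: B_Suc)
  qed
qed (auto simp: B_0 intro: order_trans)

text \<open>The induction is over the order, for all intervals inside \<open>[lo, hi]\<close> at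
  once, which makes its formula bounded.\<close>

lemma B_sub:
  assumes "B n X lo hi" "\<And>x. lo \<le> x \<Longrightarrow> x \<le> hi \<Longrightarrow> mem x X \<Longrightarrow> mem x X'"
  shows "B n X' lo hi"
proof -
  have "recd (\<lambda>e. \<forall>v\<le>hi. \<forall>u\<le>v. lo \<le> u \<longrightarrow> B (e 0) X u v \<longrightarrow> B (e 0) X' u v)"
    by (intro defs)
  from recd_sig[OF this]
  have "\<forall>v\<le>hi. \<forall>u\<le>v. lo \<le> u \<longrightarrow> B n X u v \<longrightarrow> B n X' u v"
  proof (induction n rule: sig_induct)
    case zero
    then show ?case unfolding B_0 using assms(2) by (meson order_trans)
  next
    case (step n)
    show ?case
    proof (intro allI impI)
      fix u v assume *: "v \<le> hi" "u \<le> v" "lo \<le> u" "B (n + 1) X u v"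
      have "Rn n X' x y" if R: "Rn n X x y" "u \<le> x" "y \<le> v" for x y
      proof -
        from R obtain U where U: "U \<le> y" "Ap x U y" "B n X U y" by (auto simp: Rn_def)
        then have "lo \<le> U" "y \<le> hi" using R * by (auto simp: Ap_def)
        then show ?thesis using step U by (auto simp: Rn_def)
      qed
      then have "chain (Rn n X') u u v"
        using chain_mono2[of "Rn n X" u u v "Rn n X'"] *(4) Rn_le unfolding B_Suc by blast
      then show "B (n + 1) X' u v" by (simp add: B_Suc)
    qed
  qed
  then show ?thesis using assms(1) B_le_ends by blast
qed

lemma Rn_sub:
  assumes "Rn n X t y" "\<And>x. t < x \<Longrightarrow> x \<le> y \<Longrightarrow> mem x X \<Longrightarrow> mem x X'" shows "Rn n X' t y"
proof -
  from assms(1) obtain U where U: "U \<le> y" "Ap t U y" "B n X U y" by (auto simp: Rn_def)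
  then have "t < U" by (simp add: Ap_def)
  have "B n X' U y" by (rule B_sub[OF U(3)]) (use assms(2) \<open>t < U\<close> in auto)
  then show ?thesis using U by (auto simp: Rn_def)
qed

text \<open>With \<open>lo = 0\<close> a positive order would ask for no block at all. Otherwise one
  block already provides an element, and at higher orders each block is lowered by the induction
  hypothesis.\<close>

lemma B_down_step: assumes "B (n + 1) X lo hi" "0 < lo" shows "B n X lo hi"
proof -
  have "recd (\<lambda>e. \<forall>v\<le>hi. \<forall>u\<le>v. 0 < u \<longrightarrow> B (e 0 + 1) X u v \<longrightarrow> B (e 0) X u v)"
    by (intro defs)
  from recd_sig[OF this]
  have "\<forall>v\<le>hi. \<forall>u\<le>v. 0 < u \<longrightarrow> B (n + 1) X u v \<longrightarrow> B n X u v"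
  proof (induction n rule: sig_induct)
    case zero
    show ?case
    proof (intro allI impI)
      fix u v assume "0 < u" and *: "B (0 + 1) X u v"
      then obtain k where "u = k + 1" using not_zero_ex[of u] by auto
      with * have "chain (Rn 0 X) (k + 1) u v" using B_Suc by metis
      from chain_uncons[OF this] obtain y where "y \<le> v" "Rn 0 X u y" by blast
      then obtain U where "Ap u U y" "B 0 X U y" by (auto simp: Rn_def)
      then show "B 0 X u v" using \<open>y \<le> v\<close> by (meson Ap_def B_left B_right order_less_imp_le)
    qed
  next
    case (step n)
    show ?case
    proof (intro allI impI)
      fix u v assume *: "v \<le> hi" "u \<le> v" "0 < u" "B (n + 1 + 1) X u v"
      have "Rn n X x y" if R: "Rn (n + 1) X x y" "y \<le> v" for x y
      proof -
        from R obtain U where U: "U \<le> y" "Ap x U y" "B (n + 1) X U y" by (auto simp: Rn_def)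
        then have "0 < U" unfolding Ap_def using le_less_trans zero_le by blast
        then show ?thesis using step U R * by (meson Rn_def order_trans)
      qed
      then have "chain (Rn n X) u u v"
        using chain_mono2[of "Rn (n + 1) X" u u v "Rn n X"] *(4) Rn_le unfolding B_Suc by blast
      then show "B (n + 1) X u v" by (simp add: B_Suc)
    qed
  qed
  then show ?thesis using assms B_le_ends by blast
qed

lemma B_down: assumes "B m X u v" "n \<le> m" "0 < u" shows "B n X u v"
proof -
  obtain d where d: "m = n + d" using assms(2) le_iff_add by blast
  have "recd (\<lambda>e. B (n + e 0) X u v \<longrightarrow> B n X u v)" by (intro defs)
  from recd_sig[OF this] have "B (n + d) X u v \<longrightarrow> B n X u v"
    by (induction d rule: sig_induct) (use B_down_step assms(3) in \<open>auto simp: add.assoc[symmetric]\<close>)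
  then show ?thesis using assms d by simp
qed

lemma chain_two:
  assumes "chain (Rn n X) k t w" "2 \<le> k"
  obtains v U w' where "Rn n X t v" "Ap v U w'" "B n X U w'" "w' \<le> w"
proof -
  have "chain (Rn n X) (1 + 1) t w" using chain_mono[OF assms(1), of "Rn n X" "1 + 1" w] assms(2) by simp
  from chain_uncons[OF this] obtain v where v: "Rn n X t v" "chain (Rn n X) (0 + 1) v w" by auto
  from chain_uncons[OF this(2)] obtain w' where "w' \<le> w" "Rn n X v w'" by auto
  then show thesis using that v(1) by (auto simp: Rn_def)
qed

text \<open>The second of the blocks starts above \<open>hh u\<close> and hence consists of at least \<open>hh u\<close> blocks.\<close>

lemma B_two:
  assumes "B (n + 1 + 1) X u v" "2 \<le> u"
  obtains U where "hh u \<le> U" "u < U" "U \<le> v" "chain (Rn n X) (hh u) U v"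
proof -
  from assms(1) have "chain (Rn (n + 1) X) u u v" by (simp add: B_Suc)
  from chain_two[OF this assms(2)] obtain y U w where *: "Rn (n + 1) X u y" "Ap y U w" "B (n + 1) X U w" "w \<le> v"
    by blast
  have "u < y" using * Rn_less by blast
  then have "Ap u U w" using *(2) by (meson Ap_anti order_less_imp_le)
  then have "hh u \<le> U" "u < U" "U \<le> v" using *(4) by (auto simp: Ap_def)
  moreover have "chain (Rn n X) (hh u) U v"
    using chain_mono[of "Rn n X" U U w "Rn n X" "hh u" v] * calculation by (simp add: B_Suc)
  ultimately show thesis using that by blast
qed

end

text \<open>By induction on the number of indices the witnesses have a common bound
  \<open>b\<close>. The least \<open>c\<close> that is a witness or equals \<open>b\<close> is then
  a total function of the index, hence recursive, and can be coded.\<close>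

lemma choice_code:
  assumes P: "recd (\<lambda>e. P (e 0) (e (Suc 0)))" and ex: "\<And>i. i < N \<Longrightarrow> \<exists>c. P c i"
  shows "\<exists>r. \<forall>i<N. P (ap r i) (i :: 'a::rca0)"
proof -
  have "sig (\<lambda>e. \<exists>b. \<forall>i<e 0. i < N \<longrightarrow> (\<exists>c<b. P c i))"
    by (intro sig_ex recd_sig definable recd_comp2[OF P])
  then have "\<exists>b. \<forall>i<N. i < N \<longrightarrow> (\<exists>c<b. P c i)"
  proof (induction N rule: sig_induct)
    case (step n)
    then obtain b where b: "\<forall>i<n. i < N \<longrightarrow> (\<exists>c<b. P c i)" by blast
    obtain c where c: "n < N \<longrightarrow> P c n" using ex by blast
    have "\<exists>c'<b + c + 1. P c' i" if "i < n + 1" "i < N" for i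
    proof (cases "i = n")
      case True
      then show ?thesis using c that by (intro exI[of _ c]) (simp add: add_increasing)
    next
      case False
      then obtain c' where "c' < b" "P c' i" using b \<open>i < n + 1\<close> \<open>i < N\<close> by (auto simp: order_le_less)
      then show ?thesis by (intro exI[of _ c']) (simp add: add_increasing2 order_less_imp_le)
    qed
    then show ?case by blast
  qed simp
  then obtain b where b: "\<forall>i<N. \<exists>c<b. P c i" by blast
  define Q where "Q y i \<longleftrightarrow> (P y i \<or> y = b) \<and> (\<forall>c<y. \<not> (P c i \<or> c = b))" for y i
  have Q: "Q y i \<longleftrightarrow> y = (THE y. Q y i)" for y i
  proof -
    have "recd (\<lambda>e. P (e 0) i \<or> e 0 = b)" by (intro definable recd_comp2[OF P])
    then have "\<exists>y. Q y i" using recd_least[of "\<lambda>y. P y i \<or> y = b" b, OF recd_sig] by (auto simp: Q_def)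
    moreover have uniq: "y = y'" if "Q y i" "Q y' i" for y y'
      using that unfolding Q_def by (metis linorder_neqE)
    ultimately have Q: "Q (THE y. Q y i) i" by (rule the_unique)
    then show ?thesis using uniq[OF Q] by metis
  qed
  have "recf (\<lambda>e. THE y. Q y (e 0))"
    by (rule recf_the[OF _ Q], unfold Q_def) (intro definable recd_comp2[OF P])
  from sequence_code[OF this] obtain r where r: "\<forall>i<N. ap r i = (THE y. Q y i)" by blast
  have "P (ap r i) i" if i: "i < N" for i
  proof -
    from r i have "Q (ap r i) i" using Q[of "ap r i" i] by blast
    moreover obtain c where "c < b" "P c i" using b i by blast
    ultimately show ?thesis unfolding Q_def by blast
  qed
  then show ?thesis by blast
qed

lemma seq_mono:
  fixes s :: "'a::rca0"
  assumes "\<And>i. i < k \<Longrightarrow> ap s i \<le> ap s (i + 1)" "i \<le> j" "j \<le> k"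
  shows "ap s i \<le> ap s j"
proof -
  have "recd (\<lambda>e. i \<le> e 0 \<longrightarrow> e 0 \<le> k \<longrightarrow> ap s i \<le> ap s (e 0))" by (intro definable)
  from recd_sig[OF this] have "i \<le> j \<longrightarrow> j \<le> k \<longrightarrow> ap s i \<le> ap s j"
  proof (induction j rule: sig_induct)
    case (step j)
    show ?case
    proof (intro impI)
      assume *: "i \<le> j + 1" "j + 1 \<le> k"
      show "ap s i \<le> ap s (j + 1)"
      proof (cases "i = j + 1")
        case False
        then have "i \<le> j" using *(1) by (metis less_add_one_iff order_le_less)
        moreover have "j < k" using *(2) by simp
        ultimately show ?thesis using step assms(1)[of j] by (meson order_less_imp_le order_trans)
      qed simp
    qed
  qed simp
  then show ?thesis using assms by blast
qed

lemma digits_unique: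
  fixes u :: "'a::ordered_arith"
  assumes "c * u + k = c' * u + k'" "k < u" "k' < u" shows "c = c' \<and> k = k'"
proof -
  have False if "c < c'" "c * u + k = c' * u + k'" "k < u" for c c' k k'
  proof -
    have "c * u + k < (c + 1) * u" using that(3) by (simp add: algebra_simps)
    also have "\<dots> \<le> c' * u" using that(1) by (intro mult_right_mono) (simp_all only: add_one_le_iff zero_le)
    also have "\<dots> \<le> c' * u + k'" by simp
    finally show False using that(2) by simp
  qed
  from this[of c c' k k'] this[of c' c k' k] assms have "c = c'" by (metis linorder_neqE)
  then show ?thesis using assms(1) by simp
qed

definition col :: "'a::rca0 \<Rightarrow> ('a \<Rightarrow> 'a) \<Rightarrow> 'a \<Rightarrow> 'a" where
  "col X G c = cset X (\<lambda>x. mem x X \<and> G x = c)"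

lemma mem_col: "recf (\<lambda>e. G (e 0)) \<Longrightarrow> mem x (col X G c) \<longleftrightarrow> mem x X \<and> G x = c"
proof -
  assume "recf (\<lambda>e. G (e 0))"
  then have "recd (\<lambda>e. mem (e 0) X \<and> G (e 0) = c)" by (intro definable)
  from mem_cset[OF this] show ?thesis unfolding col_def using mem_less by blast
qed

lemma recf_col: "recf (\<lambda>e. G (e 0)) \<Longrightarrow> recf f \<Longrightarrow> recf (\<lambda>e. col X G (f e))"
proof (rule recf_comp1[of "col X G"])
  assume G: "recf (\<lambda>e. G (e 0))"
  show "recf (\<lambda>e. col X G (e 0))" unfolding col_def by (intro definable recf_comp1[OF G])
qed

context apart begin

lemma B_nonempty: "B n X u v \<Longrightarrow> 0 < u \<Longrightarrow> \<exists>x. mem x X \<and> u \<le> x \<and> x \<le> v"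
  using B_down[of n X u v 0] by (auto simp: B_0)

lemma B_nat_Suc: "B (of_nat (Suc n)) X u v \<longleftrightarrow> chain (Rn (of_nat n) X) u u v"
  using B_Suc[of "of_nat n"] by (simp add: add.commute)

lemma B_nat_Suc2: "B (of_nat (Suc (Suc n))) X u v \<longleftrightarrow> B (of_nat n + 1 + 1) X u v"
  by (simp add: ac_simps)

lemma hh_square: "u * u < hh u"
proof -
  have "u * u + 0 < u * u + (u + u + 1)" by (rule add_strict_left_mono) (simp only: less_add_one_iff zero_le)
  also have "\<dots> = (u + 1) * (u + 1)" by (simp add: algebra_simps)
  also have "\<dots> \<le> hh u" unfolding hh_def by (simp only: add.assoc add_increasing zero_le add_increasing2 le_add_same_cancel1 order_refl)
  finally show ?thesis by simp
qed

text \<open>In a chain of more than \<open>u\<^sup>2\<close> blocks that are monochromatic with fewer than \<open>u\<close> colours, map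
  a block to its colour and the length of the longest chain in this colour before it; two blocks
  with the same image contradict the maximality of this length.\<close>

lemma colour_pigeonhole:
  "\<exists>m::nat. \<forall>X u v G K. recf (\<lambda>e. G (e 0)) \<longrightarrow> 2 \<le> u \<longrightarrow> B (of_nat m) X u v \<longrightarrow>
     K \<le> u \<longrightarrow> (\<forall>x. G x < K) \<longrightarrow> (\<exists>c. B (of_nat n) (col X G c) u v)"
proof (induction n)
  case 0
  have "\<exists>c. B 0 (col X G c) u v" if G: "recf (\<lambda>e. G (e 0))" and 0: "B 0 X u v" for X u v G
  proof -
    obtain x where "mem x X" "u \<le> x" "x \<le> v" using 0 by (auto simp: B_0)
    then have "B 0 (col X G (G x)) u v" by (auto simp: B_0 mem_col[OF G])
    then show ?thesis by blast
  qed
  then show ?case by (intro exI[of _ 0]) simp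
next
  case (Suc n)
  then obtain m :: nat where m: "\<And>X u v G K. recf (\<lambda>e. G (e 0)) \<Longrightarrow> 2 \<le> u \<Longrightarrow> B (of_nat m) X u v \<Longrightarrow>
     K \<le> u \<Longrightarrow> (\<forall>x. G x < K) \<Longrightarrow> (\<exists>c. B (of_nat n) (col X G c) u v)" by blast
  show ?case
  \<comment> \<open>One order is for the blocks; the other ensures, through \<open>B_two\<close>,
    that there are \<open>hh u\<close> of them, more than \<open>u * u\<close>.\<close>
  proof (intro exI[of _ "Suc (Suc m)"] allI impI)
    fix X u v G K
    assume G: "recf (\<lambda>e. G (e 0))" and u: "2 \<le> u" and big: "B (of_nat (Suc (Suc m))) X u v" and K: "K \<le> u" "\<forall>x. G x < K"
    let ?n = "of_nat n :: 'a"
    obtain U where U: "hh u \<le> U" "u < U" "U \<le> v" "chain (Rn (of_nat m) X) (hh u) U v"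
      using big u unfolding B_nat_Suc2 by (rule B_two)
    obtain s where s: "ap s 0 = U" "\<And>i. i < hh u \<Longrightarrow> Rn (of_nat m) X (ap s i) (ap s (i + 1))"
      "\<And>i. i \<le> hh u \<Longrightarrow> ap s i \<le> v" by (rule chainE[OF U(4)]) blast
    have smono: "ap s i \<le> ap s j" if "i \<le> j" "j \<le> hh u" for i j
      using seq_mono[of "hh u" s i j] s(2) Rn_le that by blast
    have "\<exists>c. Rn ?n (col X G c) (ap s i) (ap s (i + 1))" if i: "i < hh u" for i
    proof -
      obtain W where W: "W \<le> ap s (i + 1)" "Ap (ap s i) W (ap s (i + 1))" "B (of_nat m) X W (ap s (i + 1))"
        using s(2)[OF i] by (auto simp: Rn_def)
      have "U \<le> ap s i" using smono[of 0 i] i s(1) by (simp add: order_less_imp_le)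
      then have "u < W" using U(2) W(2) by (auto simp: Ap_def)
      then have "2 \<le> W" "K \<le> W" using u K(1) by auto
      then obtain c where "B ?n (col X G c) W (ap s (i + 1))" using m[OF G _ W(3) _ K(2)] by blast
      then show ?thesis using W by (auto simp: Rn_def)
    qed
    then have ex1: "\<And>i. i < hh u \<Longrightarrow> \<exists>c. Rn ?n (col X G c) (ap s i) (ap s (i + 1))" .
    have "recd (\<lambda>e. Rn ?n (col X G (e 0)) (ap s (e (Suc 0))) (ap s (e (Suc 0) + 1)))"
      by (intro defs recf_col[OF G])
    from choice_code[OF this ex1]
    obtain r where r: "\<forall>i<hh u. Rn ?n (col X G (ap r i)) (ap s i) (ap s (i + 1))" by blast
    \<comment> \<open>The chosen colour occurs in its block, which is not empty.\<close>
    have rK: "ap r i < K" if i: "i < hh u" for i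
    proof -
      from r i obtain W where W: "Ap (ap s i) W (ap s (i + 1))" "B ?n (col X G (ap r i)) W (ap s (i + 1))"
        by (auto simp: Rn_def)
      have "0 < W" using W(1) le_less_trans[OF zero_le] by (auto simp: Ap_def)
      from B_nonempty[OF W(2) this] obtain x where "G x = ap r i" by (auto simp: mem_col[OF G])
      then show ?thesis using K(2) by metis
    qed
    show "\<exists>c. B (of_nat (Suc n)) (col X G c) u v"
    proof (rule ccontr)
      assume no: "\<not> ?thesis"
      define ch where "ch i k \<longleftrightarrow> chain (Rn ?n (col X G (ap r i))) k u (ap s i)" for i k
      have "\<exists>k. k < u \<and> ch i k \<and> \<not> ch i (k + 1)" if i: "i < hh u" for i
      proof -
        have "\<not> ch i u"
        proof
          assume "ch i u"
          then have "chain (Rn ?n (col X G (ap r i))) u u v" unfolding ch_def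
            by (rule chain_mono) (use s(3)[of i] i in auto)
          then show False using no B_nat_Suc by blast
        qed
        moreover have "recd (\<lambda>e. \<not> ch i (e 0))" unfolding ch_def by (intro defs recf_col[OF G])
        ultimately obtain k where k: "k \<le> u" "\<not> ch i k" "\<forall>z<k. ch i z"
          using recd_least[of "\<lambda>k. \<not> ch i k" u, OF recd_sig] by blast
        have "ch i 0" unfolding ch_def using U(2) s(1) smono[of 0 i] i by (auto simp: order_less_imp_le)
        then have "k \<noteq> 0" using k(2) by blast
        then obtain j where "k = j + 1" using not_zero_ex by metis
        then show ?thesis using k by (intro exI[of _ j]) auto
      qed
      then have ex: "\<And>i. i < hh u \<Longrightarrow> \<exists>k. k < u \<and> ch i k \<and> \<not> ch i (k + 1)" .
      have "recd (\<lambda>e. e 0 < u \<and> ch (e (Suc 0)) (e 0) \<and> \<not> ch (e (Suc 0)) (e 0 + 1))"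
        unfolding ch_def by (intro defs recf_col[OF G])
      from choice_code[OF this ex] obtain q where
        q: "\<forall>i<hh u. ap q i < u \<and> ch i (ap q i) \<and> \<not> ch i (ap q i + 1)" by blast
      \<comment> \<open>Colour and length are the two digits to base \<open>u\<close> of a number
        below \<open>u * u\<close>.\<close>
      have "\<exists>i j. i < j \<and> j < hh u \<and> ap r i * u + ap q i = ap r j * u + ap q j"
      proof (rule pigeonhole)
        show "recf (\<lambda>e. ap r (e 0) * u + ap q (e 0))" by (intro definable)
        show "u * u < hh u" by (rule hh_square)
        show "ap r i * u + ap q i < u * u" if "i < hh u" for i
        proof -
          have "ap r i < u" using rK[OF that] K(1) by simp
          then have "(ap r i + 1) * u \<le> u * u" by (intro mult_right_mono) (simp_all only: add_one_le_iff zero_le)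
          moreover have "ap r i * u + ap q i < (ap r i + 1) * u" using q that by (simp add: algebra_simps)
          ultimately show ?thesis by simp
        qed
      qed
      then obtain i j where ij: "i < j" "j < hh u" "ap r i * u + ap q i = ap r j * u + ap q j" by blast
      then have "i < hh u" by simp
      have eq: "ap r i = ap r j" "ap q i = ap q j"
        using digits_unique[OF ij(3)] q \<open>i < hh u\<close> ij(2) by auto
      have "chain (Rn ?n (col X G (ap r i))) (ap q i) u (ap s i)" using q \<open>i < hh u\<close> by (simp add: ch_def)
      then have "chain (Rn ?n (col X G (ap r i))) (ap q i + 1) u (ap s (i + 1))"
        by (rule chain_snoc[where v' = "ap s i"]) (use r \<open>i < hh u\<close> Rn_anti smono[of i "i + 1"] in \<open>auto simp: order_less_imp_le\<close>)
      then have "chain (Rn ?n (col X G (ap r i))) (ap q i + 1) u (ap s j)"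
        by (rule chain_mono) (use smono[of "i + 1" j] ij in auto)
      then have "ch j (ap q j + 1)" unfolding ch_def eq .
      then show False using q ij(2) by blast
    qed
  qed
qed

end

subsection \<open>Ramsey's theorem for finite sets of indices\<close>

text \<open>The number of elements of \<open>Y\<close> in \<open>(t, w]\<close> is measured by increasing chains.\<close>

definition inc :: "'a::rca0 \<Rightarrow> 'a \<Rightarrow> 'a \<Rightarrow> bool" where
  "inc Y x y \<longleftrightarrow> x < y \<and> mem y Y"

lemma recd_inc [definable]: "recf f \<Longrightarrow> recf g \<Longrightarrow> recf h \<Longrightarrow> recd (\<lambda>e. inc (f e) (g e) (h e))"
  unfolding inc_def by (intro definable)

lemma inc_anti: "inc Y x y \<Longrightarrow> x' \<le> x \<Longrightarrow> inc Y x' y"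
  by (auto simp: inc_def)

text \<open>Walking along the chain, \<open>k0\<close> and \<open>k1\<close> count the elements put
  into \<open>Y0\<close> and into \<open>Y1\<close>. Of \<open>2 * K - 1\<close> elements one side
  receives at least \<open>K\<close>.\<close>

lemma chain_split:
  assumes c: "chain (inc Y) L t w" and Y: "\<And>y. mem y Y \<Longrightarrow> t < y \<Longrightarrow> y \<le> w \<Longrightarrow> mem y Y0 \<or> mem y Y1" and L: "L + 1 = K + K"
  shows "chain (inc Y0) K t w \<or> chain (inc Y1) K t w"
proof -
  obtain s where s: "ap s 0 = t" "\<And>i. i < L \<Longrightarrow> inc Y (ap s i) (ap s (i + 1))" "\<And>i. i \<le> L \<Longrightarrow> ap s i \<le> w"
    by (rule chainE[OF c]) blast
  have ge: "t \<le> ap s i" if "i \<le> L" for i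
    by (rule chain_ge[of s t L "inc Y" i, OF s(1,2) _ that]) (auto simp: inc_def)
  define P where "P i \<longleftrightarrow> i \<le> L \<longrightarrow> (\<exists>k0\<le>i. \<exists>k1\<le>i. k0 + k1 = i \<and> chain (inc Y0) k0 t (ap s i) \<and> chain (inc Y1) k1 t (ap s i))" for i
  have "recd (\<lambda>e. P (e 0))" unfolding P_def by (intro definable)
  from recd_sig[OF this] have "P L"
  proof (induction L rule: sig_induct)
    case zero
    then show ?case by (auto simp: P_def s)
  next
    case (step i)
    show ?case unfolding P_def
    proof
      assume "i + 1 \<le> L"
      then have i: "i < L" "i \<le> L" by auto
      then obtain k0 k1 where k: "k0 \<le> i" "k1 \<le> i" "k0 + k1 = i" "chain (inc Y0) k0 t (ap s i)" "chain (inc Y1) k1 t (ap s i)"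
        using step by (auto simp: P_def)
      have inc: "ap s i < ap s (i + 1)" "mem (ap s (i + 1)) Y" using s(2)[OF i(1)] by (auto simp: inc_def)
      have le: "ap s i \<le> ap s (i + 1)" using inc by simp
      have "mem (ap s (i + 1)) Y0 \<or> mem (ap s (i + 1)) Y1"
        using Y inc ge[OF i(2)] s(3)[of "i + 1"] \<open>i + 1 \<le> L\<close> by auto
      then show "\<exists>k0\<le>i + 1. \<exists>k1\<le>i + 1. k0 + k1 = i + 1 \<and> chain (inc Y0) k0 t (ap s (i + 1)) \<and> chain (inc Y1) k1 t (ap s (i + 1))"
      proof
        assume "mem (ap s (i + 1)) Y0"
        then have "inc Y0 (ap s i) (ap s (i + 1))" using inc by (simp add: inc_def)
        then have "chain (inc Y0) (k0 + 1) t (ap s (i + 1))"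
          using chain_snoc[OF k(4) _ order_refl le] inc_anti by blast
        moreover have "chain (inc Y1) k1 t (ap s (i + 1))"
          using chain_mono[OF k(5) _ order_refl le] by blast
        ultimately show ?thesis using k(1-3)
          by (intro exI[of _ "k0 + 1"] exI[of _ k1] conjI)
            (auto simp: ac_simps add_increasing intro: add_left_mono)
      next
        assume "mem (ap s (i + 1)) Y1"
        then have "inc Y1 (ap s i) (ap s (i + 1))" using inc by (simp add: inc_def)
        then have "chain (inc Y1) (k1 + 1) t (ap s (i + 1))"
          using chain_snoc[OF k(5) _ order_refl le] inc_anti by blast
        moreover have "chain (inc Y0) k0 t (ap s (i + 1))"
          using chain_mono[OF k(4) _ order_refl le] by blast
        ultimately show ?thesis using k(1-3)
          by (intro exI[of _ "k0"] exI[of _ "k1 + 1"] conjI)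
            (auto simp: ac_simps add_increasing intro: add_left_mono)
      qed
    qed
  qed
  then obtain k0 k1 where k: "k0 + k1 = L" "chain (inc Y0) k0 t (ap s L)" "chain (inc Y1) k1 t (ap s L)"
    by (auto simp: P_def)
  have "K \<le> k0 \<or> K \<le> k1"
  proof (rule ccontr)
    assume "\<not> ?thesis"
    then have "k0 + 1 \<le> K" "k1 + 1 \<le> K" by auto
    then have "k0 + 1 + (k1 + 1) \<le> K + K" by (rule add_mono)
    moreover have "k0 + 1 + (k1 + 1) = L + 1 + 1" using k(1) by (simp add: ac_simps)
    ultimately have "L + 1 + 1 \<le> L + 1" using L by simp
    then show False by simp
  qed
  then show ?thesis
    using chain_mono[OF k(2), of "inc Y0" K w] chain_mono[OF k(3), of "inc Y1" K w] s(3)[of L] by auto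
qed

lemma recd_ball_mem [definable]:
  assumes "recf f" "recd (\<lambda>e. P (e 0) (\<lambda>n. e (Suc n)))"
  shows "recd (\<lambda>e. \<forall>x. mem x (f e) \<longrightarrow> P x e)"
proof -
  have *: "(\<forall>x. mem x (f e) \<longrightarrow> P x e) \<longleftrightarrow> (\<forall>x<f e. mem x (f e) \<longrightarrow> P x e)" for e
    using mem_less by blast
  show ?thesis unfolding * by (intro definable recf_shift[OF assms(1)] assms)
qed

lemma code_union:
  "\<exists>Z'. \<forall>x. mem x Z' \<longleftrightarrow> mem x Z \<or> x = (y :: 'a::rca0)"
proof -
  have "recd (\<lambda>e. mem (e 0) Z \<or> e 0 = y)" by (intro definable)
  from code_exists[OF this, of "Z + y + 1"] obtain c where
    c: "\<forall>i. mem i c \<longleftrightarrow> i < Z + y + 1 \<and> (mem i Z \<or> i = y)" by blast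
  have "x < Z + y + 1" if "mem x Z \<or> x = y" for x
    using that mem_less[of x Z] by (auto simp: add_increasing add_increasing2 order_less_imp_le)
  with c show ?thesis by blast
qed

lemma code_restrict:
  assumes "recd (\<lambda>e. P (e 0))" shows "\<exists>Z'. \<forall>x. mem x Z' \<longleftrightarrow> mem x Z \<and> P (x :: 'a::rca0)"
proof -
  have "recd (\<lambda>e. mem (e 0) Z \<and> P (e 0))" using assms by (intro definable)
  from mem_cset[OF this, of _ Z] show ?thesis using mem_less by blast
qed

lemma pow_pos: "0 < pow 2 (k :: 'a::rca0)"
proof -
  have "recd (\<lambda>e. 0 < pow 2 (e 0 :: 'a))" by (intro definable)
  from recd_sig[OF this] show ?thesis
    by (induction k rule: sig_induct) auto
qed

text \<open>The reservoir \<open>Y\<close> is halved in each step, as in the proof of Erdos and Rado; \<open>Z0\<close> and \<open>Z1\<close>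
  collect the indices whose colour to the reservoir is 0 and 1.\<close>

lemma index_ramsey:
  fixes u :: "'a::rca0"
  assumes c: "recd (\<lambda>e. c (e 0) (e (Suc 0)))" and start: "chain (inc Y) (pow 2 (u + u)) t w"
  shows "\<exists>Z b. (\<forall>x. mem x Z \<longrightarrow> mem x Y) \<and> chain (inc Z) u t w \<and>
    (\<forall>x y. mem x Z \<longrightarrow> mem y Z \<longrightarrow> x < y \<longrightarrow> t < x \<longrightarrow> y \<le> w \<longrightarrow> (c x y \<longleftrightarrow> b))"
proof -
  \<comment> \<open>State after \<open>a\<close> of the \<open>2 * u\<close> steps, with
    \<open>b\<close> steps left: up to \<open>\<tau>\<close>, \<open>k0\<close> and
    \<open>k1\<close> indices have been collected, and the reservoir beyond \<open>\<tau>\<close>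
    still has \<open>2^b\<close> elements.\<close>
  define inv where "inv a b Z0 Z1 Y' \<tau> k0 k1 \<longleftrightarrow> a + b = u + u \<and> k0 + k1 = a \<and> t \<le> \<tau> \<and> \<tau> \<le> w \<and>
      chain (inc Z0) k0 t \<tau> \<and> chain (inc Z1) k1 t \<tau> \<and> chain (inc Y') (pow 2 b) \<tau> w \<and>
      (\<forall>x. mem x Z0 \<longrightarrow> mem x Y \<and> x \<le> \<tau> \<and> (\<forall>y. mem y Z0 \<longrightarrow> x < y \<longrightarrow> \<not> c x y) \<and> (\<forall>y. mem y Y' \<longrightarrow> \<tau> < y \<longrightarrow> \<not> c x y)) \<and>
      (\<forall>x. mem x Z1 \<longrightarrow> mem x Y \<and> x \<le> \<tau> \<and> (\<forall>y. mem y Z1 \<longrightarrow> x < y \<longrightarrow> c x y) \<and> (\<forall>y. mem y Y' \<longrightarrow> \<tau> < y \<longrightarrow> c x y)) \<and>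
      (\<forall>x. mem x Y' \<longrightarrow> mem x Y)" for a b Z0 Z1 Y' \<tau> k0 k1
  have inc_mono: "chain (inc A') k t v'" if "chain (inc A) k t v" "\<And>x. mem x A \<Longrightarrow> x \<le> v \<Longrightarrow> mem x A'" "v \<le> v'" for A A' k t v v'
    by (rule chain_mono[OF that(1) _ order_refl that(3)]) (use that(2) in \<open>auto simp: inc_def\<close>)
  have "sig (\<lambda>e. \<exists>b Z0 Z1 Y' \<tau> k0 k1. u + u < e 0 \<or> inv (e 0) b Z0 Z1 Y' \<tau> k0 k1)"
    unfolding inv_def by (intro sig_ex recd_sig definable recd_comp2[OF c])
  then have "\<exists>b Z0 Z1 Y' \<tau> k0 k1. u + u < u + u \<or> inv (u + u) b Z0 Z1 Y' \<tau> k0 k1"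
  proof (rule sig_induct)
    have "inv 0 (u + u) 0 0 Y t 0 0" using start chain_le[OF start] mem_less[of _ 0] by (auto simp: inv_def)
    then show "\<exists>b Z0 Z1 Y' \<tau> k0 k1. u + u < 0 \<or> inv 0 b Z0 Z1 Y' \<tau> k0 k1" by blast
  next
    fix a
    assume "\<exists>b Z0 Z1 Y' \<tau> k0 k1. u + u < a \<or> inv a b Z0 Z1 Y' \<tau> k0 k1"
    then obtain b Z0 Z1 Y' \<tau> k0 k1 where IH: "u + u < a \<or> inv a b Z0 Z1 Y' \<tau> k0 k1" by blast
    show "\<exists>b Z0 Z1 Y' \<tau> k0 k1. u + u < a + 1 \<or> inv (a + 1) b Z0 Z1 Y' \<tau> k0 k1"
    proof (cases "u + u < a + 1")
      case False
      then have i: "inv a b Z0 Z1 Y' \<tau> k0 k1" using IH by auto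
      then have "b \<noteq> 0" using False unfolding inv_def by auto
      then obtain b' where b: "b = b' + 1" using not_zero_ex by blast
      define K where "K = pow 2 b'"
      have "K \<noteq> 0" using pow_pos[of b'] by (simp add: K_def)
      then obtain K' where K': "K = K' + 1" using not_zero_ex by blast
      \<comment> \<open>With \<open>K = 2^b'\<close>, the reservoir has \<open>2 * K\<close>
        elements. Removing the first one, \<open>y\<close>, leaves \<open>2 * K - 1\<close>, so at
        least \<open>K\<close> of them agree in their colour with \<open>y\<close>.\<close>
      have "pow 2 b = K + K' + 1" unfolding b pow_simps K_def[symmetric] by (simp add: K' mult_2_right ac_simps)
      then have "chain (inc Y') (K + K' + 1) \<tau> w" using i by (simp add: inv_def)
      from chain_uncons[OF this] obtain y where y: "y \<le> w" "inc Y' \<tau> y" "chain (inc Y') (K + K') y w" by blast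
      have ty: "\<tau> < y" "mem y Y'" using y(2) by (auto simp: inc_def)
      have cy: "recd (\<lambda>e. c y (e 0))" by (intro recd_comp2[OF c] definable)
      from code_restrict[OF cy, of Y'] obtain Yb where Yb: "\<forall>x. mem x Yb \<longleftrightarrow> mem x Y' \<and> c y x" by blast
      from code_restrict[OF recd_not[OF cy], of Y'] obtain Ya where Ya: "\<forall>x. mem x Ya \<longleftrightarrow> mem x Y' \<and> \<not> c y x" by blast
      have split: "chain (inc Ya) K y w \<or> chain (inc Yb) K y w"
        by (rule chain_split[OF y(3)]) (use Ya Yb K' in \<open>auto simp: ac_simps\<close>)
      from code_union[of Z0 y] obtain Z0' where Z0': "\<forall>x. mem x Z0' \<longleftrightarrow> mem x Z0 \<or> x = y" by blast
      from code_union[of Z1 y] obtain Z1' where Z1': "\<forall>x. mem x Z1' \<longleftrightarrow> mem x Z1 \<or> x = y" by blast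
      have "a + 1 + b' = u + u" using i b by (simp add: inv_def ac_simps)
      have ch0: "chain (inc Z0) k0 t y" "chain (inc Z1) k1 t y"
        using i ty by (auto simp: inv_def intro: inc_mono)
      have ty': "\<tau> \<le> y" "t \<le> y" using ty i by (auto simp: inv_def)
      from split show ?thesis
      proof
        assume s: "chain (inc Ya) K y w"
        have "chain (inc Z0') k0 t \<tau>" using i Z0' by (auto simp: inv_def intro: inc_mono)
        then have "chain (inc Z0') (k0 + 1) t y"
          by (rule chain_snoc[where v' = \<tau>]) (use ty Z0' inc_anti in \<open>auto simp: inc_def\<close>)
        moreover have z1: "\<not> mem x Z0" if "y < x" for x using i that ty' unfolding inv_def by force
        ultimately have "inv (a + 1) b' Z0' Z1 Ya y (k0 + 1) k1"
          unfolding inv_def using i Z0' Ya s ch0 ty ty' y(1) \<open>a + 1 + b' = u + u\<close>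
          unfolding inv_def K_def by (auto simp: ac_simps)
        then show ?thesis by blast
      next
        assume s: "chain (inc Yb) K y w"
        have "chain (inc Z1') k1 t \<tau>" using i Z1' by (auto simp: inv_def intro: inc_mono)
        then have "chain (inc Z1') (k1 + 1) t y"
          by (rule chain_snoc[where v' = \<tau>]) (use ty Z1' inc_anti in \<open>auto simp: inc_def\<close>)
        moreover have z1: "\<not> mem x Z1" if "y < x" for x using i that ty' unfolding inv_def by force
        ultimately have "inv (a + 1) b' Z0 Z1' Yb y k0 (k1 + 1)"
          unfolding inv_def using i Z1' Yb s ch0 ty ty' y(1) \<open>a + 1 + b' = u + u\<close>
          unfolding inv_def K_def by (auto simp: ac_simps)
        then show ?thesis by blast
      qed
    qed blast
  qed
  then obtain b Z0 Z1 Y' \<tau> k0 k1 where i: "inv (u + u) b Z0 Z1 Y' \<tau> k0 k1" by auto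
  then have "u \<le> k0 \<or> u \<le> k1"
    unfolding inv_def by (metis add_strict_mono less_irrefl not_less)
  then show ?thesis
  proof
    assume "u \<le> k0"
    then have "chain (inc Z0) u t w" using i unfolding inv_def by (meson chain_mono order_refl)
    then show ?thesis using i unfolding inv_def by (intro exI[of _ Z0] exI[of _ False]) auto
  next
    assume "u \<le> k1"
    then have "chain (inc Z1) u t w" using i unfolding inv_def by (meson chain_mono order_refl)
    then show ?thesis using i unfolding inv_def by (intro exI[of _ Z1] exI[of _ True]) auto
  qed
qed

subsection \<open>Large homogeneous sets\<close>

lemma block_unique:
  fixes s :: "'a::rca0"
  assumes mono: "\<And>i j. i \<le> j \<Longrightarrow> j \<le> k \<Longrightarrow> ap s i \<le> ap s j"
    and "i < k" "j < k" "ap s i < y" "y \<le> ap s (i + 1)" "ap s j < y" "y \<le> ap s (j + 1)"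
  shows "i = j"
proof -
  have False if "i < j" "j < k" "y \<le> ap s (i + 1)" "ap s j < y" for i j
  proof -
    have "ap s (i + 1) \<le> ap s j" using that by (intro mono) auto
    then show False using that by auto
  qed
  then show ?thesis using assms by (metis linorder_neqE)
qed

definition Hm :: "('a::rca0 \<Rightarrow> 'a \<Rightarrow> bool) \<Rightarrow> bool \<Rightarrow> 'a \<Rightarrow> bool" where
  "Hm C b Y \<longleftrightarrow> (\<forall>x. mem x Y \<longrightarrow> (\<forall>y. mem y Y \<longrightarrow> x < y \<longrightarrow> (C x y \<longleftrightarrow> b)))"

context apart begin

definition ph :: "nat \<Rightarrow> nat \<Rightarrow> bool" where
  "ph n m \<longleftrightarrow> (\<forall>X u v G K. recf (\<lambda>e. G (e 0)) \<longrightarrow> 2 \<le> u \<longrightarrow> B (of_nat m) X u v \<longrightarrow>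
     K \<le> u \<longrightarrow> (\<forall>x. G x < K) \<longrightarrow> (\<exists>c. B (of_nat n) (col X G c) u v))"

text \<open>Thins all blocks at once, with a separate colouring \<open>G i\<close> for block
  \<open>i\<close>. By \<open>small\<close> its colours lie below the start \<open>W\<close> of the
  block, as \<open>ph\<close> requires. The chosen classes can be glued because the blocks are
  disjoint.\<close>

lemma refine:
  assumes mn: "ph n m"
    and s: "\<forall>i<N. Rn (of_nat m) X (ap s i) (ap s (i + 1))" "\<forall>i<N. 2 \<le> ap s i"
    and G: "recf (\<lambda>e. G (e 0) (e (Suc 0)))"
    and small: "\<forall>i<N. \<forall>W y. hh (ap s i) \<le> W \<longrightarrow> ap s i < W \<longrightarrow> G i y < W"
  obtains X1 where "\<forall>x. mem x X1 \<longrightarrow> mem x X" "\<forall>i<N. Rn (of_nat n) X1 (ap s i) (ap s (i + 1))"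
    "\<forall>i<N. \<forall>y y'. mem y X1 \<longrightarrow> mem y' X1 \<longrightarrow> ap s i < y \<longrightarrow> y \<le> ap s (i + 1) \<longrightarrow> ap s i < y' \<longrightarrow>
       y' \<le> ap s (i + 1) \<longrightarrow> G i y = G i y'"
proof -
  have G1: "recf (\<lambda>e. G i (e 0))" for i by (intro recf_comp2[OF G] definable)
  have ex: "\<exists>c. Rn (of_nat n) (col X (G i) c) (ap s i) (ap s (i + 1))" if i: "i < N" for i
  proof -
    obtain W where W: "W \<le> ap s (i + 1)" "Ap (ap s i) W (ap s (i + 1))" "B (of_nat m) X W (ap s (i + 1))"
      using s(1) i by (auto simp: Rn_def)
    have *: "hh (ap s i) \<le> W" "ap s i < W" using W(2) by (auto simp: Ap_def)
    then have "2 \<le> W" using s(2) i by fastforce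
    then obtain c where "B (of_nat n) (col X (G i) c) W (ap s (i + 1))"
      using mn[unfolded ph_def, rule_format, OF G1 _ W(3) order_refl] small i * by blast
    then show ?thesis using W by (auto simp: Rn_def)
  qed
  have "recf (\<lambda>e. col X (G (e (Suc 0))) (e 0))" unfolding col_def
    by (intro definable recf_comp2[OF G])
  then have "recd (\<lambda>e. Rn (of_nat n) (col X (G (e (Suc 0))) (e 0)) (ap s (e (Suc 0))) (ap s (e (Suc 0) + 1)))"
    by (intro defs)
  from choice_code[OF this ex] obtain r where
    r: "\<forall>i<N. Rn (of_nat n) (col X (G i) (ap r i)) (ap s i) (ap s (i + 1))" by blast
  have mono: "ap s i \<le> ap s j" if "i \<le> j" "j \<le> N" for i j
    using seq_mono[of N s i j] s(1) Rn_le that by blast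
  have "recd (\<lambda>e. \<exists>i<N. ap s i < e 0 \<and> e 0 \<le> ap s (i + 1) \<and> G i (e 0) = ap r i)"
    by (intro definable recf_comp2[OF G])
  from code_restrict[OF this, of X] obtain X1 where
    X1: "\<And>x. mem x X1 \<longleftrightarrow> mem x X \<and> (\<exists>i<N. ap s i < x \<and> x \<le> ap s (i + 1) \<and> G i x = ap r i)" by blast
  have "Rn (of_nat n) X1 (ap s i) (ap s (i + 1))" if i: "i < N" for i
    by (rule Rn_sub[OF r[rule_format, OF i]]) (use i X1 mem_col[OF G1] in blast)
  moreover have "G i y = ap r i" if i: "i < N" and y: "mem y X1" "ap s i < y" "y \<le> ap s (i + 1)" for i y
  proof -
    from y X1 obtain j where j: "j < N" "ap s j < y" "y \<le> ap s (j + 1)" "G j y = ap r j" by blast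
    have "i = j" by (rule block_unique[OF mono i j(1) y(2,3) j(2,3)])
    then show ?thesis using j by simp
  qed
  ultimately show thesis using X1 by (intro that[of X1]) simp_all
qed

text \<open>\<open>P b\<close> is the order wanted in colour \<open>b\<close>. Take \<open>N\<close>
  blocks and thin them twice, until the colour between two blocks depends on their indices only;
  \<open>index_ramsey\<close> then finds \<open>u\<close> blocks with one colour \<open>b\<close>
  between them. By induction each of these contains either a set of the other colour of full order,
  and the claim follows, or one of colour \<open>b\<close> of order \<open>P b - 1\<close>; in the
  latter case the \<open>u\<close> sets together have order \<open>P b\<close>.\<close>

lemma homogeneous:
  "\<exists>m::nat. \<forall>C X u v. recd (\<lambda>e. C (e 0) (e (Suc 0))) \<longrightarrow> 2 \<le> u \<longrightarrow> B (of_nat m) X u v \<longrightarrow>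
     (\<exists>b Y. (\<forall>x. mem x Y \<longrightarrow> mem x X) \<and> Hm C b Y \<and> B (of_nat (P b)) Y u v)"
proof (induction "P True + P False" arbitrary: P rule: less_induct)
  case less
  show ?case
  proof (cases "\<exists>b. P b = 0")
    case True
    then obtain b where b: "P b = 0" by blast
    have "\<exists>Y. (\<forall>x. mem x Y \<longrightarrow> mem x X) \<and> Hm C b Y \<and> B (of_nat (P b)) Y u v" if B0: "B 0 X u v" for C X u v
    proof -
      obtain x where x: "mem x X" "u \<le> x" "x \<le> v" using B0 by (auto simp: B_0)
      have "recd (\<lambda>e. e 0 = x)" by (intro definable)
      from code_restrict[OF this, of X] obtain Y where "\<forall>z. mem z Y \<longleftrightarrow> mem z X \<and> z = x" by blast
      then show ?thesis using x b by (intro exI[of _ Y]) (auto simp: Hm_def B_0)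
    qed
    then show ?thesis by (intro exI[of _ 0]) (simp, blast)
  next
    case False
    then have pos: "0 < P b" for b by simp
    \<comment> \<open>The target within a block: colour \<open>b\<close> may fall short by one
      order, the other colour may not.\<close>
    define Q where "Q b = P(b := P b - 1)" for b
    define St where "St R m \<longleftrightarrow> (\<forall>C X u v. recd (\<lambda>e. C (e 0) (e (Suc 0))) \<longrightarrow> 2 \<le> u \<longrightarrow> B (of_nat m) X u v \<longrightarrow>
       (\<exists>b' Y. (\<forall>x. mem x Y \<longrightarrow> mem x X) \<and> Hm C b' Y \<and> B (of_nat (R b')) Y u v))" for R :: "bool \<Rightarrow> nat" and m :: nat
    have "\<exists>m. St (Q b) m" for b unfolding St_def
      by (rule less) (use pos[of True] pos[of False] in \<open>cases b; simp add: Q_def\<close>)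
    then obtain M where "\<And>b. St (Q b) (M b)" by metis
    then have M: "\<And>b C X u v. recd (\<lambda>e. C (e 0) (e (Suc 0))) \<Longrightarrow> 2 \<le> u \<Longrightarrow> B (of_nat (M b)) X u v \<Longrightarrow>
       (\<exists>b' Y. (\<forall>x. mem x Y \<longrightarrow> mem x X) \<and> Hm C b' Y \<and> B (of_nat (Q b b')) Y u v)" unfolding St_def by blast
    define m0 where "m0 = max (M True) (M False)"
    have Mm0: "M b \<le> m0" for b by (cases b) (auto simp: m0_def)
    obtain m1 where m1: "ph m0 m1" using colour_pigeonhole[of m0] unfolding ph_def by blast
    obtain m2 where m2: "ph m1 m2" using colour_pigeonhole[of m1] unfolding ph_def by blast
    show ?thesis
    proof (intro exI[of _ "Suc (Suc m2)"] allI impI)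
      fix C :: "'a \<Rightarrow> 'a \<Rightarrow> bool" and X u v
      assume C: "recd (\<lambda>e. C (e 0) (e (Suc 0)))" and u: "2 \<le> u" and big: "B (of_nat (Suc (Suc m2))) X u v"
      obtain U where U: "hh u \<le> U" "u < U" "U \<le> v" "chain (Rn (of_nat m2) X) (hh u) U v"
        using big u unfolding B_nat_Suc2 by (rule B_two)
      obtain s where s: "ap s 0 = U" "\<And>i. i < hh u \<Longrightarrow> Rn (of_nat m2) X (ap s i) (ap s (i + 1))"
        "\<And>i. i \<le> hh u \<Longrightarrow> ap s i \<le> v" by (rule chainE[OF U(4)]) blast
      \<comment> \<open>As many blocks as \<open>index_ramsey\<close> needs for \<open>u\<close>
        homogeneous indices. The bound \<open>cb (N + 2) \<le> hh u\<close> puts the codes of sets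
        of indices below the start of every block.\<close>
      define N where "N = pow 2 (u + u)"
      have cbN: "cb (N + 2) \<le> hh u" unfolding hh_def N_def
        by (simp add: add_increasing add_increasing2 add.assoc)
      have "N \<le> N + 2" by simp
      then have Nh: "N \<le> hh u" using cbN cb_gt[of "N + 2"] by (meson order_less_imp_le order_trans)
      have s2: "\<forall>i<N. Rn (of_nat m2) X (ap s i) (ap s (i + 1))" using s(2) Nh by simp
      have mono: "ap s i \<le> ap s j" if "i \<le> j" "j \<le> N" for i j
        using seq_mono[of N s i j] s2 Rn_le that by blast
      have Ule: "U \<le> ap s i" if "i \<le> N" for i using mono[of 0 i] that s(1) by simp
      have two: "\<forall>i<N. 2 \<le> ap s i" using Ule u U(2) by (meson order_less_imp_le order_trans)
      have recC: "recd (\<lambda>e. C (f e) (g e))" if "recf f" "recf g" for f g by (rule recd_comp2[OF C that])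

      \<comment> \<open>First thinning: the pattern of colours from all points up to
        \<open>ap s i\<close> to \<open>y\<close> becomes the same for all \<open>y\<close> in block
        \<open>i\<close>.\<close>
      define G1 where "G1 i y = cset (ap s i + 1) (\<lambda>x. C x y)" for i y
      have G1: "recf (\<lambda>e. G1 (e 0) (e (Suc 0)))" unfolding G1_def by (intro definable recC)
      have memG1: "mem x (G1 i y) \<longleftrightarrow> x \<le> ap s i \<and> C x y" for i x y
        unfolding G1_def using mem_cset[OF recC[OF recf_var[of 0] recf_const[of y]]] by simp
      have "G1 i y < W" if "hh (ap s i) \<le> W" for i y W
      proof -
        have "G1 i y < cb (ap s i + 1)" unfolding G1_def by (intro cset_less recC definable)
        also have "\<dots> \<le> hh (ap s i)" unfolding hh_def by (simp add: add_increasing add_increasing2 add.assoc)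
        finally show ?thesis using that by simp
      qed
      then have small1: "\<forall>i<N. \<forall>W y. hh (ap s i) \<le> W \<longrightarrow> ap s i < W \<longrightarrow> G1 i y < W" by blast
      obtain X1 where X1: "\<And>x. mem x X1 \<Longrightarrow> mem x X"
        "\<And>i. i < N \<Longrightarrow> Rn (of_nat m1) X1 (ap s i) (ap s (i + 1))"
        "\<And>i y y'. i < N \<Longrightarrow> mem y X1 \<Longrightarrow> mem y' X1 \<Longrightarrow> ap s i < y \<Longrightarrow> y \<le> ap s (i + 1) \<Longrightarrow> ap s i < y' \<Longrightarrow>
           y' \<le> ap s (i + 1) \<Longrightarrow> G1 i y = G1 i y'"
        by (rule refine[OF m2 s2 two G1 small1]) blast

      \<comment> \<open>Second thinning: after the first, \<open>hit x j\<close> decides the colour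
        from \<open>x\<close> to the whole block \<open>j\<close>; now the set of later blocks hit
        becomes the same for all \<open>x\<close> in block \<open>i\<close>.\<close>
      define hit where "hit x j \<longleftrightarrow> (\<exists>y\<le>ap s (j + 1). ap s j < y \<and> mem y X1 \<and> C x y)" for x j
      define G2 where "G2 i x = cset (N + 2) (\<lambda>j. j < N \<and> i < j \<and> hit x j)" for i x
      have rech: "recd (\<lambda>e. hit (f e) (g e))" if "recf f" "recf g" for f g
        by (rule recd_comp2[OF _ that], unfold hit_def) (intro definable recC)
      have G2: "recf (\<lambda>e. G2 (e 0) (e (Suc 0)))" unfolding G2_def by (intro definable rech)
      have rG2: "recd (\<lambda>e. e 0 < N \<and> i < e 0 \<and> hit x (e 0))" for i x by (intro definable rech)
      have memG2: "mem j (G2 i x) \<longleftrightarrow> j < N \<and> i < j \<and> hit x j" for i j x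
        unfolding G2_def mem_cset[OF rG2] by (auto simp: add_increasing2 intro: order_less_le_trans)
      have "G2 i x < W" if "i < N" "ap s i < W" for i x W
      proof -
        have "G2 i x < cb (N + 2)" unfolding G2_def by (rule cset_less[OF rG2])
        also have "\<dots> \<le> ap s i" using cbN U(1) Ule[of i] that by (meson order_less_imp_le order_trans)
        finally show ?thesis using that by simp
      qed
      then have small2: "\<forall>i<N. \<forall>W y. hh (ap s i) \<le> W \<longrightarrow> ap s i < W \<longrightarrow> G2 i y < W" by blast
      have s3: "\<forall>i<N. Rn (of_nat m1) X1 (ap s i) (ap s (i + 1))" using X1(2) by blast
      obtain X2 where X2: "\<And>x. mem x X2 \<Longrightarrow> mem x X1"
        "\<And>i. i < N \<Longrightarrow> Rn (of_nat m0) X2 (ap s i) (ap s (i + 1))"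
        "\<And>i y y'. i < N \<Longrightarrow> mem y X2 \<Longrightarrow> mem y' X2 \<Longrightarrow> ap s i < y \<Longrightarrow> y \<le> ap s (i + 1) \<Longrightarrow> ap s i < y' \<Longrightarrow>
           y' \<le> ap s (i + 1) \<Longrightarrow> G2 i y = G2 i y'"
        by (rule refine[OF m1 s3 two G2 small2]) blast

      define cc where "cc i j \<longleftrightarrow> (\<exists>x\<le>ap s (i + 1). ap s i < x \<and> mem x X2 \<and>
         (\<exists>y\<le>ap s (j + 1). ap s j < y \<and> mem y X2 \<and> C x y))" for i j
      have cross: "C x y \<longleftrightarrow> cc i j"
        if ij: "i < j" "j < N" and x: "mem x X2" "ap s i < x" "x \<le> ap s (i + 1)"
          and y: "mem y X2" "ap s j < y" "y \<le> ap s (j + 1)" for i j x y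
      proof
        assume "cc i j"
        then obtain x' y' where x': "mem x' X2" "ap s i < x'" "x' \<le> ap s (i + 1)"
          and y': "mem y' X2" "ap s j < y'" "y' \<le> ap s (j + 1)" and "C x' y'" by (auto simp: cc_def)
        have "i < N" using ij by simp
        have "hit x' j" using y' \<open>C x' y'\<close> X2(1) by (auto simp: hit_def)
        then have "mem j (G2 i x')" using ij by (simp add: memG2)
        then have "mem j (G2 i x)" using X2(3)[OF \<open>i < N\<close> x'(1) x(1) x'(2,3) x(2,3)] by simp
        then obtain y'' where y'': "y'' \<le> ap s (j + 1)" "ap s j < y''" "mem y'' X1" "C x y''"
          by (auto simp: memG2 hit_def)
        have "x \<le> ap s j" using x(3) mono[of "i + 1" j] ij by (auto simp: order_less_imp_le)
        then have "mem x (G1 j y'')" using y'' by (simp add: memG1)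
        then have "mem x (G1 j y)" using X1(3)[OF ij(2) y''(3) X2(1)[OF y(1)] y''(2,1) y(2,3)] by simp
        then show "C x y" by (simp add: memG1)
      qed (use x y in \<open>auto simp: cc_def\<close>)
      have reccc: "recd (\<lambda>e. cc (f e) (g e))" if "recf f" "recf g" for f g
        by (rule recd_comp2[OF _ that], unfold cc_def) (intro definable recC)

      \<comment> \<open>Block \<open>i\<close> is represented by \<open>i + 1\<close>, because a
        chain of \<open>inc\<close> starts at 0 without counting it; \<open>pd\<close> translates
        back.\<close>
      have "recd (\<lambda>e. 0 < e 0)" by (intro definable)
      from code_exists[OF this, of "N + 1"] obtain I where I: "\<forall>i. mem i I \<longleftrightarrow> i < N + 1 \<and> 0 < i" by blast
      have st: "chain (inc I) (pow 2 (u + u)) 0 N"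
        by (rule chainI[of "\<lambda>i. i"]) (use I in \<open>auto simp: inc_def N_def[symmetric] intro: recf_var\<close>)
      have "recd (\<lambda>e. cc (pd (e 0)) (pd (e (Suc 0))))" by (intro reccc definable)
      from index_ramsey[of "\<lambda>x y. cc (pd x) (pd y)", OF this st] obtain Z b where
        Z': "\<forall>x. mem x Z \<longrightarrow> mem x I" "chain (inc Z) u 0 N"
        "\<forall>x y. mem x Z \<longrightarrow> mem y Z \<longrightarrow> x < y \<longrightarrow> 0 < x \<longrightarrow> y \<le> N \<longrightarrow> (cc (pd x) (pd y) \<longleftrightarrow> b)"
        by (elim exE conjE)
      note Z = Z'(1)[rule_format] Z'(2) Z'(3)[rule_format]
      have Zi: "\<exists>i. j = i + 1 \<and> pd j = i \<and> i < N" if j: "mem j Z" for j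
      proof -
        have "0 < j" "j \<le> N" using Z(1)[OF j] I by auto
        then obtain i where "j = i + 1" using not_zero_ex[of j] by auto
        then show ?thesis using \<open>j \<le> N\<close> by auto
      qed
      show "\<exists>b Y. (\<forall>x. mem x Y \<longrightarrow> mem x X) \<and> Hm C b Y \<and> B (of_nat (P b)) Y u v"
      proof (rule ccontr)
        assume no: "\<not> ?thesis"
        let ?p = "of_nat (P b - 1) :: 'a"
        \<comment> \<open>The guard makes the requirement satisfiable at every \<open>j\<close>, as
          \<open>choice_code\<close> demands.\<close>
        define good where "good Y j \<longleftrightarrow> mem j Z \<longrightarrow> (\<forall>x. mem x Y \<longrightarrow> mem x X2) \<and> Hm C b Y \<and> Rn ?p Y (ap s (pd j)) (ap s j)" for Y j
        have ex: "\<exists>Y. good Y j" for j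
        proof (cases "mem j Z")
          case True
          then obtain i where i: "j = i + 1" "pd j = i" "i < N" using Zi by blast
          then obtain W where W: "W \<le> ap s j" "Ap (ap s i) W (ap s j)" "B (of_nat m0) X2 W (ap s j)"
            using X2(2) by (auto simp: Rn_def)
          have "ap s i < W" using W(2) by (simp add: Ap_def)
          moreover have "U \<le> ap s i" using Ule[of i] i(3) by simp
          ultimately have W2: "u \<le> W" using U(2) by simp
          then have W2: "2 \<le> W" "u \<le> W" using u by auto
          have "(0::'a) < 2" by simp
          then have "0 < W" using W2(1) by (rule order_less_le_trans)
          then have "B (of_nat (M b)) X2 W (ap s j)"
            using W(3) Mm0[of b] by (intro B_down[OF W(3)]) simp_all
          from M[OF C W2(1) this] obtain b' Y where
            Y: "\<forall>x. mem x Y \<longrightarrow> mem x X2" "Hm C b' Y" "B (of_nat (Q b b')) Y W (ap s j)" by blast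
          \<comment> \<open>A set of the other colour would keep its full order \<open>P b'\<close>
            and be a solution, against \<open>no\<close>.\<close>
          have "b' = b"
          proof (rule ccontr)
            assume "b' \<noteq> b"
            then have "B (of_nat (P b')) Y W (ap s j)" using Y(3) by (simp add: Q_def)
            moreover have "ap s j \<le> v" using i Nh s(3)[of j] by auto
            ultimately have "B (of_nat (P b')) Y u v" using W2(2) B_left B_right by blast
            moreover have "\<forall>x. mem x Y \<longrightarrow> mem x X" using Y(1) X1(1) X2(1) by blast
            ultimately show False using no Y(2) by blast
          qed
          then show ?thesis using Y W i by (auto simp: good_def Q_def Rn_def)
        qed (auto simp: good_def)
        have "recd (\<lambda>e. good (e 0) (e (Suc 0)))" unfolding good_def Hm_def by (intro defs recd_ball_mem recC recd_triv)
        from choice_code[OF this ex] obtain r where r: "\<forall>j<N + 1. good (ap r j) j" by blast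
        define inY where "inY x \<longleftrightarrow> (\<exists>j\<le>N. mem j Z \<and> ap s (pd j) < x \<and> x \<le> ap s j \<and> mem x (ap r j))" for x
        have "recd (\<lambda>e. inY (e 0))" unfolding inY_def by (intro definable)
        from code_restrict[OF this, of X2] obtain Y where Y: "\<And>x. mem x Y \<longleftrightarrow> mem x X2 \<and> inY x" by blast
        have "\<forall>x. mem x Y \<longrightarrow> mem x X" using Y X1(1) X2(1) by blast
        moreover have "Hm C b Y" unfolding Hm_def
        proof (intro allI impI)
          fix x y assume xy: "mem x Y" "mem y Y" "x < y"
          from xy Y obtain j j' where j: "j \<le> N" "mem j Z" "ap s (pd j) < x" "x \<le> ap s j" "mem x (ap r j)"
            and j': "j' \<le> N" "mem j' Z" "ap s (pd j') < y" "y \<le> ap s j'" "mem y (ap r j')" by (auto simp: inY_def)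
          obtain i i' where i: "j = i + 1" "pd j = i" "i < N" and i': "j' = i' + 1" "pd j' = i'" "i' < N"
            using Zi j(2) j'(2) by metis
          show "C x y \<longleftrightarrow> b"
          proof (cases "j = j'")
            case True
            then show ?thesis using r j j' xy by (auto simp: good_def Hm_def)
          next
            case False
            have "\<not> i' < i"
            proof
              assume "i' < i"
              then have "ap s j' \<le> ap s i" using i i' by (intro mono) auto
              then have "y < x" using j(3) j'(4) i by auto
              then show False using xy by auto
            qed
            then have "i < i'" using False i i' by (metis linorder_neqE)
            then have "C x y \<longleftrightarrow> cc i i'" using j j' i i' xy Y by (intro cross) auto
            also have "\<dots> \<longleftrightarrow> b" using Z(3)[OF j(2) j'(2)] i i' \<open>i < i'\<close> by (auto simp: order_less_imp_le)
            finally show ?thesis .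
          qed
        qed
        moreover have "B (of_nat (P b)) Y u v"
        proof -
          have rn: "Rn ?p Y (ap s (pd j)) (ap s j)" if j: "mem j Z" for j
          proof -
            obtain i where i: "j = i + 1" "pd j = i" "i < N" using Zi j by blast
            then have "good (ap r j) j" using r by auto
            then have g: "Rn ?p (ap r j) (ap s (pd j)) (ap s j)" "\<forall>x. mem x (ap r j) \<longrightarrow> mem x X2"
              using j by (auto simp: good_def)
            have "j \<le> N" using i by simp
            then have "inY x" if "ap s (pd j) < x" "x \<le> ap s j" "mem x (ap r j)" for x
              using that j unfolding inY_def by blast
            then show ?thesis by (intro Rn_sub[OF g(1)]) (use g(2) Y in blast)
          qed
          obtain z where z: "ap z 0 = 0" "\<And>a. a < u \<Longrightarrow> inc Z (ap z a) (ap z (a + 1))" "\<And>a. a \<le> u \<Longrightarrow> ap z a \<le> N"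
            by (rule chainE[OF Z(2)]) blast
          have "chain (Rn ?p Y) u u v"
          \<comment> \<open>The chain has to start at \<open>u\<close> itself, which lies below all
            blocks. Antitonicity of \<open>Rn\<close> lets a gap begin earlier, here and where
            blocks outside \<open>Z\<close> are skipped.\<close>
          proof (rule chainI[of "\<lambda>a. if a = 0 then u else ap s (ap z a)"])
            show "recf (\<lambda>e. if e 0 = 0 then u else ap s (ap z (e 0)))" by (intro definable)
            show "(if (0::'a) = 0 then u else ap s (ap z 0)) = u" by simp
            show "Rn ?p Y (if a = 0 then u else ap s (ap z a)) (if a + 1 = 0 then u else ap s (ap z (a + 1)))"
              if a: "a < u" for a
            proof -
              have j: "ap z a < ap z (a + 1)" "mem (ap z (a + 1)) Z" using z(2)[OF a] by (auto simp: inc_def)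
              obtain i where i: "ap z (a + 1) = i + 1" "pd (ap z (a + 1)) = i" "i < N" using Zi j(2) by blast
              have "(if a = 0 then u else ap s (ap z a)) \<le> ap s i"
                using Ule[of i] U(2) i j(1) mono[of "ap z a" i] by (auto simp: order_less_imp_le)
              with rn[OF j(2)] i have "Rn ?p Y (if a = 0 then u else ap s (ap z a)) (ap s (ap z (a + 1)))"
                by (metis Rn_anti)
              moreover have "a + 1 \<noteq> 0" by simp
              ultimately show ?thesis by simp
            qed
            show "(if a = 0 then u else ap s (ap z a)) \<le> v" if "a \<le> u" for a
              using s(3)[of "ap z a"] z(3)[OF that] Nh U(2,3) by (auto intro: order_trans)
          qed
          then show ?thesis using B_nat_Suc[of "P b - 1"] pos[of b] by simp
        qed
        ultimately show False using no by blast
      qed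
    qed
  qed
qed

end

section \<open>The cut\<close>

definition nonstandard :: "'a::ordered_arith \<Rightarrow> bool" where
  "nonstandard c \<longleftrightarrow> (\<forall>n. of_nat n < c)"

lemma below_of_nat: "x \<le> of_nat n \<Longrightarrow> \<exists>k. x = (of_nat k :: 'a::ordered_arith)"
proof (induction n arbitrary: x)
  case 0
  then show ?case by (intro exI[of _ 0]) simp
next
  case (Suc n)
  show ?case
  proof (cases "x = of_nat (Suc n)")
    case False
    then have "x < of_nat n + 1" using Suc.prems by (simp add: ac_simps)
    then show ?thesis using Suc.IH by simp
  qed blast
qed

text \<open>If \<open>P\<close> held at standard numbers only, it would hold at 0 and pass to
  successors, so induction would carry it to \<open>c\<close>.\<close>

lemma overspill:
  fixes P :: "'a::rca0 \<Rightarrow> bool"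
  assumes c: "nonstandard (c::'a::rca0)" and P: "sig (\<lambda>e. P (e 0))" "\<And>n. P (of_nat n)"
  obtains \<nu> where "nonstandard \<nu>" "P \<nu>"
proof (rule ccontr)
  assume no: "\<not> thesis"
  from P(1) have "P c"
  proof (induction c rule: sig_induct)
    case zero
    show ?case using P(2)[of 0] by simp
  next
    case (step x)
    then have "\<not> nonstandard x" using no that by blast
    then obtain n where "x \<le> of_nat n" by (auto simp: nonstandard_def not_less)
    then obtain k where "x = of_nat k" using below_of_nat by blast
    then show ?case using P(2)[of "Suc k"] by (simp add: add.commute)
  qed
  then show False using no that c by blast
qed

definition full :: "'a::rca0 \<Rightarrow> 'a" where "full v = cset (v + 1) (\<lambda>i. i = i)"

lemma recf_full: "recf f \<Longrightarrow> recf (\<lambda>e. full (f e))"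
  unfolding full_def by (intro definable)

lemma mem_full [simp]: "mem x (full v) \<longleftrightarrow> x \<le> v"
proof -
  have "recd (\<lambda>e. e 0 = (e 0 :: 'a))" by (intro definable)
  from mem_cset[OF this] show ?thesis by (simp add: full_def)
qed

context apart begin

text \<open>The induction on \<open>n\<close> is external, since the claim for all \<open>u\<close>
  is Pi_2. Inside it, the blocks are added one by one by Sigma_1 induction. Assumption
  \<open>T\<close> is the yield of collection: for all \<open>x \<le> t\<close> one bound for
  witnesses that serve every \<open>z\<close>, so that a gap can be closed before the block after it
  is known.\<close>

lemma large_exists:
  assumes T: "\<And>t. \<exists>u. \<forall>x\<le>t. \<exists>y\<le>u. \<forall>z. Th x y z"
  shows "\<exists>v. B (of_nat n) (full v) u v"
proof (induction n arbitrary: u)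
  case 0
  show ?case by (intro exI[of _ u]) (auto simp: B_0)
next
  case (Suc n)
  let ?n = "of_nat n :: 'a"
  have next_block: "\<exists>v. Rn ?n (full v) t v" for t
  proof -
    obtain u' where u': "\<forall>x\<le>t. \<exists>y\<le>u'. \<forall>z. Th x y z" using T by blast
    have "recf (\<lambda>e. hh (e 0) :: 'a)" by (intro definable)
    from recf_bounded[OF this, of "t + 1"] obtain b where b: "\<forall>x\<le>t. hh x < b" by auto
    obtain v where v: "B ?n (full v) (u' + b + t + 1) v" using Suc by blast
    have le: "u' \<le> u' + b + t + 1" "b \<le> u' + b + t + 1" "t < u' + b + t + 1"
      by (simp_all add: add_increasing add_increasing2)
    have "Ap t (u' + b + t + 1) v"
      unfolding Ap_def using u' b le B_le_ends[OF v] by (meson order_trans order_less_imp_le)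
    then have "Rn ?n (full v) t v" using v B_le_ends[OF v] unfolding Rn_def by blast
    then show ?thesis by blast
  qed
  have "recd (\<lambda>e. chain (\<lambda>x y. Rn ?n (full (e 0)) x y) (e (Suc 0)) u (e 0))"
    by (rule recd_chain[of "\<lambda>x y e. Rn ?n (full (e 0)) x y"]) (intro defs recf_full)+
  then have "sig (\<lambda>e. \<exists>w. chain (Rn ?n (full w)) (e 0) u w)"
    by (intro sig_ex recd_sig) simp
  then have "\<exists>w. chain (Rn ?n (full w)) u u w"
  proof (rule sig_induct)
    show "\<exists>w. chain (Rn ?n (full w)) 0 u w" by auto
    fix k assume "\<exists>w. chain (Rn ?n (full w)) k u w"
    then obtain w where w: "chain (Rn ?n (full w)) k u w" by blast
    obtain v where v: "Rn ?n (full v) w v" using next_block by blast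
    have "w \<le> v" using v by (rule Rn_le)
    have "chain (Rn ?n (full v)) k u w"
      by (rule chain_mono[OF w _ order_refl order_refl]) (use \<open>w \<le> v\<close> in \<open>auto elim!: Rn_sub\<close>)
    then have "chain (Rn ?n (full v)) (k + 1) u v"
      using chain_snoc[of "Rn ?n (full v)" k u w w v] v \<open>w \<le> v\<close> Rn_anti by blast
    then show "\<exists>w. chain (Rn ?n (full w)) (k + 1) u w" by blast
  qed
  then show ?case unfolding B_nat_Suc .
qed

text \<open>An external notion, as \<open>n\<close> ranges over the standard numbers. It is
  recovered from one nonstandard order by \<open>GoodI\<close>, and that order comes from
  overspill.\<close>

definition Good :: "'a \<Rightarrow> 'a \<Rightarrow> 'a \<Rightarrow> bool" where
  "Good X u v \<longleftrightarrow> 2 \<le> u \<and> (\<forall>n. B (of_nat n) X u v)"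

lemma two_pos: "2 \<le> (u::'a) \<Longrightarrow> 0 < u"
  by (rule order_less_le_trans[of 0 2]) simp_all

lemma GoodI: "nonstandard \<nu> \<Longrightarrow> B \<nu> X u v \<Longrightarrow> 2 \<le> u \<Longrightarrow> Good X u v"
  unfolding Good_def nonstandard_def using B_down two_pos by (meson order_less_imp_le)

lemma Good_start:
  assumes T: "\<And>t. \<exists>u. \<forall>x\<le>t. \<exists>y\<le>u. \<forall>z. Th x y z" and c: "nonstandard (c::'a)"
  shows "\<exists>X u v. Good X u v"
proof -
  have "sig (\<lambda>e. \<exists>v. B (e 0) (full v) 2 v)" by (intro sig_ex recd_sig defs recf_full)
  moreover have "\<exists>v. B (of_nat n) (full v) 2 v" for n by (rule large_exists[OF T])
  ultimately obtain \<nu> where "nonstandard \<nu>" "\<exists>v. B \<nu> (full v) 2 v" by (rule overspill[OF c])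
  then show ?thesis using GoodI by blast
qed

text \<open>Of two consecutive blocks the second becomes the new interval, while the first leaves an
  element of \<open>X\<close> behind. Such elements make the homogeneous sets unbounded in the
  cut.\<close>

lemma Good_next:
  assumes c: "nonstandard (c::'a)" and X: "Good X u v"
  shows "\<exists>u' v'. v' \<le> v \<and> Good X u' v' \<and> Ap u u' v' \<and> (\<exists>x. mem x X \<and> u \<le> x \<and> x < u')"
proof -
  define P where "P n \<longleftrightarrow> (\<exists>U w x. w \<le> v \<and> Ap u U w \<and> B n X U w \<and> mem x X \<and> u \<le> x \<and> x < U)" for n
  have u: "2 \<le> u" using X by (simp add: Good_def)
  have "sig (\<lambda>e. P (e 0))" unfolding P_def by (intro sig_ex recd_sig defs)
  moreover have "P (of_nat n)" for n
  proof -
    have "chain (Rn (of_nat n) X) u u v" using X unfolding Good_def B_nat_Suc[symmetric] by blast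
    then obtain y U w where *: "Rn (of_nat n) X u y" "Ap y U w" "B (of_nat n) X U w" "w \<le> v"
      using chain_two[OF _ u] by metis
    from *(1) obtain W where W: "Ap u W y" "B (of_nat n) X W y" by (auto simp: Rn_def)
    then have "u < W" by (simp add: Ap_def)
    then obtain x where "mem x X" "W \<le> x" "x \<le> y" using B_nonempty[OF W(2)] le_less_trans[OF zero_le] by blast
    then have "mem x X \<and> u \<le> x \<and> x < U" using * \<open>u < W\<close> by (auto simp: Ap_def)
    moreover have "Ap u U w" using Ap_anti[OF *(2)] Rn_le[OF *(1)] by blast
    ultimately show ?thesis unfolding P_def using * by blast
  qed
  ultimately obtain \<nu> where "nonstandard \<nu>" "P \<nu>" by (rule overspill[OF c])
  then obtain U w x where *: "w \<le> v" "Ap u U w" "B \<nu> X U w" "mem x X" "u \<le> x" "x < U" unfolding P_def by blast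
  have "2 \<le> U" using u *(2) by (auto simp: Ap_def)
  then have "Good X U w" using GoodI[OF \<open>nonstandard \<nu>\<close> *(3)] by blast
  then show ?thesis using * by blast
qed

text \<open>Fewer than \<open>u\<close> values cannot meet all of the \<open>u\<close> blocks.\<close>

lemma Good_avoid:
  assumes c: "nonstandard (c::'a)" and X: "Good X u v"
  shows "\<exists>u' v'. u \<le> u' \<and> v' \<le> v \<and> Good X u' v' \<and> (\<forall>x. x + 1 < u \<longrightarrow> \<not> (u' \<le> ap g x \<and> ap g x \<le> v'))"
proof -
  define P where "P n \<longleftrightarrow> (\<exists>U w. u \<le> U \<and> w \<le> v \<and> B n X U w \<and> (\<forall>x<u. x + 1 < u \<longrightarrow> \<not> (U \<le> ap g x \<and> ap g x \<le> w)))" for n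
  have u: "2 \<le> u" using X by (simp add: Good_def)
  have "sig (\<lambda>e. P (e 0))" unfolding P_def by (intro sig_ex recd_sig defs)
  moreover have "P (of_nat n)" for n
  proof (rule ccontr)
    assume no: "\<not> P (of_nat n)"
    have "chain (Rn (of_nat n) X) u u v" using X unfolding Good_def B_nat_Suc[symmetric] by blast
    then obtain s where s: "ap s 0 = u" "\<And>i. i < u \<Longrightarrow> Rn (of_nat n) X (ap s i) (ap s (i + 1))"
      "\<And>i. i \<le> u \<Longrightarrow> ap s i \<le> v" by (rule chainE) blast
    have mono: "ap s i \<le> ap s j" if "i \<le> j" "j \<le> u" for i j
      using seq_mono[of u s i j] s(2) Rn_le that by blast
    have ex: "\<exists>x. x + 1 < u \<and> ap s i < ap g x \<and> ap g x \<le> ap s (i + 1)" if i: "i < u" for i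
    proof -
      obtain W where W: "W \<le> ap s (i + 1)" "Ap (ap s i) W (ap s (i + 1))" "B (of_nat n) X W (ap s (i + 1))"
        using s(2)[OF i] by (auto simp: Rn_def)
      have "ap s i < W" using W(2) by (simp add: Ap_def)
      moreover have "u \<le> ap s i" using mono[of 0 i] i s(1) by simp
      moreover have "ap s (i + 1) \<le> v" using s(3)[of "i + 1"] i by simp
      ultimately have "u \<le> W" by simp
      then have "\<exists>x<u. x + 1 < u \<and> W \<le> ap g x \<and> ap g x \<le> ap s (i + 1)"
        using no W(3) \<open>ap s (i + 1) \<le> v\<close> unfolding P_def by blast
      then show ?thesis using \<open>ap s i < W\<close> by (meson order_less_le_trans)
    qed
    have "recd (\<lambda>e. e 0 + 1 < u \<and> ap s (e (Suc 0)) < ap g (e 0) \<and> ap g (e 0) \<le> ap s (e (Suc 0) + 1))"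
      by (intro definable)
    from choice_code[OF this ex] obtain r where
      r: "\<forall>i<u. ap r i + 1 < u \<and> ap s i < ap g (ap r i) \<and> ap g (ap r i) \<le> ap s (i + 1)" by blast
    \<comment> \<open>The condition \<open>x + 1 < u\<close> leaves \<open>u - 1\<close> arguments,
      one fewer than there are blocks.\<close>
    obtain u' where u': "u = u' + 1" using not_zero_ex[of u] two_pos[OF u] by auto
    have "\<exists>i j. i < j \<and> j < u \<and> ap r i = ap r j"
      proof (rule pigeonhole[of "ap r" u u'])
      show "recf (\<lambda>e. ap r (e 0))" by (intro definable)
      show "ap r i < u'" if "i < u" for i
      proof -
        have "ap r i + 1 < u' + 1" using r that u' by blast
        then show ?thesis by (simp only: add_less_cancel_right)
      qed
      show "u' < u" using u' by simp
    qed
    then obtain i j where ij: "i < j" "j < u" "ap r i = ap r j" by blast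
    then have "i < u" by simp
    from r \<open>i < u\<close> have ri: "ap s i < ap g (ap r i)" "ap g (ap r i) \<le> ap s (i + 1)" by simp_all
    from r ij(2) have "ap s j < ap g (ap r j)" "ap g (ap r j) \<le> ap s (j + 1)" by simp_all
    then have rj: "ap s j < ap g (ap r i)" "ap g (ap r i) \<le> ap s (j + 1)" unfolding ij(3) .
    have "i = j" by (rule block_unique[OF mono \<open>i < u\<close> ij(2) ri rj])
    then show False using ij by simp
  qed
  ultimately obtain \<nu> where "nonstandard \<nu>" "P \<nu>" by (rule overspill[OF c])
  then obtain U w where *: "u \<le> U" "w \<le> v" "B \<nu> X U w" "\<forall>x<u. x + 1 < u \<longrightarrow> \<not> (U \<le> ap g x \<and> ap g x \<le> w)"
    unfolding P_def by blast
  have "2 \<le> U" using u *(1) by simp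
  then have "Good X U w" using GoodI[OF \<open>nonstandard \<nu>\<close> *(3)] by blast
  moreover have "x < u" if "x + 1 < u" for x using that by (meson less_add_one_self order_less_trans)
  ultimately show ?thesis using * by blast
qed

lemma Good_homogeneous:
  assumes c: "nonstandard (c::'a)" and X: "Good X u v" and C: "recd (\<lambda>e. C (e 0) (e (Suc 0)))"
  shows "\<exists>Y b. (\<forall>x. mem x Y \<longrightarrow> mem x X) \<and> Hm C b Y \<and> Good Y u v"
proof -
  define P where "P n \<longleftrightarrow> (\<exists>Y. (\<forall>x. mem x Y \<longrightarrow> mem x X) \<and> (Hm C True Y \<or> Hm C False Y) \<and> B n Y u v)" for n
  have u: "2 \<le> u" using X by (simp add: Good_def)
  have "sig (\<lambda>e. P (e 0))" unfolding P_def Hm_def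
    by (intro sig_ex recd_sig defs recd_ball_mem recd_comp2[OF C] recd_triv)
  moreover have "P (of_nat n)" for n
  proof -
    obtain m :: nat where "\<forall>C X u v. recd (\<lambda>e. C (e 0) (e (Suc 0))) \<longrightarrow> 2 \<le> u \<longrightarrow> B (of_nat m) X u v \<longrightarrow>
     (\<exists>b Y. (\<forall>x. mem x Y \<longrightarrow> mem x X) \<and> Hm C b Y \<and> B (of_nat n) Y u v)"
      using homogeneous[of "\<lambda>_. n"] by blast
    moreover have "B (of_nat m) X u v" using X by (simp add: Good_def)
    ultimately obtain b Y where "\<forall>x. mem x Y \<longrightarrow> mem x X" "Hm C b Y" "B (of_nat n) Y u v" using C u by blast
    then show ?thesis unfolding P_def by (cases b) auto
  qed
  ultimately obtain \<nu> where "nonstandard \<nu>" "P \<nu>" by (rule overspill[OF c])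
  then show ?thesis unfolding P_def using GoodI u by blast
qed

text \<open>Every number is read as a two-colouring, with truth for colour 1, so all colourings are
  reached by an enumeration of the numbers.\<close>

definition colour :: "'a \<Rightarrow> 'a \<Rightarrow> 'a \<Rightarrow> bool" where
  "colour Z x y \<longleftrightarrow> mem (pr (pr x y) 1) Z"

text \<open>The same code \<open>g\<close> is treated both as a function to be avoided and as a
  colouring, so a single enumeration serves both tasks.\<close>

lemma Good_step:
  assumes c: "nonstandard (c::'a)" and X: "Good X u v"
  shows "\<exists>X' u' v'. (\<forall>x. mem x X' \<longrightarrow> mem x X) \<and> v' \<le> v \<and> Good X' u' v' \<and> Ap u u' v' \<and>
    (\<exists>x. mem x X \<and> u \<le> x \<and> x < u') \<and> (\<forall>x. x + 1 < u \<longrightarrow> \<not> (u' \<le> ap g x \<and> ap g x \<le> v')) \<and>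
    (\<exists>b. Hm (colour g) b X')"
proof -
  obtain u1 v1 where 1: "v1 \<le> v" "Good X u1 v1" "Ap u u1 v1" "\<exists>x. mem x X \<and> u \<le> x \<and> x < u1"
    using Good_next[OF c X] by blast
  obtain u2 v2 where 2: "u1 \<le> u2" "v2 \<le> v1" "Good X u2 v2" "\<forall>x. x + 1 < u1 \<longrightarrow> \<not> (u2 \<le> ap g x \<and> ap g x \<le> v2)"
    using Good_avoid[OF c 1(2)] by blast
  have "recd (\<lambda>e. colour g (e 0) (e (Suc 0)))" unfolding colour_def by (intro definable)
  from Good_homogeneous[OF c 2(3) this] obtain X' b where
    3: "\<forall>x. mem x X' \<longrightarrow> mem x X" "Hm (colour g) b X'" "Good X' u2 v2" by blast
  have "B (of_nat 0) X u2 v2" using 2(3) unfolding Good_def by blast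
  then have "u2 \<le> v2" by (rule B_le_ends)
  then have "Ap u u2 v2" using 1(3) 2(1,2) unfolding Ap_def by (meson order_less_le_trans order_trans)
  moreover have "u \<le> u1" using 1(3) by (auto simp: Ap_def)
  ultimately show ?thesis using 1 2 3
    by (intro exI[of _ X'] exI[of _ u2] exI[of _ v2]) (auto intro: order_trans order_less_le_trans)
qed

end

text \<open>All that is kept of the construction. \<open>J_semiregular\<close> yields Sigma_1
  induction in the cut, and \<open>top\<close> turns unbounded searches in \<open>J\<close> into
  bounded ones in \<open>M\<close>.\<close>

locale cut = apart +
  fixes J :: "'a set" and top :: 'a
  assumes J_0: "0 \<in> J" and J_down: "\<And>x y. x \<in> J \<Longrightarrow> y \<le> x \<Longrightarrow> y \<in> J" and J_top: "\<And>x. x \<in> J \<Longrightarrow> x < top"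
    and J_hh: "\<And>x. x \<in> J \<Longrightarrow> hh x \<in> J"
    and J_Th: "\<And>x. x \<in> J \<Longrightarrow> \<exists>y\<in>J. \<forall>z\<in>J. Th x y z"
    and J_semiregular: "\<And>b g. b \<in> J \<Longrightarrow> \<exists>c\<in>J. \<forall>x\<le>b. ap g x \<in> J \<longrightarrow> ap g x < c"
    and J_homogeneous: "\<And>Z. \<exists>Y b. Hm (colour Z) b Y \<and> (\<forall>x\<in>J. \<exists>y\<in>J. x < y \<and> mem y Y)"

text \<open>\<open>J\<close> is the initial segment generated by the left ends \<open>u i\<close>;
  all right ends lie above it. Each code has to be treated infinitely often: a treatment at stage
  \<open>j\<close> only concerns arguments below \<open>u j\<close>, while semiregularity has to
  hold up to any \<open>b\<close> in \<open>J\<close>.\<close>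

lemma (in apart) cut_exists:
  fixes en :: "nat \<Rightarrow> 'a"
  assumes T: "\<And>t. \<exists>u. \<forall>x\<le>t. \<exists>y\<le>u. \<forall>z. Th x y z" and c: "nonstandard (c::'a)"
    and en: "\<And>a N. \<exists>i\<ge>N. en i = a"
  shows "\<exists>J top. cut Th J top"
proof -
  define good where "good = (\<lambda>(X, u, v). Good X u v)"
  define stepr where "stepr i = (\<lambda>(X, u, v) (X', u', v'). (\<forall>x. mem x X' \<longrightarrow> mem x X) \<and> v' \<le> v \<and> Ap u u' v' \<and>
    (\<exists>x. mem x X \<and> u \<le> x \<and> x < u') \<and> (\<forall>x. x + 1 < u \<longrightarrow> \<not> (u' \<le> ap (en i) x \<and> ap (en i) x \<le> v')) \<and>
    (\<exists>b. Hm (colour (en i)) b X'))" for i :: nat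
  have "\<exists>f. \<forall>i. good (f i) \<and> stepr i (f i) (f (Suc i))"
  proof (rule dependent_nat_choice)
    show "\<exists>x. good x" using Good_start[OF T c] by (auto simp: good_def)
    fix x i assume "good x"
    moreover obtain X u v where x: "x = (X, u, v)" by (cases x)
    ultimately have "Good X u v" by (simp add: good_def)
    from Good_step[OF c this, of "en i"] obtain X' u' v' where "(\<forall>x. mem x X' \<longrightarrow> mem x X) \<and> v' \<le> v \<and> Good X' u' v' \<and> Ap u u' v' \<and>
    (\<exists>x. mem x X \<and> u \<le> x \<and> x < u') \<and> (\<forall>x. x + 1 < u \<longrightarrow> \<not> (u' \<le> ap (en i) x \<and> ap (en i) x \<le> v')) \<and>
    (\<exists>b. Hm (colour (en i)) b X')" by blast
    then show "\<exists>y. good y \<and> stepr i x y"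
      by (intro exI[of _ "(X', u', v')"]) (auto simp: good_def stepr_def x)
  qed
  then obtain f where f: "\<And>i. good (f i)" "\<And>i. stepr i (f i) (f (Suc i))" by blast
  define X where "X i = fst (f i)" for i
  define u where "u i = fst (snd (f i))" for i
  define v where "v i = snd (snd (f i))" for i
  have fi: "f i = (X i, u i, v i)" for i by (simp add: X_def u_def v_def)
  have good: "Good (X i) (u i) (v i)" for i using f(1)[of i] by (simp add: fi good_def)
  have st: "mem x (X (Suc i)) \<Longrightarrow> mem x (X i)" "v (Suc i) \<le> v i" "Ap (u i) (u (Suc i)) (v (Suc i))"
    "\<exists>x. mem x (X i) \<and> u i \<le> x \<and> x < u (Suc i)"
    "x + 1 < u i \<Longrightarrow> \<not> (u (Suc i) \<le> ap (en i) x \<and> ap (en i) x \<le> v (Suc i))"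
    "\<exists>b. Hm (colour (en i)) b (X (Suc i))" for i x
    using f(2)[of i] by (auto simp: fi stepr_def)
  have uSuc: "u i < u (Suc i)" for i using st(3)[of i] by (simp add: Ap_def)
  have umono: "u i \<le> u j" if "i \<le> j" for i j
    by (rule lift_Suc_mono_le[OF _ that]) (use uSuc order_less_imp_le in blast)
  have vanti: "v j \<le> v i" if "i \<le> j" for i j
    by (rule lift_Suc_antimono_le[OF _ that]) (rule st(2))
  have Xanti: "mem x (X j) \<Longrightarrow> mem x (X i)" if "i \<le> j" for i j x
    using that by (induction j) (auto simp: le_Suc_eq dest: st(1))
  have uv: "u i \<le> v j" for i j
  proof -
    have "B (of_nat 0) (X (max i j)) (u (max i j)) (v (max i j))" using good unfolding Good_def by blast
    then have "u (max i j) \<le> v (max i j)" by (rule B_le_ends)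
    then show ?thesis using umono[of i "max i j"] vanti[of j "max i j"] by (meson max.cobounded1 max.cobounded2 order_trans)
  qed
  define J where "J = {x. \<exists>i. x \<le> u i}"
  have JI: "x \<le> u i \<Longrightarrow> x \<in> J" for x i by (auto simp: J_def)
  have JE: "\<exists>i\<ge>N. x < u i" if xJ: "x \<in> J" for x N
  proof -
    obtain i where "x \<le> u i" using xJ by (auto simp: J_def)
    then have "x \<le> u (max i N)" using umono[of i "max i N"] by (meson max.cobounded1 order_trans)
    then have "x < u (Suc (max i N))" using uSuc[of "max i N"] by simp
    then show ?thesis by (intro exI[of _ "Suc (max i N)"]) auto
  qed
  have "cut Th J (v 0)"
  proof
    show "0 \<in> J" by (rule JI) simp
    show "x \<in> J \<Longrightarrow> y \<le> x \<Longrightarrow> y \<in> J" for x y by (auto simp: J_def intro: order_trans)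
    show "x < v 0" if "x \<in> J" for x using JE[OF that] uv[of _ 0] by (meson order_less_le_trans)
    show "hh x \<in> J" if xJ: "x \<in> J" for x
    proof -
      obtain i where "x \<le> u i" using xJ by (auto simp: J_def)
      then have "hh x \<le> u (Suc i)" using st(3)[of i] by (simp add: Ap_def)
      then show ?thesis by (rule JI)
    qed
    show "\<exists>y\<in>J. \<forall>z\<in>J. Th x y z" if xJ: "x \<in> J" for x
    proof -
      obtain i where "x \<le> u i" using xJ by (auto simp: J_def)
      then obtain y where y: "y \<le> u (Suc i)" "\<forall>z\<le>v (Suc i). Th x y z" using st(3)[of i] by (auto simp: Ap_def)
      have "z \<le> v (Suc i)" if "z \<in> J" for z using JE[OF that] uv[of _ "Suc i"] by (meson order_less_imp_le order_trans)
      then show ?thesis using y JI by blast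
    qed
    show "\<exists>c\<in>J. \<forall>x\<le>b. ap g x \<in> J \<longrightarrow> ap g x < c" if bJ: "b \<in> J" for b g
    proof -
      obtain i where i: "b < u i" using JE[OF bJ] by blast
      then have "b + 1 \<le> u i" by simp
      then have "b + 1 < u (Suc i)" using uSuc[of i] by (rule order_le_less_trans)
      obtain j where j: "Suc i \<le> j" "en j = g" using en by blast
      have "b + 1 < u j" using \<open>b + 1 < u (Suc i)\<close> umono[OF j(1)] by simp
      \<comment> \<open>A value in \<open>J\<close> lies below every right end, and it avoids the
        interval of stage \<open>Suc j\<close>; so it lies below the left end.\<close>
      have "ap g x < u (Suc j)" if "x \<le> b" "ap g x \<in> J" for x
      proof -
        have "x + 1 \<le> b + 1" using that(1) by (rule add_right_mono)
        then have "x + 1 < u j" using \<open>b + 1 < u j\<close> by (rule order_le_less_trans)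
        moreover have "ap g x \<le> v (Suc j)" using JE[OF that(2)] uv[of _ "Suc j"] by (meson order_less_imp_le order_trans)
        ultimately show ?thesis using st(5)[of x j] j(2) by auto
      qed
      then show ?thesis using JI[of "u (Suc j)" "Suc j"] by blast
    qed
    show "\<exists>Y b. Hm (colour Z) b Y \<and> (\<forall>x\<in>J. \<exists>y\<in>J. x < y \<and> mem y Y)" for Z
    proof -
      obtain j where j: "en j = Z" using en by blast
      obtain b where "Hm (colour Z) b (X (Suc j))" using st(6)[of j] j by blast
      moreover have "\<exists>y\<in>J. x < y \<and> mem y (X (Suc j))" if xJ: "x \<in> J" for x
      proof -
        obtain i where i: "Suc j \<le> i" "x < u i" using JE[OF xJ] by blast
        obtain y where y: "mem y (X i)" "u i \<le> y" "y < u (Suc i)" using st(4)[of i] by blast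
        then have "y \<in> J" "x < y" "mem y (X (Suc j))" using i Xanti[OF i(1)] JI[of y "Suc i"] by auto
        then show ?thesis by blast
      qed
      ultimately show ?thesis by blast
    qed
  qed
  then show ?thesis by blast
qed

subsection \<open>The cut as a model\<close>

lemma closures_sat:
  assumes "\<And>e s. range e \<subseteq> univ A \<Longrightarrow> range s \<subseteq> setsM A \<Longrightarrow> sat A e s p" and "q \<in> closures p"
    and "range e \<subseteq> univ A" "range s \<subseteq> setsM A"
  shows "sat A e s q"
proof -
  have S: "sat A e s ((AllS ^^ m) p)" if "range e \<subseteq> univ A" "range s \<subseteq> setsM A" for e s m
    using that by (induction m arbitrary: s) (auto simp: assms(1) range_scons)
  have "sat A e s ((AllN ^^ n) ((AllS ^^ m) p))" if "range e \<subseteq> univ A" "range s \<subseteq> setsM A" for e s n m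
    using that by (induction n arbitrary: e) (auto simp: S range_scons)
  then show ?thesis using assms(2-4) by (auto simp: closures_def)
qed

lemma val_shift_gen: "val A e (shift k t) = val A (\<lambda>n. e (n + k)) t"
  by (simp add: shift_def val_subst)

lemma sat_substN_Suc:
  "sat A (x ## e) s (substN (NVar(0 := Add (NVar 0) One)) p) \<longleftrightarrow> sat A (addM A x (oneM A) ## e) s p"
proof -
  have "(\<lambda>n. val A (x ## e) ((NVar(0 := Add (NVar 0) One)) n)) = addM A x (oneM A) ## e"
    by (rule HOL.ext) (simp split: nat.split)
  then show ?thesis by (simp add: substN_def sat_subst)
qed

lemma sat_induction_ax:
  "sat A e s (induction_ax p) \<longleftrightarrow> (sat A (zeroM A ## e) s p \<longrightarrow>
     (\<forall>x\<in>univ A. sat A (x ## e) s p \<longrightarrow> sat A (addM A x (oneM A) ## e) s p) \<longrightarrow> (\<forall>x\<in>univ A. sat A (x ## e) s p))"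
  by (auto simp: induction_ax_def sat_instN sat_substN_Suc)

lemma sat_comprehension_ax:
  "sat A e s (comprehension_ax p q) \<longleftrightarrow> ((\<forall>x\<in>univ A. sat A (x ## e) s p \<longleftrightarrow> sat A (x ## e) s q) \<longrightarrow>
     (\<exists>X\<in>setsM A. \<forall>x\<in>univ A. x \<in> X \<longleftrightarrow> sat A (x ## e) s p))"
  by (auto simp: comprehension_ax_def sat_liftS)

lemma sat_Ex1N:
  "sat A e s (Ex1N p) \<longleftrightarrow> (\<exists>x\<in>univ A. sat A (x ## e) s p \<and> (\<forall>y\<in>univ A. sat A (y ## e) s p \<longrightarrow> y = x))"
proof -
  have "(\<lambda>n. (y ## x ## e) (if n = 0 then n else n + Suc 0)) = y ## e" for x y
    by (rule HOL.ext) (simp split: nat.split)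
  then show ?thesis by (simp add: Ex1N_def liftN_def substN_def sat_subst)
qed

lemma val_pair: "val (std D S) e (pair t u) = pr (val (std D S) e t) (val (std D S) e u)"
  by (simp add: pair_def pr_def)

context cut begin

definition SJ :: "'a set set" where "SJ = {fset c \<inter> J | c. True}"

abbreviation MJ :: "'a model" where "MJ \<equiv> std J SJ"

lemma cb_J: "x \<in> J \<Longrightarrow> cb (x + 1) \<in> J"
proof (rule J_down[OF J_hh])
  show "cb (x + 1) \<le> hh x" unfolding hh_def
    by (simp only: add.assoc add_increasing zero_le add_increasing2 le_add_same_cancel1 order_refl)
qed

lemma square_J: "x \<in> J \<Longrightarrow> (x + 1) * (x + 1) \<in> J"
proof (rule J_down[OF J_hh])
  show "(x + 1) * (x + 1) \<le> hh x" unfolding hh_def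
    by (simp only: add.assoc add_increasing zero_le add_increasing2 le_add_same_cancel1 order_refl)
qed

lemma one_le_sq: "a \<le> x \<Longrightarrow> b \<le> x \<Longrightarrow> a + b \<le> (x + 1) * (x + 1) \<and> a * b \<le> (x + 1) * (x + (1::'a))"
proof
  assume ab: "a \<le> x" "b \<le> x"
  have "a + b \<le> x + x" using ab by (rule add_mono)
  also have "\<dots> \<le> x + x + (x * x + 1)" by (simp add: add_increasing2)
  also have "\<dots> = (x + 1) * (x + 1)" by (simp add: algebra_simps)
  finally show "a + b \<le> (x + 1) * (x + 1)" .
  show "a * b \<le> (x + 1) * (x + 1)" using ab by (intro mult_mono) (auto intro: order_trans simp: add_increasing2)
qed

lemma J_arith: assumes "x \<in> J" "y \<in> J" shows "x + y \<in> J" "x * y \<in> J"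
proof -
  have m: "max x y \<in> J" using assms by (simp add: max_def)
  show "x + y \<in> J" "x * y \<in> J"
    using one_le_sq[of x "max x y" y] square_J[OF m] J_down by auto
qed

lemma J_1: "1 \<in> J"
  using square_J[OF J_0] by simp

lemma J_pr: "x \<in> J \<Longrightarrow> y \<in> J \<Longrightarrow> pr x y \<in> J"
  by (simp add: pr_def J_arith)

lemma J_pr_iff: "pr x y \<in> J \<longleftrightarrow> x \<in> J \<and> y \<in> J"
  using J_pr J_down pr_ge1 pr_ge2 by blast

lemma J_mem: "mem i c \<Longrightarrow> c \<in> J \<Longrightarrow> i \<in> J"
  using J_down mem_less order_less_imp_le by blast

lemma wf_MJ: "wf_model MJ"
  by (auto simp: wf_model_def J_0 J_1 J_arith SJ_def)

lemma val_J: "range e \<subseteq> J \<Longrightarrow> val MJ e t \<in> J"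
  using val_univ[OF wf_MJ] by simp

text \<open>Absoluteness: \<open>J\<close> is an initial segment closed under the operations, so it
  contains the values of all bounds and everything below them.\<close>

lemma sat_bounded_J:
  "bounded p \<Longrightarrow> range e \<subseteq> J \<Longrightarrow> sat MJ e (\<lambda>n. Z n \<inter> J) p \<longleftrightarrow> bsat e Z p"
proof (induction p arbitrary: e rule: bounded.induct)
  case (4 t X)
  then show ?case using val_J[of e t] by (simp add: val_std[of J SJ])
next
  case (8 p t)
  have "val MJ e t \<in> J" using 8 by (intro val_J)
  then have "(\<forall>x\<in>J. x < val MJ e t \<longrightarrow> Q x) \<longleftrightarrow> (\<forall>x<val MJ e t. Q x)" for Q
    using J_down order_less_imp_le by blast
  moreover have "x \<in> J" if "x < val MJ e t" for x using \<open>val MJ e t \<in> J\<close> that J_down order_less_imp_le by blast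
  ultimately show ?case using 8 by (simp add: val_shift range_scons val_std[of J SJ])
next
  case (9 p t)
  have "val MJ e t \<in> J" using 9 by (intro val_J)
  then have "(\<exists>x\<in>J. x < val MJ e t \<and> Q x) \<longleftrightarrow> (\<exists>x<val MJ e t. Q x)" for Q
    using J_down order_less_imp_le by blast
  moreover have "x \<in> J" if "x < val MJ e t" for x using \<open>val MJ e t \<in> J\<close> that J_down order_less_imp_le by blast
  ultimately show ?case using 9 by (simp add: val_shift range_scons val_std[of J SJ] cong: conj_cong)
qed (auto simp: val_std[of J SJ])

lemma fset_second_order: "fset c \<in> second_order"
proof -
  have "recd (\<lambda>e. mem (e 0) c)" by (intro definable)
  from comprehension[OF this] show ?thesis by (simp add: fset_def)
qed

lemma recd_bsat:
  assumes "bounded p" shows "recd (\<lambda>e'. bsat (e' 0 ## e' (Suc 0) ## e) (\<lambda>n. fset (z n)) p)"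
proof (rule recd_dlt, unfold dlt_def, intro exI conjI allI)
  show "bounded p" by (rule assms)
  show "range (\<lambda>n. fset (z n)) \<subseteq> second_order" using fset_second_order by blast
  fix e'
  have "(e' 0 ## e' (Suc 0) ## e) = (\<lambda>n. ev e' (case n of 0 \<Rightarrow> Inl 0 | Suc 0 \<Rightarrow> Inl (Suc 0) | Suc (Suc n) \<Rightarrow> Inr (e n)))"
    by (rule HOL.ext) (simp split: nat.split)
  then show "bsat (e' 0 ## e' (Suc 0) ## e) (\<lambda>n. fset (z n)) p \<longleftrightarrow>
    bsat (\<lambda>n. ev e' (case n of 0 \<Rightarrow> Inl 0 | Suc 0 \<Rightarrow> Inl (Suc 0) | Suc (Suc n) \<Rightarrow> Inr (e n))) (\<lambda>n. fset (z n)) p"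
    by simp
qed

lemma SJ_codes: assumes "range s \<subseteq> SJ" obtains z where "s = (\<lambda>n. fset (z n) \<inter> J)"
proof -
  have "\<forall>n. \<exists>c. s n = fset c \<inter> J" using assms by (auto simp: SJ_def)
  then obtain z where "\<forall>n. s n = fset (z n) \<inter> J" by metis
  then show thesis using that by blast
qed

lemma sat_Sigma1_J:
  assumes "bounded p" "range e \<subseteq> J" "x \<in> J"
  shows "sat MJ (x ## e) (\<lambda>n. fset (z n) \<inter> J) (ExN p) \<longleftrightarrow> (\<exists>y\<in>J. bsat (y ## x ## e) (\<lambda>n. fset (z n)) p)"
    "sat MJ (x ## e) (\<lambda>n. fset (z n) \<inter> J) (AllN p) \<longleftrightarrow> (\<forall>y\<in>J. bsat (y ## x ## e) (\<lambda>n. fset (z n)) p)"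
  using assms by (auto simp: sat_bounded_J[where Z = "\<lambda>n. fset (z n)"] range_scons)

text \<open>Let \<open>g x\<close> be the least witness for \<open>x\<close>, or \<open>top\<close>
  if there is none below. By semiregularity the values in \<open>J\<close> at arguments up to
  \<open>b\<close> lie below some \<open>c\<close> in \<open>J\<close>. Up to \<open>b\<close> the
  formula thus agrees with one bounded by \<open>c\<close>, and induction in \<open>M\<close>
  applies to that.\<close>

lemma induction_J:
  assumes p: "bounded p" and e: "range e \<subseteq> J" and s: "range s \<subseteq> SJ"
  shows "sat MJ e s (induction_ax (ExN p))"
proof -
  obtain z where z: "s = (\<lambda>n. fset (z n) \<inter> J)" using SJ_codes[OF s] .
  define Q where "Q y x \<longleftrightarrow> bsat (y ## x ## e) (\<lambda>n. fset (z n)) p" for y x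
  have Q: "recd (\<lambda>e. Q (e 0) (e (Suc 0)))" unfolding Q_def by (rule recd_bsat[OF p])
  have "\<exists>y\<in>J. Q y b" if 0: "\<exists>y\<in>J. Q y 0" and step: "\<And>x. x \<in> J \<Longrightarrow> \<exists>y\<in>J. Q y x \<Longrightarrow> \<exists>y\<in>J. Q y (x + 1)" and b: "b \<in> J" for b
  proof -
    define R where "R c x \<longleftrightarrow> (Q c x \<or> c = top) \<and> (\<forall>c'<c. \<not> Q c' x)" for c x
    have ex: "\<exists>c. R c x" for x
    proof -
      have "recd (\<lambda>e. Q (e 0) x \<or> e 0 = top)" by (intro definable recd_comp2[OF Q])
      from recd_least[of "\<lambda>c. Q c x \<or> c = top" top, OF recd_sig[OF this]] show ?thesis unfolding R_def by blast
    qed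
    have "recd (\<lambda>e. R (e 0) (e (Suc 0)))" unfolding R_def by (intro definable recd_comp2[OF Q])
    from choice_code[OF this ex] obtain g where g: "\<forall>x<b + 1. R (ap g x) x" by blast
    obtain c where c: "c \<in> J" "\<forall>x\<le>b. ap g x \<in> J \<longrightarrow> ap g x < c" using J_semiregular[OF b] by blast
    have bound: "\<exists>y<c. Q y x" if ex: "\<exists>y\<in>J. Q y x" and "x \<le> b" for x
    proof -
      obtain y where y: "y \<in> J" "Q y x" using ex by blast
      have R: "R (ap g x) x" using g \<open>x \<le> b\<close> by simp
      then have "ap g x \<le> y" using y(2) unfolding R_def using not_less by blast
      then have "ap g x \<in> J" using y(1) J_down by blast
      then have "ap g x < c" "ap g x \<noteq> top" using c(2) \<open>x \<le> b\<close> J_top by auto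
      then show ?thesis using R unfolding R_def by blast
    qed
    have inJ: "y \<in> J" if "y < c" for y using that c(1) J_down order_less_imp_le by blast
    have "recd (\<lambda>e. e 0 \<le> b \<longrightarrow> (\<exists>y<c. Q y (e 0)))" by (intro definable recd_comp2[OF Q])
    from recd_sig[OF this] have "b \<le> b \<longrightarrow> (\<exists>y<c. Q y b)"
    proof (rule sig_induct)
      show "0 \<le> b \<longrightarrow> (\<exists>y<c. Q y 0)" using bound 0 by simp
      fix x assume IH: "x \<le> b \<longrightarrow> (\<exists>y<c. Q y x)"
      show "x + 1 \<le> b \<longrightarrow> (\<exists>y<c. Q y (x + 1))"
      proof
        assume "x + 1 \<le> b"
        then have x: "x \<le> b" by simp
        then have "x \<in> J" using b J_down by blast
        moreover have "\<exists>y\<in>J. Q y x" using IH x inJ by blast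
        ultimately show "\<exists>y<c. Q y (x + 1)" using bound step \<open>x + 1 \<le> b\<close> by blast
      qed
    qed
    then show ?thesis using inJ by blast
  qed
  note main = this
  have "sat MJ (x ## e) s (ExN p) \<longleftrightarrow> (\<exists>y\<in>J. Q y x)" if "x \<in> J" for x
    unfolding z Q_def by (rule sat_Sigma1_J(1)[OF p e that])
  then show ?thesis unfolding sat_induction_ax
    using main J_0 J_1 J_arith(1) by (simp del: sat.simps)
qed

text \<open>Search below \<open>top\<close> for a \<open>y\<close> that satisfies \<open>P\<close>,
  with \<open>Q\<close> true at everything before it. If the first such search result lies outside
  \<open>J\<close>, then \<open>Q\<close> holds throughout \<open>J\<close>, so by the equivalence
  \<open>P\<close> has a witness in \<open>J\<close> as well. The search is Delta_1 in
  \<open>M\<close>, hence its result is coded.\<close>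

lemma comprehension_J:
  assumes p: "bounded p" and q: "bounded q" and e: "range e \<subseteq> J" and s: "range s \<subseteq> SJ"
  shows "sat MJ e s (comprehension_ax (ExN p) (AllN q))"
proof -
  obtain z where z: "s = (\<lambda>n. fset (z n) \<inter> J)" using SJ_codes[OF s] .
  define P where "P y x \<longleftrightarrow> bsat (y ## x ## e) (\<lambda>n. fset (z n)) p" for y x
  define Q where "Q y x \<longleftrightarrow> bsat (y ## x ## e) (\<lambda>n. fset (z n)) q" for y x
  have P: "recd (\<lambda>e. P (e 0) (e (Suc 0)))" unfolding P_def by (rule recd_bsat[OF p])
  have Q: "recd (\<lambda>e. Q (e 0) (e (Suc 0)))" unfolding Q_def by (rule recd_bsat[OF q])
  have "\<exists>X\<in>SJ. \<forall>x\<in>J. x \<in> X \<longleftrightarrow> (\<exists>y\<in>J. P y x)" if eq: "\<And>x. x \<in> J \<Longrightarrow> (\<exists>y\<in>J. P y x) \<longleftrightarrow> (\<forall>y\<in>J. Q y x)"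
  proof -
    define R where "R x \<longleftrightarrow> (\<exists>y<top. P y x \<and> (\<forall>y'<y. Q y' x))" for x
    have R: "recd (\<lambda>e. R (e 0))" unfolding R_def by (intro definable recd_comp2[OF P] recd_comp2[OF Q])
    have "R x \<longleftrightarrow> (\<exists>y\<in>J. P y x)" if x: "x \<in> J" for x
    proof
      assume "R x"
      then obtain y where y: "y < top" "P y x" "\<forall>y'<y. Q y' x" by (auto simp: R_def)
      show "\<exists>y\<in>J. P y x"
      proof (cases "y \<in> J")
        case False
        then have "y' < y" if "y' \<in> J" for y' using that J_down not_less by blast
        then have "\<forall>y'\<in>J. Q y' x" using y(3) by blast
        then show ?thesis using eq[OF x] by blast
      qed (use y in blast)
    next
      assume ex: "\<exists>y\<in>J. P y x"
      then obtain y where y: "y \<in> J" "P y x" by blast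
      have "Q y' x" if "y' < y" for y' using ex eq[OF x] y(1) that J_down order_less_imp_le by blast
      then show "R x" using y J_top by (auto simp: R_def)
    qed
    then have "\<forall>x\<in>J. x \<in> fset (cset top R) \<inter> J \<longleftrightarrow> (\<exists>y\<in>J. P y x)"
      using J_top by (auto simp: mem_cset[OF R])
    then show ?thesis unfolding SJ_def by blast
  qed
  note main = this
  have "sat MJ (x ## e) s (ExN p) \<longleftrightarrow> (\<exists>y\<in>J. P y x)" "sat MJ (x ## e) s (AllN q) \<longleftrightarrow> (\<forall>y\<in>J. Q y x)" if "x \<in> J" for x
    unfolding z P_def Q_def using sat_Sigma1_J(1)[OF p e that] sat_Sigma1_J(2)[OF q e that] by auto
  then show ?thesis unfolding sat_comprehension_ax using main by (simp del: sat.simps)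
qed

lemma basic_J: "q \<in> basic_axioms \<Longrightarrow> sat MJ e s q"
  by (auto simp: basic_axioms_def Let_def algebra_simps order_le_less)

lemma RCA0_J:
  assumes "q \<in> RCA0" "range e \<subseteq> J" "range s \<subseteq> SJ" shows "sat MJ e s q"
proof -
  have S1: "\<exists>q. bounded q \<and> p = ExN q" if "p \<in> Sigma0 1" for p using that by auto
  have P1: "\<exists>q. bounded q \<and> p = AllN q" if "p \<in> Pi0 1" for p using that by auto
  from assms(1) consider "q \<in> basic_axioms" | p where "p \<in> Sigma0 1" "q \<in> closures (induction_ax p)"
    | p p' where "p \<in> Sigma0 1" "p' \<in> Pi0 1" "q \<in> closures (comprehension_ax p p')"
    unfolding RCA0_def by blast
  then show ?thesis
  proof cases
    case 1
    then show ?thesis by (rule basic_J)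
  next
    case 2
    then obtain r where r: "bounded r" "p = ExN r" using S1 by blast
    show ?thesis
      by (rule closures_sat[OF _ 2(2)]) (use r assms induction_J in auto)
  next
    case 3
    then obtain r r' where r: "bounded r" "p = ExN r" "bounded r'" "p' = AllN r'" using S1 P1 by blast
    show ?thesis
      by (rule closures_sat[OF _ 3(3)]) (use r assms comprehension_J in auto)
  qed
qed

lemma two_J: "c < (2::'a) \<longleftrightarrow> c = 0 \<or> c = 1"
  unfolding one_add_one[symmetric] less_add_one_iff by (auto simp: order_le_less)

lemma RT22_J:
  assumes "range e \<subseteq> J" "range s \<subseteq> SJ" shows "sat MJ e s RT22"
proof -
  have "sat MJ e (F ## s) (ExS (Conj (infiniteF 0) (homogeneousF 0 1)))"
    if F: "F \<in> SJ" and col: "sat MJ e (F ## s) (coloringF 0)" for F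
  proof -
    obtain Z where Z: "F = fset Z \<inter> J" using F by (auto simp: SJ_def)
    obtain Y b where Y: "Hm (colour Z) b Y" "\<forall>x\<in>J. \<exists>y\<in>J. x < y \<and> mem y Y" using J_homogeneous by blast
    let ?c = "if b then 1 else 0 :: 'a"
    have c1: "\<exists>x\<in>J. \<exists>y\<in>J. \<exists>c\<in>J. x < y \<and> (c = 0 \<or> c = 1) \<and> w = pr (pr x y) c" if "w \<in> F" for w
    proof -
      have "w \<in> J" using that Z by blast
      then show ?thesis using col that by (auto simp: coloringF_def val_pair two_J)
    qed
    have c2: "\<exists>c\<in>J. pr (pr x y) c \<in> F" if "x \<in> J" "y \<in> J" "x < y" for x y
      using col that by (simp add: coloringF_def val_pair sat_Ex1N) blast
    have hom: "pr (pr x y) ?c \<in> F" if xy: "x \<in> J" "y \<in> J" "mem x Y" "mem y Y" "x < y" for x y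
    proof -
      obtain c where c: "c \<in> J" "pr (pr x y) c \<in> F" using c2 xy by blast
      then have "c = 0 \<or> c = 1" using c1[OF c(2)] by auto
      \<comment> \<open>The pair has colour 0 or 1 in \<open>F\<close>, and homogeneity tells
        whether it is 1.\<close>
      moreover have "mem (pr (pr x y) 1) Z \<longleftrightarrow> b" using Y(1) xy by (simp add: Hm_def colour_def)
      ultimately show ?thesis using c xy J_pr J_1 Z by (cases b) auto
    qed
    have "fset Y \<inter> J \<in> SJ" by (auto simp: SJ_def)
    moreover have "sat MJ e ((fset Y \<inter> J) ## F ## s) (infiniteF 0)"
      using Y(2) by (simp add: infiniteF_def)
    moreover have "sat MJ e ((fset Y \<inter> J) ## F ## s) (homogeneousF 0 1)"
    proof -
      have "?c \<in> J" "?c < 1 + 1" using J_0 J_1 by auto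
      then show ?thesis unfolding homogeneousF_def using hom
        by (simp only: sat.simps) (rule bexI[of _ ?c], auto simp: val_pair val_shift_gen)
    qed
    ultimately show ?thesis by auto
  qed
  then show ?thesis by (simp add: RT22_def del: sat.simps(11)) 
qed

end

section \<open>Codes of sequences as described by the formula macros\<close>

definition triple :: "'a::ordered_arith \<Rightarrow> bool" where
  "triple c \<longleftrightarrow> (\<exists>k m n. c = pr k (pr m n))"

definition isfc :: "'a::ordered_arith \<Rightarrow> bool" where
  "isfc c \<longleftrightarrow> triple c \<and> (\<forall>c'<c. triple c' \<longrightarrow> fset c' \<noteq> fset c)"

definition islen :: "'a::ordered_arith \<Rightarrow> 'a \<Rightarrow> bool" where
  "islen s l \<longleftrightarrow> (\<forall>i. i < l \<longleftrightarrow> (\<exists>y. mem (pr i y) s))"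

definition isseq :: "'a::ordered_arith \<Rightarrow> bool" where
  "isseq s \<longleftrightarrow> isfc s \<and> (\<forall>x. mem x s \<longrightarrow> (\<exists>i y. x = pr i y)) \<and>
     (\<forall>i y y'. mem (pr i y) s \<longrightarrow> mem (pr i y') s \<longrightarrow> y = y') \<and> (\<exists>l. islen s l)"

lemma mem_triple: "mem i c \<Longrightarrow> triple c"
  by (auto simp: mem_def triple_def)

lemma pr_0_0: "pr 0 0 = (0 :: 'a::ordered_arith)"
  by (simp add: pr_def)

lemma triple_0: "triple (0 :: 'a::ordered_arith)"
  unfolding triple_def by (intro exI[of _ 0]) (simp add: pr_0_0)

lemma isfc_cset:
  assumes P: "recd (\<lambda>e. P (e 0))" shows "isfc (cset b P)"
proof -
  have least: "\<forall>c'<cset b P. \<not> is_cset b P c'" using cset_unique[OF P] by blast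
  have "fset c' \<noteq> fset (cset b P)" if "c' < cset b P" for c'
    using least that mem_cset[OF P] by (auto simp: is_cset_iff fset_def)
  moreover have "triple (cset b P)"
  proof (cases "\<exists>i. mem i (cset b P)")
    case False
    \<comment> \<open>The least code of the empty set is 0, which is itself a triple.\<close>
    then have "is_cset b P 0" using mem_cset[OF P] mem_less[of _ "0::'a"] by (auto simp: is_cset_iff)
    then have "cset b P = 0" using least zero_less_iff_neq_zero by blast
    then show ?thesis by (simp add: triple_0)
  qed (use mem_triple in blast)
  ultimately show ?thesis by (simp add: isfc_def)
qed

lemma isfc_unique: "isfc c \<Longrightarrow> isfc c' \<Longrightarrow> fset c = fset c' \<Longrightarrow> c = c'"
  unfolding isfc_def by (metis linorder_neqE)

text \<open>Used in contraposition: a binary sequence with a large code must be long.\<close>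

lemma isfc_less:
  assumes "isfc c" "\<And>x. mem x c \<Longrightarrow> x < b" shows "c < cb (b :: 'a::rca0)"
proof -
  have P: "recd (\<lambda>e. mem (e 0) c)" by (intro definable)
  have "fset c = fset (cset b (\<lambda>x. mem x c))" using assms(2) by (auto simp: mem_cset[OF P])
  then have "c = cset b (\<lambda>x. mem x c)" using isfc_unique assms(1) isfc_cset[OF P] by blast
  then show ?thesis using cset_less[OF P, of b] by simp
qed

text \<open>Arguments and values are cut off, so the code is bounded in terms of \<open>l\<close>
  alone; for \<open>l\<close> in \<open>J\<close> it lies in \<open>J\<close> even if
  \<open>c\<close> does not.\<close>

definition restr :: "'a::rca0 \<Rightarrow> 'a \<Rightarrow> 'a" where
  "restr c l = cset (pr l 2 + 1) (\<lambda>x. \<exists>i<l. \<exists>y<2. x = pr i y \<and> mem x c)"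

lemma recd_restr: "recd (\<lambda>e. \<exists>i<l. \<exists>y<2. e 0 = pr i y \<and> mem (e 0) c)"
  by (intro definable)

lemma mem_restr: "mem x (restr c l) \<longleftrightarrow> (\<exists>i<l. \<exists>y<2. x = pr i y \<and> mem x c)"
  unfolding restr_def mem_cset[OF recd_restr] by (auto intro!: pr_mono)

lemma recf_restr: "recf f \<Longrightarrow> recf g \<Longrightarrow> recf (\<lambda>e. restr (f e) (g e))"
  by (rule recf_comp2[of restr], unfold restr_def) (intro definable)

text \<open>\<open>c\<close> contains the graph of a binary function on \<open>{i. i < l}\<close>.\<close>

definition binfun :: "'a::rca0 \<Rightarrow> 'a \<Rightarrow> bool" where
  "binfun c l \<longleftrightarrow> (\<forall>i<l. \<exists>y<2. mem (pr i y) c \<and> (\<forall>y'<2. mem (pr i y') c \<longrightarrow> y' = y))"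

lemma recd_binfun: "recf f \<Longrightarrow> recf g \<Longrightarrow> recd (\<lambda>e. binfun (f e) (g e))"
  by (rule recd_comp2[of binfun], unfold binfun_def) (intro definable)

lemma islen_restr: "binfun c l \<Longrightarrow> l' \<le> l \<Longrightarrow> islen (restr c l') l'"
  unfolding islen_def mem_restr binfun_def by (metis order_less_le_trans pr_inject)

lemma isseq_restr: "binfun c l \<Longrightarrow> l' \<le> l \<Longrightarrow> isseq (restr c l')"
  unfolding isseq_def
proof (intro conjI allI impI)
  assume b: "binfun c l" "l' \<le> l"
  show "isfc (restr c l')" unfolding restr_def by (rule isfc_cset[OF recd_restr])
  show "\<exists>l. islen (restr c l') l" using islen_restr[OF b] by blast
  show "\<exists>i y. x = pr i y" if "mem x (restr c l')" for x using that by (auto simp: mem_restr)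
  show "y = y'" if "mem (pr i y) (restr c l')" "mem (pr i y') (restr c l')" for i y y'
  proof -
    have "i < l" "y < 2" "y' < 2" "mem (pr i y) c" "mem (pr i y') c"
      using that b(2) by (auto simp: mem_restr)
    then show ?thesis using b(1) unfolding binfun_def by blast
  qed
qed

section \<open>The sequence macros in the cut, and weak Koenig's lemma\<close>

context cut begin

lemma dvdF_J:
  assumes "range e \<subseteq> J" shows "sat MJ e s (dvdF t u) \<longleftrightarrow> val MJ e t dvd val MJ e u"
proof -
  have "val MJ e u \<in> J" using assms by (rule val_J)
  then have "\<exists>q\<in>J. val MJ e u = val MJ e t * q" if "val MJ e t dvd val MJ e u"
    using dvd_bound[THEN iffD1, OF that] J_down by blast
  then have "(\<exists>q\<in>J. val MJ e u = val MJ e t * q) \<longleftrightarrow> val MJ e t dvd val MJ e u"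
    by (auto simp: dvd_def)
  then show ?thesis by (simp add: dvdF_def val_shift)
qed

lemma triple_J: assumes "c \<in> J" shows "(\<exists>k\<in>J. \<exists>m\<in>J. \<exists>n\<in>J. c = pr k (pr m n) \<and> Q k m n) \<longleftrightarrow> (\<exists>k m n. c = pr k (pr m n) \<and> Q k m n)"
  using assms by (auto simp: J_pr_iff)

lemma inF_J:
  assumes "range e \<subseteq> J" shows "sat MJ e s (inF i c) \<longleftrightarrow> mem (val MJ e i) (val MJ e c)"
proof -
  have c: "val MJ e c \<in> J" using assms by (rule val_J)
  have shift3: "(\<lambda>j. (n ## m ## k ## e) (j + 3)) = e" for k m n by (simp add: eval_nat_numeral)
  show ?thesis unfolding inF_def Let_def mem_def
    using triple_J[OF c] by (simp add: dvdF_J range_scons assms val_pair val_shift_gen shift3 cong: conj_cong bex_cong)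
qed

lemma tripleF_J:
  assumes "range e \<subseteq> J" shows "sat MJ e s (tripleF c) \<longleftrightarrow> triple (val MJ e c)"
proof -
  have c: "val MJ e c \<in> J" using assms by (rule val_J)
  have shift3: "(\<lambda>j. (n ## m ## k ## e) (j + 3)) = e" for k m n by (simp add: eval_nat_numeral)
  show ?thesis unfolding tripleF_def triple_def
    using triple_J[OF c, of "\<lambda>_ _ _. True"] by (simp add: val_pair val_shift_gen shift3)
qed

lemma fset_eq_J: "c \<in> J \<Longrightarrow> c' \<in> J \<Longrightarrow> (\<forall>i\<in>J. mem i c \<longleftrightarrow> mem i c') \<longleftrightarrow> fset c = fset c'"
  unfolding fset_def using J_mem by blast

lemma fin_codeF_J:
  assumes e: "range e \<subseteq> J" shows "sat MJ e s (fin_codeF c) \<longleftrightarrow> isfc (val MJ e c)"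
proof -
  have c: "val MJ e c \<in> J" using assms by (rule val_J)
  have shift2: "(\<lambda>j. (m ## k ## e) (j + 2)) = e" for k m by (simp add: eval_nat_numeral)
  have "sat MJ e s (fin_codeF c) \<longleftrightarrow> triple (val MJ e c) \<and>
    (\<forall>x\<in>J. x < val MJ e c \<longrightarrow> triple x \<longrightarrow> \<not> (\<forall>i\<in>J. mem i x \<longleftrightarrow> mem i (val MJ e c)))"
    unfolding fin_codeF_def
    by (simp add: tripleF_J inF_J e range_scons val_shift val_shift_gen shift2 iff_conv_conj_imp[symmetric])
  then show ?thesis unfolding isfc_def using c fset_eq_J J_down order_less_imp_le by (smt (verit, best))
qed

lemma lengthF_J:
  assumes e: "range e \<subseteq> J" shows "sat MJ e s (lengthF t l) \<longleftrightarrow> islen (val MJ e t) (val MJ e l)"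
proof -
  have c: "val MJ e t \<in> J" "val MJ e l \<in> J" using assms by (auto intro: val_J)
  have shift2: "(\<lambda>j. (m ## k ## e) (j + 2)) = e" for k m by (simp add: eval_nat_numeral)
  have 1: "(\<exists>y\<in>J. mem (pr i y) (val MJ e t)) \<longleftrightarrow> (\<exists>y. mem (pr i y) (val MJ e t))" for i
    using J_mem c J_pr_iff by blast
  have "sat MJ e s (lengthF t l) \<longleftrightarrow> (\<forall>i\<in>J. i < val MJ e l \<longleftrightarrow> (\<exists>y\<in>J. mem (pr i y) (val MJ e t)))"
    unfolding lengthF_def
    by (simp add: inF_J e range_scons val_shift val_shift_gen val_pair shift2 iff_conv_conj_imp[symmetric] numeral_2_eq_2)
  also have "\<dots> \<longleftrightarrow> islen (val MJ e t) (val MJ e l)"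
    unfolding 1 islen_def using c J_mem J_pr_iff J_down order_less_imp_le by blast
  finally show ?thesis .
qed

lemma seqF_J:
  assumes e: "range e \<subseteq> J" shows "sat MJ e s (seqF t) \<longleftrightarrow> isseq (val MJ e t)"
proof -
  have c: "val MJ e t \<in> J" using assms by (rule val_J)
  have shift3: "(\<lambda>j. (n ## m ## k ## e) (j + 3)) = e" for k m n by (simp add: eval_nat_numeral)
  let ?t = "val MJ e t"
  have len: "l \<in> J" if "islen ?t l" for l
  proof -
    have "i < ?t" if "i < l" for i using \<open>islen ?t l\<close> that mem_less pr_ge1 unfolding islen_def
      by (meson order_le_less_trans)
    then have "l \<le> ?t" by (meson less_irrefl not_le)
    then show ?thesis using c J_down by blast
  qed
  have "sat MJ e s (seqF t) \<longleftrightarrow> isfc ?t \<and> (\<forall>x\<in>J. mem x ?t \<longrightarrow> (\<exists>i\<in>J. \<exists>y\<in>J. x = pr i y)) \<and>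
     (\<forall>i\<in>J. \<forall>y\<in>J. \<forall>y'\<in>J. mem (pr i y) ?t \<and> mem (pr i y') ?t \<longrightarrow> y = y') \<and> (\<exists>l\<in>J. islen ?t l)"
    unfolding seqF_def
    by (simp add: fin_codeF_J lengthF_J inF_J e range_scons val_shift val_shift_gen val_pair shift3)
  also have "\<dots> \<longleftrightarrow> isseq ?t"
  proof -
    have "(\<forall>x\<in>J. mem x ?t \<longrightarrow> (\<exists>i\<in>J. \<exists>y\<in>J. x = pr i y)) \<longleftrightarrow> (\<forall>x. mem x ?t \<longrightarrow> (\<exists>i y. x = pr i y))"
      using c J_mem J_pr_iff by metis
    moreover have "(\<forall>i\<in>J. \<forall>y\<in>J. \<forall>y'\<in>J. mem (pr i y) ?t \<and> mem (pr i y') ?t \<longrightarrow> y = y') \<longleftrightarrow>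
        (\<forall>i y y'. mem (pr i y) ?t \<longrightarrow> mem (pr i y') ?t \<longrightarrow> y = y')"
      using c J_mem J_pr_iff by metis
    moreover have "(\<exists>l\<in>J. islen ?t l) \<longleftrightarrow> (\<exists>l. islen ?t l)" using len by blast
    ultimately show ?thesis unfolding isseq_def by simp
  qed
  finally show ?thesis .
qed

lemma binseqF_J:
  assumes e: "range e \<subseteq> J"
  shows "sat MJ e s (binseqF t) \<longleftrightarrow> isseq (val MJ e t) \<and> (\<forall>i y. mem (pr i y) (val MJ e t) \<longrightarrow> y < 2)"
proof -
  have c: "val MJ e t \<in> J" using assms by (rule val_J)
  have shift2: "(\<lambda>j. (m ## k ## e) (j + 2)) = e" for k m by (simp add: eval_nat_numeral)
  have "sat MJ e s (binseqF t) \<longleftrightarrow> isseq (val MJ e t) \<and> (\<forall>i\<in>J. \<forall>y\<in>J. mem (pr i y) (val MJ e t) \<longrightarrow> y < 2)"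
    unfolding binseqF_def
    by (simp add: seqF_J inF_J e range_scons val_shift_gen val_pair shift2)
  then show ?thesis using c J_mem J_pr_iff by blast
qed

lemma subseteqF_J:
  assumes e: "range e \<subseteq> J"
  shows "sat MJ e s (subseteqF t u) \<longleftrightarrow> fset (val MJ e t) \<subseteq> fset (val MJ e u)"
proof -
  have c: "val MJ e t \<in> J" using assms by (rule val_J)
  show ?thesis unfolding subseteqF_def using c J_mem
    by (auto simp: inF_J e range_scons val_shift_gen)
qed

text \<open>If \<open>P\<close> held on \<open>J\<close> only, it would be inductive, because
  \<open>J\<close> is closed under successor, and it would hold at \<open>top\<close>.\<close>

lemma overspill_J:
  assumes "sig (\<lambda>e. P (e 0))" "\<And>x. x \<in> J \<Longrightarrow> P x"
  shows "\<exists>x. x \<notin> J \<and> P x"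
proof (rule ccontr)
  assume no: "\<not> ?thesis"
  from assms(1) have "P top"
  proof (induction top rule: sig_induct)
    case (step x)
    then show ?case using no assms(2) J_arith(1)[OF _ J_1] by blast
  qed (use assms(2) J_0 in blast)
  then show False using no J_top by blast
qed

text \<open>An infinite tree in \<open>J\<close> has branches of every length in \<open>J\<close>.
  Overspill in \<open>M\<close> gives one of a length \<open>L\<close> outside \<open>J\<close>, all
  of whose initial segments lie in the code \<open>z\<close> of the tree; its part in
  \<open>J\<close> is a path.\<close>

lemma WKL_J:
  assumes e: "range e \<subseteq> J" and s: "range s \<subseteq> SJ"
  shows "sat MJ e s WKL"
proof -
  have "sat MJ e (T ## s) (ExS (pathF 0 1))"
    if T: "T \<in> SJ" and tree: "sat MJ e (T ## s) (bintreeF 0)" and inf: "sat MJ e (T ## s) (infiniteF 0)" for T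
  proof -
    obtain z where z: "T = fset z \<inter> J" using T by (auto simp: SJ_def)
    have t1: "isseq \<sigma>" "mem (pr i y) \<sigma> \<Longrightarrow> y < 2" if "\<sigma> \<in> T" for \<sigma> i y
      using tree that z by (auto simp: bintreeF_def binseqF_J e range_scons)
    have t2: "\<tau> \<in> T" if "\<sigma> \<in> T" "\<tau> \<in> J" "isseq \<tau>" "fset \<tau> \<subseteq> fset \<sigma>" for \<sigma> \<tau>
      using tree that z by (auto simp: bintreeF_def seqF_J subseteqF_J e range_scons)
    have t3: "\<exists>\<sigma>. \<sigma> \<in> T \<and> x < \<sigma>" if "x \<in> J" for x
      using inf that by (auto simp: infiniteF_def)
    have restrJ: "restr c l \<in> J" if "l \<in> J" for c l
    proof -
      have "restr c l < cb (pr l 2 + 1)" unfolding restr_def by (rule cset_less[OF recd_restr])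
      moreover have "cb (pr l 2 + 1) \<in> J" using that J_arith(1)[OF J_1 J_1] by (intro cb_J J_pr) auto
      ultimately show ?thesis using J_down order_less_imp_le by blast
    qed
    define \<Phi> where "\<Phi> l \<longleftrightarrow> (\<exists>c. binfun c l \<and> (\<forall>l'\<le>l. mem (restr c l') z))" for l
    have "sig (\<lambda>e. \<Phi> (e 0))" unfolding \<Phi>_def by (intro sig_ex recd_sig definable recd_binfun recf_restr)
    moreover have "\<Phi> l" if l: "l \<in> J" for l
    proof -
      \<comment> \<open>Binary sequences shorter than \<open>l\<close> have codes below this number,
        so an element of the tree beyond it has length at least \<open>l\<close>.\<close>
      have "cb (pr l 2 + 1) \<in> J" using l J_arith(1)[OF J_1 J_1] by (intro cb_J J_pr) auto
      then obtain \<sigma> where \<sigma>: "\<sigma> \<in> T" "cb (pr l 2 + 1) < \<sigma>" using t3 by blast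
      obtain k where k: "islen \<sigma> k" using t1(1)[OF \<sigma>(1)] by (auto simp: isseq_def)
      have "l \<le> k"
      proof (rule ccontr)
        assume "\<not> l \<le> k"
        have "x < pr l 2 + 1" if "mem x \<sigma>" for x
        proof -
          obtain i y where x: "x = pr i y" using t1(1)[OF \<sigma>(1)] \<open>mem x \<sigma>\<close> by (auto simp: isseq_def)
          then have "i < k" using k that by (auto simp: islen_def)
          then have "i \<le> l" "y \<le> 2" using \<open>\<not> l \<le> k\<close> t1(2)[OF \<sigma>(1)] that x by (auto simp: order_less_imp_le)
          then show ?thesis using pr_mono x by auto
        qed
        then have "\<sigma> < cb (pr l 2 + 1)" using t1(1)[OF \<sigma>(1)] by (intro isfc_less) (auto simp: isseq_def)
        then show False using \<sigma>(2) by simp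
      qed
      have "binfun \<sigma> l" unfolding binfun_def
      proof (intro allI impI)
        fix i assume "i < l"
        then have "i < k" using \<open>l \<le> k\<close> by simp
        then obtain y where y: "mem (pr i y) \<sigma>" using k by (auto simp: islen_def)
        then show "\<exists>y<2. mem (pr i y) \<sigma> \<and> (\<forall>y'<2. mem (pr i y') \<sigma> \<longrightarrow> y' = y)"
          using t1[OF \<sigma>(1)] unfolding isseq_def by metis
      qed
      moreover have "mem (restr \<sigma> l') z" if l': "l' \<le> l" for l'
      proof -
        have "fset (restr \<sigma> l') \<subseteq> fset \<sigma>" by (auto simp: mem_restr)
        moreover have "restr \<sigma> l' \<in> J" using restrJ l l' J_down by blast
        ultimately have "restr \<sigma> l' \<in> T" using t2[OF \<sigma>(1)] isseq_restr[OF \<open>binfun \<sigma> l\<close> l'] by blast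
        then show ?thesis using z by simp
      qed
      ultimately show ?thesis unfolding \<Phi>_def by blast
    qed
    ultimately obtain L where L: "L \<notin> J" "\<Phi> L" using overspill_J by blast
    then obtain c where c: "binfun c L" "\<forall>l\<le>L. mem (restr c l) z" by (auto simp: \<Phi>_def)
    have JL: "l < L" if "l \<in> J" for l using that L(1) J_down not_le by blast
    define f where "f = fset (restr c L) \<inter> J"
    have "f \<in> SJ" by (auto simp: f_def SJ_def)
    have memf: "x \<in> f \<longleftrightarrow> x \<in> J \<and> (\<exists>i<L. \<exists>y<2. x = pr i y \<and> mem x c)" for x
      by (auto simp: f_def mem_restr)
    have two: "y \<in> J" if "y < 2" for y using that J_0 J_1 two_J by auto
    have "sat MJ e (f ## T ## s) (functionF 0)"
    proof -
      have "\<exists>i\<in>J. \<exists>y\<in>J. x = pr i y" if "x \<in> f" for x using that by (auto simp: memf J_pr_iff)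
      moreover have "\<exists>y\<in>J. pr i y \<in> f \<and> (\<forall>y'\<in>J. pr i y' \<in> f \<longrightarrow> y' = y)" if iJ: "i \<in> J" for i
      proof -
        from c(1) JL[OF iJ] have "\<exists>y<2. mem (pr i y) c \<and> (\<forall>y'<2. mem (pr i y') c \<longrightarrow> y' = y)"
          by (simp add: binfun_def)
        then obtain y where y: "y < 2" "mem (pr i y) c" "\<forall>y'<2. mem (pr i y') c \<longrightarrow> y' = y" by blast
        have "pr i y \<in> J" using iJ two[OF y(1)] by (simp add: J_pr_iff)
        then have "pr i y \<in> f" unfolding memf using JL[OF iJ] y(1,2) by blast
        moreover have "y' = y" if "pr i y' \<in> f" for y'
        proof -
          from that have "y' < 2" "mem (pr i y') c" by (auto simp: memf)
          then show ?thesis using y(3) by blast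
        qed
        ultimately show ?thesis using two[OF y(1)] by blast
      qed
      ultimately show ?thesis unfolding functionF_def by (simp add: val_pair sat_Ex1N)
    qed
    moreover have "\<exists>\<sigma>\<in>J. \<sigma> \<in> T \<and> isseq \<sigma> \<and> islen \<sigma> n \<and> (\<forall>x\<in>J. mem x \<sigma> \<longrightarrow> x \<in> f)" if n: "n \<in> J" for n
    proof (rule bexI[OF _ restrJ[OF n]], intro conjI ballI impI)
      have nL: "n \<le> L" using JL[OF n] by simp
      show "restr c n \<in> T" using c(2) nL restrJ[OF n] z by simp
      show "isseq (restr c n)" "islen (restr c n) n" using isseq_restr[OF c(1) nL] islen_restr[OF c(1) nL] by auto
      show "x \<in> f" if "x \<in> J" "mem x (restr c n)" for x
        using that nL by (auto simp: memf mem_restr intro: order_less_le_trans)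
    qed
    ultimately have "sat MJ e (f ## T ## s) (pathF 0 1)"
      unfolding pathF_def by (simp add: seqF_J lengthF_J inF_J e range_scons)
    then show ?thesis using \<open>f \<in> SJ\<close> by auto
  qed
  then show ?thesis by (simp add: WKL_def del: sat.simps(11))
qed

theorem model_J:
  assumes "q \<in> WKL0 \<union> {RT22}" "range e \<subseteq> J" "range s \<subseteq> SJ"
  shows "sat MJ e s q"
  using assms RCA0_J WKL_J RT22_J by (auto simp: WKL0_def)

end

section \<open>Arithmetic from the axioms\<close>

definition models :: "'a model \<Rightarrow> fm set \<Rightarrow> bool" where
  "models A \<Gamma> \<longleftrightarrow> (\<forall>q\<in>\<Gamma>. \<forall>e s. range e \<subseteq> univ A \<longrightarrow> range s \<subseteq> setsM A \<longrightarrow> sat A e s q)"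

lemma val_closed: "closed_tm n t \<Longrightarrow> (\<And>i. i < n \<Longrightarrow> e i = e' i) \<Longrightarrow> val A e t = val A e' t"
  by (induction t) auto

lemma sat_closed:
  "closed n m p \<Longrightarrow> (\<And>i. i < n \<Longrightarrow> e i = e' i) \<Longrightarrow> (\<And>i. i < m \<Longrightarrow> s i = s' i) \<Longrightarrow>
    sat A e s p = sat A e' s' p"
proof (induction p arbitrary: n m e e' s s')
  case (AllN p)
  have "sat A (x ## e) s p = sat A (x ## e') s' p" for x
    using AllN.prems by (intro AllN.IH[of "Suc n" m]) (auto split: nat.split)
  then show ?case by simp
next
  case (ExN p)
  have "sat A (x ## e) s p = sat A (x ## e') s' p" for x
    using ExN.prems by (intro ExN.IH[of "Suc n" m]) (auto split: nat.split)
  then show ?case by simp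
next
  case (AllS p)
  have "sat A e (x ## s) p = sat A e' (x ## s') p" for x
    using AllS.prems by (intro AllS.IH[of n "Suc m"]) (auto split: nat.split)
  then show ?case by simp
next
  case (ExS p)
  have "sat A e (x ## s) p = sat A e' (x ## s') p" for x
    using ExS.prems by (intro ExS.IH[of n "Suc m"]) (auto split: nat.split)
  then show ?case by simp
next
  case (Eq t u)
  then show ?case using val_closed[of n t e e' A] val_closed[of n u e e' A] by simp
next
  case (Less t u)
  then show ?case using val_closed[of n t e e' A] val_closed[of n u e e' A] by simp
next
  case (Mem t X)
  then show ?case using val_closed[of n t e e' A] by simp
next
  case (Imp p q)
  have "sat A e s p = sat A e' s' p" "sat A e s q = sat A e' s' q"
    using Imp.prems Imp.IH(1)[of n m e e' s s'] Imp.IH(2)[of n m e e' s s'] by simp_all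
  then show ?case by simp
next
  case (Conj p q)
  have "sat A e s p = sat A e' s' p" "sat A e s q = sat A e' s' q"
    using Conj.prems Conj.IH(1)[of n m e e' s s'] Conj.IH(2)[of n m e e' s s'] by simp_all
  then show ?case by simp
next
  case (Disj p q)
  have "sat A e s p = sat A e' s' p" "sat A e s q = sat A e' s' q"
    using Disj.prems Disj.IH(1)[of n m e e' s s'] Disj.IH(2)[of n m e e' s s'] by simp_all
  then show ?case by simp
qed auto

lemma models_sentences: "\<forall>q\<in>\<Gamma>. sentence q \<Longrightarrow> \<forall>q\<in>\<Gamma>. sat A e s q \<Longrightarrow> models A \<Gamma>"
  unfolding models_def sentence_def using sat_closed by (metis not_less_zero)

lemma models_mono: "models A \<Gamma> \<Longrightarrow> \<Delta> \<subseteq> \<Gamma> \<Longrightarrow> models A \<Delta>"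
  by (auto simp: models_def)

lemma funpow_closed: "closed n m p \<Longrightarrow> closed 0 0 ((AllN ^^ n) ((AllS ^^ m) p))"
proof -
  have 1: "closed n (m + k) p \<Longrightarrow> closed n k ((AllS ^^ m) p)" for m k
    by (induction m arbitrary: k) simp_all
  have 2: "closed (n + k) 0 p \<Longrightarrow> closed k 0 ((AllN ^^ n) p)" for n k p
    by (induction n arbitrary: k) simp_all
  assume "closed n m p"
  then show ?thesis using 1[of m 0] 2[of n 0] by simp
qed

lemma models_closures:
  assumes "models A (closures p)" "range e \<subseteq> univ A" "range s \<subseteq> setsM A"
  shows "sat A e s p"
proof -
  obtain n m where "closed n m p" using closed_ex by blast
  then have "(AllN ^^ n) ((AllS ^^ m) p) \<in> closures p"
    using funpow_closed by (auto simp: closures_def sentence_def)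
  then have *: "\<And>e s. range e \<subseteq> univ A \<Longrightarrow> range s \<subseteq> setsM A \<Longrightarrow> sat A e s ((AllN ^^ n) ((AllS ^^ m) p))"
    using assms(1) by (auto simp: models_def)
  have N: "sat A e s q" if "\<And>e. range e \<subseteq> univ A \<Longrightarrow> sat A e s ((AllN ^^ n) q)" "range e \<subseteq> univ A" for e s q n
    using that
  proof (induction n)
    case (Suc n)
    have "sat A e s ((AllN ^^ n) q)" if e: "range e \<subseteq> univ A" for e
    proof -
      have "range (\<lambda>i. e (Suc i)) \<subseteq> univ A" using e by auto
      then have "sat A (\<lambda>i. e (Suc i)) s ((AllN ^^ Suc n) q)" by (rule Suc.prems(1))
      then have "sat A (e 0 ## (\<lambda>i. e (Suc i))) s ((AllN ^^ n) q)" using e by auto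
      then show ?thesis by (simp add: scons_eta)
    qed
    then show ?case using Suc by blast
  qed simp
  have S: "sat A e s q" if "\<And>s. range s \<subseteq> setsM A \<Longrightarrow> sat A e s ((AllS ^^ n) q)" "range s \<subseteq> setsM A" for e s q n
    using that
  proof (induction n)
    case (Suc n)
    have "sat A e s ((AllS ^^ n) q)" if s: "range s \<subseteq> setsM A" for s
    proof -
      have "range (\<lambda>i. s (Suc i)) \<subseteq> setsM A" using s by auto
      then have "sat A e (\<lambda>i. s (Suc i)) ((AllS ^^ Suc n) q)" by (rule Suc.prems(1))
      then have "sat A e (s 0 ## (\<lambda>i. s (Suc i))) ((AllS ^^ n) q)" using s by auto
      then show ?thesis by (simp add: scons_eta)
    qed
    then show ?case using Suc by blast
  qed simp
  show ?thesis using S[OF N[OF *] assms(3)] assms(2) by blast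
qed

text \<open>The operations are parameters, because the laws of arithmetic have to be derived from
  the axioms before a class instance can be formed.\<close>

locale rca0_structure =
  fixes ze :: 'a ("\<zero>") and un :: 'a ("\<one>") and ad :: "'a \<Rightarrow> 'a \<Rightarrow> 'a" (infixl "\<oplus>" 65)
    and mu :: "'a \<Rightarrow> 'a \<Rightarrow> 'a" (infixl "\<otimes>" 70) and le :: "'a \<Rightarrow> 'a \<Rightarrow> bool" (infix "\<prec>" 50) and S :: "'a set set"
  assumes S_ne: "S \<noteq> {}" and axioms: "models (mk_model \<zero> \<one> (\<oplus>) (\<otimes>) (\<prec>) UNIV S) RCA0"
begin

abbreviation "A \<equiv> mk_model \<zero> \<one> (\<oplus>) (\<otimes>) (\<prec>) UNIV S"

lemma sat_sets: "bounded p \<Longrightarrow> sat (mk_model \<zero> \<one> (\<oplus>) (\<otimes>) (\<prec>) UNIV S') e s p \<longleftrightarrow> sat A e s p"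
proof (induction p arbitrary: e rule: bounded.induct)
  have v: "val (mk_model \<zero> \<one> (\<oplus>) (\<otimes>) (\<prec>) UNIV S') e t = val A e t" for e t
    by (induction t) simp_all
  {
    case 2 then show ?case by (simp only: v sat.simps)
  next
    case 3 then show ?case by (simp only: v sat.simps mk_model_simps)
  next
    case 4 then show ?case by (simp only: v sat.simps)
  next
    case 8 then show ?case by (simp only: v sat.simps mk_model_simps)
  next
    case 9 then show ?case by (simp only: v sat.simps mk_model_simps)
  }
qed simp_all

lemma basic: assumes "q \<in> basic_axioms" shows "sat A e s q"
proof -
  obtain X where X: "X \<in> S" using S_ne by blast
  have "q \<in> RCA0" using assms by (simp add: RCA0_def)
  then have "sat A e (\<lambda>_. X) q" using axioms X by (auto simp: models_def)
  moreover have "closed 0 0 q" using assms by (auto simp: basic_axioms_def Let_def)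
  ultimately show ?thesis using sat_closed[of 0 0 q e e "\<lambda>_. X" s A] by simp
qed

lemma basic_facts:
  "n \<oplus> \<one> \<noteq> \<zero>" "m \<oplus> \<one> = n \<oplus> \<one> \<Longrightarrow> m = n" "n \<oplus> \<zero> = n" "m \<oplus> (n \<oplus> \<one>) = (m \<oplus> n) \<oplus> \<one>"
  "n \<otimes> \<zero> = \<zero>" "m \<otimes> (n \<oplus> \<one>) = (m \<otimes> n) \<oplus> m" "\<not> n \<prec> \<zero>" "m \<prec> n \<oplus> \<one> \<longleftrightarrow> m \<prec> n \<or> m = n"
proof -
  have "\<forall>q\<in>basic_axioms. sat A undefined undefined q" using basic by blast
  then have *: "(\<forall>n. n \<oplus> \<one> \<noteq> \<zero>) \<and> (\<forall>m n. m \<oplus> \<one> = n \<oplus> \<one> \<longrightarrow> m = n) \<and> (\<forall>n. n \<oplus> \<zero> = n) \<and>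
    (\<forall>m n. m \<oplus> (n \<oplus> \<one>) = (m \<oplus> n) \<oplus> \<one>) \<and> (\<forall>n. n \<otimes> \<zero> = \<zero>) \<and> (\<forall>m n. m \<otimes> (n \<oplus> \<one>) = (m \<otimes> n) \<oplus> m) \<and>
    (\<forall>n. \<not> n \<prec> \<zero>) \<and> (\<forall>m n. m \<prec> n \<oplus> \<one> \<longleftrightarrow> m \<prec> n \<or> m = n)"
    unfolding basic_axioms_def Let_def by simp blast
  show "n \<oplus> \<one> \<noteq> \<zero>" "m \<oplus> \<one> = n \<oplus> \<one> \<Longrightarrow> m = n" "n \<oplus> \<zero> = n" "m \<oplus> (n \<oplus> \<one>) = (m \<oplus> n) \<oplus> \<one>"
    "n \<otimes> \<zero> = \<zero>" "m \<otimes> (n \<oplus> \<one>) = (m \<otimes> n) \<oplus> m" "\<not> n \<prec> \<zero>" "m \<prec> n \<oplus> \<one> \<longleftrightarrow> m \<prec> n \<or> m = n"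
    using * by blast+
qed

lemma sigma_induct:
  assumes p: "bounded p" and s: "range s \<subseteq> S" and 0: "\<exists>y. sat A (y ## \<zero> ## e) s p"
    and step: "\<And>x. \<exists>y. sat A (y ## x ## e) s p \<Longrightarrow> \<exists>y. sat A (y ## (x \<oplus> \<one>) ## e) s p"
  shows "\<exists>y. sat A (y ## x ## e) s p"
proof -
  have "models A (closures (induction_ax (ExN p)))"
    by (rule models_mono[OF axioms]) (use p in \<open>auto simp: RCA0_def\<close>)
  then have "sat A e s (induction_ax (ExN p))" by (rule models_closures) (use s in auto)
  then show ?thesis using 0 step by (simp add: sat_induction_ax)
qed

lemma delta_comprehension:
  assumes p: "bounded p" and q: "bounded q" and s: "range s \<subseteq> S"
    and eq: "\<And>x. (\<exists>y. sat A (y ## x ## e) s p) \<longleftrightarrow> (\<forall>y. sat A (y ## x ## e) s q)"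
  shows "{x. \<exists>y. sat A (y ## x ## e) s p} \<in> S"
proof -
  have "models A (closures (comprehension_ax (ExN p) (AllN q)))"
    by (rule models_mono[OF axioms]) (use p q in \<open>auto simp: RCA0_def\<close>)
  then have "sat A e s (comprehension_ax (ExN p) (AllN q))" by (rule models_closures) (use s in auto)
  then obtain X where "X \<in> S" "\<forall>x. x \<in> X \<longleftrightarrow> (\<exists>y. sat A (y ## x ## e) s p)"
    using eq by (auto simp: sat_comprehension_ax)
  moreover from this have "X = {x. \<exists>y. sat A (y ## x ## e) s p}" by blast
  ultimately show ?thesis by simp
qed

lemma delta_induct:
  assumes p: "bounded p" and 0: "sat A (\<zero> ## e) s p"
    and step: "\<And>x. sat A (x ## e) s p \<Longrightarrow> sat A ((x \<oplus> \<one>) ## e) s p" and s: "range s \<subseteq> S"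
  shows "sat A (x ## e) s p"
  using sigma_induct[of "liftN 0 1 p" s e x] p s 0 step
  by (simp add: liftN_def substN_def bounded_subst sat_subst)

definition s0 :: "nat \<Rightarrow> 'a set" where "s0 = (\<lambda>_. SOME X. X \<in> S)"

lemma s0: "range s0 \<subseteq> S"
  using S_ne by (auto simp: s0_def some_in_eq)

text \<open>An algebraic law is stated as an equation between two terms, with the induction variable
  at position 0, and thereby becomes an instance of the scheme.\<close>

lemma eq_induct:
  assumes "val A (\<zero> ## e) t = val A (\<zero> ## e) u"
    and "\<And>x. val A (x ## e) t = val A (x ## e) u \<Longrightarrow> val A ((x \<oplus> \<one>) ## e) t = val A ((x \<oplus> \<one>) ## e) u"
  shows "val A (x ## e) t = val A (x ## e) u"
  using delta_induct[of "Eq t u" e s0 x] assms s0 by (auto intro: bounded.intros)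

abbreviation (input) "e0 \<equiv> (\<lambda>_. \<zero>) :: nat \<Rightarrow> 'a"

lemma add_assoc: "(x \<oplus> y) \<oplus> z = x \<oplus> (y \<oplus> z)"
proof -
  have "val A (z ## x ## y ## e0) (Add (Add (NVar 1) (NVar 2)) (NVar 0)) = val A (z ## x ## y ## e0) (Add (NVar 1) (Add (NVar 2) (NVar 0)))"
    by (rule eq_induct) (simp_all add: basic_facts(3,4) eval_nat_numeral)
  then show ?thesis by (simp add: eval_nat_numeral)
qed

lemma zero_add: "\<zero> \<oplus> x = x"
proof -
  have "val A (x ## e0) (Add Zero (NVar 0)) = val A (x ## e0) (NVar 0)"
    by (rule eq_induct) (simp_all add: basic_facts(3,4) eval_nat_numeral)
  then show ?thesis by (simp add: eval_nat_numeral)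
qed

lemma Suc_add: "(x \<oplus> \<one>) \<oplus> y = (x \<oplus> y) \<oplus> \<one>"
proof -
  have "val A (y ## x ## e0) (Add (Add (NVar 1) One) (NVar 0)) = val A (y ## x ## e0) (Add (Add (NVar 1) (NVar 0)) One)"
    by (rule eq_induct) (simp_all add: basic_facts(3,4) eval_nat_numeral)
  then show ?thesis by (simp add: eval_nat_numeral)
qed

lemma add_comm: "x \<oplus> y = y \<oplus> x"
proof -
  have "val A (y ## x ## e0) (Add (NVar 1) (NVar 0)) = val A (y ## x ## e0) (Add (NVar 0) (NVar 1))"
    by (rule eq_induct) (simp_all add: basic_facts(3,4) zero_add Suc_add eval_nat_numeral)
  then show ?thesis by (simp add: eval_nat_numeral)
qed

lemma add_left_comm: "x \<oplus> (y \<oplus> z) = y \<oplus> (x \<oplus> z)"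
  by (metis add_assoc add_comm)

lemmas add_ac' = add_assoc add_comm add_left_comm

lemma zero_mul: "\<zero> \<otimes> x = \<zero>"
proof -
  have "val A (x ## e0) (Mul Zero (NVar 0)) = val A (x ## e0) (Zero)"
    by (rule eq_induct) (simp_all add: basic_facts(3,5,6) eval_nat_numeral)
  then show ?thesis by (simp add: eval_nat_numeral)
qed

lemma Suc_mul: "(x \<oplus> \<one>) \<otimes> y = (x \<otimes> y) \<oplus> y"
proof -
  have "val A (y ## x ## e0) (Mul (Add (NVar 1) One) (NVar 0)) = val A (y ## x ## e0) (Add (Mul (NVar 1) (NVar 0)) (NVar 0))"
    by (rule eq_induct) (simp_all add: basic_facts(3,5,6) add_ac' eval_nat_numeral)
  then show ?thesis by (simp add: eval_nat_numeral)
qed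

lemma mul_comm: "x \<otimes> y = y \<otimes> x"
proof -
  have "val A (y ## x ## e0) (Mul (NVar 1) (NVar 0)) = val A (y ## x ## e0) (Mul (NVar 0) (NVar 1))"
    by (rule eq_induct) (simp_all add: basic_facts(5,6) zero_mul Suc_mul eval_nat_numeral)
  then show ?thesis by (simp add: eval_nat_numeral)
qed

lemma one_mul: "\<one> \<otimes> x = x"
  using basic_facts(6)[of x \<zero>] by (simp add: zero_add basic_facts(5) mul_comm)

lemma mul_one: "x \<otimes> \<one> = x"
  by (simp add: mul_comm[of x] one_mul)

lemma distrib: "x \<otimes> (y \<oplus> z) = x \<otimes> y \<oplus> x \<otimes> z"
proof -
  have "val A (z ## x ## y ## e0) (Mul (NVar 1) (Add (NVar 2) (NVar 0))) = val A (z ## x ## y ## e0) (Add (Mul (NVar 1) (NVar 2)) (Mul (NVar 1) (NVar 0)))"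
    by (rule eq_induct) (simp_all add: basic_facts(3,5,6) add_assoc[symmetric] eval_nat_numeral)
  then show ?thesis by (simp add: eval_nat_numeral)
qed

lemma mul_assoc: "(x \<otimes> y) \<otimes> z = x \<otimes> (y \<otimes> z)"
proof -
  have "val A (z ## x ## y ## e0) (Mul (Mul (NVar 1) (NVar 2)) (NVar 0)) = val A (z ## x ## y ## e0) (Mul (NVar 1) (Mul (NVar 2) (NVar 0)))"
    by (rule eq_induct) (simp_all add: basic_facts(5,6) distrib mul_one eval_nat_numeral)
  then show ?thesis by (simp add: eval_nat_numeral)
qed

lemma add_cancel: "x \<oplus> z = y \<oplus> z \<Longrightarrow> x = y"
proof -
  have "sat A (z ## x ## y ## e0) s0 (Imp (Eq (Add (NVar 1) (NVar 0)) (Add (NVar 2) (NVar 0))) (Eq (NVar 1) (NVar 2)))"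
  proof (rule delta_induct)
    show "bounded (Imp (Eq (Add (NVar 1) (NVar 0)) (Add (NVar 2) (NVar 0))) (Eq (NVar 1) (NVar 2)))"
      by (intro bounded.intros)
  qed (use basic_facts(2) s0 in \<open>auto simp: basic_facts(3,4) eval_nat_numeral\<close>)
  then show "x \<oplus> z = y \<oplus> z \<Longrightarrow> x = y" by (simp add: eval_nat_numeral)
qed

lemma zero_or_Suc: "x = \<zero> \<or> (\<exists>y. x = y \<oplus> \<one>)"
proof -
  have "\<exists>y. sat A (y ## x ## e0) s0 (Disj (Eq (NVar 1) Zero) (Eq (NVar 1) (Add (NVar 0) One)))"
    by (rule sigma_induct) (auto intro: bounded.intros s0[THEN subsetD])
  then show ?thesis by simp
qed

text \<open>From left to right by Sigma_1 induction on \<open>y\<close>, with \<open>c\<close> as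
  the witness; this identifies the order with the one given by addition, as
  \<open>ordered_arith\<close> requires.\<close>

lemma less_iff: "x \<prec> y \<longleftrightarrow> (\<exists>c. y = x \<oplus> (c \<oplus> \<one>))"
proof
  have "\<exists>c. sat A (c ## y ## x ## e0) s0 (Imp (Less (NVar 2) (NVar 1)) (Eq (NVar 1) (Add (NVar 2) (Add (NVar 0) One))))"
  proof (rule sigma_induct)
    fix y
    assume *: "\<exists>c. sat A (c ## y ## x ## e0) s0 (Imp (Less (NVar 2) (NVar 1)) (Eq (NVar 1) (Add (NVar 2) (Add (NVar 0) One))))"
    have "\<exists>c. x \<prec> y \<oplus> \<one> \<longrightarrow> y \<oplus> \<one> = x \<oplus> (c \<oplus> \<one>)"
    proof (cases "x = y")
      case True
      then show ?thesis by (intro exI[of _ \<zero>]) (simp add: zero_add)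
    next
      case False
      obtain c where "x \<prec> y \<longrightarrow> y = x \<oplus> (c \<oplus> \<one>)" using * by (auto simp: eval_nat_numeral)
      then show ?thesis using False by (intro exI[of _ "c \<oplus> \<one>"]) (auto simp: basic_facts(8) add_assoc)
    qed
    then show "\<exists>c. sat A (c ## (y \<oplus> \<one>) ## x ## e0) s0 (Imp (Less (NVar 2) (NVar 1)) (Eq (NVar 1) (Add (NVar 2) (Add (NVar 0) One))))"
      by (simp add: eval_nat_numeral)
  qed (use s0 basic_facts(7) in \<open>auto intro: bounded.intros\<close>)
  then show "x \<prec> y \<Longrightarrow> \<exists>c. y = x \<oplus> (c \<oplus> \<one>)" by (auto simp: eval_nat_numeral)
next
  have "sat A (c ## x ## e0) s0 (Less (NVar 1) (Add (NVar 1) (Add (NVar 0) One)))" for c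
    by (rule delta_induct) (use s0 in \<open>auto intro: bounded.intros simp: zero_add basic_facts(8) add_assoc[symmetric] basic_facts(3)\<close>)
  then have "x \<prec> x \<oplus> (c \<oplus> \<one>)" for c by simp
  then show "\<exists>c. y = x \<oplus> (c \<oplus> \<one>) \<Longrightarrow> x \<prec> y" by blast
qed

lemma less_irrefl': "\<not> x \<prec> x"
proof
  assume "x \<prec> x"
  then obtain c where "x = x \<oplus> (c \<oplus> \<one>)" by (auto simp: less_iff)
  then have "\<zero> \<oplus> x = (c \<oplus> \<one>) \<oplus> x" using zero_add[of x] add_comm[of x "c \<oplus> \<one>"] by simp
  then show False using add_cancel[of \<zero> x "c \<oplus> \<one>"] basic_facts(1)[of c] by simp
qed

lemma less_trans': "x \<prec> y \<Longrightarrow> y \<prec> z \<Longrightarrow> x \<prec> z"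
  unfolding less_iff by (metis add_assoc)

lemma trichotomy: "x \<prec> y \<or> x = y \<or> y \<prec> x"
proof -
  have z: "\<zero> \<prec> x \<or> \<zero> = x" for x
    using zero_or_Suc[of x] less_iff[of \<zero> x] zero_add by auto
  have "sat A (y ## x ## e0) s0 (Disj (Less (NVar 1) (NVar 0)) (Disj (Eq (NVar 1) (NVar 0)) (Less (NVar 0) (NVar 1))))"
  proof (rule delta_induct)
    fix y
    assume "sat A (y ## x ## e0) s0 (Disj (Less (NVar 1) (NVar 0)) (Disj (Eq (NVar 1) (NVar 0)) (Less (NVar 0) (NVar 1))))"
    then consider "x \<prec> y \<or> x = y" | "y \<prec> x" by auto
    then have "x \<prec> y \<oplus> \<one> \<or> x = y \<oplus> \<one> \<or> y \<oplus> \<one> \<prec> x"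
    proof cases
      case 2
      then obtain c where c: "x = y \<oplus> (c \<oplus> \<one>)" by (auto simp: less_iff)
      show ?thesis
      proof (cases "c = \<zero>")
        case True
        then show ?thesis using c by (simp add: zero_add)
      next
        case False
        then obtain d where "c = d \<oplus> \<one>" using zero_or_Suc[of c] by auto
        then have "x = (y \<oplus> \<one>) \<oplus> (d \<oplus> \<one>)" using c by (simp add: add_ac')
        then show ?thesis using less_iff by blast
      qed
    qed (auto simp: basic_facts(8))
    then show "sat A ((y \<oplus> \<one>) ## x ## e0) s0 (Disj (Less (NVar 1) (NVar 0)) (Disj (Eq (NVar 1) (NVar 0)) (Less (NVar 0) (NVar 1))))"
      by simp
  qed (use s0 z in \<open>auto intro: bounded.intros\<close>)
  then show ?thesis by simp
qed

definition leq :: "'a \<Rightarrow> 'a \<Rightarrow> bool" where "leq x y \<longleftrightarrow> x \<prec> y \<or> x = y"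

lemma leq_iff: "leq x y \<longleftrightarrow> (\<exists>c. y = x \<oplus> c)"
proof
  assume "leq x y"
  then show "\<exists>c. y = x \<oplus> c" unfolding leq_def less_iff using basic_facts(3)[of x] by metis
next
  assume "\<exists>c. y = x \<oplus> c"
  then obtain c where c: "y = x \<oplus> c" by blast
  show "leq x y"
  proof (cases "c = \<zero>")
    case False
    then obtain d where "c = d \<oplus> \<one>" using zero_or_Suc[of c] by auto
    then show ?thesis using c unfolding leq_def less_iff by blast
  qed (use c in \<open>simp add: leq_def basic_facts(3)\<close>)
qed

text \<open>Truncated subtraction, an operation of the class
  \<open>linordered_semidom\<close>.\<close>

definition sub :: "'a \<Rightarrow> 'a \<Rightarrow> 'a" where
  "sub x y = (if leq y x then THE c. x = y \<oplus> c else \<zero>)"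

lemma sub_add: "sub (x \<oplus> y) x = y"
proof -
  have "leq x (x \<oplus> y)" using leq_iff by blast
  moreover have "(THE c. x \<oplus> y = x \<oplus> c) = y"
  proof (rule the_equality)
    show "c = y" if "x \<oplus> y = x \<oplus> c" for c
      using add_cancel[of c x y] that add_comm[of c x] add_comm[of y x] by simp
  qed simp
  ultimately show ?thesis by (simp add: sub_def)
qed

lemma sub_sub: "sub (sub x y) z = sub x (y \<oplus> z)"
proof (cases "leq (y \<oplus> z) x")
  case True
  then obtain c where "x = y \<oplus> z \<oplus> c" using leq_iff by blast
  then show ?thesis using sub_add add_assoc by metis
next
  case False
  have zz: "sub \<zero> z = \<zero>" for z
  proof (cases "z = \<zero>")
    case True
    then show ?thesis using sub_add[of \<zero> \<zero>] zero_add[of \<zero>] by simp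
  next
    case False
    then show ?thesis using basic_facts(7)[of z] by (simp add: sub_def leq_def)
  qed
  show ?thesis
  proof (cases "leq y x")
    case True
    then obtain c where c: "x = y \<oplus> c" using leq_iff by blast
    have "\<not> leq z c" using False c leq_iff add_assoc by metis
    then show ?thesis using c sub_add[of y c] False by (simp add: sub_def[of _ z] sub_def[of _ "y \<oplus> z"])
  next
    case yx: False
    then have "sub x y = \<zero>" by (simp add: sub_def)
    then show ?thesis using zz False by (simp add: sub_def[of x "y \<oplus> z"])
  qed
qed

lemma mul_less: assumes "x \<prec> y" "\<zero> \<prec> z" shows "z \<otimes> x \<prec> z \<otimes> y"
proof -
  obtain c d where "y = x \<oplus> (c \<oplus> \<one>)" "z = \<zero> \<oplus> (d \<oplus> \<one>)" using assms less_iff by metis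
  then have "z \<otimes> y = z \<otimes> x \<oplus> ((z \<otimes> c \<oplus> d) \<oplus> \<one>)"
    by (simp add: distrib zero_add mul_one mul_comm[of _ c] mul_comm[of _ x] add_ac')
  then show ?thesis using less_iff by blast
qed

lemma mul_nonzero: "x \<noteq> \<zero> \<Longrightarrow> y \<noteq> \<zero> \<Longrightarrow> x \<otimes> y \<noteq> \<zero>"
proof -
  assume "x \<noteq> \<zero>" "y \<noteq> \<zero>"
  then obtain a b where "x = a \<oplus> \<one>" "y = b \<oplus> \<one>" using zero_or_Suc[of x] zero_or_Suc[of y] by auto
  then have "x \<otimes> y = (x \<otimes> b \<oplus> a) \<oplus> \<one>" by (simp add: basic_facts(6) add_assoc)
  then show ?thesis using basic_facts(1) by simp
qed

lemma distrib_right: "(x \<oplus> y) \<otimes> z = x \<otimes> z \<oplus> y \<otimes> z"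
  by (simp add: mul_comm[of _ z] distrib)

lemma sub_eq_zero: "leq x y \<Longrightarrow> sub x y = \<zero>"
proof -
  assume xy: "leq x y"
  show ?thesis
  proof (cases "x = y")
    case True
    then show ?thesis using sub_add[of y \<zero>] by (simp add: basic_facts(3))
  next
    case False
    then have "x \<prec> y" using xy by (simp add: leq_def)
    then have "\<not> leq y x" using less_irrefl' less_trans' unfolding leq_def by blast
    then show ?thesis by (simp add: sub_def)
  qed
qed

lemma mul_sub: "x \<otimes> sub y z = sub (x \<otimes> y) (x \<otimes> z)"
proof -
  consider "leq z y" | "leq y z" using trichotomy[of y z] by (auto simp: leq_def)
  then show ?thesis
  proof cases
    case 1
    then obtain c where c: "y = z \<oplus> c" using leq_iff by blast
    show ?thesis unfolding c distrib sub_add ..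
  next
    case 2
    then obtain c where c: "z = y \<oplus> c" using leq_iff by blast
    have "leq (x \<otimes> y) (x \<otimes> z)" unfolding leq_iff c distrib by blast
    then show ?thesis using 2 by (simp add: sub_eq_zero basic_facts(5))
  qed
qed

end

section \<open>A countable nonstandard model\<close>

text \<open>Transport along a bijection. The sets of a model may have elements outside its universe,
  hence the intersection.\<close>

definition img :: "('a \<Rightarrow> 'b) \<Rightarrow> ('b \<Rightarrow> 'a) \<Rightarrow> 'a model \<Rightarrow> 'b model" where
  "img f g A = mk_model (f (zeroM A)) (f (oneM A)) (\<lambda>x y. f (addM A (g x) (g y)))
     (\<lambda>x y. f (mulM A (g x) (g y))) (\<lambda>x y. lessM A (g x) (g y)) UNIV ((\<lambda>X. f ` (X \<inter> univ A)) ` setsM A)"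

lemma sat_img:
  assumes wf: "wf_model A" and gf: "\<And>x. x \<in> univ A \<Longrightarrow> g (f x) = x" and fg: "\<And>y. g y \<in> univ A \<and> f (g y) = y"
    and "range e \<subseteq> univ A"
  shows "sat (img f g A) (\<lambda>n. f (e n)) (\<lambda>n. f ` (s n \<inter> univ A)) p \<longleftrightarrow> sat A e s p"
  using assms(4)
proof (induction p arbitrary: e s)
  have val: "val (img f g A) (\<lambda>n. f (e n)) t = f (val A e t)" if "range e \<subseteq> univ A" for e t
  proof (induction t)
    case (Add t u)
    then show ?case using gf val_univ[OF wf that] by (simp add: img_def)
  next
    case (Mul t u)
    then show ?case using gf val_univ[OF wf that] by (simp add: img_def)
  qed (simp_all add: img_def)
  have inj: "f x = f y \<longleftrightarrow> x = y" if "x \<in> univ A" "y \<in> univ A" for x y using gf that by metis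
  have cons: "(f x ## (\<lambda>n. f (e n))) = (\<lambda>n. f ((x ## e) n))" for x e
    by (rule HOL.ext) (simp split: nat.split)
  have consS: "((f ` (X \<inter> univ A)) ## (\<lambda>n. f ` (s n \<inter> univ A))) = (\<lambda>n. f ` ((X ## s) n \<inter> univ A))" for X s
    by (rule HOL.ext) (simp split: nat.split)
  have all: "(\<forall>x\<in>univ (img f g A). Q x) \<longleftrightarrow> (\<forall>x\<in>univ A. Q (f x))" for Q
    using fg by (simp add: img_def) metis
  have ex: "(\<exists>x\<in>univ (img f g A). Q x) \<longleftrightarrow> (\<exists>x\<in>univ A. Q (f x))" for Q
    using fg by (simp add: img_def) metis
  {
    case (Eq t u)
    then show ?case using inj val_univ[OF wf] val by simp
  next
    case (Less t u)
    then have "g (f (val A e t)) = val A e t" "g (f (val A e u)) = val A e u" using gf val_univ[OF wf] by auto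
    then show ?case using Less val by (simp only: sat.simps) (simp add: img_def)
  next
    case (Mem t X)
    have "val A e t \<in> univ A" using Mem val_univ[OF wf] by blast
    then have "f (val A e t) \<in> f ` (s X \<inter> univ A) \<longleftrightarrow> val A e t \<in> s X" using inj by (auto simp: image_iff)
    then show ?case using Mem val by simp
  next
    case (AllN p)
    then show ?case unfolding sat.simps all by (simp add: cons range_scons)
  next
    case (ExN p)
    then show ?case unfolding sat.simps ex by (simp add: cons range_scons)
  next
    case (AllS p)
    have "setsM (img f g A) = (\<lambda>X. f ` (X \<inter> univ A)) ` setsM A" by (simp add: img_def)
    then show ?case using AllS by (simp add: consS)
  next
    case (ExS p)
    have "setsM (img f g A) = (\<lambda>X. f ` (X \<inter> univ A)) ` setsM A" by (simp add: img_def)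
    then show ?case using ExS by (simp add: consS)
  }
qed simp_all

lemma RCA0_sentences: "q \<in> RCA0 \<union> BSigma02 \<Longrightarrow> sentence q"
  by (auto simp: RCA0_def BSigma02_def closures_def basic_axioms_def Let_def sentence_def)

primrec numM :: "'a model \<Rightarrow> nat \<Rightarrow> 'a" where
  "numM A 0 = zeroM A"
| "numM A (Suc n) = addM A (numM A n) (oneM A)"

definition nonstd :: "'a model \<Rightarrow> bool" where
  "nonstd A \<longleftrightarrow> (\<exists>c\<in>univ A. \<forall>n. lessM A (numM A n) c)"

definition failing :: "fm \<Rightarrow> bool" where
  "failing p \<longleftrightarrow> p \<in> forall_Pi0 4 \<and> sentence p \<and> WKL0 \<union> {RT22} \<turnstile> p \<and> \<not> RCA0 \<union> BSigma02 \<turnstile> p"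

text \<open>A conditional property: some model has it in any case, so the type class can be
  instantiated outright, and it is a counterexample model if conservation fails.\<close>

definition suitable :: "'a model \<Rightarrow> bool" where
  "suitable A \<longleftrightarrow> wf_model A \<and> models A RCA0 \<and>
     ((\<exists>p. failing p) \<longrightarrow> nonstd A \<and> models A BSigma02 \<and> (\<exists>p. failing p \<and> models A {Neg p}))"

lemma num_facts:
  assumes wf: "wf_model A" and R: "models A RCA0"
  shows "numM A n \<in> univ A" "n < m \<Longrightarrow> lessM A (numM A n) (numM A m)" "inj (numM A)"
proof -
  have U: "numM A n \<in> univ A" for n using wf by (induction n) (auto simp: wf_model_def)
  then show "numM A n \<in> univ A" .
  obtain X where X: "X \<in> setsM A" using wf by (auto simp: wf_model_def)
  have "\<forall>q\<in>basic_axioms. sat A (\<lambda>_. zeroM A) (\<lambda>_. X) q"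
    using R X wf by (auto simp: models_def RCA0_def wf_model_def)
  then have *: "(\<forall>n\<in>univ A. addM A n (oneM A) \<noteq> zeroM A) \<and>
     (\<forall>m\<in>univ A. \<forall>n\<in>univ A. addM A m (oneM A) = addM A n (oneM A) \<longrightarrow> m = n) \<and>
     (\<forall>m\<in>univ A. \<forall>n\<in>univ A. lessM A m (addM A n (oneM A)) \<longleftrightarrow> lessM A m n \<or> m = n)"
    unfolding basic_axioms_def Let_def by simp blast
  show "n < m \<Longrightarrow> lessM A (numM A n) (numM A m)"
  proof (induction m)
    case (Suc m)
    then show ?case using * U by (auto simp: less_Suc_eq)
  qed simp
  show "inj (numM A)"
  proof (rule injI)
    show "n = m" if "numM A n = numM A m" for n m
      using that
    proof (induction n arbitrary: m)
      case 0
      then show ?case using * U by (cases m) force+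
    next
      case (Suc n)
      then show ?case using * U by (cases m) force+
    qed
  qed
qed

primrec numt :: "nat \<Rightarrow> tm" where
  "numt 0 = Zero"
| "numt (Suc n) = Add (numt n) One"

lemma val_numt: "val A e (numt n) = numM A n"
  by (induction n) auto

lemma numt_inject: "numt n = numt m \<longleftrightarrow> n = m"
proof (induction n arbitrary: m)
  case 0
  show ?case by (cases m) auto
next
  case (Suc n)
  then show ?case by (cases m) auto
qed

lemma closed_numt: "closed_tm k (numt n)"
  by (induction n) auto

text \<open>The theory consists of sentences, so the free variable 0 can play the new constant above
  all numerals. A finite part of the extended theory mentions finitely many numerals, and a first
  model satisfies it with the variable set to a larger one.\<close>

lemma suitable_exists_tm:
  assumes f: "failing p"
  obtains A :: "tm model" where "suitable A" "infinite (univ A)"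
proof -
  let ?G0 = "RCA0 \<union> BSigma02 \<union> {Neg p}"
  let ?G1 = "?G0 \<union> range (\<lambda>n. Less (numt n) (NVar 0))"
  have sent: "\<forall>q\<in>?G0. sentence q" using f RCA0_sentences by (auto simp: failing_def sentence_def)
  have "cons ?G0" unfolding cons_def
  proof
    assume "?G0 \<turnstile> Fls"
    then have "RCA0 \<union> BSigma02 \<turnstile> p" by - (rule provable.RAA, simp)
    then show False using f by (simp add: failing_def)
  qed
  moreover have "fresh_bound ?G0" using sent unfolding fresh_bound_def sentence_def by blast
  ultimately obtain A :: "tm model" and e s where A: "wf_model A" "range e \<subseteq> univ A" "range s \<subseteq> setsM A"
    "\<forall>p\<in>?G0. sat A e s p" by (rule completeness)
  have mA: "models A ?G0" using models_sentences[OF sent A(4)] .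
  then have RA: "models A RCA0" by (rule models_mono) auto
  have "cons ?G1" unfolding cons_def
  proof
    assume "?G1 \<turnstile> Fls"
    then obtain D where D: "finite D" "D \<subseteq> ?G1" "D \<turnstile> Fls" using provable_finite by blast
    have "\<exists>N. \<forall>n. Less (numt n) (NVar 0) \<in> D \<longrightarrow> n < N" using D(1)
    proof (induction rule: finite_induct)
      case (insert q D)
      then obtain N where N: "\<forall>n. Less (numt n) (NVar 0) \<in> D \<longrightarrow> n < N" by blast
      show ?case
      proof (cases "\<exists>k. q = Less (numt k) (NVar 0)")
        case True
        then obtain k where "q = Less (numt k) (NVar 0)" by blast
        then show ?thesis using N by (intro exI[of _ "max N (Suc k)"]) (auto simp: numt_inject less_max_iff_disj)
      next
        case False
        then show ?thesis using N by (intro exI[of _ N]) auto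
      qed
    qed simp
    then obtain N where N: "\<forall>n. Less (numt n) (NVar 0) \<in> D \<longrightarrow> n < N" by blast
    have env: "range (numM A N ## e) \<subseteq> univ A" using A(2) num_facts(1)[OF A(1) RA] by (simp add: range_scons)
    have "sat A (numM A N ## e) s q" if q: "q \<in> D" for q
    proof (cases "q \<in> ?G0")
      case True
      then show ?thesis using mA env A(3) unfolding models_def by blast
    next
      case False
      then obtain n where n: "q = Less (numt n) (NVar 0)" using q D(2) by blast
      then show ?thesis using N q num_facts(2)[OF A(1) RA] by (simp add: val_numt)
    qed
    then have "sat A (numM A N ## e) s Fls" using soundness[OF D(3) A(1) env A(3)] by blast
    then show False by simp
  qed
  moreover have "fresh_bound ?G1"
  proof -
    have "closed (Suc 0) 0 q" if "q \<in> ?G1" for q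
      using that sent closed_mono[of 0 0 q "Suc 0" 0] by (auto simp: sentence_def closed_numt)
    then show ?thesis unfolding fresh_bound_def by blast
  qed
  ultimately obtain A :: "tm model" and e s where A: "wf_model A" "range e \<subseteq> univ A" "range s \<subseteq> setsM A"
    "\<forall>p\<in>?G1. sat A e s p" by (rule completeness)
  have mA: "models A ?G0" using models_sentences[OF sent] A(4) by blast
  then have RA: "models A RCA0" "models A BSigma02" "models A {Neg p}" by (auto elim: models_mono)
  have "lessM A (numM A n) (e 0)" for n
  proof -
    have "sat A e s (Less (numt n) (NVar 0))" using A(4) by blast
    then show ?thesis by (simp add: val_numt)
  qed
  moreover have "e 0 \<in> univ A" using A(2) by auto
  ultimately have "nonstd A" unfolding nonstd_def by blast
  then have "suitable A" using A(1) RA f by (auto simp: suitable_def)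
  moreover have "infinite (univ A)"
    using num_facts(1,3)[OF A(1) RA(1)] range_inj_infinite infinite_super by (metis image_subsetI)
  ultimately show thesis using that by blast
qed

text \<open>Supplies a suitable model in the case that no sentence fails.\<close>

lemma standard_model: "models (mk_model 0 1 (+) (*) (<) UNIV UNIV :: nat model) RCA0" (is "models ?N _")
proof -
  have ind: "sat ?N e s (induction_ax p)" for e s p
    unfolding sat_induction_ax
  proof (intro impI ballI)
    fix x
    assume "sat ?N (zeroM ?N ## e) s p"
      and *: "\<forall>x\<in>univ ?N. sat ?N (x ## e) s p \<longrightarrow> sat ?N (addM ?N x (oneM ?N) ## e) s p"
    then show "sat ?N (x ## e) s p" by (induction x) auto
  qed
  have comp: "sat ?N e s (comprehension_ax p q)" for e s p q
    unfolding sat_comprehension_ax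
    by (intro impI, rule bexI[of _ "{x. sat ?N (x ## e) s p}"]) auto
  have basic: "sat ?N e s q" if "q \<in> basic_axioms" for q e s
    using that by (auto simp: basic_axioms_def Let_def less_Suc_eq)
  show ?thesis unfolding models_def
  proof (intro ballI allI impI)
    fix q e s assume "q \<in> RCA0"
    then consider "q \<in> basic_axioms" | p where "q \<in> closures (induction_ax p)"
      | p p' where "q \<in> closures (comprehension_ax p p')" unfolding RCA0_def by blast
    then show "sat ?N e s q"
    proof cases
      case 2
      then show ?thesis using closures_sat[of ?N "induction_ax p" q e s] ind by simp
    next
      case 3
      then show ?thesis using closures_sat[of ?N "comprehension_ax p p'" q e s] comp by simp
    qed (rule basic)
  qed
qed

lemma suitable_img:
  assumes A: "suitable A" and bij: "bij_betw f (univ A) (UNIV :: 'b set)"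
  shows "\<exists>B :: 'b model. suitable B \<and> univ B = UNIV"
proof -
  define g where "g = inv_into (univ A) f"
  have gf: "\<And>x. x \<in> univ A \<Longrightarrow> g (f x) = x" using bij unfolding g_def bij_betw_def by (simp add: inv_into_f_f)
  have fg: "\<And>y. g y \<in> univ A \<and> f (g y) = y" using bij unfolding g_def bij_betw_def
    by (metis UNIV_I f_inv_into_f inv_into_into)
  let ?B = "img f g A"
  have wfA: "wf_model A" using A by (simp add: suitable_def)
  obtain X where X: "X \<in> setsM A" using wfA by (auto simp: wf_model_def)
  have e: "range (\<lambda>_. zeroM A) \<subseteq> univ A" using wfA by (auto simp: wf_model_def)
  have tr: "models ?B \<Gamma>" if "models A \<Gamma>" "\<forall>q\<in>\<Gamma>. sentence q" for \<Gamma>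
  proof (rule models_sentences[OF that(2)])
    show "\<forall>q\<in>\<Gamma>. sat ?B (\<lambda>n. f (zeroM A)) (\<lambda>n. f ` (X \<inter> univ A)) q"
      using that(1) e X sat_img[OF wfA gf fg e, of "\<lambda>_. X"] by (auto simp: models_def)
  qed
  have num: "numM ?B n = f (numM A n)" for n
  proof (induction n)
    case (Suc n)
    have "numM A n \<in> univ A" using wfA by (induction n) (auto simp: wf_model_def)
    then show ?case using Suc gf wfA by (simp add: img_def wf_model_def)
  qed (simp add: img_def)
  have "numM A n \<in> univ A" for n using wfA by (induction n) (auto simp: wf_model_def)
  then have "nonstd ?B" if "nonstd A"
  proof -
    from that obtain c where "c \<in> univ A" "\<forall>n. lessM A (numM A n) c" by (auto simp: nonstd_def)
    then show ?thesis using gf \<open>\<And>n. numM A n \<in> univ A\<close> unfolding nonstd_def num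
      by (intro bexI[of _ "f c"]) (simp_all add: img_def)
  qed
  moreover have "wf_model ?B" using X by (auto simp: wf_model_def img_def)
  ultimately have "suitable ?B" using A tr RCA0_sentences unfolding suitable_def
    by (auto simp: failing_def sentence_def)
  then show ?thesis by (intro exI[of _ ?B]) (simp add: img_def)
qed

text \<open>A fresh copy, since \<open>nat\<close> already carries its own arithmetic.\<close>

typedef number = "UNIV :: nat set" by simp

lemma bij_Abs_number: "bij Abs_number"
  by (rule bijI) (auto simp: inj_def Abs_number_inject surj_def intro: Abs_number_cases)

text \<open>The type class \<open>rca0\<close> needs one fixed structure, so a counterexample is chosen here, for whichever
  sentence there is one.\<close>

definition chosen :: "number model" where
  "chosen = (SOME A. suitable A \<and> univ A = UNIV)"

lemma chosen: "suitable chosen" "univ chosen = UNIV"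
proof -
  have "\<exists>A :: number model. suitable A \<and> univ A = UNIV"
  proof (cases "\<exists>p. failing p")
    case True
    then obtain A :: "tm model" where A: "suitable A" "infinite (univ A)" using suitable_exists_tm by blast
    have "bij_betw (to_nat_on (univ A)) (univ A) UNIV"
      using A(2) by (intro to_nat_on_infinite) (auto intro: countableI_type)
    then have "bij_betw (Abs_number \<circ> to_nat_on (univ A)) (univ A) UNIV"
      using bij_Abs_number by (rule bij_betw_trans)
    then show ?thesis using suitable_img A(1) by blast
  next
    case False
    have "suitable (mk_model 0 1 (+) (*) (<) UNIV UNIV :: nat model)"
      using False standard_model by (auto simp: suitable_def wf_model_def)
    moreover have "bij_betw Abs_number (univ (mk_model 0 1 (+) (*) (<) UNIV UNIV :: nat model)) UNIV"
      using bij_Abs_number by simp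
    ultimately show ?thesis by (rule suitable_img)
  qed
  then have "suitable chosen \<and> univ chosen = UNIV" unfolding chosen_def by (rule someI_ex)
  then show "suitable chosen" "univ chosen = UNIV" by auto
qed

lemma chosen_eq:
  "mk_model (zeroM chosen) (oneM chosen) (addM chosen) (mulM chosen) (lessM chosen) UNIV (setsM chosen) = chosen"
  using chosen(2) by (simp add: mk_model_def)

interpretation num: rca0_structure "zeroM chosen" "oneM chosen" "addM chosen" "mulM chosen" "lessM chosen" "setsM chosen"
proof
  show "setsM chosen \<noteq> {}" using chosen(1) by (simp add: suitable_def wf_model_def)
  show "models (mk_model (zeroM chosen) (oneM chosen) (addM chosen) (mulM chosen) (lessM chosen) UNIV (setsM chosen)) RCA0"
    unfolding chosen_eq using chosen(1) by (simp add: suitable_def)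
qed

instantiation number :: rca0
begin

definition "0 = zeroM chosen"
definition "1 = oneM chosen"
definition "x + y = addM chosen x y"
definition "x * y = mulM chosen x y"
definition "x < y \<longleftrightarrow> lessM chosen x y"
definition "x \<le> y \<longleftrightarrow> num.leq x y"
definition "x - y = num.sub x y"
definition "second_order = setsM chosen"

lemmas number_defs = zero_number_def one_number_def plus_number_def times_number_def less_number_def
  less_eq_number_def minus_number_def second_order_number_def

lemma number_model:
  "mk_model 0 1 (+) (*) (<) UNIV S =
    mk_model (zeroM chosen) (oneM chosen) (addM chosen) (mulM chosen) (lessM chosen) UNIV S"
proof -
  have "(+) = addM chosen" "(*) = mulM chosen" "(<) = lessM chosen"
    by (intro HOL.ext, simp add: number_defs)+
  then show ?thesis by (simp add: number_defs)
qed

instance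
proof
  fix a b c :: number
  show "a + b + c = a + (b + c)" by (simp only: number_defs num.add_assoc)
  show "a + b = b + a" unfolding number_defs by (rule num.add_comm)
  show "0 + a = a" by (simp only: number_defs num.zero_add)
  show "a < b \<longleftrightarrow> a \<le> b \<and> \<not> b \<le> a"
    unfolding number_defs num.leq_def using num.less_irrefl' num.less_trans' by blast
  show "a \<le> a" by (simp add: number_defs num.leq_def)
  show "a \<le> b \<Longrightarrow> b \<le> c \<Longrightarrow> a \<le> c"
    unfolding number_defs num.leq_def using num.less_trans' by blast
  show "a \<le> b \<Longrightarrow> b \<le> a \<Longrightarrow> a = b"
    unfolding number_defs num.leq_def using num.less_irrefl' num.less_trans' by blast
  show "a \<le> b \<longleftrightarrow> (\<exists>c. b = a + c)" unfolding number_defs by (rule num.leq_iff)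
  show "a + b - a = b" unfolding number_defs by (rule num.sub_add)
  show "a - b - c = a - (b + c)" unfolding number_defs by (rule num.sub_sub)
  show "a \<le> b \<Longrightarrow> c + a \<le> c + b"
    unfolding number_defs num.leq_iff by (metis num.add_assoc)
  show "a \<le> b \<or> b \<le> a"
    unfolding number_defs num.leq_def using num.trichotomy by blast
  show "a * b * c = a * (b * c)" unfolding number_defs by (rule num.mul_assoc)
  show "a * b = b * a" unfolding number_defs by (rule num.mul_comm)
  show "(a + b) * c = a * c + b * c" unfolding number_defs by (rule num.distrib_right)
  show "0 * a = 0" unfolding number_defs by (rule num.zero_mul)
  show "a * 0 = 0" unfolding number_defs by (rule num.basic_facts(5))
  show "a < b \<Longrightarrow> 0 < c \<Longrightarrow> c * a < c * b" unfolding number_defs by (rule num.mul_less)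
  show "1 * a = a" unfolding number_defs by (rule num.one_mul)
  show "(0::number) \<noteq> 1" unfolding number_defs
    using num.basic_facts(1)[of "zeroM chosen"] num.zero_add[of "oneM chosen"] by simp
  show "a * (b - c) = a * b - a * c" unfolding number_defs by (rule num.mul_sub)
  show "a * (b + c) = a * b + a * c" unfolding number_defs by (rule num.distrib)
  show "a \<noteq> 0 \<Longrightarrow> b \<noteq> 0 \<Longrightarrow> a * b \<noteq> 0" unfolding number_defs by (rule num.mul_nonzero)
  show "(0::number) < 1" unfolding number_defs num.less_iff
    using num.zero_add by metis
  show "b \<le> a \<Longrightarrow> a - b + b = a"
    unfolding number_defs num.leq_iff using num.sub_add num.add_comm by metis
  show "a < b + 1 \<longleftrightarrow> a \<le> b" unfolding number_defs num.leq_def by (rule num.basic_facts(8))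
  show "(second_order :: number set set) \<noteq> {}" unfolding number_defs by (rule num.S_ne)
next
  fix p s x and e :: "nat \<Rightarrow> number"
  assume "bounded p" "range s \<subseteq> second_order"
    "\<exists>y. sat (mk_model 0 1 (+) (*) (<) UNIV {}) (y ## 0 ## e) s p"
    "\<And>x. \<exists>y. sat (mk_model 0 1 (+) (*) (<) UNIV {}) (y ## x ## e) s p \<Longrightarrow>
      \<exists>y. sat (mk_model 0 1 (+) (*) (<) UNIV {}) (y ## (x + 1) ## e) s p"
  then show "\<exists>y. sat (mk_model 0 1 (+) (*) (<) UNIV {}) (y ## x ## e) s p"
    unfolding number_model num.sat_sets[where S' = "{}", OF \<open>bounded p\<close>] unfolding number_defs
    by (rule num.sigma_induct)
next
  fix p q s and e :: "nat \<Rightarrow> number"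
  assume "bounded p" "bounded q" "range s \<subseteq> second_order"
    "\<And>x. (\<exists>y. sat (mk_model 0 1 (+) (*) (<) UNIV {}) (y ## x ## e) s p) \<longleftrightarrow>
      (\<forall>y. sat (mk_model 0 1 (+) (*) (<) UNIV {}) (y ## x ## e) s q)"
  then show "{x. \<exists>y. sat (mk_model 0 1 (+) (*) (<) UNIV {}) (y ## x ## e) s p} \<in> second_order"
    unfolding number_model num.sat_sets[where S' = "{}", OF \<open>bounded p\<close>]
      num.sat_sets[where S' = "{}", OF \<open>bounded q\<close>] unfolding number_defs
    by (rule num.delta_comprehension)
qed

end

section \<open>Conservation\<close>

lemma sat_collection_ax:
  "sat A e s (collection_ax p) \<longleftrightarrow> (\<forall>t\<in>univ A. (\<forall>x\<in>univ A. lessM A x t \<longrightarrow> (\<exists>y\<in>univ A. sat A (y ## x ## e) s p)) \<longrightarrow>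
     (\<exists>b\<in>univ A. \<forall>x\<in>univ A. lessM A x t \<longrightarrow> (\<exists>y\<in>univ A. lessM A y b \<and> sat A (y ## x ## e) s p)))"
proof -
  have "(\<lambda>n. (y ## x ## t ## e) (if n < 2 then n else n + Suc 0)) = y ## x ## e" for x y t
    by (rule HOL.ext) (simp split: nat.split)
  then have 1: "sat A (y ## x ## t ## e) s (liftN 2 1 p) \<longleftrightarrow> sat A (y ## x ## e) s p" for x y t
    by (simp add: liftN_def substN_def sat_subst)
  have "(\<lambda>n. (y ## x ## b ## t ## e) (if n < 2 then n else n + 2)) = y ## x ## e" for x y b t
    by (rule HOL.ext) (simp split: nat.split)
  then have 2: "sat A (y ## x ## b ## t ## e) s (liftN 2 2 p) \<longleftrightarrow> sat A (y ## x ## e) s p" for x y b t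
    by (simp add: liftN_def substN_def sat_subst)
  show ?thesis unfolding collection_ax_def sat.simps 1 2 by (simp add: shift_def)
qed

text \<open>The cut satisfies the theory, hence by soundness the sentence, which for the parameters
  \<open>A\<close> and \<open>w\<close> yields an \<open>x\<close>. But \<open>J_Th\<close> yields a
  \<open>y\<close> in \<open>J\<close> that refutes the matrix for all \<open>z\<close> in
  \<open>J\<close>, and bounded formulas are absolute.\<close>

lemma not_provable:
  fixes en :: "nat \<Rightarrow> 'a::rca0" and w :: 'a
  assumes c: "nonstandard (c::'a)" and en: "\<And>a N. \<exists>i\<ge>N. en i = a"
    and coll: "\<And>q. bounded q \<Longrightarrow> sat (std UNIV second_order) (w ## (\<lambda>_. 0)) (\<lambda>_. A) (collection_ax (ExN (AllN q)))"
    and \<phi>: "bounded \<phi>" "closed 4 1 \<phi>" and A: "A \<in> second_order"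
    and no: "\<forall>x. \<exists>y. \<forall>z. \<not> bsat (z ## y ## x ## w ## (\<lambda>_. 0)) (\<lambda>_. A) \<phi>"
  shows "\<not> WKL0 \<union> {RT22} \<turnstile> AllS (AllN (ExN (AllN (ExN \<phi>))))"
proof
  assume prov: "WKL0 \<union> {RT22} \<turnstile> AllS (AllN (ExN (AllN (ExN \<phi>))))"
  define N where "N x y z \<longleftrightarrow> \<not> bsat (z ## y ## x ## w ## (\<lambda>_. 0)) (\<lambda>_. A) \<phi>" for x y z
  have "(e (Suc (Suc 0)) ## e (Suc 0) ## e 0 ## w ## (\<lambda>_. 0)) =
      (\<lambda>n. ev e (case n of 0 \<Rightarrow> Inl (Suc (Suc 0)) | Suc 0 \<Rightarrow> Inl (Suc 0) | Suc (Suc 0) \<Rightarrow> Inl 0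
        | Suc (Suc (Suc n)) \<Rightarrow> Inr ((w ## (\<lambda>_. 0)) n)))" for e :: "nat \<Rightarrow> 'a"
    by (rule HOL.ext) (simp split: nat.split)
  then have "dlt (\<lambda>e. bsat (e (Suc (Suc 0)) ## e (Suc 0) ## e 0 ## w ## (\<lambda>_. 0)) (\<lambda>_. A) \<phi>)"
    unfolding dlt_def using \<phi>(1) A by (intro exI[of _ \<phi>] exI[of _ "\<lambda>_. A"] exI) auto
  then have N: "recd (\<lambda>e. N (e 0) (e (Suc 0)) (e (Suc (Suc 0))))" unfolding N_def
    by (intro recd_dlt dlt_not)
  \<comment> \<open>The case \<open>x = 0\<close> forces the parameter \<open>w\<close> into the cut.\<close>
  define Th where "Th x y z \<longleftrightarrow> (x = 0 \<and> w \<le> y) \<or> (\<exists>x'<x. x = x' + 1 \<and> N x' y z)" for x y z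
  interpret apart Th
  proof
    show "recd (\<lambda>e. Th (e 0) (e (Suc 0)) (e (Suc (Suc 0))))" unfolding Th_def
      by (intro definable recd_comp3[OF N])
  qed
  have Th_Suc: "Th (x + 1) y z \<longleftrightarrow> N x y z" for x y z unfolding Th_def by (auto simp: not_le)
  have T: "\<exists>u. \<forall>x\<le>t. \<exists>y\<le>u. \<forall>z. Th x y z" for t
  proof -
    \<comment> \<open>Collection is stated for Sigma_2 formulas, so the Pi_1 condition on
      \<open>y\<close> receives a vacuous existential quantifier; the substitution makes room for
      its variable.\<close>
    let ?q = "Neg (subst (\<lambda>n. NVar (if n = 0 then 0 else Suc n)) id \<phi>)"
    have "(\<lambda>n. (z ## d ## y ## x ## e) (if n = 0 then 0 else Suc n)) = z ## y ## x ## e" for x y z d and e :: "nat \<Rightarrow> 'a"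
      by (rule HOL.ext) (simp split: nat.split)
    then have q: "sat (std UNIV second_order) (y ## x ## w ## (\<lambda>_. 0)) (\<lambda>_. A) (ExN (AllN ?q)) \<longleftrightarrow> (\<forall>z. N x y z)" for x y
      by (simp add: sat_subst N_def sat_std[OF \<phi>(1), of second_order])
    have "bounded ?q" using \<phi>(1) by (intro bounded.intros bounded_subst)
    from coll[OF this] have "(\<forall>x<t. \<exists>y. \<forall>z. N x y z) \<longrightarrow> (\<exists>b. \<forall>x<t. \<exists>y<b. \<forall>z. N x y z)"
      unfolding sat_collection_ax q by simp
    moreover have "\<forall>x. \<exists>y. \<forall>z. N x y z" using no by (simp add: N_def)
    ultimately obtain b where b: "\<forall>x<t. \<exists>y<b. \<forall>z. N x y z" by blast
    have "\<exists>y\<le>b + w. \<forall>z. Th x y z" if "x \<le> t" for x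
    proof (cases "x = 0")
      case True
      then show ?thesis by (intro exI[of _ w]) (simp add: Th_def)
    next
      case False
      then obtain x' where x': "x = x' + 1" using not_zero_ex by blast
      then have "x' < t" using that by simp
      then obtain y where "y < b" "\<forall>z. N x' y z" using b by blast
      then show ?thesis unfolding x' Th_Suc
        by (intro exI[of _ y]) (auto intro: order_trans[OF order_less_imp_le])
    qed
    then show ?thesis by blast
  qed
  obtain J top where "cut Th J top" using cut_exists[OF T c en] by blast
  then interpret cut Th J top .
  have e: "range (\<lambda>_. 0::'a) \<subseteq> J" using J_0 by auto
  have s: "range (\<lambda>_. fset 0 \<inter> J :: 'a set) \<subseteq> SJ" by (auto simp: SJ_def)
  have "sat MJ (\<lambda>_. 0) (\<lambda>_. fset 0 \<inter> J) (AllS (AllN (ExN (AllN (ExN \<phi>)))))"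
    using soundness[OF prov wf_MJ] model_J[OF _ e s] e s by simp
  \<comment> \<open>A set of the model need not be coded, but its part below \<open>top\<close>
    is.\<close>
  moreover have "A \<inter> J \<in> SJ"
  proof -
    have "recd (\<lambda>e. e 0 \<in> A)" using A by (intro recd_dlt dlt_mem tmf_var)
    then have "A \<inter> J = fset (cset top (\<lambda>x. x \<in> A)) \<inter> J"
      using J_top by (auto simp: fset_def mem_cset[of "\<lambda>x. x \<in> A"])
    then show ?thesis unfolding SJ_def by blast
  qed
  moreover have w: "w \<in> J"
  proof -
    obtain y where "y \<in> J" "\<forall>z\<in>J. Th 0 y z" using J_Th J_0 by blast
    then have "w \<le> y" using J_0 by (auto simp: Th_def)
    then show ?thesis using \<open>y \<in> J\<close> J_down by blast
  qed
  ultimately obtain x where x: "x \<in> J"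
    "\<forall>y\<in>J. \<exists>z\<in>J. sat MJ (z ## y ## x ## w ## (\<lambda>_. 0)) ((A \<inter> J) ## (\<lambda>_. fset 0 \<inter> J)) \<phi>"
    unfolding sat.simps mk_model_simps by blast
  obtain y where y: "y \<in> J" "\<forall>z\<in>J. N x y z" using J_Th[OF J_arith(1)[OF x(1) J_1]] unfolding Th_Suc by blast
  then obtain z where z: "z \<in> J" "sat MJ (z ## y ## x ## w ## (\<lambda>_. 0)) ((A \<inter> J) ## (\<lambda>_. fset 0 \<inter> J)) \<phi>"
    using x(2) by blast
  have "range (z ## y ## x ## w ## (\<lambda>_. 0)) \<subseteq> J" using x(1) y(1) z(1) w J_0 by (simp add: range_scons)
  then have "sat MJ (z ## y ## x ## w ## (\<lambda>_. 0)) (\<lambda>_. A \<inter> J) \<phi> \<longleftrightarrow> bsat (z ## y ## x ## w ## (\<lambda>_. 0)) (\<lambda>_. A) \<phi>"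
    by (rule sat_bounded_J[OF \<phi>(1)])
  moreover have "sat MJ (z ## y ## x ## w ## (\<lambda>_. 0)) (\<lambda>_. A \<inter> J) \<phi>"
    using z(2) sat_closed[OF \<phi>(2), of "z ## y ## x ## w ## (\<lambda>_. 0)" "z ## y ## x ## w ## (\<lambda>_. 0)"
        "(A \<inter> J) ## (\<lambda>_. fset 0 \<inter> J)" "\<lambda>_. A \<inter> J" MJ] by simp
  ultimately show False using y z(1) unfolding N_def by blast
qed

lemma chosen_std: "chosen = std UNIV second_order"
  unfolding number_model using chosen_eq by (simp add: second_order_number_def)

theorem theorem1p4:
  shows "conservative_over (forall_Pi0 4) (WKL0 \<union> {RT22}) (RCA0 \<union> BSigma02)"
proof -
  \<comment> \<open>The chosen model refutes some failing sentence, perhaps not a given one; this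
    suffices to exclude failing sentences altogether.\<close>
  have False if "\<exists>p. failing p"
  proof -
    have ch: "nonstd chosen" "models chosen BSigma02" "\<exists>p. failing p \<and> models chosen {Neg p}"
      using chosen(1) that by (auto simp: suitable_def)
    then obtain p where p: "failing p" "models chosen {Neg p}" by blast
    have "p \<in> AllS ` AllN ` ExN ` AllN ` ExN ` Collect bounded"
      using p(1) by (simp add: failing_def forall_Pi0_def eval_nat_numeral)
    then obtain \<phi> where \<phi>: "bounded \<phi>" and p_eq: "p = AllS (AllN (ExN (AllN (ExN \<phi>))))" by blast
    have cl: "closed 4 1 \<phi>" using p(1) by (simp add: failing_def sentence_def p_eq eval_nat_numeral)
    obtain S0 :: "number set" where S0: "S0 \<in> second_order" using second_order_nonempty by blast
    have "\<not> sat (std UNIV second_order) (\<lambda>_. 0 :: number) (\<lambda>_. S0) p"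
      using p(2) S0 unfolding models_def chosen_std by auto
    then obtain A w where A: "A \<in> second_order" and
      no: "\<forall>x. \<exists>y. \<forall>z. \<not> sat (std UNIV second_order) (z ## y ## x ## w ## (\<lambda>_. 0 :: number)) (A ## (\<lambda>_. S0)) \<phi>"
      unfolding p_eq by auto
    have "sat (std UNIV second_order) (z ## y ## x ## w ## (\<lambda>_. 0 :: number)) (A ## (\<lambda>_. S0)) \<phi> \<longleftrightarrow>
        bsat (z ## y ## x ## w ## (\<lambda>_. 0)) (\<lambda>_. A) \<phi>" for x y z
      by (rule trans[OF sat_std[OF \<phi>] sat_closed[OF cl]]) simp_all
    with no have no: "\<forall>x. \<exists>y. \<forall>z. \<not> bsat (z ## y ## x ## w ## (\<lambda>_. 0)) (\<lambda>_. A) \<phi>" by simp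
    have num: "numM chosen n = of_nat n" for n
    proof (induction n)
      case 0
      show ?case by (simp add: zero_number_def)
    next
      case (Suc n)
      then show ?case using add.commute[of "1::number"] by (simp add: plus_number_def one_number_def)
    qed
    obtain c where c: "nonstandard (c :: number)"
      using ch(1) by (auto simp: nonstd_def num nonstandard_def less_number_def)
    \<comment> \<open>Every number is the first component of pairs with arbitrarily large codes, so
      it is enumerated infinitely often.\<close>
    have en: "\<exists>i\<ge>N. Abs_number (fst (prod_decode i)) = a" for a N
    proof -
      obtain k where k: "a = Abs_number k" by (rule Abs_number_cases)
      show ?thesis using le_prod_encode_2[of N k] k
        by (intro exI[of _ "prod_encode (k, N)"]) simp
    qed
    have coll: "sat (std UNIV second_order) (w ## (\<lambda>_. 0)) (\<lambda>_. A) (collection_ax (ExN (AllN q)))" if q: "bounded q" for q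
    proof (rule models_closures)
      have "ExN (AllN q) \<in> Sigma0 2" using q by (simp add: eval_nat_numeral)
      then have "closures (collection_ax (ExN (AllN q))) \<subseteq> BSigma02" unfolding BSigma02_def by blast
      then show "models (std UNIV second_order :: number model) (closures (collection_ax (ExN (AllN q))))"
        using ch(2) models_mono unfolding chosen_std by blast
    qed (use A in auto)
    have "\<not> WKL0 \<union> {RT22} \<turnstile> p"
      unfolding p_eq using c en coll \<phi> cl A no by (rule not_provable)
    then show False using p(1) by (simp add: failing_def)
  qed
  then show ?thesis by (auto simp: conservative_over_def failing_def)
qed

end
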